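(* Let $k\in\mathbb{N}_0$, $r\in(1,\infty)$, $s\in\mathbb{R}$. Suppose that $\Psi\in C^1(\mathbb M)$ is convex, $\mathbb M=\mathbb{R}^{m\times n}$, and that $\psi_h(x,\cdot)\in C^1(\mathbb{R}^m)$ is convex for a.e. $x\in\Omega$. Let $u_h=(u_{\mathcal M},u_\Sigma)\in V_{\mathrm D}(\mathcal M)$ be a minimizer in $V_{\mathrm D}(\mathcal M)$ of the discrete energy $E_h(v_h)=\int_\Omega(\Psi(\mathrm D_hv_h)+\psi_h(x,\Pi^k_{\mathcal M}v_{\mathcal M}))\,\mathrm{d}x+\mathrm s_h(v_h;v_h)/r$, so that, with $\sigma_{\mathcal M}=\Pi^k_{\mathcal M}\mathrm D\Psi(\mathrm D_hu_h)\in P_k(\mathcal M;\mathbb M)$, the discrete Euler–Lagrange equations $$\int_\Omega\big(\sigma_{\mathcal M}:\mathrm D_hv_h+\nabla_u\psi_h(x,\Pi^k_{\mathcal M}u_{\mathcal M})\cdot\Pi^k_{\mathcal M}v_{\mathcal M}\big)\,\mathrm{d}x+\mathrm s_h(u_h;v_h)=0\quad\text{for all }v_h=(v_{\mathcal M},v_\Sigma)\in V_{\mathrm D}(\mathcal M)$$ hold. Define the discrete dual variable $\sigma_h=(\sigma_{\mathcal M},\sigma_\Sigma)\in W_{\mathrm N}(\mathcal M)$ by $$\sigma_S=\begin{cases}\{\sigma_{\mathcal M}\nu_S\}_S+h_S^{-s}(T_{K_+,S}u_h-T_{K_-,S}u_h)/2&\text{if }S\in\Sigma(\Omega),\\\sigma_{\mathcal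 M}\nu_S+h_S^{-s}T_{K_+,S}u_h&\text{if }S\in\Sigma_{\mathrm D},\end{cases}$$ and $\sigma_S=0$ if $S\in\Sigma_{\mathrm N}$. Then $\mathrm{div}_h\sigma_h=\Pi^k_{\mathcal M}\nabla_u\psi_h(x,\Pi^k_{\mathcal M}u_{\mathcal M})\in P_k(\mathcal M;\mathbb{R}^m)$. Moreover, given a matching simplicial submesh $\mathcal T$ of $\mathcal M$ with set of faces $\mathcal F$, let $\sigma_0\in\mathrm{RT}_k(\mathcal T;\mathbb M)\cap W_{\mathrm N}$ be the unique Raviart–Thomas function defined by $\Pi^{k-1}_{\mathcal T}\sigma_0=\Pi^{k-1}_{\mathcal T}\sigma_{\mathcal M}$ and, for $F\in\mathcal F$, $$\sigma_0\nu_F=\begin{cases}\sigma_S&\text{if }F\subset S\text{ for some }S\in\Sigma,\\\sigma_{\mathcal M}|_K\,\nu_F&\text{if }F\subset K\text{ for some }K\in\mathcal M\text{ but }F\not\subset\partial K.\end{cases}$$ Then $\Pi^k_{\mathcal M}\mathrm{div}\,\sigma_0=\Pi^k_{\mathcal M}\nabla_u\psi_h(x,\Pi^k_{\mathcal M}u_{\mathcal M})$.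
   Context: Domain and mesh. $\Omega\subset\mathbb{R}^n$ is an open bounded polyhedral Lipschitz domain with outer unit normal $\nu$; $\Gamma_{\mathrm D}\subset\partial\Omega$ is non-empty and closed, $\Gamma_{\mathrm N}=\partial\Omega\setminus\Gamma_{\mathrm D}$. For fixed $p\in(1,\infty)$ with $p'=p/(p-1)$, $W_{\mathrm N}$ is the space of $\tau\in L^{p'}(\Omega;\mathbb M)$ with distributional (row-wise) divergence in $L^{p'}(\Omega;\mathbb{R}^m)$ and normal trace vanishing weakly on $\Gamma_{\mathrm N}$, i.e. $\int_\Omega(\tau:\mathrm Dv+v\cdot\mathrm{div}\,\tau)\,\mathrm{d}x=0$ for all $v\in W^{1,p}(\Omega;\mathbb{R}^m)$ with zero trace on $\Gamma_{\mathrm D}$. $\mathcal M$ is a finite collection of closed polytopes (cells) of positive volume, with pairwise overlap of measure zero, covering $\overline\Omega$. A face $S$ is a closed connected subset of a hyperplane with positive $(n-1)$-dimensional measure that is contained either in $K_+\cap K_-$ for two distinct cells (interior face) or in $K_+\cap\partial\Omega$ for one cell (boundary face). $\Sigma$ is a finite collection of faces with pairwise overlap of $(n-1)$-dimensional measure zero, covering the skeleton $\partial\mathcal M=\bigcup_{K\in\mathcal M}\partial K=\bigcup_{S\in\Sigma}S$; $\Sigma(\Omega)$, $\Sigma(\partial\Omega)$ are its interior and boundary faces, $\Sigma_{\mathrm D}=\{S\in\Sigma:S\subset\Gamma_{\mathrm D}\}$, $\Sigma_{\mathrm N}=\Sigma(\partial\Omega)\setminus\Sigma_{\mathrm D}$,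 $\Sigma(K)$ is the set of faces $S\in\Sigma$ of $K$. Each interior face has a fixed unit normal $\nu_S$, and $K_\pm$ are the adjacent cells with outer normals $\nu_{K_\pm}|_S=\pm\nu_S$; for boundary faces $\nu_S=\nu|_S$ and $K_+$ is the unique adjacent cell. Jump and average: $[v]_S=v|_{K_+}-v|_{K_-}$, $\{v\}_S=(v|_{K_+}+v|_{K_-})/2$ on interior faces, and $[v]_S=\{v\}_S=v|_{K_+}$ on boundary faces. $h_S$ is the diameter of $S$. Spaces. $P_k(\mathcal M;X)$, $P_k(\Sigma;X)$ are the piecewise polynomials of degree at most $k$ on cells, resp. faces; $\Pi^k_{\mathcal M}$, $\Pi^k_{\mathcal T}$, $\Pi^k_S$ are the $L^2$ projections onto piecewise polynomials of degree at most $k$ on $\mathcal M$, $\mathcal T$, resp. polynomials on $S$ (componentwise; a condition with degree $-1$ is void). $V(\mathcal M)=P_{k+1}(\mathcal M;\mathbb{R}^m)\times P_k(\Sigma;\mathbb{R}^m)$, $W(\mathcal M)=P_k(\mathcal M;\mathbb M)\times P_k(\Sigma;\mathbb{R}^m)$; $V_{\mathrm D}(\mathcal M)=\{(v_{\mathcal M},v_\Sigma)\in V(\mathcal M):v_\Sigma|_S=0\ \forall S\in\Sigma_{\mathrm D}\}$, $W_{\mathrm N}(\mathcal M)=\{(\tau_{\mathcal M},\tau_\Sigma)\in W(\mathcal M):\tau_\Sigma|_S=0\ \forall S\in\Sigma_{\mathrm N}\}$; $v_K=v_{\mathcal M}|_K$, $v_S=v_\Sigma|_S$, similarly $\tau_S$.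 Operators. $\mathrm D_hv_h\in P_k(\mathcal M;\mathbb M)$: $\int_\Omega\mathrm D_hv_h:\tau_k\,\mathrm{d}x=-\int_\Omega v_{\mathcal M}\cdot\mathrm{div}_{\mathrm{pw}}\tau_k\,\mathrm{d}x+\sum_{S\in\Sigma}\int_Sv_S\cdot[\tau_k\nu_S]_S\,\mathrm{d}s$ for all $\tau_k\in P_k(\mathcal M;\mathbb M)$. $\mathrm{div}_h\tau_h\in P_k(\mathcal M;\mathbb{R}^m)$: $\int_\Omega\mathrm{div}_h\tau_h\cdot\varphi_k\,\mathrm{d}x=-\int_\Omega\mathrm D_{\mathrm{pw}}\varphi_k:\tau_{\mathcal M}\,\mathrm{d}x+\sum_{S\in\Sigma}\int_S[\varphi_k]_S\cdot\tau_S\,\mathrm{d}s$ for all $\varphi_k\in P_k(\mathcal M;\mathbb{R}^m)$. ($\mathrm D_{\mathrm{pw}},\mathrm{div}_{\mathrm{pw}}$: piecewise gradient and divergence.) For $K\in\mathcal M$, $S\in\Sigma(K)$: $T_{K,S}u_h=\Pi_S^k\big(|u_S-\Pi_S^ku_K|^{r-2}(u_S-\Pi_S^ku_K)\big)$ (with $|0|^{r-2}0=0$), and $\mathrm s_h(u_h;v_h)=\sum_{K\in\mathcal M}\sum_{S\in\Sigma(K)}h_S^{-s}\int_ST_{K,S}u_h\cdot(v_S-\Pi_S^kv_K)\,\mathrm{d}s$. $\nabla_u\psi_h(x,\cdot)$ is the gradient of $\psi_h(x,\cdot)$; $\nabla_u\psi_h(\cdot,\Pi^k_{\mathcal M}u_{\mathcal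 M})$ is assumed integrable on $\Omega$. Submesh and Raviart–Thomas space. A matching simplicial submesh $\mathcal T$ of $\mathcal M$ is a regular triangulation of $\Omega$ into simplices (no hanging nodes) such that every simplex is contained in exactly one cell of $\mathcal M$ and every face $F\in\mathcal F$ lying on the skeleton $\partial\mathcal M$ is contained in exactly one $S\in\Sigma$; each $F\in\mathcal F$ has a fixed unit normal $\nu_F$, with $\nu_F=\nu_S$ if $F\subset S\in\Sigma$. For a simplex $T$, $\mathrm{RT}_k(T)=P_k(T;\mathbb{R}^n)+x\,P_k(T)$; $\mathrm{RT}_k(\mathcal T;\mathbb M)$ consists of the matrix fields on $\Omega$ with distributional row-wise divergence in $L^{p'}(\Omega;\mathbb{R}^m)$ all of whose rows are in $\mathrm{RT}_k(T)$ on every $T\in\mathcal T$. *)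

theory Defs
  imports "HOL-Analysis.Analysis"
begin

section \<open>Calculus and Sobolev notions\<close>

definition partial_deriv :: "'n::finite \<Rightarrow> (real^'n \<Rightarrow> 'b::real_normed_vector) \<Rightarrow> real^'n \<Rightarrow> 'b" where
  "partial_deriv j f x = frechet_derivative f (at x) (axis j 1)"

definition Jac :: "(real^'n::finite \<Rightarrow> real^'m::finite) \<Rightarrow> real^'n \<Rightarrow> real^'n^'m" where
  "Jac v x = (\<chi> i j. partial_deriv j v x $ i)"

definition row_div :: "(real^'n::finite \<Rightarrow> real^'n^'m::finite) \<Rightarrow> real^'n \<Rightarrow> real^'m" where
  "row_div \<tau> x = (\<chi> i. \<Sum>j\<in>UNIV. partial_deriv j \<tau> x $ i $ j)"

text \<open>A function is smooth iff it belongs to a family of differentiable functions that is closed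
  under partial derivatives.\<close>

definition smooth_fun :: "(real^'n::finite \<Rightarrow> real) \<Rightarrow> bool" where
  "smooth_fun f \<longleftrightarrow> (\<exists>A. f \<in> A \<and>
     (\<forall>g\<in>A. (\<forall>x. g differentiable (at x)) \<and> (\<forall>j. partial_deriv j g \<in> A)))"

definition test_fun :: "(real^'n::finite) set \<Rightarrow> (real^'n \<Rightarrow> real) \<Rightarrow> bool" where
  "test_fun \<Omega> \<phi> \<longleftrightarrow> smooth_fun \<phi> \<and> (\<exists>C. compact C \<and> C \<subseteq> \<Omega> \<and> (\<forall>x. x \<notin> C \<longrightarrow> \<phi> x = 0))"

definition Lp_fun :: "real \<Rightarrow> (real^'n::finite) set \<Rightarrow> (real^'n \<Rightarrow> 'b::euclidean_space) \<Rightarrow> bool" where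
  "Lp_fun p \<Omega> f \<longleftrightarrow> f \<in> borel_measurable (lebesgue_on \<Omega>) \<and>
     integrable (lebesgue_on \<Omega>) (\<lambda>x. norm (f x) powr p)"

definition W1p_fun ::
  "real \<Rightarrow> (real^'n::finite) set \<Rightarrow> (real^'n \<Rightarrow> real^'m::finite) \<Rightarrow> (real^'n \<Rightarrow> real^'n^'m) \<Rightarrow> bool" where
  \<comment> \<open>\<open>v\<close> is a Sobolev function on \<open>\<Omega>\<close> with weak derivative \<open>G\<close>\<close>
  "W1p_fun p \<Omega> v G \<longleftrightarrow> Lp_fun p \<Omega> v \<and> Lp_fun p \<Omega> G \<and>
     (\<forall>\<phi> i j. test_fun \<Omega> \<phi> \<longrightarrow>
        (LINT x|lebesgue_on \<Omega>. v x $ i * partial_deriv j \<phi> x)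
          = - (LINT x|lebesgue_on \<Omega>. G x $ i $ j * \<phi> x))"

definition has_weak_div ::
  "real \<Rightarrow> (real^'n::finite) set \<Rightarrow> (real^'n \<Rightarrow> real^'n^'m::finite) \<Rightarrow> (real^'n \<Rightarrow> real^'m) \<Rightarrow> bool" where
  "has_weak_div q \<Omega> \<tau> g \<longleftrightarrow> Lp_fun q \<Omega> g \<and>
     (\<forall>\<phi> i. test_fun \<Omega> \<phi> \<longrightarrow>
        (LINT x|lebesgue_on \<Omega>. (\<Sum>j\<in>UNIV. \<tau> x $ i $ j * partial_deriv j \<phi> x))
          = - (LINT x|lebesgue_on \<Omega>. g x $ i * \<phi> x))"

definition weak_div ::
  "real \<Rightarrow> (real^'n::finite) set \<Rightarrow> (real^'n \<Rightarrow> real^'n^'m::finite) \<Rightarrow> real^'n \<Rightarrow> real^'m" where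
  \<comment> \<open>unique up to null sets\<close>
  "weak_div q \<Omega> \<tau> = (SOME g. has_weak_div q \<Omega> \<tau> g)"


section \<open>Surface measure on hyperplanes\<close>

text \<open>For a unit vector \<open>\<nu>\<close>, Lebesgue measure is the product of the \<open>(n-1)\<close>-dimensional measure
  on the hyperplane \<open>\<nu> \<bullet> x = c\<close> and of arc length along \<open>\<nu>\<close>. Hence the former is the image of
  Lebesgue measure on the slab of thickness 1 over the hyperplane under orthogonal projection.
  For \<open>n = 1\<close> it is the Dirac measure at the only point of the hyperplane.\<close>

definition hyperplane_measure :: "real^'n::finite \<Rightarrow> real \<Rightarrow> (real^'n) measure" where
  "hyperplane_measure \<nu> c =
     distr (restrict_space lborel {x. c \<le> \<nu> \<bullet> x \<and> \<nu> \<bullet> x \<le> c + 1}) borel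
       (\<lambda>x. x - (\<nu> \<bullet> x - c) *\<^sub>R \<nu>)"

text \<open>Surface measure on a set \<open>S\<close> contained in a hyperplane with unit normal \<open>\<nu>\<close>; the result
  does not depend on the chosen point of \<open>S\<close> or on the sign of \<open>\<nu>\<close>.\<close>

definition surf :: "real^'n::finite \<Rightarrow> (real^'n) set \<Rightarrow> (real^'n) measure" where
  "surf \<nu> S = restrict_space (hyperplane_measure \<nu> (\<nu> \<bullet> (SOME x. x \<in> S))) S"


section \<open>Domain and mesh\<close>

definition lipschitz_boundary :: "(real^'n::finite) set \<Rightarrow> bool" where
  "lipschitz_boundary \<Omega> \<longleftrightarrow> (\<forall>x\<in>frontier \<Omega>. \<exists>\<rho> e L g.
     0 < \<rho> \<and> norm e = 1 \<and> L-lipschitz_on UNIV (g :: real^'n \<Rightarrow> real) \<and>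
     (\<forall>y\<in>ball x \<rho>. y \<in> \<Omega> \<longleftrightarrow> g (y - (e \<bullet> y) *\<^sub>R e) < e \<bullet> y))"

text \<open>Polyhedral sets need not be convex, in contrast to \<open>polytope\<close>.\<close>

definition polyhedral_set :: "(real^'n::finite) set \<Rightarrow> bool" where
  "polyhedral_set A \<longleftrightarrow> (\<exists>P. finite P \<and> (\<forall>Q\<in>P. polytope Q) \<and> A = \<Union>P)"

definition polyhedral_lipschitz_domain :: "(real^'n::finite) set \<Rightarrow> bool" where
  "polyhedral_lipschitz_domain \<Omega> \<longleftrightarrow> open \<Omega> \<and> bounded \<Omega> \<and> connected \<Omega> \<and> \<Omega> \<noteq> {} \<and>
     polyhedral_set (closure \<Omega>) \<and> lipschitz_boundary \<Omega>"

definition polytopal_cell :: "(real^'n::finite) set \<Rightarrow> bool" where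
  "polytopal_cell K \<longleftrightarrow> polyhedral_set K \<and> K = closure (interior K) \<and> 0 < measure lebesgue K"

definition outer_normal_on :: "(real^'n::finite) set \<Rightarrow> (real^'n) set \<Rightarrow> real^'n \<Rightarrow> bool" where
  "outer_normal_on A S \<nu> \<longleftrightarrow>
     (AE x in surf \<nu> S. \<exists>\<epsilon>>0. \<forall>t. 0 < t \<and> t < \<epsilon> \<longrightarrow> x - t *\<^sub>R \<nu> \<in> A \<and> x + t *\<^sub>R \<nu> \<notin> A)"

text \<open>\<open>Kminus S\<close> is relevant only for interior faces \<open>S\<close>.\<close>

record ('n::finite) mesh =
  dom :: "(real^'n) set"
  GammaD :: "(real^'n) set"
  cells :: "(real^'n) set set"
  faces :: "(real^'n) set set"
  nrm :: "(real^'n) set \<Rightarrow> real^'n"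
  Kplus :: "(real^'n) set \<Rightarrow> (real^'n) set"
  Kminus :: "(real^'n) set \<Rightarrow> (real^'n) set"

definition int_faces :: "'n::finite mesh \<Rightarrow> (real^'n) set set" where
  "int_faces X = {S \<in> faces X. \<exists>K\<in>cells X. \<exists>K'\<in>cells X. K \<noteq> K' \<and> S \<subseteq> K \<inter> K'}"

definition bd_faces :: "'n::finite mesh \<Rightarrow> (real^'n) set set" where
  "bd_faces X = {S \<in> faces X. \<exists>K\<in>cells X. S \<subseteq> K \<inter> frontier (dom X)}"

definition D_faces :: "'n::finite mesh \<Rightarrow> (real^'n) set set" where
  "D_faces X = {S \<in> faces X. S \<subseteq> GammaD X}"

definition N_faces :: "'n::finite mesh \<Rightarrow> (real^'n) set set" where
  "N_faces X = bd_faces X - D_faces X"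

definition skeleton :: "'n::finite mesh \<Rightarrow> (real^'n) set" where
  "skeleton X = (\<Union>K\<in>cells X. frontier K)"

definition faces_of :: "'n::finite mesh \<Rightarrow> (real^'n) set \<Rightarrow> (real^'n) set set" where
  "faces_of X K = {S \<in> faces X. K = Kplus X S \<or> (S \<in> int_faces X \<and> K = Kminus X S)}"

definition flat_face :: "real^'n::finite \<Rightarrow> (real^'n) set \<Rightarrow> bool" where
  "flat_face \<nu> S \<longleftrightarrow> closed S \<and> connected S \<and> norm \<nu> = 1 \<and> (\<exists>c. \<forall>x\<in>S. \<nu> \<bullet> x = c) \<and>
     0 < emeasure (surf \<nu> S) S"

definition polytopal_mesh :: "'n::finite mesh \<Rightarrow> bool" where
  "polytopal_mesh X \<longleftrightarrow>
     polyhedral_lipschitz_domain (dom X) \<and>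
     GammaD X \<noteq> {} \<and> closed (GammaD X) \<and> GammaD X \<subseteq> frontier (dom X) \<and>
     finite (cells X) \<and> (\<forall>K\<in>cells X. polytopal_cell K) \<and>
     (\<forall>K\<in>cells X. \<forall>K'\<in>cells X. K \<noteq> K' \<longrightarrow> emeasure lebesgue (K \<inter> K') = 0) \<and>
     \<Union>(cells X) = closure (dom X) \<and>
     finite (faces X) \<and> (\<forall>S\<in>faces X. flat_face (nrm X S) S) \<and>
     faces X = int_faces X \<union> bd_faces X \<and>
     (\<forall>S\<in>faces X. \<forall>S'\<in>faces X. S \<noteq> S' \<longrightarrow> emeasure (surf (nrm X S) S) (S \<inter> S') = 0) \<and>
     skeleton X = \<Union>(faces X) \<and>
     (\<forall>S\<in>int_faces X. Kplus X S \<in> cells X \<and> Kminus X S \<in> cells X \<and> Kplus X S \<noteq> Kminus X S \<and>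
        S \<subseteq> Kplus X S \<inter> Kminus X S \<and>
        outer_normal_on (Kplus X S) S (nrm X S) \<and> outer_normal_on (Kminus X S) S (- nrm X S)) \<and>
     (\<forall>S\<in>bd_faces X. Kplus X S \<in> cells X \<and> S \<subseteq> Kplus X S \<inter> frontier (dom X) \<and>
        outer_normal_on (dom X) S (nrm X S))"


section \<open>Piecewise polynomials and \<open>L\<^sup>2\<close> projections\<close>

text \<open>A piecewise function on a collection of sets (cells, faces, simplices) is a family of
  functions indexed by these sets, so that the value from either side of a face is available.
  The piece with index \<open>A\<close> matters only on \<open>A\<close>. Off the null set where pieces overlap,
  \<open>glue\<close> is the function that the family describes.\<close>

type_synonym ('n, 'b) pieces = "(real^'n) set \<Rightarrow> real^'n \<Rightarrow> 'b"

definition glue :: "(real^'n::finite) set set \<Rightarrow> ('n, 'b) pieces \<Rightarrow> real^'n \<Rightarrow> 'b" where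
  "glue \<A> v x = v (SOME A. A \<in> \<A> \<and> x \<in> A) x"

definition polys :: "nat \<Rightarrow> (real^'n::finite \<Rightarrow> 'b::euclidean_space) set" where
  \<comment> \<open>total degree at most \<open>k\<close>\<close>
  "polys k = {f. \<forall>b\<in>Basis. \<exists>c. \<forall>x.
     f x \<bullet> b = (\<Sum>\<alpha> | (\<Sum>i\<in>UNIV. \<alpha> i) \<le> k. c \<alpha> * (\<Prod>i\<in>UNIV. x $ i ^ \<alpha> i))}"

definition pw_polys :: "nat \<Rightarrow> (real^'n::finite) set set \<Rightarrow> ('n, 'b::euclidean_space) pieces set" where
  "pw_polys k \<A> = {v. \<forall>A\<in>\<A>. v A \<in> polys k}"

definition L2_proj ::
  "(real^'n::finite) measure \<Rightarrow> nat \<Rightarrow> (real^'n \<Rightarrow> 'b::euclidean_space) \<Rightarrow> real^'n \<Rightarrow> 'b" where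
  "L2_proj \<mu> k f = (SOME q. q \<in> polys k \<and>
     (\<forall>\<phi>\<in>polys k. (LINT x|\<mu>. q x \<bullet> \<phi> x) = (LINT x|\<mu>. f x \<bullet> \<phi> x)))"

text \<open>The projections onto piecewise polynomials on the cells and on the simplices
  act separately on each piece \<open>A\<close>.\<close>

definition pw_proj ::
  "nat \<Rightarrow> (real^'n::finite \<Rightarrow> 'b::euclidean_space) \<Rightarrow> ('n, 'b) pieces" where
  "pw_proj k f A = L2_proj (lebesgue_on A) k f"

definition face_proj ::
  "'n::finite mesh \<Rightarrow> nat \<Rightarrow> (real^'n) set \<Rightarrow> (real^'n \<Rightarrow> 'b::euclidean_space) \<Rightarrow> real^'n \<Rightarrow> 'b" where
  "face_proj X k S f = L2_proj (surf (nrm X S) S) k f"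

definition jump ::
  "'n::finite mesh \<Rightarrow> ('n, 'b::real_vector) pieces \<Rightarrow> (real^'n) set \<Rightarrow> real^'n \<Rightarrow> 'b" where
  "jump X v S x = (if S \<in> int_faces X then v (Kplus X S) x - v (Kminus X S) x else v (Kplus X S) x)"

definition avg ::
  "'n::finite mesh \<Rightarrow> ('n, 'b::real_vector) pieces \<Rightarrow> (real^'n) set \<Rightarrow> real^'n \<Rightarrow> 'b" where
  "avg X v S x = (if S \<in> int_faces X then (v (Kplus X S) x + v (Kminus X S) x) /\<^sub>R 2
                  else v (Kplus X S) x)"

abbreviation vol_int :: "'n::finite mesh \<Rightarrow> (real^'n \<Rightarrow> real) \<Rightarrow> real" where
  "vol_int X f \<equiv> integral\<^sup>L (lebesgue_on (dom X)) f"

abbreviation face_int :: "'n::finite mesh \<Rightarrow> (real^'n) set \<Rightarrow> (real^'n \<Rightarrow> real) \<Rightarrow> real" where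
  "face_int X S f \<equiv> integral\<^sup>L (surf (nrm X S) S) f"


section \<open>The space of fields with vanishing normal trace on the Neumann boundary\<close>

text \<open>The trace is the continuous extension of the restriction of smooth functions, so it vanishes
  on the Dirichlet boundary iff the restrictions of some approximating sequence tend to zero there.
  The boundary faces partition the boundary of the domain up to null sets.\<close>

definition zero_trace_D ::
  "real \<Rightarrow> 'n::finite mesh \<Rightarrow> (real^'n \<Rightarrow> real^'m::finite) \<Rightarrow> (real^'n \<Rightarrow> real^'n^'m) \<Rightarrow> bool" where
  "zero_trace_D p X v G \<longleftrightarrow> (\<exists>w :: nat \<Rightarrow> real^'n \<Rightarrow> real^'m.
     (\<forall>l i. smooth_fun (\<lambda>x. w l x $ i)) \<and>
     (\<lambda>l. vol_int X (\<lambda>x. norm (v x - w l x) powr p)) \<longlonglongrightarrow> 0 \<and>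
     (\<lambda>l. vol_int X (\<lambda>x. norm (G x - Jac (w l) x) powr p)) \<longlonglongrightarrow> 0 \<and>
     (\<lambda>l. \<Sum>S\<in>bd_faces X. face_int X S (\<lambda>x. indicat_real (GammaD X) x * norm (w l x) powr p))
        \<longlonglongrightarrow> 0)"

definition WN_space :: "real \<Rightarrow> 'n::finite mesh \<Rightarrow> (real^'n \<Rightarrow> real^'n^'m::finite) set" where
  "WN_space p X = {\<tau>. Lp_fun (p / (p - 1)) (dom X) \<tau> \<and>
     (\<exists>g. has_weak_div (p / (p - 1)) (dom X) \<tau> g \<and>
       (\<forall>v G. W1p_fun p (dom X) v G \<and> zero_trace_D p X v G \<longrightarrow>
          vol_int X (\<lambda>x. \<tau> x \<bullet> G x + v x \<bullet> g x) = 0))}"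


section \<open>Discrete spaces and operators\<close>

definition V_h ::
  "nat \<Rightarrow> 'n::finite mesh \<Rightarrow> (('n, real^'m::finite) pieces \<times> ('n, real^'m) pieces) set" where
  "V_h k X = pw_polys (k + 1) (cells X) \<times> pw_polys k (faces X)"

definition VD_h ::
  "nat \<Rightarrow> 'n::finite mesh \<Rightarrow> (('n, real^'m::finite) pieces \<times> ('n, real^'m) pieces) set" where
  "VD_h k X = {v \<in> V_h k X. \<forall>S\<in>D_faces X. \<forall>x\<in>S. snd v S x = 0}"

definition W_h ::
  "nat \<Rightarrow> 'n::finite mesh \<Rightarrow> (('n, real^'n^'m::finite) pieces \<times> ('n, real^'m) pieces) set" where
  "W_h k X = pw_polys k (cells X) \<times> pw_polys k (faces X)"

definition WN_h ::
  "nat \<Rightarrow> 'n::finite mesh \<Rightarrow> (('n, real^'n^'m::finite) pieces \<times> ('n, real^'m) pieces) set" where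
  "WN_h k X = {\<tau> \<in> W_h k X. \<forall>S\<in>N_faces X. \<forall>x\<in>S. snd \<tau> S x = 0}"

definition D_h ::
  "nat \<Rightarrow> 'n::finite mesh \<Rightarrow> ('n, real^'m::finite) pieces \<times> ('n, real^'m) pieces
     \<Rightarrow> ('n, real^'n^'m) pieces" where
  "D_h k X v = (SOME G. G \<in> pw_polys k (cells X) \<and>
     (\<forall>\<tau>\<in>pw_polys k (cells X).
        vol_int X (\<lambda>x. glue (cells X) G x \<bullet> glue (cells X) \<tau> x) =
        - vol_int X (\<lambda>x. glue (cells X) (fst v) x \<bullet> glue (cells X) (\<lambda>K. row_div (\<tau> K)) x)
        + (\<Sum>S\<in>faces X. face_int X S (\<lambda>x. snd v S x \<bullet> jump X (\<lambda>K y. \<tau> K y *v nrm X S) S x))))"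

definition div_h ::
  "nat \<Rightarrow> 'n::finite mesh \<Rightarrow> ('n, real^'n^'m::finite) pieces \<times> ('n, real^'m) pieces
     \<Rightarrow> ('n, real^'m) pieces" where
  "div_h k X \<tau> = (SOME d. d \<in> pw_polys k (cells X) \<and>
     (\<forall>\<phi>\<in>pw_polys k (cells X).
        vol_int X (\<lambda>x. glue (cells X) d x \<bullet> glue (cells X) \<phi> x) =
        - vol_int X (\<lambda>x. glue (cells X) (\<lambda>K. Jac (\<phi> K)) x \<bullet> glue (cells X) (fst \<tau>) x)
        + (\<Sum>S\<in>faces X. face_int X S (\<lambda>x. jump X \<phi> S x \<bullet> snd \<tau> S x))))"

definition T_stab ::
  "nat \<Rightarrow> real \<Rightarrow> 'n::finite mesh \<Rightarrow> (real^'n) set \<Rightarrow> (real^'n) set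
     \<Rightarrow> ('n, real^'m::finite) pieces \<times> ('n, real^'m) pieces \<Rightarrow> real^'n \<Rightarrow> real^'m" where
  "T_stab k r X K S u =
     (let w = (\<lambda>x. snd u S x - face_proj X k S (fst u K) x)
      in face_proj X k S (\<lambda>x. norm (w x) powr (r - 2) *\<^sub>R w x))"

definition s_h ::
  "nat \<Rightarrow> real \<Rightarrow> real \<Rightarrow> 'n::finite mesh
     \<Rightarrow> ('n, real^'m::finite) pieces \<times> ('n, real^'m) pieces
     \<Rightarrow> ('n, real^'m) pieces \<times> ('n, real^'m) pieces \<Rightarrow> real" where
  "s_h k r s X u v = (\<Sum>K\<in>cells X. \<Sum>S\<in>faces_of X K. diameter S powr (- s) *
     face_int X S (\<lambda>x. T_stab k r X K S u x \<bullet> (snd v S x - face_proj X k S (fst v K) x)))"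

definition energy_density ::
  "nat \<Rightarrow> 'n::finite mesh \<Rightarrow> (real^'n^'m::finite \<Rightarrow> real) \<Rightarrow> (real^'n \<Rightarrow> real^'m \<Rightarrow> real)
     \<Rightarrow> ('n, real^'m) pieces \<times> ('n, real^'m) pieces \<Rightarrow> real^'n \<Rightarrow> real" where
  "energy_density k X \<Psi> \<psi> v x = \<Psi> (glue (cells X) (D_h k X v) x)
     + \<psi> x (glue (cells X) (pw_proj k (glue (cells X) (fst v))) x)"

definition E_h ::
  "nat \<Rightarrow> real \<Rightarrow> real \<Rightarrow> 'n::finite mesh \<Rightarrow> (real^'n^'m::finite \<Rightarrow> real)
     \<Rightarrow> (real^'n \<Rightarrow> real^'m \<Rightarrow> real) \<Rightarrow> ('n, real^'m) pieces \<times> ('n, real^'m) pieces \<Rightarrow> real" where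
  "E_h k r s X \<Psi> \<psi> v = vol_int X (energy_density k X \<Psi> \<psi> v) + s_h k r s X v v / r"

text \<open>Minimality among all functions of finite energy. By convexity the energy density is bounded
  from below by an integrable function as soon as the density and the gradient of \<open>\<psi>\<close> at the
  minimizer are integrable, so a non-integrable density means that the energy is \<open>+\<infinity>\<close>.\<close>

definition discrete_minimizer ::
  "nat \<Rightarrow> real \<Rightarrow> real \<Rightarrow> 'n::finite mesh \<Rightarrow> (real^'n^'m::finite \<Rightarrow> real)
     \<Rightarrow> (real^'n \<Rightarrow> real^'m \<Rightarrow> real) \<Rightarrow> ('n, real^'m) pieces \<times> ('n, real^'m) pieces \<Rightarrow> bool" where
  "discrete_minimizer k r s X \<Psi> \<psi> u \<longleftrightarrow> u \<in> VD_h k X \<and>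
     integrable (lebesgue_on (dom X)) (energy_density k X \<Psi> \<psi> u) \<and>
     (\<forall>v\<in>VD_h k X. integrable (lebesgue_on (dom X)) (energy_density k X \<Psi> \<psi> v) \<longrightarrow>
        E_h k r s X \<Psi> \<psi> u \<le> E_h k r s X \<Psi> \<psi> v)"

definition sigma_cells ::
  "nat \<Rightarrow> 'n::finite mesh \<Rightarrow> (real^'n^'m::finite \<Rightarrow> real^'n^'m)
     \<Rightarrow> ('n, real^'m) pieces \<times> ('n, real^'m) pieces \<Rightarrow> ('n, real^'n^'m) pieces" where
  "sigma_cells k X D\<Psi> u = pw_proj k (\<lambda>x. D\<Psi> (glue (cells X) (D_h k X u) x))"

definition sigma_faces ::
  "nat \<Rightarrow> real \<Rightarrow> real \<Rightarrow> 'n::finite mesh \<Rightarrow> (real^'n^'m::finite \<Rightarrow> real^'n^'m)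
     \<Rightarrow> ('n, real^'m) pieces \<times> ('n, real^'m) pieces \<Rightarrow> ('n, real^'m) pieces" where
  "sigma_faces k r s X D\<Psi> u S x =
    (if S \<in> int_faces X then
       avg X (\<lambda>K y. sigma_cells k X D\<Psi> u K y *v nrm X S) S x
       + diameter S powr (- s) *\<^sub>R
         ((T_stab k r X (Kplus X S) S u x - T_stab k r X (Kminus X S) S u x) /\<^sub>R 2)
     else if S \<in> D_faces X then
       sigma_cells k X D\<Psi> u (Kplus X S) x *v nrm X S
       + diameter S powr (- s) *\<^sub>R T_stab k r X (Kplus X S) S u x
     else 0)"

definition sigma_h ::
  "nat \<Rightarrow> real \<Rightarrow> real \<Rightarrow> 'n::finite mesh \<Rightarrow> (real^'n^'m::finite \<Rightarrow> real^'n^'m)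
     \<Rightarrow> ('n, real^'m) pieces \<times> ('n, real^'m) pieces
     \<Rightarrow> ('n, real^'n^'m) pieces \<times> ('n, real^'m) pieces" where
  "sigma_h k r s X D\<Psi> u = (sigma_cells k X D\<Psi> u, sigma_faces k r s X D\<Psi> u)"


section \<open>Simplicial submesh and Raviart--Thomas space\<close>

definition submesh_faces :: "(real^'n::finite) set set \<Rightarrow> (real^'n) set set" where
  "submesh_faces \<T> = {F. \<exists>T\<in>\<T>. F facet_of T}"

text \<open>The library's \<open>triangulation\<close> requires any two simplices to meet in a common face,
  which excludes hanging nodes.\<close>

definition matching_submesh ::
  "'n::finite mesh \<Rightarrow> (real^'n) set set \<Rightarrow> ((real^'n) set \<Rightarrow> real^'n) \<Rightarrow> bool" where
  "matching_submesh X \<T> \<nu>F \<longleftrightarrow>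
     triangulation \<T> \<and> (\<forall>T\<in>\<T>. int CARD('n) simplex T) \<and> \<Union>\<T> = closure (dom X) \<and>
     (\<forall>T\<in>\<T>. \<exists>!K. K \<in> cells X \<and> T \<subseteq> K) \<and>
     (\<forall>F\<in>submesh_faces \<T>. F \<subseteq> skeleton X \<longrightarrow> (\<exists>!S. S \<in> faces X \<and> F \<subseteq> S)) \<and>
     (\<forall>F\<in>submesh_faces \<T>. norm (\<nu>F F) = 1 \<and> (\<exists>c. \<forall>x\<in>F. \<nu>F F \<bullet> x = c)) \<and>
     (\<forall>F\<in>submesh_faces \<T>. \<forall>S\<in>faces X. F \<subseteq> S \<longrightarrow> \<nu>F F = nrm X S)"

definition RT_local :: "nat \<Rightarrow> (real^'n::finite \<Rightarrow> real^'n) set" where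
  "RT_local k = {q. \<exists>a\<in>polys k. \<exists>b\<in>polys k. \<forall>x. q x = a x + b x *\<^sub>R x}"

definition RT_space ::
  "nat \<Rightarrow> real \<Rightarrow> 'n::finite mesh \<Rightarrow> (real^'n) set set \<Rightarrow> ('n, real^'n^'m::finite) pieces set" where
  "RT_space k p X \<T> = {\<tau>. (\<forall>T\<in>\<T>. \<forall>i. (\<lambda>x. \<tau> T x $ i) \<in> RT_local k) \<and>
     (\<exists>g. has_weak_div (p / (p - 1)) (dom X) (glue \<T> \<tau>) g)}"

text \<open>On a face \<open>F\<close>, the normal component of \<open>\<tau>\<close> is prescribed as the trace from every
  simplex that has \<open>F\<close> as a facet.\<close>

definition RT_interpolates ::
  "nat \<Rightarrow> 'n::finite mesh \<Rightarrow> (real^'n) set set \<Rightarrow> ((real^'n) set \<Rightarrow> real^'n)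
     \<Rightarrow> ('n, real^'n^'m::finite) pieces \<times> ('n, real^'m) pieces
     \<Rightarrow> ('n, real^'n^'m) pieces \<Rightarrow> bool" where
  "RT_interpolates k X \<T> \<nu>F \<sigma> \<tau> \<longleftrightarrow>
     (0 < k \<longrightarrow> (\<forall>T\<in>\<T>. \<forall>x\<in>T.
        pw_proj (k - 1) (glue \<T> \<tau>) T x = pw_proj (k - 1) (glue (cells X) (fst \<sigma>)) T x)) \<and>
     (\<forall>T\<in>\<T>. \<forall>F. F facet_of T \<longrightarrow>
        (\<forall>S\<in>faces X. F \<subseteq> S \<longrightarrow> (\<forall>x\<in>F. \<tau> T x *v \<nu>F F = snd \<sigma> S x)) \<and>
        (\<forall>K\<in>cells X. F \<subseteq> K \<and> \<not> F \<subseteq> frontier K \<longrightarrow>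
           (\<forall>x\<in>F. \<tau> T x *v \<nu>F F = fst \<sigma> K x *v \<nu>F F)))"

end

theory Submission
  imports Defs
begin

text \<open>
  Testing the discrete Euler--Lagrange equations with \<open>v\<^sub>h = (\<phi>, v\<^sub>\<Sigma>)\<close>, where \<open>v\<^sub>\<Sigma>\<close> is zero on
  Dirichlet faces and the average of \<open>\<phi>\<close> on all other faces, and integrating by parts on every cell
  yields the defining identity of \<open>div\<^sub>h \<sigma>\<^sub>h\<close>. For the Raviart--Thomas function, integration by parts
  on every simplex and the prescribed moments and normal traces reproduce the same right-hand side.

  Integration by parts is proved for any compact set \<open>A\<close> whose frontier is covered by finitely many
  flat faces. Near almost every point of a face, the indicator of \<open>A\<close> is constant on both sides of
  the hyperplane. Hence, along almost every line in direction \<open>e\<close>, the indicator equals the signed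
  number of crossings ahead, so that the integral of a derivative in direction \<open>e\<close> over \<open>A\<close> is a sum
  of integrals over half-infinite cylinders based on the faces, which Fubini's theorem reduces to
  the faces. The same jumps match the faces of the mesh with the facets of the simplices: the
  orientation of a facet, summed over the simplices of a cell, is the jump of the indicator of the
  cell, which vanishes unless the facet lies on the frontier of the cell.
\<close>

section \<open>Surface measure and oblique projections\<close>

text \<open>Cells may be nonconvex, and the mesh fixes orientations only through the normal line at
  almost every point of a face; on boundary faces it orients the domain and not the cell. Generic
  points upgrade this to full half balls. Since \<open>surf\<close> pushes a unit slab forward along
  the normal while cylinders in direction \<open>e\<close> meet a face obliquely, shears are needed
  to compare projections. The chord of the slab in direction \<open>e\<close>, of length
  \<open>1 / \<bar>e \<bullet> \<nu>\<bar>\<close>, is the origin of the factor in the flux.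
  \<open>D_h\<close>, \<open>div_h\<close>, the projections and the weak divergence are choices by
  \<open>SOME\<close>, so existence must come first. The L2 form on polynomials is degenerate on a
  face; the Riesz representation therefore rests on a semidefinite system and asks that functionals
  ignore polynomials vanishing almost everywhere. Uniqueness holds only for values on cells. For the
  weak divergence only integrals against compactly supported smooth functions are available, hence
  the cutoffs before it is paired with a polynomial on a simplex.\<close>

definition slab :: "real^'n::finite \<Rightarrow> real \<Rightarrow> (real^'n) set" where
  "slab \<nu> c = {z. c \<le> \<nu> \<bullet> z \<and> \<nu> \<bullet> z \<le> c + 1}"

lemma slab_borel[measurable]: "slab \<nu> c \<in> sets borel"
proof -
  have "closed (slab \<nu> c)" unfolding slab_def
    by (intro closed_Collect_conj closed_Collect_le continuous_intros)
  then show ?thesis by simp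
qed

section \<open>Shears preserve Lebesgue measure\<close>

lemma nn_integral_lborel_translate:
  fixes a :: "'a::euclidean_space"
  assumes [measurable]: "f \<in> borel_measurable borel"
  shows "(\<integral>\<^sup>+x. f (a + x) \<partial>lborel) = (\<integral>\<^sup>+x. f x \<partial>lborel)"
  by (subst (2) lborel_distr_plus[of a, symmetric], subst nn_integral_distr) auto

text \<open>The right-hand side no longer contains \<open>w\<close>, so the left-hand side is the
  same for all \<open>w\<close>; comparison with \<open>w = 0\<close> gives invariance of Lebesgue
  measure without determinants. Only translations and Tonelli's theorem are used, after inserting a
  factor that integrates to 1 along direction \<open>\<nu>\<close>.\<close>

lemma nn_integral_shear:
  fixes \<nu> w :: "real^'n"
  assumes \<nu>: "\<nu> \<bullet> \<nu> = 1" and w: "\<nu> \<bullet> w = 0" and f[measurable]: "f \<in> borel_measurable borel"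
  shows "(\<integral>\<^sup>+x. f (x + (\<nu> \<bullet> x) *\<^sub>R w) \<partial>lborel) =
    (\<integral>\<^sup>+t. (\<integral>\<^sup>+y. indicator (slab \<nu> 0) y * f (y - (\<nu> \<bullet> y) *\<^sub>R \<nu> + t *\<^sub>R \<nu>) \<partial>lborel) \<partial>lborel)"
proof -
  have m1: "(\<lambda>p. indicator (slab \<nu> 0) (h p) * f (g p)) \<in> borel_measurable borel"
    if "continuous_on UNIV g" "continuous_on UNIV h"
    for g h :: "'x::topological_space \<Rightarrow> real^'n"
  proof -
    have [measurable]: "g \<in> borel_measurable borel" "h \<in> borel_measurable borel"
      using that by (auto intro: borel_measurable_continuous_onI)
    show ?thesis by measurable
  qed
  have m2: "(\<lambda>(x, t). indicator (slab \<nu> 0) (h x t) * f (g x t)) \<in> borel_measurable (lborel \<Otimes>\<^sub>M lborel)"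
    if "continuous_on UNIV (\<lambda>(x, t). h x t)" "continuous_on UNIV (\<lambda>(x, t). g x t)"
    for g h :: "real^'n \<Rightarrow> real \<Rightarrow> real^'n"
  proof -
    have [measurable]: "(\<lambda>(x, t). h x t) \<in> borel_measurable (lborel \<Otimes>\<^sub>M lborel)"
        "(\<lambda>(x, t). g x t) \<in> borel_measurable (lborel \<Otimes>\<^sub>M lborel)"
      using that by (simp_all add: lborel_prod borel_measurable_continuous_onI)
    then have [measurable]: "(\<lambda>p. h (fst p) (snd p)) \<in> borel_measurable (lborel \<Otimes>\<^sub>M lborel)"
        "(\<lambda>p. g (fst p) (snd p)) \<in> borel_measurable (lborel \<Otimes>\<^sub>M lborel)" by (simp_all add: case_prod_unfold)
    show ?thesis unfolding case_prod_unfold by measurable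
  qed
  let ?s = "indicator (slab \<nu> 0) :: real^'n \<Rightarrow> ennreal"
  have one: "(\<integral>\<^sup>+t. ?s (x - t *\<^sub>R \<nu>) \<partial>lborel) = 1" for x
  proof -
    have "(\<integral>\<^sup>+t. ?s (x - t *\<^sub>R \<nu>) \<partial>lborel) = (\<integral>\<^sup>+t. indicator {\<nu> \<bullet> x - 1 .. \<nu> \<bullet> x} t \<partial>lborel)"
      by (rule nn_integral_cong) (use \<nu> in \<open>auto simp: slab_def inner_simps split: split_indicator\<close>)
    then show ?thesis by simp
  qed
  have "(\<integral>\<^sup>+x. f (x + (\<nu> \<bullet> x) *\<^sub>R w) \<partial>lborel) =
      (\<integral>\<^sup>+x. (\<integral>\<^sup>+t. ?s (x - t *\<^sub>R \<nu>) * f (x + (\<nu> \<bullet> x) *\<^sub>R w) \<partial>lborel) \<partial>lborel)"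
    by (subst nn_integral_multc) (auto simp: one intro!: measurable_compose[OF _ borel_measurable_indicator] borel_measurable_continuous_onI continuous_intros)
  also have "\<dots> = (\<integral>\<^sup>+t. (\<integral>\<^sup>+x. ?s (x - t *\<^sub>R \<nu>) * f (x + (\<nu> \<bullet> x) *\<^sub>R w) \<partial>lborel) \<partial>lborel)"
    by (rule lborel_pair.Fubini'[symmetric], rule m2) (auto simp: case_prod_unfold intro!: continuous_intros)
  also have "\<dots> = (\<integral>\<^sup>+t. (\<integral>\<^sup>+x. ?s x * f (x + (\<nu> \<bullet> x) *\<^sub>R w + t *\<^sub>R (\<nu> + w)) \<partial>lborel) \<partial>lborel)"
  proof (rule nn_integral_cong)
    fix t :: real
    have "(\<lambda>x. ?s (x - t *\<^sub>R \<nu>) * f (x + (\<nu> \<bullet> x) *\<^sub>R w)) \<in> borel_measurable borel"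
      by (intro m1 continuous_intros)
    from nn_integral_lborel_translate[OF this, of "t *\<^sub>R \<nu>"]
    show "(\<integral>\<^sup>+x. ?s (x - t *\<^sub>R \<nu>) * f (x + (\<nu> \<bullet> x) *\<^sub>R w) \<partial>lborel) =
      (\<integral>\<^sup>+x. ?s x * f (x + (\<nu> \<bullet> x) *\<^sub>R w + t *\<^sub>R (\<nu> + w)) \<partial>lborel)"
      using \<nu> by (simp add: inner_simps algebra_simps)
  qed
  also have "\<dots> = (\<integral>\<^sup>+x. (\<integral>\<^sup>+t. ?s x * f (x + (\<nu> \<bullet> x) *\<^sub>R w + t *\<^sub>R (\<nu> + w)) \<partial>lborel) \<partial>lborel)"
    by (rule lborel_pair.Fubini', rule m2) (auto simp: case_prod_unfold intro!: continuous_intros)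
  \<comment> \<open>Translating \<open>t\<close> by \<open>\<nu> \<bullet> x\<close> removes the
    shear term: \<open>w\<close> is left only in the displacement
    \<open>t *\<^sub>R (\<nu> + w)\<close>.\<close>
  also have "\<dots> = (\<integral>\<^sup>+x. (\<integral>\<^sup>+t. ?s x * f (x - (\<nu> \<bullet> x) *\<^sub>R \<nu> + t *\<^sub>R (\<nu> + w)) \<partial>lborel) \<partial>lborel)"
  proof (rule nn_integral_cong)
    fix x :: "real^'n"
    have "(\<lambda>t. ?s x * f (x - (\<nu> \<bullet> x) *\<^sub>R \<nu> + t *\<^sub>R (\<nu> + w))) \<in> borel_measurable borel"
      by (intro m1 continuous_intros)
    from nn_integral_lborel_translate[OF this, of "\<nu> \<bullet> x"]
    show "(\<integral>\<^sup>+t. ?s x * f (x + (\<nu> \<bullet> x) *\<^sub>R w + t *\<^sub>R (\<nu> + w)) \<partial>lborel) =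
      (\<integral>\<^sup>+t. ?s x * f (x - (\<nu> \<bullet> x) *\<^sub>R \<nu> + t *\<^sub>R (\<nu> + w)) \<partial>lborel)"
      by (simp add: algebra_simps)
  qed
  also have "\<dots> = (\<integral>\<^sup>+t. (\<integral>\<^sup>+x. ?s x * f (x - (\<nu> \<bullet> x) *\<^sub>R \<nu> + t *\<^sub>R (\<nu> + w)) \<partial>lborel) \<partial>lborel)"
    by (rule lborel_pair.Fubini'[symmetric], rule m2) (auto simp: case_prod_unfold intro!: continuous_intros)
  \<comment> \<open>For fixed \<open>t\<close> the vector \<open>t *\<^sub>R w\<close> is constant,
    and translating by it preserves the slab because \<open>w\<close> is orthogonal to
    \<open>\<nu>\<close>.\<close>
  also have "\<dots> = (\<integral>\<^sup>+t. (\<integral>\<^sup>+x. ?s x * f (x - (\<nu> \<bullet> x) *\<^sub>R \<nu> + t *\<^sub>R \<nu>) \<partial>lborel) \<partial>lborel)"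
  proof (rule nn_integral_cong)
    fix t :: real
    have "(\<lambda>x. ?s x * f (x - (\<nu> \<bullet> x) *\<^sub>R \<nu> + t *\<^sub>R \<nu>)) \<in> borel_measurable borel"
      by (intro m1 continuous_intros)
    from nn_integral_lborel_translate[OF this, of "t *\<^sub>R w"]
    have "(\<integral>\<^sup>+x. ?s (t *\<^sub>R w + x) * f (t *\<^sub>R w + x - (\<nu> \<bullet> (t *\<^sub>R w + x)) *\<^sub>R \<nu> + t *\<^sub>R \<nu>) \<partial>lborel) =
      (\<integral>\<^sup>+x. ?s x * f (x - (\<nu> \<bullet> x) *\<^sub>R \<nu> + t *\<^sub>R \<nu>) \<partial>lborel)" .
    moreover have "?s (t *\<^sub>R w + x) = ?s x" for x
      using w by (simp add: slab_def inner_simps indicator_def)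
    ultimately show "(\<integral>\<^sup>+x. ?s x * f (x - (\<nu> \<bullet> x) *\<^sub>R \<nu> + t *\<^sub>R (\<nu> + w)) \<partial>lborel) =
      (\<integral>\<^sup>+x. ?s x * f (x - (\<nu> \<bullet> x) *\<^sub>R \<nu> + t *\<^sub>R \<nu>) \<partial>lborel)"
      using w by (simp add: inner_add_right algebra_simps)
  qed
  finally show ?thesis .
qed

lemma distr_shear:
  fixes \<nu> w :: "real^'n"
  assumes "norm \<nu> = 1" "\<nu> \<bullet> w = 0"
  shows "distr lborel borel (\<lambda>x. x + (\<nu> \<bullet> x) *\<^sub>R w) = lborel"
proof (rule measure_eqI)
  fix B assume "B \<in> sets (distr lborel borel (\<lambda>x. x + (\<nu> \<bullet> x) *\<^sub>R w))"
  then have B[measurable]: "B \<in> sets borel" by simp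
  have \<nu>: "\<nu> \<bullet> \<nu> = 1" using assms by (simp add: dot_square_norm)
  have m[measurable]: "(\<lambda>x. x + (\<nu> \<bullet> x) *\<^sub>R w) \<in> borel_measurable borel"
    by (intro borel_measurable_continuous_onI continuous_intros)
  have "emeasure (distr lborel borel (\<lambda>x. x + (\<nu> \<bullet> x) *\<^sub>R w)) B
      = (\<integral>\<^sup>+x. indicator B (x + (\<nu> \<bullet> x) *\<^sub>R w) \<partial>lborel)"
    by (subst nn_integral_indicator[symmetric], simp, subst nn_integral_distr) auto
  also have "\<dots> = (\<integral>\<^sup>+x. indicator B (x + (\<nu> \<bullet> x) *\<^sub>R 0) \<partial>lborel)"
    using nn_integral_shear[OF \<nu> assms(2), of "indicator B"] nn_integral_shear[OF \<nu>, of 0 "indicator B"] by simp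
  finally show "emeasure (distr lborel borel (\<lambda>x. x + (\<nu> \<bullet> x) *\<^sub>R w)) B = emeasure lborel B"
    by simp
qed simp

text \<open>A projection onto the hyperplane \<open>\<nu> \<bullet> x = c\<close> only when
  \<open>\<nu> \<bullet> d = 1\<close>; then the fibres are lines in direction \<open>d\<close>. The
  choice \<open>d = \<nu>\<close> with a unit normal is the orthogonal projection in
  \<open>hyperplane_measure\<close>.\<close>

definition oproj :: "real^'n::finite \<Rightarrow> real \<Rightarrow> real^'n \<Rightarrow> real^'n \<Rightarrow> real^'n" where
  "oproj \<nu> c d z = z - (\<nu> \<bullet> z - c) *\<^sub>R d"

lemma oproj_measurable[measurable]: "oproj \<nu> c d \<in> borel_measurable borel"
  unfolding oproj_def by (intro borel_measurable_continuous_onI continuous_intros)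

text \<open>Shears parallel to the slab map one oblique projection to the other.\<close>

lemma distr_oproj:
  fixes \<nu> d d' :: "real^'n"
  assumes "norm \<nu> = 1" "\<nu> \<bullet> d = 1" "\<nu> \<bullet> d' = 1"
  shows "distr (restrict_space lborel (slab \<nu> c)) borel (oproj \<nu> c d)
       = distr (restrict_space lborel (slab \<nu> c)) borel (oproj \<nu> c d')"
proof (rule measure_eqI)
  fix B :: "(real^'n) set" assume "B \<in> sets (distr (restrict_space lborel (slab \<nu> c)) borel (oproj \<nu> c d))"
  then have B[measurable]: "B \<in> sets borel" by simp
  \<comment> \<open>The affine shear that moves \<open>x\<close> by
    \<open>(\<nu> \<bullet> x - c) *\<^sub>R (d' - d)\<close>: it keeps
    \<open>\<nu> \<bullet> x\<close>, hence the slab, and projection along \<open>d'\<close> after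
    it is projection along \<open>d\<close>.\<close>
  let ?s = "\<lambda>x. x + (\<nu> \<bullet> x) *\<^sub>R (d' - d) - c *\<^sub>R (d' - d)"
  have s: "distr lborel borel ?s = lborel"
  proof -
    have "distr lborel borel ?s = distr (distr lborel borel (\<lambda>x. x + (\<nu> \<bullet> x) *\<^sub>R (d' - d))) borel
        (\<lambda>x. - c *\<^sub>R (d' - d) + x)"
      by (subst distr_distr) (auto simp: comp_def intro!: borel_measurable_continuous_onI continuous_intros arg_cong[where f="distr lborel borel"])
    also have "\<dots> = lborel"
      using assms by (simp only: distr_shear inner_diff_right lborel_distr_plus diff_self)
    finally show ?thesis .
  qed
  have sm[measurable]: "?s \<in> borel_measurable borel"
    by (intro borel_measurable_continuous_onI continuous_intros)
  have eq: "emeasure (distr (restrict_space lborel (slab \<nu> c)) borel (oproj \<nu> c d)) B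
      = emeasure lborel (oproj \<nu> c d -` B \<inter> slab \<nu> c)" for d
    by (subst emeasure_distr)
       (auto simp: space_restrict_space emeasure_restrict_space intro!: measurable_restrict_space1)
  have "emeasure lborel (oproj \<nu> c d' -` B \<inter> slab \<nu> c)
      = emeasure (distr lborel borel ?s) (oproj \<nu> c d' -` B \<inter> slab \<nu> c)" by (simp only: s)
  also have "\<dots> = emeasure lborel (?s -` (oproj \<nu> c d' -` B \<inter> slab \<nu> c))"
  proof -
    have "oproj \<nu> c d' -` B \<in> sets borel"
      using measurable_sets[OF oproj_measurable B] by simp
    then have "oproj \<nu> c d' -` B \<inter> slab \<nu> c \<in> sets borel" by simp
    then show ?thesis by (subst emeasure_distr) auto
  qed
  also have "?s -` (oproj \<nu> c d' -` B \<inter> slab \<nu> c) = oproj \<nu> c d -` B \<inter> slab \<nu> c"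
    using assms by (auto simp: oproj_def slab_def inner_simps algebra_simps)
  finally show "emeasure (distr (restrict_space lborel (slab \<nu> c)) borel (oproj \<nu> c d)) B
      = emeasure (distr (restrict_space lborel (slab \<nu> c)) borel (oproj \<nu> c d')) B"
    by (simp add: eq)
qed simp

text \<open>The freedom in \<open>d\<close> is the point:
  \<open>d = e /\<^sub>R (e \<bullet> \<nu>)\<close> makes the projection of \<open>x\<close> the
  point where the line through \<open>x\<close> in direction \<open>e\<close> crosses the
  hyperplane.\<close>

lemma surf_eq:
  fixes \<nu> d :: "real^'n"
  assumes "S \<noteq> {}" "\<And>x. x \<in> S \<Longrightarrow> \<nu> \<bullet> x = c" "norm \<nu> = 1" "\<nu> \<bullet> d = 1"
  shows "surf \<nu> S = restrict_space (distr (restrict_space lborel (slab \<nu> c)) borel (oproj \<nu> c d)) S"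
proof -
  have "\<nu> \<bullet> (SOME x. x \<in> S) = c" using assms by (metis some_in_eq)
  moreover have "\<nu> \<bullet> \<nu> = 1" using assms by (simp add: dot_square_norm)
  ultimately show ?thesis unfolding surf_def hyperplane_measure_def
    using distr_oproj[OF assms(3) _ assms(4), of \<nu> c] by (simp add: slab_def oproj_def[abs_def])
qed

lemma space_surf[simp]: "space (surf \<nu> S) = S"
  unfolding surf_def hyperplane_measure_def by (simp add: space_restrict_space)

lemma sets_surf[measurable_cong]: "sets (surf \<nu> S) = sets (restrict_space borel S)"
  unfolding surf_def hyperplane_measure_def by (simp add: sets_restrict_space)

lemma surf_integral:
  fixes \<nu> d :: "real^'n" and g :: "real^'n \<Rightarrow> real"
  assumes "S \<noteq> {}" "closed S" "\<And>x. x \<in> S \<Longrightarrow> \<nu> \<bullet> x = c" "norm \<nu> = 1" "\<nu> \<bullet> d = 1"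
    and g[measurable]: "g \<in> borel_measurable borel"
  shows "integral\<^sup>L (surf \<nu> S) g =
     (LINT z|lborel. indicat_real (slab \<nu> c) z * (indicat_real S (oproj \<nu> c d z) * g (oproj \<nu> c d z)))"
proof -
  have [measurable]: "S \<in> sets borel" using assms by simp
  have "integral\<^sup>L (surf \<nu> S) g = 
    (LINT x|distr (restrict_space lborel (slab \<nu> c)) borel (oproj \<nu> c d). indicat_real S x * g x)"
    by (subst surf_eq[OF assms(1) assms(3) assms(4,5)], assumption, subst integral_restrict_space) auto
  also have "\<dots> = (LINT z|restrict_space lborel (slab \<nu> c). indicat_real S (oproj \<nu> c d z) * g (oproj \<nu> c d z))"
    by (subst integral_distr) (auto intro!: measurable_restrict_space1)
  also have "\<dots> = (LINT z|lborel. indicat_real (slab \<nu> c) z * (indicat_real S (oproj \<nu> c d z) * g (oproj \<nu> c d z)))"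
    by (subst integral_restrict_space) auto
  finally show ?thesis .
qed

section \<open>Properties that hold at almost every point of a face\<close>

lemma AE_lborel_translate:
  fixes a :: "'a::euclidean_space"
  assumes "AE x in lborel. P x"
  shows "AE x in lborel. P (a + x)"
  using AE_distrD[of "(+) a" lborel borel P] assms unfolding lborel_distr_plus by simp

text \<open>Statements about almost every point of \<open>S\<close>, seen through the orthogonal projection onto the
  hyperplane. Unlike \<open>AE\<close> over \<open>surf\<close>, this form transfers to oblique projections and to the
  opposite normal without measurability considerations.\<close>

definition face_AE :: "real^'n::finite \<Rightarrow> real \<Rightarrow> (real^'n) set \<Rightarrow> (real^'n \<Rightarrow> bool) \<Rightarrow> bool" where
  "face_AE \<nu> c S P \<longleftrightarrow> (AE z in lborel. oproj \<nu> c \<nu> z \<in> S \<longrightarrow> P (oproj \<nu> c \<nu> z))"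

lemma oproj_shift:
  assumes "\<nu> \<bullet> d = 1"
  shows "oproj \<nu> c d (t *\<^sub>R d + z) = oproj \<nu> c d z"
  using assms by (simp add: oproj_def inner_simps algebra_simps)

text \<open>The surface measure sees only the unit slab, while \<open>face_AE\<close> concerns all
  points that project into \<open>S\<close>. Every point reaches the slab by an integer multiple of
  \<open>\<nu>\<close>, which does not change its projection, and countably many translates of a
  null set are null.\<close>

lemma AE_surf_imp_face_AE:
  fixes \<nu> :: "real^'n"
  assumes "S \<noteq> {}" "closed S" "\<And>x. x \<in> S \<Longrightarrow> \<nu> \<bullet> x = c" "norm \<nu> = 1"
    and ae: "AE y in surf \<nu> S. P y"
  shows "face_AE \<nu> c S P"
proof -
  have S[measurable]: "S \<in> sets borel" using assms by simp
  have \<nu>: "\<nu> \<bullet> \<nu> = 1" using assms(4) by (simp add: dot_square_norm)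
  let ?Q = "oproj \<nu> c \<nu>"
  have "AE y in distr (restrict_space lborel (slab \<nu> c)) borel ?Q. y \<in> S \<longrightarrow> P y"
    using ae unfolding surf_eq[OF assms(1) assms(3) assms(4) \<nu>, simplified] by (simp add: AE_restrict_space_iff)
  then have "AE z in restrict_space lborel (slab \<nu> c). ?Q z \<in> S \<longrightarrow> P (?Q z)"
    by (rule AE_distrD[rotated]) (auto intro!: measurable_restrict_space1)
  then have "AE z in lborel. z \<in> slab \<nu> c \<longrightarrow> ?Q z \<in> S \<longrightarrow> P (?Q z)"
    by (subst (asm) AE_restrict_space_iff) auto
  then have "AE z in lborel. \<forall>k::int. of_int k *\<^sub>R \<nu> + z \<in> slab \<nu> c \<longrightarrow>
      ?Q (of_int k *\<^sub>R \<nu> + z) \<in> S \<longrightarrow> P (?Q (of_int k *\<^sub>R \<nu> + z))"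
    by (subst AE_all_countable) (intro allI, erule AE_lborel_translate)
  then show ?thesis unfolding face_AE_def
  proof eventually_elim
    case (elim z)
    have "of_int (- \<lfloor>\<nu> \<bullet> z - c\<rfloor>) *\<^sub>R \<nu> + z \<in> slab \<nu> c"
      unfolding slab_def using \<nu> by (simp add: inner_simps) linarith
    then show ?case using elim oproj_shift[OF \<nu>] by metis
  qed
qed

text \<open>A shear followed by a translation turns the orthogonal projection into the one along
  \<open>d\<close>, and both maps preserve Lebesgue measure.\<close>

lemma face_AE_oblique:
  fixes \<nu> d :: "real^'n"
  assumes "norm \<nu> = 1" "\<nu> \<bullet> d = 1" and ae: "face_AE \<nu> c S P"
  shows "AE z in lborel. oproj \<nu> c d z \<in> S \<longrightarrow> P (oproj \<nu> c d z)"
proof -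
  have \<nu>: "\<nu> \<bullet> \<nu> = 1" using assms(1) by (simp add: dot_square_norm)
  let ?s = "\<lambda>x. x + (\<nu> \<bullet> x) *\<^sub>R (\<nu> - d)"
  have s: "distr lborel borel ?s = lborel"
    using assms \<nu> by (intro distr_shear) (simp_all add: inner_diff_right)
  have sm: "?s \<in> measurable lborel borel"
    by (auto intro!: borel_measurable_continuous_onI continuous_intros)
  have "AE z in lborel. oproj \<nu> c \<nu> (- c *\<^sub>R (\<nu> - d) + z) \<in> S \<longrightarrow> P (oproj \<nu> c \<nu> (- c *\<^sub>R (\<nu> - d) + z))"
    using ae unfolding face_AE_def by (rule AE_lborel_translate)
  then have "AE z in lborel. oproj \<nu> c \<nu> (- c *\<^sub>R (\<nu> - d) + ?s z) \<in> S \<longrightarrow> P (oproj \<nu> c \<nu> (- c *\<^sub>R (\<nu> - d) + ?s z))"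
    using AE_distrD[OF sm, unfolded s] by blast
  moreover have "oproj \<nu> c \<nu> (- c *\<^sub>R (\<nu> - d) + ?s z) = oproj \<nu> c d z" for z
    using assms \<nu> by (auto simp: oproj_def inner_simps algebra_simps)
  ultimately show ?thesis by simp
qed

lemma face_AE_uminus: "face_AE (- \<nu>) (- c) S P \<longleftrightarrow> face_AE \<nu> c S P"
  by (simp add: face_AE_def oproj_def algebra_simps)

lemma face_AE_mp:
  assumes "face_AE \<nu> c S P" "\<And>y. y \<in> S \<Longrightarrow> P y \<Longrightarrow> Q y"
  shows "face_AE \<nu> c S Q"
  using assms(1) unfolding face_AE_def by eventually_elim (use assms(2) in auto)

lemma face_AE_conj:
  assumes "face_AE \<nu> c S P" "face_AE \<nu> c S Q"
  shows "face_AE \<nu> c S (\<lambda>y. P y \<and> Q y)"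
  using assms unfolding face_AE_def by eventually_elim auto

lemma face_AE_subset: "face_AE \<nu> c S P \<Longrightarrow> S' \<subseteq> S \<Longrightarrow> face_AE \<nu> c S' P"
  unfolding face_AE_def by (erule eventually_mono) auto

lemma face_AE_ball:
  assumes "finite I" "\<And>i. i \<in> I \<Longrightarrow> face_AE \<nu> c S (P i)"
  shows "face_AE \<nu> c S (\<lambda>y. \<forall>i\<in>I. P i y)"
proof -
  have "AE z in lborel. \<forall>i\<in>I. oproj \<nu> c \<nu> z \<in> S \<longrightarrow> P i (oproj \<nu> c \<nu> z)"
    using assms by (intro AE_finite_allI) (auto simp: face_AE_def)
  then show ?thesis unfolding face_AE_def by eventually_elim auto
qed

lemma face_AE_I: "(\<And>y. y \<in> S \<Longrightarrow> P y) \<Longrightarrow> face_AE \<nu> c S P"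
  by (simp add: face_AE_def)


section \<open>Jumps across hyperplanes and signed crossings\<close>

text \<open>Punctured neighbourhoods are used because values at crossing times are uncontrolled. The
  punctured limits \<open>g\<close> are locally constant, hence constant on the connected line and
  equal to the value near infinity; at \<open>t0\<close> the function agrees with its punctured
  limit.\<close>

lemma locally_const_real_line:
  fixes D :: "real \<Rightarrow> 'b"
  assumes loc: "\<And>t. \<exists>c. \<forall>\<^sub>F s in at t. D s = c"
    and top: "\<forall>\<^sub>F s in at_top. D s = k" and t0: "\<forall>\<^sub>F s in at t0. D s = D t0"
  shows "D t0 = k"
proof -
  define g where "g t = (SOME c. \<forall>\<^sub>F s in at t. D s = c)" for t
  have g: "\<forall>\<^sub>F s in at t. D s = g t" for t
    unfolding g_def using loc[of t] by (rule someI_ex)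
  have uniq: "a = g t" if "\<forall>\<^sub>F s in at t. D s = a" for a t
  proof -
    have "\<forall>\<^sub>F s in at t. a = g t" using that g[of t] by eventually_elim simp
    then show ?thesis by simp
  qed
  have "g a = g b" for a b
  proof (rule connected_local_const[where A = UNIV])
    show "\<forall>a\<in>UNIV. \<forall>\<^sub>F b in at a. g a = g b"
    proof
      fix a
      obtain S where S: "open S" "a \<in> S" "\<And>x. x \<in> S \<Longrightarrow> x \<noteq> a \<Longrightarrow> D x = g a"
        using g[of a] unfolding eventually_at_topological by auto
      have "g a = g b" if "b \<in> S" "b \<noteq> a" for b
      proof (rule uniq)
        show "\<forall>\<^sub>F s in at b. D s = g a"
          unfolding eventually_at_topological
          by (rule exI[of _ "S - {a}"]) (use S that in auto)
      qed
      then show "\<forall>\<^sub>F b in at a. g a = g b"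
        unfolding eventually_at_topological using S by auto
    qed
  qed auto
  moreover have "D t0 = g t0" using t0 by (rule uniq)
  moreover obtain M where M: "\<And>s. s \<ge> M \<Longrightarrow> D s = k"
    using top unfolding eventually_at_top_linorder by auto
  have "k = g (M + 1)"
  proof (rule uniq)
    show "\<forall>\<^sub>F s in at (M + 1). D s = k"
      unfolding eventually_at_topological
      by (rule exI[of _ "{M<..}"]) (use M in auto)
  qed
  ultimately show ?thesis by metis
qed

text \<open>Values on the hyperplane itself are left free. The sign is that of the value behind
  \<open>\<nu>\<close> minus the value ahead, so \<open>\<epsilon>\<close> is 1 for the indicator of
  a set with outer normal \<open>\<nu>\<close>, -1 for an inner one, and 0 where both sides
  agree.\<close>

definition has_jump :: "(real^'n::finite \<Rightarrow> real) \<Rightarrow> real^'n \<Rightarrow> real \<Rightarrow> real^'n \<Rightarrow> bool" where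
  "has_jump f \<nu> \<epsilon> y \<longleftrightarrow> (\<exists>b. \<forall>\<^sub>F z in nhds y.
     (\<nu> \<bullet> (z - y) < 0 \<longrightarrow> f z = b) \<and> (\<nu> \<bullet> (z - y) > 0 \<longrightarrow> f z = b - \<epsilon>))"

text \<open>Both descriptions are compared along the line \<open>y + t *\<^sub>R \<nu>\<close>,
  which enters both half-spaces. Uniqueness is what later identifies orientation numbers read off
  from the mesh with those read off from the simplices.\<close>

lemma has_jump_unique:
  assumes "\<nu> \<noteq> 0" "has_jump f \<nu> \<epsilon> y" "has_jump f \<nu> \<epsilon>' y"
  shows "\<epsilon> = \<epsilon>'"
proof -
  obtain b b' where ev: "\<forall>\<^sub>F z in nhds y. (\<nu> \<bullet> (z - y) < 0 \<longrightarrow> f z = b) \<and> (\<nu> \<bullet> (z - y) > 0 \<longrightarrow> f z = b - \<epsilon>)"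
    "\<forall>\<^sub>F z in nhds y. (\<nu> \<bullet> (z - y) < 0 \<longrightarrow> f z = b') \<and> (\<nu> \<bullet> (z - y) > 0 \<longrightarrow> f z = b' - \<epsilon>')"
    using assms unfolding has_jump_def by blast
  have lim: "((\<lambda>t. y + t *\<^sub>R \<nu>) \<longlongrightarrow> y) (at 0 within A)" for A :: "real set"
  proof -
    have "((\<lambda>t. y + t *\<^sub>R \<nu>) \<longlongrightarrow> y + 0 *\<^sub>R \<nu>) (at 0 within A)" by (intro tendsto_intros)
    then show ?thesis by simp
  qed
  have sgn: "\<nu> \<bullet> (y + t *\<^sub>R \<nu> - y) = t * (norm \<nu>)\<^sup>2" for t
    by (simp add: power2_norm_eq_inner)
  have n: "(norm \<nu>)\<^sup>2 > 0" using assms by simp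
  have "b - \<epsilon> = b' - \<epsilon>'"
  proof -
    have "\<forall>\<^sub>F t in at_right 0. 0 < t \<and> f (y + t *\<^sub>R \<nu>) = b - \<epsilon> \<and> f (y + t *\<^sub>R \<nu>) = b' - \<epsilon>'"
      using eventually_at_right_less[of 0] ev(1)[THEN eventually_compose_filterlim, OF lim] ev(2)[THEN eventually_compose_filterlim, OF lim]
      by eventually_elim (use n in \<open>simp add: sgn\<close>)
    then obtain t where "f (y + t *\<^sub>R \<nu>) = b - \<epsilon>" "f (y + t *\<^sub>R \<nu>) = b' - \<epsilon>'"
      using eventually_happens'[OF trivial_limit_at_right_real] by blast
    then show ?thesis by simp
  qed
  moreover have "b = b'"
  proof -
    have neg: "\<forall>\<^sub>F t in at_left (0::real). t < 0" by (simp add: eventually_at_filter)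
    have "\<forall>\<^sub>F t in at_left 0. t < 0 \<and> f (y + t *\<^sub>R \<nu>) = b \<and> f (y + t *\<^sub>R \<nu>) = b'"
      using neg ev(1)[THEN eventually_compose_filterlim, OF lim] ev(2)[THEN eventually_compose_filterlim, OF lim]
      by eventually_elim (use n in \<open>simp add: sgn mult_less_0_iff\<close>)
    then obtain t where "f (y + t *\<^sub>R \<nu>) = b" "f (y + t *\<^sub>R \<nu>) = b'"
      using eventually_happens'[OF trivial_limit_at_left_real] by blast
    then show ?thesis by simp
  qed
  ultimately show ?thesis by simp
qed

lemma has_jump_sum:
  assumes "finite I" "\<And>i. i \<in> I \<Longrightarrow> has_jump (f i) \<nu> (\<epsilon> i) y"
  shows "has_jump (\<lambda>z. \<Sum>i\<in>I. f i z) \<nu> (\<Sum>i\<in>I. \<epsilon> i) y"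
proof -
  have "\<forall>i\<in>I. \<exists>b. \<forall>\<^sub>F z in nhds y. (\<nu> \<bullet> (z - y) < 0 \<longrightarrow> f i z = b) \<and> (\<nu> \<bullet> (z - y) > 0 \<longrightarrow> f i z = b - \<epsilon> i)"
    using assms(2) unfolding has_jump_def by blast
  from bchoice[OF this] obtain b where b: "\<forall>i\<in>I. \<forall>\<^sub>F z in nhds y. (\<nu> \<bullet> (z - y) < 0 \<longrightarrow> f i z = b i) \<and> (\<nu> \<bullet> (z - y) > 0 \<longrightarrow> f i z = b i - \<epsilon> i)"
    by blast
  have "\<forall>\<^sub>F z in nhds y. \<forall>i\<in>I. (\<nu> \<bullet> (z - y) < 0 \<longrightarrow> f i z = b i) \<and> (\<nu> \<bullet> (z - y) > 0 \<longrightarrow> f i z = b i - \<epsilon> i)"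
    using b by (intro eventually_ball_finite[OF assms(1)])
  then show ?thesis unfolding has_jump_def
    by (intro exI[of _ "\<Sum>i\<in>I. b i"], elim eventually_mono) (auto simp: sum_subtractf[symmetric] intro!: sum.cong)
qed

lemma has_jump_cong:
  assumes "has_jump f \<nu> \<epsilon> y" "\<forall>\<^sub>F z in nhds y. \<nu> \<bullet> (z - y) \<noteq> 0 \<longrightarrow> f z = g z"
  shows "has_jump g \<nu> \<epsilon> y"
proof -
  obtain b where "\<forall>\<^sub>F z in nhds y. (\<nu> \<bullet> (z - y) < 0 \<longrightarrow> f z = b) \<and> (\<nu> \<bullet> (z - y) > 0 \<longrightarrow> f z = b - \<epsilon>)"
    using assms unfolding has_jump_def by blast
  then have "\<forall>\<^sub>F z in nhds y. (\<nu> \<bullet> (z - y) < 0 \<longrightarrow> g z = b) \<and> (\<nu> \<bullet> (z - y) > 0 \<longrightarrow> g z = b - \<epsilon>)"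
    using assms(2) by eventually_elim auto
  then show ?thesis unfolding has_jump_def by blast
qed

lemma has_jump_uminus: "has_jump f \<nu> \<epsilon> y \<Longrightarrow> has_jump f (- \<nu>) (- \<epsilon>) y"
proof -
  assume "has_jump f \<nu> \<epsilon> y"
  then obtain b where "\<forall>\<^sub>F z in nhds y. (\<nu> \<bullet> (z - y) < 0 \<longrightarrow> f z = b) \<and> (\<nu> \<bullet> (z - y) > 0 \<longrightarrow> f z = b - \<epsilon>)"
    unfolding has_jump_def by blast
  then show ?thesis unfolding has_jump_def
    by (intro exI[of _ "b - \<epsilon>"]) (auto elim!: eventually_mono)
qed

lemma indicator_locally_const:
  fixes y :: "'a::real_normed_vector"
  assumes "y \<notin> frontier A"
  shows "\<exists>b. \<forall>\<^sub>F z in nhds y. indicat_real A z = b"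
proof (cases "y \<in> interior A")
  case True
  then have "\<forall>\<^sub>F z in nhds y. z \<in> interior A" by (intro eventually_nhds_in_open) auto
  then have "\<forall>\<^sub>F z in nhds y. indicat_real A z = 1"
    by eventually_elim (use interior_subset in \<open>auto simp: indicator_def\<close>)
  then show ?thesis by blast
next
  case False
  then have "y \<in> - closure A" using assms by (auto simp: frontier_def)
  then have "\<forall>\<^sub>F z in nhds y. z \<in> - closure A" by (intro eventually_nhds_in_open) auto
  then have "\<forall>\<^sub>F z in nhds y. indicat_real A z = 0"
    by eventually_elim (use closure_subset in \<open>auto simp: indicator_def\<close>)
  then show ?thesis by blast
qed

lemma has_jump_zero:
  assumes "y \<notin> frontier A" shows "has_jump (indicat_real A) \<nu> 0 y"
  using indicator_locally_const[OF assms] unfolding has_jump_def by (auto elim!: eventually_mono)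

text \<open>Along the line the value before \<open>t0\<close> exceeds the value after it by
  \<open>\<epsilon> * sgn (e \<bullet> \<nu>)\<close>, since the sign of
  \<open>e \<bullet> \<nu>\<close> tells which side comes first. Subtracting this step removes the
  jump.\<close>

lemma has_jump_line:
  fixes e :: "real^'n"
  assumes "has_jump f \<nu> \<epsilon> (x + t0 *\<^sub>R e)" "e \<bullet> \<nu> \<noteq> 0"
  shows "\<exists>c. \<forall>\<^sub>F t in at t0. f (x + t *\<^sub>R e) - \<epsilon> * sgn (e \<bullet> \<nu>) * (if t < t0 then 1 else 0) = c"
proof -
  let ?y = "x + t0 *\<^sub>R e"
  obtain b where ev: "\<forall>\<^sub>F z in nhds ?y. (\<nu> \<bullet> (z - ?y) < 0 \<longrightarrow> f z = b) \<and> (\<nu> \<bullet> (z - ?y) > 0 \<longrightarrow> f z = b - \<epsilon>)"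
    using assms unfolding has_jump_def by blast
  have lim: "((\<lambda>t. x + t *\<^sub>R e) \<longlongrightarrow> ?y) (at t0)"
    by (intro tendsto_intros)
  have eq: "\<nu> \<bullet> (x + t *\<^sub>R e - ?y) = (t - t0) * (e \<bullet> \<nu>)" for t
    by (simp add: inner_simps algebra_simps inner_commute)
  have ne: "\<forall>\<^sub>F t in at t0. t \<noteq> t0" by (simp add: eventually_at_filter)
  let ?c = "if e \<bullet> \<nu> > 0 then b - \<epsilon> else b"
  have "\<forall>\<^sub>F t in at t0. f (x + t *\<^sub>R e) - \<epsilon> * sgn (e \<bullet> \<nu>) * (if t < t0 then 1 else 0) = ?c"
    using ne ev[THEN eventually_compose_filterlim, OF lim]
  proof eventually_elim
    case (elim t)
    note elim' = elim(1) elim(2)[unfolded eq mult_less_0_iff zero_less_mult_iff]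
    show ?case using assms(2) elim'
      by (cases "e \<bullet> \<nu> > 0"; cases "t < t0") auto
  qed
  then show ?thesis by blast
qed

text \<open>The time at which the line through \<open>x\<close> in direction \<open>e\<close> meets
  the hyperplane. If \<open>e\<close> is parallel to it, division by zero yields 0; such faces are
  silenced by \<open>sgn 0 = 0\<close> or excluded from the index set.\<close>

definition cross_time :: "real^'n::finite \<Rightarrow> real^'n \<Rightarrow> real \<Rightarrow> real^'n \<Rightarrow> real" where
  "cross_time e \<nu> c x = (c - \<nu> \<bullet> x) / (e \<bullet> \<nu>)"

lemma oproj_cross_time:
  "e \<bullet> \<nu> \<noteq> 0 \<Longrightarrow> oproj \<nu> c (e /\<^sub>R (e \<bullet> \<nu>)) x = x + cross_time e \<nu> c x *\<^sub>R e"
  by (simp add: oproj_def cross_time_def divide_inverse algebra_simps)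

lemma ev_const_sum:
  fixes g :: "'i \<Rightarrow> 'a \<Rightarrow> real"
  assumes "finite I" "\<And>i. i \<in> I \<Longrightarrow> \<exists>c. \<forall>\<^sub>F t in F. g i t = c"
  shows "\<exists>c. \<forall>\<^sub>F t in F. (\<Sum>i\<in>I. g i t) = c"
proof -
  have "\<forall>i\<in>I. \<exists>c. \<forall>\<^sub>F t in F. g i t = c" using assms(2) by blast
  from bchoice[OF this] obtain c where "\<forall>i\<in>I. \<forall>\<^sub>F t in F. g i t = c i" by blast
  then have "\<forall>\<^sub>F t in F. \<forall>i\<in>I. g i t = c i" by (intro eventually_ball_finite[OF assms(1)]) blast
  then have "\<forall>\<^sub>F t in F. (\<Sum>i\<in>I. g i t) = (\<Sum>i\<in>I. c i)" by eventually_elim simp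
  then show ?thesis by blast
qed

text \<open>Along a generic line the indicator of \<open>A\<close> and the signed number of crossings ahead have the
  same jumps, and both vanish far out.\<close>

lemma indicator_eq_signed_crossings:
  fixes A :: "(real^'n::finite) set" and \<nu> :: "'s \<Rightarrow> real^'n" and c \<epsilon> :: "'s \<Rightarrow> real" and S :: "'s \<Rightarrow> (real^'n) set"
  assumes fin: "finite I" and bd: "bounded A" and front: "frontier A \<subseteq> (\<Union>i\<in>I. S i)" and e: "e \<noteq> 0"
    and plane: "\<And>i x. i \<in> I \<Longrightarrow> x \<in> S i \<Longrightarrow> \<nu> i \<bullet> x = c i"
    and x: "\<And>i. i \<in> I \<Longrightarrow> \<nu> i \<bullet> x \<noteq> c i"
    and good: "\<And>i. i \<in> I \<Longrightarrow> e \<bullet> \<nu> i \<noteq> 0 \<Longrightarrow> x + cross_time e (\<nu> i) (c i) x *\<^sub>R e \<in> S i \<Longrightarrow>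
       (\<forall>j\<in>I. x + cross_time e (\<nu> i) (c i) x *\<^sub>R e \<in> S j \<longrightarrow> j = i) \<and>
       has_jump (indicat_real A) (\<nu> i) (\<epsilon> i) (x + cross_time e (\<nu> i) (c i) x *\<^sub>R e)"
  shows "indicat_real A x = (\<Sum>i\<in>I. \<epsilon> i * sgn (e \<bullet> \<nu> i) *
     (if x + cross_time e (\<nu> i) (c i) x *\<^sub>R e \<in> S i \<and> 0 < cross_time e (\<nu> i) (c i) x then 1 else 0))"
proof -
  define \<tau> where "\<tau> i = cross_time e (\<nu> i) (c i) x" for i
  define g where "g i t = \<epsilon> i * sgn (e \<bullet> \<nu> i) * (if x + \<tau> i *\<^sub>R e \<in> S i \<and> t < \<tau> i then 1 else 0)" for i t
  define D where "D t = indicat_real A (x + t *\<^sub>R e) - (\<Sum>i\<in>I. g i t)" for t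
  have g_const: "\<exists>c. \<forall>\<^sub>F t in at t0. g i t = c"
    if "x + \<tau> i *\<^sub>R e \<in> S i \<Longrightarrow> e \<bullet> \<nu> i \<noteq> 0 \<Longrightarrow> \<tau> i \<noteq> t0" for i t0
  proof (cases "x + \<tau> i *\<^sub>R e \<in> S i \<and> e \<bullet> \<nu> i \<noteq> 0")
    case True
    then have "\<tau> i < t0 \<or> t0 < \<tau> i" using that by force
    then have "(\<forall>\<^sub>F t in at t0. \<not> t < \<tau> i) \<or> (\<forall>\<^sub>F t in at t0. t < \<tau> i)"
    proof
      assume "\<tau> i < t0"
      then have "\<forall>\<^sub>F t in at t0. \<tau> i < t" using order_tendstoD(1)[OF tendsto_ident_at] by blast
      then show ?thesis by (intro disjI1) (auto elim: eventually_mono)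
    next
      assume "t0 < \<tau> i"
      then show ?thesis using order_tendstoD(2)[OF tendsto_ident_at] by blast
    qed
    then show ?thesis
    proof
      assume "\<forall>\<^sub>F t in at t0. \<not> t < \<tau> i"
      then have "\<forall>\<^sub>F t in at t0. g i t = 0" by eventually_elim (simp add: g_def)
      then show ?thesis by blast
    next
      assume "\<forall>\<^sub>F t in at t0. t < \<tau> i"
      then have "\<forall>\<^sub>F t in at t0. g i t = \<epsilon> i * sgn (e \<bullet> \<nu> i)"
        by eventually_elim (use True in \<open>simp add: g_def\<close>)
      then show ?thesis by blast
    qed
  next
    case False
    then have "g i t = 0" for t by (auto simp: g_def)
    then show ?thesis by (intro exI[of _ 0]) simp
  qed
  \<comment> \<open>If the line meets some face at \<open>t0\<close>, the hypothesis
    \<open>good\<close> makes it the only one, and the step in \<open>g i\<close> cancels the jump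
    of the indicator. Otherwise the indicator is constant near that point, and no counted crossing
    happens at \<open>t0\<close>.\<close>
  have loc: "\<exists>c. \<forall>\<^sub>F t in at t0. D t = c" for t0
  proof (cases "x + t0 *\<^sub>R e \<in> (\<Union>i\<in>I. S i)")
    case True
    then obtain i where i: "i \<in> I" "x + t0 *\<^sub>R e \<in> S i" by auto
    have ev: "e \<bullet> \<nu> i \<noteq> 0"
      using plane[OF i] x[OF i(1)] by (auto simp: inner_simps inner_commute)
    have t0: "\<tau> i = t0"
    proof -
      have "\<nu> i \<bullet> x + t0 * (e \<bullet> \<nu> i) = c i" using plane[OF i] by (simp add: inner_simps inner_commute)
      then have "c i - \<nu> i \<bullet> x = t0 * (e \<bullet> \<nu> i)" by linarith
      then show ?thesis using ev by (simp add: \<tau>_def cross_time_def)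
    qed
    have gd: "\<forall>j\<in>I. x + t0 *\<^sub>R e \<in> S j \<longrightarrow> j = i"
      and gj: "has_jump (indicat_real A) (\<nu> i) (\<epsilon> i) (x + t0 *\<^sub>R e)"
      using good[OF i(1) ev, folded \<tau>_def, unfolded t0, OF i(2)] by blast+
    obtain c1 where c1: "\<forall>\<^sub>F t in at t0. indicat_real A (x + t *\<^sub>R e) - \<epsilon> i * sgn (e \<bullet> \<nu> i) * (if t < t0 then 1 else 0) = c1"
      using has_jump_line[OF gj ev] by blast
    have "\<exists>c. \<forall>\<^sub>F t in at t0. (\<Sum>j\<in>I - {i}. g j t) = c"
    proof (rule ev_const_sum)
      fix j assume j: "j \<in> I - {i}"
      show "\<exists>c. \<forall>\<^sub>F t in at t0. g j t = c"
        by (rule g_const) (use gd j in auto)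
    qed (use fin in auto)
    then obtain c2 where c2: "\<forall>\<^sub>F t in at t0. (\<Sum>j\<in>I - {i}. g j t) = c2" by blast
    have "\<forall>\<^sub>F t in at t0. D t = c1 - c2"
      using c1 c2
    proof eventually_elim
      case (elim t)
      have "(\<Sum>j\<in>I. g j t) = g i t + (\<Sum>j\<in>I - {i}. g j t)"
        using fin i by (rule_tac sum.remove) auto
      moreover have "g i t = \<epsilon> i * sgn (e \<bullet> \<nu> i) * (if t < t0 then 1 else 0)"
        using i t0 by (simp add: g_def)
      ultimately show ?case using elim by (simp add: D_def)
    qed
    then show ?thesis by blast
  next
    case False
    then have "x + t0 *\<^sub>R e \<notin> frontier A" using front by auto
    then obtain b where b: "\<forall>\<^sub>F z in nhds (x + t0 *\<^sub>R e). indicat_real A z = b"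
      using indicator_locally_const by blast
    have lim: "((\<lambda>t. x + t *\<^sub>R e) \<longlongrightarrow> x + t0 *\<^sub>R e) (at t0)" by (intro tendsto_intros)
    have "\<exists>c. \<forall>\<^sub>F t in at t0. (\<Sum>j\<in>I. g j t) = c"
    proof (rule ev_const_sum)
      fix j assume j: "j \<in> I"
      show "\<exists>c. \<forall>\<^sub>F t in at t0. g j t = c"
        by (rule g_const) (use False j in auto)
    qed (use fin in auto)
    then obtain c2 where c2: "\<forall>\<^sub>F t in at t0. (\<Sum>j\<in>I. g j t) = c2" by blast
    have "\<forall>\<^sub>F t in at t0. D t = b - c2"
      using b[THEN eventually_compose_filterlim, OF lim] c2 by eventually_elim (simp add: D_def)
    then show ?thesis by blast
  qed
  have top: "\<forall>\<^sub>F t in at_top. D t = 0"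
  proof -
    obtain B where B: "\<And>a. a \<in> A \<Longrightarrow> norm a \<le> B" using bd by (auto simp: bounded_iff)
    have 1: "\<forall>\<^sub>F t in at_top. x + t *\<^sub>R e \<notin> A"
      using eventually_gt_at_top[of "(B + norm x) / norm e"]
    proof eventually_elim
      case (elim t)
      then have "B + norm x < t * norm e" using e by (simp add: field_simps)
      also have "\<dots> \<le> norm (t *\<^sub>R e)" by (simp add: mult_right_mono)
      also have "\<dots> \<le> norm (x + t *\<^sub>R e) + norm x" by (metis add_diff_cancel_left' norm_triangle_ineq4)
      finally show ?case using B by force
    qed
    have 2: "\<forall>\<^sub>F t in at_top. \<forall>i\<in>I. \<not> t < \<tau> i"
      using fin by (auto simp: eventually_ball_finite_distrib not_less intro!: eventually_ge_at_top)
    show ?thesis using 1 2 by eventually_elim (simp add: D_def g_def)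
  qed
  \<comment> \<open>Here the actual value at 0 matters. As \<open>x\<close> lies on none of the
    hyperplanes, it is off the frontier and no counted crossing has time 0, so nothing changes near
    0.\<close>
  have t0: "\<forall>\<^sub>F t in at 0. D t = D 0"
  proof -
    have notin: "x \<notin> (\<Union>i\<in>I. S i)" using plane x by auto
    then have "x \<notin> frontier A" using front by auto
    then obtain b where b: "\<forall>\<^sub>F z in nhds x. indicat_real A z = b"
      using indicator_locally_const by blast
    then have bx: "indicat_real A x = b" by (rule eventually_nhds_x_imp_x)
    have lim: "((\<lambda>t. x + t *\<^sub>R e) \<longlongrightarrow> x) (at 0)"
      by (rule tendsto_eq_intros | simp)+
    have "\<forall>\<^sub>F t in at 0. \<forall>i\<in>I. g i t = g i 0"
    proof (rule eventually_ball_finite[OF fin], rule ballI)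
      fix i assume i: "i \<in> I"
      have "x + \<tau> i *\<^sub>R e \<in> S i \<Longrightarrow> \<tau> i \<noteq> 0" using notin i by auto
      then have "x + \<tau> i *\<^sub>R e \<notin> S i \<or> \<tau> i < 0 \<or> 0 < \<tau> i" by linarith
      then show "\<forall>\<^sub>F t in at 0. g i t = g i 0"
      proof (elim disjE)
        assume "x + \<tau> i *\<^sub>R e \<notin> S i"
        then show ?thesis by (simp add: g_def)
      next
        assume neg: "\<tau> i < 0"
        then have "\<forall>\<^sub>F t in at 0. \<tau> i < t" using order_tendstoD(1)[OF tendsto_ident_at] by blast
        then show ?thesis by eventually_elim (use neg in \<open>simp add: g_def\<close>)
      next
        assume pos: "0 < \<tau> i"
        then have "\<forall>\<^sub>F t in at 0. t < \<tau> i" using order_tendstoD(2)[OF tendsto_ident_at] by blast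
        then show ?thesis by eventually_elim (use pos in \<open>simp add: g_def\<close>)
      qed
    qed
    then show ?thesis using b[THEN eventually_compose_filterlim, OF lim]
      by eventually_elim (simp add: D_def bx)
  qed
  have "D 0 = 0" by (rule locally_const_real_line[OF loc top t0])
  then show ?thesis by (simp add: D_def g_def \<tau>_def)
qed


section \<open>The Gauss--Green formula\<close>

lemma cross_time_measurable[measurable]: "cross_time e \<nu> c \<in> borel_measurable borel"
  unfolding cross_time_def[abs_def] divide_inverse
  by (intro borel_measurable_continuous_onI continuous_intros)

lemma cross_time_shift:
  assumes "e \<bullet> \<nu> \<noteq> 0"
  shows "cross_time e \<nu> c (x + s *\<^sub>R e) = cross_time e \<nu> c x - s"
  using assms by (simp add: cross_time_def inner_simps field_simps inner_commute)

lemma integral_lborel_translate: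
  fixes a :: "'a::euclidean_space" and f :: "'a \<Rightarrow> real"
  assumes [measurable]: "f \<in> borel_measurable borel"
  shows "(LINT x|lborel. f (a + x)) = (LINT x|lborel. f x)"
  by (subst (2) lborel_distr_plus[of a, symmetric], subst integral_distr) auto

lemma compact_continuous_bound:
  fixes f :: "'a::topological_space \<Rightarrow> 'b::real_normed_vector"
  assumes "compact K" "continuous_on UNIV f"
  obtains B where "\<And>x. x \<in> K \<Longrightarrow> norm (f x) \<le> B"
proof -
  have "compact (f ` K)" using assms continuous_on_subset by (intro compact_continuous_image) auto
  then have "bounded (f ` K)" by (rule compact_imp_bounded)
  then obtain B where "\<forall>x\<in>K. norm (f x) \<le> B" by (auto simp: bounded_iff)
  then show ?thesis by (intro that[of B]) auto
qed

lemma integrable_lborel_bounded_support: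
  fixes f :: "'a::euclidean_space \<Rightarrow> real"
  assumes "f \<in> borel_measurable borel" "\<And>x. f x \<noteq> 0 \<Longrightarrow> norm x \<le> R \<and> \<bar>f x\<bar> \<le> B"
  shows "integrable lborel f"
proof (rule integrableI_bounded_set[where A = "cball 0 R" and B = "max 0 B"])
  show "emeasure lborel (cball (0::'a) R) < \<infinity>" by (rule emeasure_compact_finite) simp
  have "norm (f x) \<le> max 0 B" for x using assms(2)[of x] by (cases "f x = 0") auto
  then show "AE x in lborel. x \<in> cball 0 R \<longrightarrow> norm (f x) \<le> max 0 B" by simp
qed (use assms in auto)

text \<open>\<open>W\<close> is the derivative of \<open>h\<close> along \<open>e\<close> on the
  part of the cylinder from which the line in direction \<open>e\<close> still has to reach
  \<open>S\<close>, cut off at height \<open>b\<close>, where \<open>h\<close> vanishes. An extra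
  integration through the slab is inserted: in one order Fubini's theorem leaves the fundamental
  theorem of calculus along lines, in the other the constant chord length of the slab.\<close>

lemma face_cylinder_integral:
  fixes c :: real and e \<nu> :: "real^'n" and h :: "real^'n \<Rightarrow> real" and h' :: "real^'n \<Rightarrow> real^'n \<Rightarrow> real"
  defines "\<tau> \<equiv> cross_time e \<nu> c"
  assumes S: "compact S" "S \<noteq> {}" "\<And>x. x \<in> S \<Longrightarrow> \<nu> \<bullet> x = c" and \<nu>: "norm \<nu> = 1"
    and e: "e \<bullet> e = 1" "e \<bullet> \<nu> \<noteq> 0"
    and h: "\<And>x. (h has_derivative h' x) (at x)" and G: "continuous_on UNIV (\<lambda>x. h' x e)"
    and b: "\<And>x. x \<in> S \<Longrightarrow> b < e \<bullet> x" and zero: "\<And>x. e \<bullet> x = b \<Longrightarrow> h x = 0"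
  defines "W \<equiv> (\<lambda>x. indicat_real S (x + \<tau> x *\<^sub>R e) * (indicat_real {0..} (\<tau> x) * indicat_real {b..} (e \<bullet> x) * h' x e))"
  shows "integral\<^sup>L lborel W = \<bar>e \<bullet> \<nu>\<bar> * integral\<^sup>L (surf \<nu> S) h" "integrable lborel W"
proof -
  let ?G = "\<lambda>x. h' x e"
  have [measurable]: "?G \<in> borel_measurable borel" using G by (rule borel_measurable_continuous_onI)
  have [measurable]: "\<tau> \<in> borel_measurable borel" by (simp add: \<tau>_def)
  have [measurable]: "S \<in> sets borel" using S by (simp add: borel_compact)
  have contfull: "continuous_on UNIV h"
    by (meson h has_derivative_continuous continuous_at_imp_continuous_on)
  then have [measurable]: "h \<in> borel_measurable borel" by (rule borel_measurable_continuous_onI)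
  \<comment> \<open>Joint integrand in a slab point \<open>y\<close> and a displacement
    \<open>s\<close>, describing the cylinder point \<open>x = y - s *\<^sub>R e\<close>.
    Integration over \<open>s\<close> with \<open>y\<close> fixed gives \<open>h\<close> at the
    crossing point in \<open>S\<close>; with \<open>x\<close> fixed it gives
    \<open>L * W x\<close>.\<close>
  define K where "K y s = indicat_real (slab \<nu> c) y * (indicat_real S (y + \<tau> y *\<^sub>R e) *
     (indicat_real {0..} (s + \<tau> y) * indicat_real {b..} (e \<bullet> (y - s *\<^sub>R e)) * ?G (y - s *\<^sub>R e)))" for y s
  have \<tau>_shift: "\<tau> (x + s *\<^sub>R e) = \<tau> x - s" for x s
    unfolding \<tau>_def by (rule cross_time_shift[OF e(2)])
  have K': "K (x + s *\<^sub>R e) s = indicat_real (slab \<nu> c) (x + s *\<^sub>R e) * W x" for x s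
    by (simp add: K_def W_def \<tau>_shift algebra_simps)
  obtain BS where BS: "\<And>x. x \<in> S \<Longrightarrow> norm x \<le> BS" using compact_imp_bounded[OF S(1)] by (auto simp: bounded_iff)
  have ne: "norm e = 1" using e(1) by (simp add: norm_eq_sqrt_inner)
  \<comment> \<open>Length of the piece of a line in direction \<open>e\<close> inside the slab,
    which also bounds the crossing time of a slab point.\<close>
  define L where "L = 1 / \<bar>e \<bullet> \<nu>\<bar>"
  have \<tau>L: "\<bar>\<tau> y\<bar> \<le> L" if "y \<in> slab \<nu> c" for y
  proof -
    have "\<bar>c - \<nu> \<bullet> y\<bar> \<le> 1" using that by (simp add: slab_def)
    then show ?thesis by (simp add: \<tau>_def cross_time_def L_def abs_divide divide_right_mono)
  qed
  define R where "R = BS + L + (BS + L + \<bar>b\<bar> + L)"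
  have supp: "norm y \<le> BS + L \<and> \<bar>s\<bar> \<le> BS + L + \<bar>b\<bar> + L" if "K y s \<noteq> 0" for y s
  proof -
    have 1: "y \<in> slab \<nu> c" "y + \<tau> y *\<^sub>R e \<in> S" "0 \<le> s + \<tau> y" "b \<le> e \<bullet> (y - s *\<^sub>R e)"
      using that by (auto simp: K_def indicator_def split: if_splits)
    have "norm y = norm (y + \<tau> y *\<^sub>R e - \<tau> y *\<^sub>R e)" by simp
    also have "\<dots> \<le> norm (y + \<tau> y *\<^sub>R e) + norm (\<tau> y *\<^sub>R e)" by (rule norm_triangle_ineq4)
    also have "\<dots> \<le> BS + L" using BS[OF 1(2)] \<tau>L[OF 1(1)] ne by simp
    finally have n: "norm y \<le> BS + L" .
    have "s \<le> e \<bullet> y - b" using 1(4) e(1) by (simp add: inner_simps)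
    moreover have "e \<bullet> y \<le> norm y" using Cauchy_Schwarz_ineq2[of e y] ne by simp
    moreover have "- L \<le> s" "0 \<le> L" using 1(3) \<tau>L[OF 1(1)] by auto
    moreover have "0 \<le> BS" using BS S(2) norm_ge_zero order_trans by blast
    ultimately show ?thesis using n by auto
  qed
  obtain BG where BG: "\<And>x. norm x \<le> R \<Longrightarrow> \<bar>?G x\<bar> \<le> BG"
    using compact_continuous_bound[OF compact_cball G, of 0 R] by auto
  have Kb: "norm (y, s) \<le> R \<and> norm (y - s *\<^sub>R e) \<le> R \<and> \<bar>K y s\<bar> \<le> BG" if "K y s \<noteq> 0" for y s
  proof -
    have n: "norm y + \<bar>s\<bar> \<le> R" using supp[OF that] by (simp add: R_def)
    have 1: "norm (y - s *\<^sub>R e) \<le> R" using norm_triangle_ineq4[of y "s *\<^sub>R e"] n ne by simp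
    have 2: "norm (y, s) \<le> R" using norm_Pair_le[of y s] n by simp
    have "\<bar>K y s\<bar> \<le> \<bar>?G (y - s *\<^sub>R e)\<bar>" unfolding K_def by (simp add: indicator_def)
    then show ?thesis using BG[OF 1] 1 2 by simp
  qed
  have Km: "(\<lambda>(y, s). K y s) \<in> borel_measurable (lborel \<Otimes>\<^sub>M lborel)"
    unfolding K_def case_prod_unfold by measurable
  have K'm: "(\<lambda>(x, s). K (x + s *\<^sub>R e) s) \<in> borel_measurable (lborel \<Otimes>\<^sub>M lborel)"
    unfolding K_def case_prod_unfold by measurable
  have intK: "integrable (lborel \<Otimes>\<^sub>M lborel) (\<lambda>(y, s). K y s)"
    unfolding lborel_prod
    by (rule integrable_lborel_bounded_support[where R = R and B = BG])
       (use Km Kb in \<open>auto simp: lborel_prod\<close>)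
  have intK': "integrable (lborel \<Otimes>\<^sub>M lborel) (\<lambda>(x, s). K (x + s *\<^sub>R e) s)"
    unfolding lborel_prod
  proof (rule integrable_lborel_bounded_support[where R = "R + R" and B = BG])
    fix p assume "(\<lambda>(x, s). K (x + s *\<^sub>R e) s) p \<noteq> 0"
    then obtain x s where p: "p = (x, s)" and nz: "K (x + s *\<^sub>R e) s \<noteq> 0" by (cases p) auto
    from Kb[OF nz] have 1: "norm (x + s *\<^sub>R e, s) \<le> R" "norm (x + s *\<^sub>R e - s *\<^sub>R e) \<le> R" "\<bar>K (x + s *\<^sub>R e) s\<bar> \<le> BG" by auto
    have "\<bar>s\<bar> \<le> R" using norm_snd_le[of s "x + s *\<^sub>R e"] 1(1) by simp
    then have "norm (x, s) \<le> R + R" using norm_Pair_le[of x s] 1(2) by simp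
    then show "norm p \<le> R + R \<and> \<bar>case p of (x, s) \<Rightarrow> K (x + s *\<^sub>R e) s\<bar> \<le> BG" using 1 p by simp
  qed (use K'm in \<open>simp add: lborel_prod\<close>)
  have inner1: "(LINT s|lborel. K y s) = indicat_real (slab \<nu> c) y * (indicat_real S (y + \<tau> y *\<^sub>R e) * h (y + \<tau> y *\<^sub>R e))" for y
  proof (cases "y \<in> slab \<nu> c \<and> y + \<tau> y *\<^sub>R e \<in> S")
    case False
    then show ?thesis by (auto simp: K_def indicator_def)
  next
    case True
    \<comment> \<open>At \<open>s = ?a\<close> the point \<open>y - s *\<^sub>R e\<close> lies on
      \<open>S\<close>, at \<open>s = ?b\<close> it has height \<open>b\<close>, where
      \<open>h\<close> vanishes; so the primitive contributes only the value on the face.\<close>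
    let ?a = "- \<tau> y" and ?b = "e \<bullet> y - b"
    have ab: "?a \<le> ?b" using b[of "y + \<tau> y *\<^sub>R e"] True e(1) by (simp add: inner_simps)
    have der: "((\<lambda>s. - h (y - s *\<^sub>R e)) has_vector_derivative ?G (y - s *\<^sub>R e)) (at s within X)" for s X
    proof -
      have "((\<lambda>s. y - s *\<^sub>R e) has_derivative (\<lambda>s. - (s *\<^sub>R e))) (at s within X)"
        by (rule derivative_eq_intros refl | simp)+
      from has_derivative_compose[OF this h]
      have "((\<lambda>s. - h (y - s *\<^sub>R e)) has_derivative (\<lambda>t. - h' (y - s *\<^sub>R e) (- (t *\<^sub>R e)))) (at s within X)"
        by (rule has_derivative_minus)
      moreover have "- h' z (- (t *\<^sub>R e)) = t *\<^sub>R ?G z" for t z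
        using has_derivative_linear[OF h[of z]] by (simp add: linear_neg linear_scale)
      ultimately show ?thesis by (simp add: has_vector_derivative_def)
    qed
    have "continuous_on UNIV (\<lambda>s. ?G (y - s *\<^sub>R e))"
      by (rule continuous_on_compose2[OF G]) (auto intro!: continuous_intros)
    then have cG: "continuous_on {?a..?b} (\<lambda>s. ?G (y - s *\<^sub>R e))" using continuous_on_subset by blast
    have "K y s = indicator {?a..?b} s *\<^sub>R ?G (y - s *\<^sub>R e)" for s
      using True e(1) by (auto simp: K_def indicator_def inner_simps)
    then have "(LINT s|lborel. K y s) = (LINT s|lborel. indicator {?a..?b} s *\<^sub>R ?G (y - s *\<^sub>R e))" by simp
    also have "\<dots> = - h (y - ?b *\<^sub>R e) - (- h (y - ?a *\<^sub>R e))"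
      by (rule has_bochner_integral_integral_eq, rule has_bochner_integral_FTC_Icc[OF ab der cG])
    also have "h (y - ?b *\<^sub>R e) = 0" by (rule zero) (use e(1) in \<open>simp add: inner_simps\<close>)
    finally show ?thesis using True by simp
  qed
  have inner2: "(LINT s|lborel. K (x + s *\<^sub>R e) s) = L * W x" for x
  proof -
    let ?u = "(c - \<nu> \<bullet> x) / (e \<bullet> \<nu>)" and ?v = "(c + 1 - \<nu> \<bullet> x) / (e \<bullet> \<nu>)"
    have "indicat_real (slab \<nu> c) (x + s *\<^sub>R e) = indicat_real {min ?u ?v .. max ?u ?v} s" for s
      using e(2) by (cases "e \<bullet> \<nu> > 0")
        (auto simp: slab_def indicator_def inner_simps inner_commute min_def max_def field_simps)
    then have "(LINT s|lborel. indicat_real (slab \<nu> c) (x + s *\<^sub>R e)) = max ?u ?v - min ?u ?v" by simp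
    also have "\<dots> = L" using e(2)
      by (cases "e \<bullet> \<nu> > 0") (auto simp: L_def min_def max_def divide_le_cancel add_divide_distrib diff_divide_distrib)
    finally show ?thesis unfolding K' by simp
  qed
  have "integral\<^sup>L (surf \<nu> S) h = (LINT y|lborel. indicat_real (slab \<nu> c) y * (indicat_real S (y + \<tau> y *\<^sub>R e) * h (y + \<tau> y *\<^sub>R e)))"
  proof -
    have "\<nu> \<bullet> (e /\<^sub>R (e \<bullet> \<nu>)) = 1" using e(2) by (simp add: inner_commute)
    from surf_integral[OF S(2) compact_imp_closed[OF S(1)] S(3) \<nu> this, of h]
    show ?thesis by (simp add: oproj_cross_time[OF e(2)] \<tau>_def)
  qed
  also have "\<dots> = (LINT y|lborel. LINT s|lborel. K y s)" by (simp add: inner1)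
  also have "\<dots> = (LINT s|lborel. LINT y|lborel. K y s)"
    by (rule lborel_pair.Fubini_integral[symmetric, OF intK])
  also have "\<dots> = (LINT s|lborel. LINT x|lborel. K (x + s *\<^sub>R e) s)"
  proof (rule Bochner_Integration.integral_cong[OF refl])
    fix s :: real
    have "(\<lambda>y. K y s) \<in> borel_measurable borel" unfolding K_def by measurable
    from integral_lborel_translate[OF this, of "s *\<^sub>R e"]
    show "(LINT y|lborel. K y s) = (LINT x|lborel. K (x + s *\<^sub>R e) s)" by (simp add: add.commute)
  qed
  also have "\<dots> = (LINT x|lborel. LINT s|lborel. K (x + s *\<^sub>R e) s)"
    by (rule lborel_pair.Fubini_integral[OF intK'])
  also have "\<dots> = L * integral\<^sup>L lborel W" unfolding inner2 by simp
  finally show "integral\<^sup>L lborel W = \<bar>e \<bullet> \<nu>\<bar> * integral\<^sup>L (surf \<nu> S) h"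
    using e(2) by (simp add: L_def)
  have "integrable lborel (\<lambda>x. LINT s|lborel. K (x + s *\<^sub>R e) s)"
    using lborel_pair.integrable_fst'[OF intK'] by simp
  then have "integrable lborel (\<lambda>x. inverse L * (L * W x))" unfolding inner2 by (rule integrable_mult_right)
  then show "integrable lborel W" using e(2) by (simp add: L_def)
qed

text \<open>A simple C1 transition; it builds the cutoff in height that lets the antiderivative
  start from zero.\<close>

lemma has_real_derivative_max0_square:
  "((\<lambda>t. (max 0 t)\<^sup>2) has_real_derivative 2 * max 0 t) (at (t::real))"
proof -
  consider "t > 0" | "t < 0" | "t = 0" by linarith
  then show ?thesis
  proof cases
    case 1
    have "((\<lambda>t. t\<^sup>2) has_real_derivative 2 * t) (at t)" by (auto intro!: derivative_eq_intros)
    then have "((\<lambda>t. (max 0 t)\<^sup>2) has_real_derivative 2 * t) (at t)"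
      by (rule has_field_derivative_transform_within_open[where S = "{0<..}"]) (use 1 in auto)
    then show ?thesis using 1 by simp
  next
    case 2
    have "((\<lambda>t. 0) has_real_derivative 0) (at t)" by simp
    then have "((\<lambda>t. (max 0 t)\<^sup>2) has_real_derivative 0) (at t)"
      by (rule has_field_derivative_transform_within_open[where S = "{..<0}"]) (use 2 in auto)
    then show ?thesis using 2 by simp
  next
    case 3
    have "((\<lambda>h::real. (max 0 h)\<^sup>2 / h) \<longlongrightarrow> 0) (at 0)"
    proof (rule Lim_null_comparison)
      show "\<forall>\<^sub>F h in at 0. norm ((max 0 h)\<^sup>2 / h) \<le> \<bar>h::real\<bar>"
        by (intro always_eventually allI) (auto simp: max_def power2_eq_square)
      show "((\<lambda>h::real. \<bar>h\<bar>) \<longlongrightarrow> 0) (at 0)" by (rule tendsto_eq_intros | simp)+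
    qed
    then show ?thesis using 3 by (simp add: has_field_derivative_iff)
  qed
qed

theorem gauss_green:
  fixes A :: "(real^'n) set" and \<nu> :: "'s \<Rightarrow> real^'n" and c \<epsilon> :: "'s \<Rightarrow> real" and S :: "'s \<Rightarrow> (real^'n) set"
    and h :: "real^'n \<Rightarrow> real"
  assumes fin: "finite I" and A: "bounded A" "closed A" and front: "frontier A \<subseteq> (\<Union>i\<in>I. S i)"
    and S: "\<And>i. i \<in> I \<Longrightarrow> compact (S i)" "\<And>i. i \<in> I \<Longrightarrow> S i \<noteq> {}"
    and \<nu>: "\<And>i. i \<in> I \<Longrightarrow> norm (\<nu> i) = 1"
    and plane: "\<And>i x. i \<in> I \<Longrightarrow> x \<in> S i \<Longrightarrow> \<nu> i \<bullet> x = c i"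
    and good: "\<And>i. i \<in> I \<Longrightarrow> face_AE (\<nu> i) (c i) (S i)
       (\<lambda>y. (\<forall>j\<in>I. y \<in> S j \<longrightarrow> j = i) \<and> has_jump (indicat_real A) (\<nu> i) (\<epsilon> i) y)"
    and e: "e \<bullet> e = 1"
    and h: "\<And>x. (h has_derivative h' x) (at x)" and G: "continuous_on UNIV (\<lambda>x. h' x e)"
  shows "(LINT x|lebesgue_on A. h' x e) = (\<Sum>i\<in>I. \<epsilon> i * (e \<bullet> \<nu> i) * integral\<^sup>L (surf (\<nu> i) (S i)) h)"
proof -
  have "bounded (A \<union> (\<Union>i\<in>I. S i))" using A S fin by (auto simp: compact_imp_bounded)
  then obtain B where B: "\<And>x. x \<in> A \<union> (\<Union>i\<in>I. S i) \<Longrightarrow> norm x \<le> B" by (auto simp: bounded_iff)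
  \<comment> \<open>Points of \<open>A\<close> and of all faces have height at least
    \<open>- B\<close>, which exceeds \<open>b + 1\<close>.\<close>
  define b where "b = - B - 2"
  have eb: "b + 1 < e \<bullet> x" if "x \<in> A \<union> (\<Union>i\<in>I. S i)" for x
  proof -
    have "norm e = 1" using e by (simp add: norm_eq_sqrt_inner)
    then have "\<bar>e \<bullet> x\<bar> \<le> norm x" using Cauchy_Schwarz_ineq2[of e x] by simp
    then show ?thesis using B[OF that] by (simp add: b_def)
  qed
  \<comment> \<open>A continuously differentiable factor equal to 1 above height
    \<open>b + 1\<close>, where \<open>A\<close> and the faces lie, and equal to 0 at height
    \<open>b\<close>, as \<open>face_cylinder_integral\<close> demands.\<close>
  define \<eta> where "\<eta> t = 1 - (max 0 (b + 1 - t))\<^sup>2" for t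
  define h2 where "h2 x = h x * \<eta> (e \<bullet> x)" for x
  define h2' where "h2' x v = h x * (2 * max 0 (b + 1 - e \<bullet> x) * (e \<bullet> v)) + h' x v * \<eta> (e \<bullet> x)" for x v
  have \<eta>': "(\<eta> has_real_derivative 2 * max 0 (b + 1 - t)) (at t)" for t
    unfolding \<eta>_def
    by (rule derivative_eq_intros DERIV_chain2[OF has_real_derivative_max0_square] refl | simp)+
  have h2: "(h2 has_derivative h2' x) (at x)" for x
  proof -
    have "((\<lambda>x. e \<bullet> x) has_derivative (\<lambda>v. e \<bullet> v)) (at x)" by (intro derivative_intros)
    from has_derivative_compose[OF this \<eta>'[of "e \<bullet> x", unfolded has_field_derivative_def]]
    have "((\<lambda>x. \<eta> (e \<bullet> x)) has_derivative (\<lambda>v. 2 * max 0 (b + 1 - e \<bullet> x) * (e \<bullet> v))) (at x)" .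
    from has_derivative_mult[OF h this] show ?thesis unfolding h2_def h2'_def[abs_def] .
  qed
  have conth: "continuous_on UNIV h"
    by (meson h has_derivative_continuous continuous_at_imp_continuous_on)
  have G2: "continuous_on UNIV (\<lambda>x. h2' x e)"
    unfolding h2'_def \<eta>_def by (intro continuous_intros conth G)
  have h2_eq[simp]: "h2 x = h x" and [simp]: "h2' x e = h' x e" if "x \<in> A \<union> (\<Union>i\<in>I. S i)" for x
    using eb[OF that] by (simp_all add: h2_def h2'_def \<eta>_def)
  define \<tau> where "\<tau> i = cross_time e (\<nu> i) (c i)" for i
  define W where "W i x = indicat_real (S i) (x + \<tau> i x *\<^sub>R e) * (indicat_real {0..} (\<tau> i x) * indicat_real {b..} (e \<bullet> x) * h2' x e)" for i x
  define J where "J = {i\<in>I. e \<bullet> \<nu> i \<noteq> 0}"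
  have W: "integral\<^sup>L lborel (W i) = \<bar>e \<bullet> \<nu> i\<bar> * integral\<^sup>L (surf (\<nu> i) (S i)) h2" "integrable lborel (W i)"
    if "i \<in> J" for i
  proof -
    have i: "i \<in> I" "e \<bullet> \<nu> i \<noteq> 0" using that by (auto simp: J_def)
    have 1: "x \<in> S i \<Longrightarrow> b < e \<bullet> x" for x using eb[of x] i by force
    have 2: "e \<bullet> x = b \<Longrightarrow> h2 x = 0" for x by (simp add: h2_def \<eta>_def)
    note fc = face_cylinder_integral[OF S(1,2)[OF i(1)] plane[OF i(1)] \<nu>[OF i(1)] e i(2) h2 G2, of b, OF _ 1 2]
    show "integral\<^sup>L lborel (W i) = \<bar>e \<bullet> \<nu> i\<bar> * integral\<^sup>L (surf (\<nu> i) (S i)) h2"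
      using fc(1) by (simp add: W_def[abs_def] \<tau>_def)
    show "integrable lborel (W i)"
      using fc(2) by (simp add: W_def[abs_def] \<tau>_def)
  qed
  have ae1: "AE x in lborel. \<forall>i\<in>I. \<nu> i \<bullet> x \<noteq> c i"
  proof (intro AE_finite_allI fin)
    fix i assume "i \<in> I"
    then have "\<nu> i \<noteq> 0" using \<nu> by fastforce
    then have "negligible {x. \<nu> i \<bullet> x = c i}" by (intro negligible_hyperplane) auto
    then have "AE x in lebesgue. x \<notin> {x. \<nu> i \<bullet> x = c i}"
      by (intro AE_not_in) (simp add: negligible_iff_null_sets)
    then show "AE x in lborel. \<nu> i \<bullet> x \<noteq> c i" by (simp add: AE_completion_iff)
  qed
  have ae2: "AE x in lborel. \<forall>i\<in>J. x + \<tau> i x *\<^sub>R e \<in> S i \<longrightarrow>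
     (\<forall>j\<in>I. x + \<tau> i x *\<^sub>R e \<in> S j \<longrightarrow> j = i) \<and> has_jump (indicat_real A) (\<nu> i) (\<epsilon> i) (x + \<tau> i x *\<^sub>R e)"
  proof (intro AE_finite_allI)
    fix i assume "i \<in> J"
    then have i: "i \<in> I" "e \<bullet> \<nu> i \<noteq> 0" by (auto simp: J_def)
    have "\<nu> i \<bullet> (e /\<^sub>R (e \<bullet> \<nu> i)) = 1" using i(2) by (simp add: inner_commute)
    from face_AE_oblique[OF \<nu>[OF i(1)] this good[OF i(1)]]
    show "AE x in lborel. x + \<tau> i x *\<^sub>R e \<in> S i \<longrightarrow>
     (\<forall>j\<in>I. x + \<tau> i x *\<^sub>R e \<in> S j \<longrightarrow> j = i) \<and> has_jump (indicat_real A) (\<nu> i) (\<epsilon> i) (x + \<tau> i x *\<^sub>R e)"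
      by (simp only: oproj_cross_time[OF i(2)] \<tau>_def)
  qed (use fin in \<open>simp add: J_def\<close>)
  have "e \<noteq> 0" using e by auto
  have ae: "AE x in lborel. indicat_real A x * h2' x e = (\<Sum>i\<in>J. \<epsilon> i * sgn (e \<bullet> \<nu> i) * W i x)"
    using ae1 ae2
  proof eventually_elim
    case (elim x)
    have "indicat_real A x = (\<Sum>i\<in>I. \<epsilon> i * sgn (e \<bullet> \<nu> i) *
        (if x + \<tau> i x *\<^sub>R e \<in> S i \<and> 0 < \<tau> i x then 1 else 0))"
      unfolding \<tau>_def
      by (rule indicator_eq_signed_crossings[OF fin A(1) front \<open>e \<noteq> 0\<close> plane])
         (use elim in \<open>auto simp: J_def \<tau>_def\<close>)
    also have "\<dots> = (\<Sum>i\<in>J. \<epsilon> i * sgn (e \<bullet> \<nu> i) *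
        (if x + \<tau> i x *\<^sub>R e \<in> S i \<and> 0 < \<tau> i x then 1 else 0))"
      using fin by (intro sum.mono_neutral_right) (auto simp: J_def)
    finally have *: "indicat_real A x = (\<Sum>i\<in>J. \<epsilon> i * sgn (e \<bullet> \<nu> i) *
        (if x + \<tau> i x *\<^sub>R e \<in> S i \<and> 0 < \<tau> i x then 1 else 0))" .
    have "indicat_real A x * h2' x e = indicat_real A x * (indicat_real {b..} (e \<bullet> x) * h2' x e)"
      using eb[of x] by (auto simp: indicator_def)
    also have "\<dots> = (\<Sum>i\<in>J. \<epsilon> i * sgn (e \<bullet> \<nu> i) *
        (if x + \<tau> i x *\<^sub>R e \<in> S i \<and> 0 < \<tau> i x then 1 else 0) * (indicat_real {b..} (e \<bullet> x) * h2' x e))"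
      unfolding * by (rule sum_distrib_right)
    also have "\<dots> = (\<Sum>i\<in>J. \<epsilon> i * sgn (e \<bullet> \<nu> i) * W i x)"
    proof (rule sum.cong[OF refl])
      fix i assume "i \<in> J"
      \<comment> \<open>For generic \<open>x\<close> no crossing time is 0, so the strict inequality
        of the crossing count and the closed one in \<open>W\<close> agree.\<close>
      then have "\<tau> i x \<noteq> 0" using elim(1) by (auto simp: J_def \<tau>_def cross_time_def)
      then show "\<epsilon> i * sgn (e \<bullet> \<nu> i) *
        (if x + \<tau> i x *\<^sub>R e \<in> S i \<and> 0 < \<tau> i x then 1 else 0) * (indicat_real {b..} (e \<bullet> x) * h2' x e)
        = \<epsilon> i * sgn (e \<bullet> \<nu> i) * W i x"
        by (auto simp: W_def indicator_def)
    qed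
    finally show ?case .
  qed
  have [measurable]: "A \<in> sets borel" using A by simp
  have [measurable]: "(\<lambda>x. h2' x e) \<in> borel_measurable borel" using G2 by (rule borel_measurable_continuous_onI)
  have "(LINT x|lebesgue_on A. h' x e) = (LINT x|lebesgue_on A. h2' x e)"
    by (rule Bochner_Integration.integral_cong) auto
  also have "\<dots> = (LINT x|lebesgue. indicat_real A x * h2' x e)"
    by (subst integral_restrict_space) auto
  also have "\<dots> = (LINT x|lborel. indicat_real A x * h2' x e)"
    by (rule integral_completion) auto
  also have "\<dots> = (LINT x|lborel. (\<Sum>i\<in>J. \<epsilon> i * sgn (e \<bullet> \<nu> i) * W i x))"
    by (rule integral_cong_AE) (use ae W(2) in auto)
  also have "\<dots> = (\<Sum>i\<in>J. \<epsilon> i * sgn (e \<bullet> \<nu> i) * integral\<^sup>L lborel (W i))"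
    using W(2) by (subst Bochner_Integration.integral_sum) auto
  also have "\<dots> = (\<Sum>i\<in>J. \<epsilon> i * (e \<bullet> \<nu> i) * integral\<^sup>L (surf (\<nu> i) (S i)) h)"
  proof (rule sum.cong[OF refl])
    fix i assume i: "i \<in> J"
    have "integral\<^sup>L (surf (\<nu> i) (S i)) h2 = integral\<^sup>L (surf (\<nu> i) (S i)) h"
      by (rule Bochner_Integration.integral_cong[OF refl], rule h2_eq) (use i in \<open>auto simp: J_def\<close>)
    then show "\<epsilon> i * sgn (e \<bullet> \<nu> i) * integral\<^sup>L lborel (W i) = \<epsilon> i * (e \<bullet> \<nu> i) * integral\<^sup>L (surf (\<nu> i) (S i)) h"
      using W(1)[OF i] by (simp add: sgn_mult_abs mult.assoc[symmetric] mult_sgn_abs)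
  qed
  also have "\<dots> = (\<Sum>i\<in>I. \<epsilon> i * (e \<bullet> \<nu> i) * integral\<^sup>L (surf (\<nu> i) (S i)) h)"
    using fin by (intro sum.mono_neutral_left) (auto simp: J_def)
  finally show ?thesis .
qed


section \<open>Polynomials\<close>

text \<open>Fredholm alternative for a symmetric positive semidefinite matrix: the system is
  solvable once the right-hand side is orthogonal to the kernel. The induction adds one index
  \<open>a\<close> and eliminates it by a Schur complement.\<close>

lemma semidefinite_system_solvable:
  fixes G :: "'i \<Rightarrow> 'i \<Rightarrow> real"
  assumes sym: "\<And>i j. G i j = G j i"
    and psd: "\<And>J c. finite J \<Longrightarrow> 0 \<le> (\<Sum>i\<in>J. \<Sum>j\<in>J. c i * c j * G i j)"
    and "finite I"
    and ker: "\<And>c. (\<And>i. i \<in> I \<Longrightarrow> (\<Sum>j\<in>I. c j * G i j) = 0) \<Longrightarrow> (\<Sum>i\<in>I. c i * l i) = 0"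
  shows "\<exists>c. \<forall>i\<in>I. (\<Sum>j\<in>I. c j * G i j) = l i"
  using assms(3) ker
proof (induction I arbitrary: l rule: finite_induct)
  case empty
  then show ?case by simp
next
  case (insert a I)
  \<comment> \<open>Otherwise the quadratic form at \<open>c(a := t)\<close>, which is
    \<open>2 * t * ?s + t * t * G a a\<close>, takes a negative value: at \<open>- ?s\<close> if
    \<open>G a a = 0\<close>, and at its minimum if \<open>G a a > 0\<close>.\<close>
  have null: "(\<Sum>j\<in>I. c j * G a j) = 0" if c: "\<And>i. i \<in> I \<Longrightarrow> (\<Sum>j\<in>I. c j * G i j) = 0" for c
  proof (rule ccontr)
    let ?s = "\<Sum>j\<in>I. c j * G a j"
    assume s: "?s \<noteq> 0"
    have q: "0 \<le> 2 * t * ?s + t * t * G a a" for t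
    proof -
      let ?d = "c(a := t)"
      have "0 \<le> (\<Sum>i\<in>insert a I. \<Sum>j\<in>insert a I. ?d i * ?d j * G i j)"
        using psd[of "insert a I" ?d] insert.hyps by blast
      also have "\<dots> = (\<Sum>i\<in>insert a I. ?d i * (t * G i a + (\<Sum>j\<in>I. c j * G i j)))"
        using insert.hyps by (intro sum.cong refl) (auto simp: distrib_left sum_distrib_left mult.assoc intro!: sum.cong)
      also have "\<dots> = t * (t * G a a + ?s) + (\<Sum>i\<in>I. c i * (t * G i a + (\<Sum>j\<in>I. c j * G i j)))"
      proof -
        have "(\<Sum>i\<in>I. ?d i * (t * G i a + (\<Sum>j\<in>I. c j * G i j))) = (\<Sum>i\<in>I. c i * (t * G i a + (\<Sum>j\<in>I. c j * G i j)))"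
          using insert.hyps by (intro sum.cong) auto
        then show ?thesis using insert.hyps by simp
      qed
      also have "(\<Sum>i\<in>I. c i * (t * G i a + (\<Sum>j\<in>I. c j * G i j))) = t * ?s"
        using c by (auto simp: sum_distrib_left sym[of _ a] intro!: sum.cong)
      finally show ?thesis by (simp add: algebra_simps)
    qed
    define u where "u = ?s"
    have q: "0 \<le> 2 * t * u + t * t * G a a" for t using q[of t] by (simp only: u_def)
    have u: "0 < u * u" using s by (simp add: u_def) (metis not_real_square_gt_zero)
    show False
    proof (cases "G a a = 0")
      case True
      then show ?thesis using q[of "- u"] u by simp
    next
      case False
      have "0 \<le> G a a" using psd[of "{a}" "\<lambda>_. 1"] by simp
      then have pos: "0 < G a a" using False by simp
      have "2 * (- u / G a a) * u + (- u / G a a) * (- u / G a a) * G a a = - (u * u) / G a a"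
        using pos by (simp add: field_simps)
      then have "0 \<le> - (u * u) / G a a" using q[of "- u / G a a"] by simp
      then show False using divide_pos_pos[OF u pos] by simp
    qed
  qed
  have "\<exists>p. \<forall>i\<in>I. (\<Sum>j\<in>I. p j * G i j) = G i a"
    by (rule insert.IH) (use null in \<open>simp add: sym[of _ a]\<close>)
  then obtain p where p: "\<And>i. i \<in> I \<Longrightarrow> (\<Sum>j\<in>I. p j * G i j) = G i a" by blast
  have "\<exists>c. \<forall>i\<in>I. (\<Sum>j\<in>I. c j * G i j) = l i"
  proof (rule insert.IH)
    fix c assume c: "\<And>i. i \<in> I \<Longrightarrow> (\<Sum>j\<in>I. c j * G i j) = 0"
    let ?d = "c(a := 0)"
    have d: "(\<Sum>j\<in>I. ?d j * g j) = (\<Sum>j\<in>I. c j * g j)" for g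
      using insert.hyps by (intro sum.cong) auto
    have d': "(\<Sum>j\<in>insert a I. ?d j * g j) = (\<Sum>j\<in>I. c j * g j)" for g
      unfolding sum.insert[OF insert.hyps] d by simp
    have "(\<Sum>i\<in>insert a I. ?d i * l i) = 0"
      by (rule insert.prems) (use c null[OF c] in \<open>auto simp only: d' insert_iff\<close>)
    then show "(\<Sum>i\<in>I. c i * l i) = 0" by (simp only: d')
  qed
  then obtain c0 where c0: "\<And>i. i \<in> I \<Longrightarrow> (\<Sum>j\<in>I. c0 j * G i j) = l i" by blast
  \<comment> \<open>The unit vector at \<open>a\<close> minus \<open>p\<close> is annihilated by all
    rows in \<open>I\<close>; its product with row \<open>a\<close> is the Schur complement
    \<open>?\<delta>\<close>.\<close>
  define w where "w = (\<lambda>i. - p i)(a := 1)"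
  have w: "(\<Sum>j\<in>insert a I. w j * g j) = g a - (\<Sum>j\<in>I. p j * g j)" for g
  proof -
    have "(\<Sum>j\<in>I. w j * g j) = (\<Sum>j\<in>I. - (p j * g j))"
      using insert.hyps by (intro sum.cong) (auto simp: w_def)
    then show ?thesis using insert.hyps by (simp add: w_def sum_negf)
  qed
  let ?\<delta> = "G a a - (\<Sum>j\<in>I. p j * G a j)" and ?r = "l a - (\<Sum>j\<in>I. c0 j * G a j)"
  obtain t where t: "t * ?\<delta> = ?r"
  proof (cases "?\<delta> = 0")
    case False
    then show ?thesis using that[of "?r / ?\<delta>"] by simp
  next
    \<comment> \<open>Now \<open>w\<close> is a kernel vector, and orthogonality of \<open>l\<close>
      to it says that the last equation already holds for \<open>c0\<close>.\<close>
    case True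
    have "(\<Sum>i\<in>insert a I. w i * l i) = 0"
      by (rule insert.prems) (use p True in \<open>auto simp: w\<close>)
    then have "l a = (\<Sum>i\<in>I. p i * l i)" by (simp add: w)
    also have "\<dots> = (\<Sum>i\<in>I. \<Sum>j\<in>I. p i * (c0 j * G i j))" by (simp add: c0 sum_distrib_left[symmetric])
    also have "\<dots> = (\<Sum>j\<in>I. \<Sum>i\<in>I. p i * (c0 j * G i j))" by (rule sum.swap)
    also have "\<dots> = (\<Sum>j\<in>I. c0 j * (\<Sum>i\<in>I. p i * G j i))"
      by (auto simp: sum_distrib_left sym mult.left_commute intro!: sum.cong)
    also have "\<dots> = (\<Sum>j\<in>I. c0 j * G a j)" by (simp add: p sym[of a])
    finally show ?thesis using that[of 0] True by simp
  qed
  define c where "c i = (if i = a then 0 else c0 i) + t * w i" for i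
  have c: "(\<Sum>j\<in>insert a I. c j * g j) = (\<Sum>j\<in>I. c0 j * g j) + t * (g a - (\<Sum>j\<in>I. p j * g j))" for g
  proof -
    have "(\<Sum>j\<in>insert a I. c j * g j) = (\<Sum>j\<in>insert a I. (if j = a then 0 else c0 j) * g j) + t * (\<Sum>j\<in>insert a I. w j * g j)"
      by (simp only: c_def distrib_right sum.distrib sum_distrib_left mult.assoc)
    also have "(\<Sum>j\<in>insert a I. (if j = a then 0 else c0 j) * g j) = (\<Sum>j\<in>I. c0 j * g j)"
      using insert.hyps by (auto intro!: sum.cong)
    finally show ?thesis by (simp only: w)
  qed
  show ?case
    by (rule exI[of _ c]) (use c0 p t in \<open>auto simp: c\<close>)
qed

section \<open>Polynomials in monomial form\<close>

definition monomial :: "('n \<Rightarrow> nat) \<Rightarrow> real^'n::finite \<Rightarrow> real" where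
  "monomial \<alpha> x = (\<Prod>i\<in>UNIV. x $ i ^ \<alpha> i)"

definition multi_indices :: "nat \<Rightarrow> ('n::finite \<Rightarrow> nat) set" where
  "multi_indices k = {\<alpha>. (\<Sum>i\<in>UNIV. \<alpha> i) \<le> k}"

lemma finite_multi_indices: "finite (multi_indices k :: ('n::finite \<Rightarrow> nat) set)"
proof (rule finite_subset)
  show "multi_indices k \<subseteq> (UNIV :: 'n set) \<rightarrow>\<^sub>E {..k}"
  proof
    fix \<alpha> :: "'n \<Rightarrow> nat" assume "\<alpha> \<in> multi_indices k"
    then have "\<alpha> i \<le> k" for i
      using member_le_sum[of i UNIV \<alpha>] by (simp add: multi_indices_def)
    then show "\<alpha> \<in> UNIV \<rightarrow>\<^sub>E {..k}" by auto
  qed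
  show "finite ((UNIV :: 'n set) \<rightarrow>\<^sub>E {..k})" by (rule finite_PiE) auto
qed

lemma polys_iff:
  fixes f :: "real^'n::finite \<Rightarrow> 'b::euclidean_space"
  shows "f \<in> polys k \<longleftrightarrow> (\<exists>C. f = (\<lambda>x. \<Sum>\<alpha>\<in>multi_indices k. monomial \<alpha> x *\<^sub>R C \<alpha>))" (is "_ \<longleftrightarrow> ?R")
proof
  assume "f \<in> polys k"
  then have "\<forall>b\<in>Basis. \<exists>c. \<forall>x. f x \<bullet> b = (\<Sum>\<alpha>\<in>multi_indices k. c \<alpha> * monomial \<alpha> x)"
    by (simp add: polys_def multi_indices_def monomial_def)
  from bchoice[OF this] obtain c where
    c: "\<And>b x. b \<in> Basis \<Longrightarrow> f x \<bullet> b = (\<Sum>\<alpha>\<in>multi_indices k. c b \<alpha> * monomial \<alpha> x)" by blast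
  have "f x = (\<Sum>\<alpha>\<in>multi_indices k. monomial \<alpha> x *\<^sub>R (\<Sum>b\<in>Basis. c b \<alpha> *\<^sub>R b))" for x
  proof -
    have "f x = (\<Sum>b\<in>Basis. (f x \<bullet> b) *\<^sub>R b)" by (simp add: euclidean_representation)
    also have "\<dots> = (\<Sum>b\<in>Basis. \<Sum>\<alpha>\<in>multi_indices k. (c b \<alpha> * monomial \<alpha> x) *\<^sub>R b)"
      by (simp add: c scaleR_sum_left)
    also have "\<dots> = (\<Sum>\<alpha>\<in>multi_indices k. \<Sum>b\<in>Basis. (c b \<alpha> * monomial \<alpha> x) *\<^sub>R b)" by (rule sum.swap)
    finally show ?thesis by (simp add: scaleR_sum_right mult.commute)
  qed
  then have "f = (\<lambda>x. \<Sum>\<alpha>\<in>multi_indices k. monomial \<alpha> x *\<^sub>R (\<Sum>b\<in>Basis. c b \<alpha> *\<^sub>R b))" by (rule ext)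
  then show ?R by (rule exI[of _ "\<lambda>\<alpha>. \<Sum>b\<in>Basis. c b \<alpha> *\<^sub>R b"])
next
  assume ?R
  then obtain C where C: "f = (\<lambda>x. \<Sum>\<alpha>\<in>multi_indices k. monomial \<alpha> x *\<^sub>R C \<alpha>)" by blast
  have "\<exists>c. \<forall>x. f x \<bullet> b = (\<Sum>\<alpha>\<in>multi_indices k. c \<alpha> * monomial \<alpha> x)" for b
    by (rule exI[of _ "\<lambda>\<alpha>. C \<alpha> \<bullet> b"]) (simp add: C inner_sum_left mult.commute)
  then show "f \<in> polys k" by (simp add: polys_def multi_indices_def monomial_def)
qed

lemma polys_monomial: "\<alpha> \<in> multi_indices k \<Longrightarrow> (\<lambda>x. monomial \<alpha> x *\<^sub>R C) \<in> polys k"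
  unfolding polys_iff
  by (rule exI[of _ "\<lambda>\<beta>. if \<beta> = \<alpha> then C else 0"])
     (simp add: finite_multi_indices if_distrib cong: if_cong)

lemma polys_0: "(\<lambda>x. 0) \<in> polys k"
  unfolding polys_iff by (rule exI[of _ "\<lambda>_. 0"]) simp

lemma polys_add: "f \<in> polys k \<Longrightarrow> g \<in> polys k \<Longrightarrow> (\<lambda>x. f x + g x) \<in> polys k"
  unfolding polys_iff
proof (elim exE)
  fix C D assume "f = (\<lambda>x. \<Sum>\<alpha>\<in>multi_indices k. monomial \<alpha> x *\<^sub>R C \<alpha>)"
    "g = (\<lambda>x. \<Sum>\<alpha>\<in>multi_indices k. monomial \<alpha> x *\<^sub>R D \<alpha>)"
  then show "\<exists>C. (\<lambda>x. f x + g x) = (\<lambda>x. \<Sum>\<alpha>\<in>multi_indices k. monomial \<alpha> x *\<^sub>R C \<alpha>)"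
    by (intro exI[of _ "\<lambda>\<alpha>. C \<alpha> + D \<alpha>"]) (simp add: sum.distrib scaleR_add_right)
qed

lemma polys_linear:
  fixes L :: "'b::euclidean_space \<Rightarrow> 'c::euclidean_space"
  assumes "linear L" "f \<in> polys k"
  shows "(\<lambda>x. L (f x)) \<in> polys k"
proof -
  obtain C where "f = (\<lambda>x. \<Sum>\<alpha>\<in>multi_indices k. monomial \<alpha> x *\<^sub>R C \<alpha>)"
    using assms(2) polys_iff by blast
  then have "(\<lambda>x. L (f x)) = (\<lambda>x. \<Sum>\<alpha>\<in>multi_indices k. monomial \<alpha> x *\<^sub>R L (C \<alpha>))"
    using assms(1) by (simp add: linear_sum linear_scale)
  then show ?thesis unfolding polys_iff by (rule exI[of _ "\<lambda>\<alpha>. L (C \<alpha>)"])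
qed

lemma polys_scaleR: "f \<in> polys k \<Longrightarrow> (\<lambda>x. c *\<^sub>R f x) \<in> polys k"
  by (rule polys_linear[of "\<lambda>x. c *\<^sub>R x"]) (auto intro: linearI simp: algebra_simps)

lemma polys_diff:
  assumes "f \<in> polys k" "g \<in> polys k" shows "(\<lambda>x. f x - g x) \<in> polys k"
  using polys_add[OF assms(1) polys_scaleR[OF assms(2), of "-1"]] by simp

lemma polys_sum: "finite A \<Longrightarrow> (\<And>i. i \<in> A \<Longrightarrow> f i \<in> polys k) \<Longrightarrow> (\<lambda>x. \<Sum>i\<in>A. f i x) \<in> polys k"
  by (induction A rule: finite_induct) (auto intro: polys_0 polys_add)

lemma polys_le: "f \<in> polys k \<Longrightarrow> k \<le> k' \<Longrightarrow> f \<in> polys k'"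
proof -
  assume f: "f \<in> polys k" and k: "k \<le> k'"
  obtain C where C: "f = (\<lambda>x. \<Sum>\<alpha>\<in>multi_indices k. monomial \<alpha> x *\<^sub>R C \<alpha>)"
    using f polys_iff by blast
  show ?thesis unfolding C
    by (rule polys_sum[OF finite_multi_indices], rule polys_monomial) (use k in \<open>auto simp: multi_indices_def\<close>)
qed

text \<open>Continuity is asked of each directional derivative separately, which in finite dimension
  is continuity of the derivative and is the form in which integration along lines uses it.\<close>

definition C1 :: "('a::real_normed_vector \<Rightarrow> 'b::real_normed_vector) \<Rightarrow> bool" where
  "C1 f \<longleftrightarrow> (\<exists>f'. (\<forall>x. (f has_derivative f' x) (at x)) \<and> (\<forall>v. continuous_on UNIV (\<lambda>x. f' x v)))"

lemma C1I:
  assumes "\<And>x. (f has_derivative f' x) (at x)" "\<And>v. continuous_on UNIV (\<lambda>x. f' x v)"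
  shows "C1 f"
  unfolding C1_def using assms by (intro exI[of _ f']) blast

lemma C1_differentiable: "C1 f \<Longrightarrow> f differentiable (at x)"
  unfolding C1_def differentiable_def by blast

lemma C1_has_derivative: "C1 f \<Longrightarrow> (f has_derivative frechet_derivative f (at x)) (at x)"
  using C1_differentiable frechet_derivative_works by blast

lemma C1_continuous_deriv: "C1 f \<Longrightarrow> continuous_on UNIV (\<lambda>x. frechet_derivative f (at x) v)"
proof -
  assume "C1 f"
  then obtain f' where f': "\<And>x. (f has_derivative f' x) (at x)" "\<And>v. continuous_on UNIV (\<lambda>x. f' x v)"
    unfolding C1_def by blast
  have "frechet_derivative f (at x) = f' x" for x using frechet_derivative_at[OF f'(1)] by simp
  then show ?thesis using f'(2) by simp
qed

lemma C1_continuous: "C1 f \<Longrightarrow> continuous_on UNIV f"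
  by (meson C1_has_derivative continuous_at_imp_continuous_on has_derivative_continuous)

lemma C1_partial_deriv: "C1 f \<Longrightarrow> continuous_on UNIV (partial_deriv j f)"
  unfolding partial_deriv_def[abs_def] by (rule C1_continuous_deriv)

lemma C1_const: "C1 (\<lambda>x. c)"
  unfolding C1_def by (rule exI[of _ "\<lambda>x v. 0"]) auto

lemma C1_linear: "bounded_linear f \<Longrightarrow> C1 f"
  unfolding C1_def by (rule exI[of _ "\<lambda>x. f"]) (auto simp: bounded_linear_imp_has_derivative)

lemma C1_bilinear:
  assumes "bounded_bilinear B" "C1 f" "C1 g"
  shows "C1 (\<lambda>x. B (f x) (g x))"
proof -
  let ?f = "\<lambda>x. frechet_derivative f (at x)" and ?g = "\<lambda>x. frechet_derivative g (at x)"
  have "((\<lambda>x. B (f x) (g x)) has_derivative (\<lambda>v. B (f x) (?g x v) + B (?f x v) (g x))) (at x)" for x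
    using bounded_bilinear.FDERIV[OF assms(1) C1_has_derivative[OF assms(2)] C1_has_derivative[OF assms(3)]] .
  moreover have "continuous_on UNIV (\<lambda>x. B (f x) (?g x v) + B (?f x v) (g x))" for v
    by (rule continuous_on_add[OF bounded_bilinear.continuous_on[OF assms(1) C1_continuous[OF assms(2)] C1_continuous_deriv[OF assms(3)]]
      bounded_bilinear.continuous_on[OF assms(1) C1_continuous_deriv[OF assms(2)] C1_continuous[OF assms(3)]]])
  ultimately show ?thesis by (rule C1I)
qed

lemma C1_add:
  assumes "C1 f" "C1 g" shows "C1 (\<lambda>x. f x + g x)"
proof -
  have "((\<lambda>x. f x + g x) has_derivative (\<lambda>v. frechet_derivative f (at x) v + frechet_derivative g (at x) v)) (at x)" for x
    using has_derivative_add[OF C1_has_derivative[OF assms(1)] C1_has_derivative[OF assms(2)]] .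
  then show ?thesis by (rule C1I) (intro continuous_on_add C1_continuous_deriv assms)
qed

lemma C1_linear_compose:
  assumes "bounded_linear L" "C1 f" shows "C1 (\<lambda>x. L (f x))"
proof -
  have "((\<lambda>x. L (f x)) has_derivative (\<lambda>v. L (frechet_derivative f (at x) v))) (at x)" for x
    using bounded_linear.has_derivative[OF assms(1) C1_has_derivative[OF assms(2)]] .
  then show ?thesis
    by (rule C1I) (rule bounded_linear.continuous_on[OF assms(1) C1_continuous_deriv[OF assms(2)]])
qed

lemma C1_sum: "finite A \<Longrightarrow> (\<And>i. i \<in> A \<Longrightarrow> C1 (f i)) \<Longrightarrow> C1 (\<lambda>x. \<Sum>i\<in>A. f i x)"
  by (induction A rule: finite_induct) (auto intro: C1_const C1_add)

lemma C1_mult: "C1 f \<Longrightarrow> C1 g \<Longrightarrow> C1 (\<lambda>x. f x * g x :: real)"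
  by (rule C1_bilinear[OF bounded_bilinear_mult])

lemma C1_prod:
  fixes f :: "'i \<Rightarrow> 'a::real_normed_vector \<Rightarrow> real"
  shows "finite A \<Longrightarrow> (\<And>i. i \<in> A \<Longrightarrow> C1 (f i)) \<Longrightarrow> C1 (\<lambda>x. \<Prod>i\<in>A. f i x)"
  by (induction A rule: finite_induct) (auto intro: C1_const C1_mult)

lemma C1_power:
  fixes f :: "'a::real_normed_vector \<Rightarrow> real"
  shows "C1 f \<Longrightarrow> C1 (\<lambda>x. f x ^ k)"
  by (induction k) (auto intro: C1_const C1_mult)

lemma C1_monomial: "C1 (monomial \<alpha>)"
  unfolding monomial_def[abs_def]
  by (intro C1_prod C1_power C1_linear bounded_linear_vec_nth) auto

lemma C1_polys: "f \<in> polys k \<Longrightarrow> C1 f"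
  unfolding polys_iff
  by (auto intro!: C1_sum finite_multi_indices C1_bilinear[OF bounded_bilinear_scaleR] C1_monomial C1_const)

lemma C1_vec_nth: "C1 f \<Longrightarrow> C1 (\<lambda>x. f x $ i)"
  by (rule C1_linear_compose[OF bounded_linear_vec_nth])

lemma partial_deriv_linear:
  fixes f :: "real^'n::finite \<Rightarrow> 'b::real_normed_vector"
  assumes "bounded_linear L" "C1 f"
  shows "partial_deriv j (\<lambda>x. L (f x)) x = L (partial_deriv j f x)"
proof -
  have "((\<lambda>x. L (f x)) has_derivative (\<lambda>v. L (frechet_derivative f (at x) v))) (at x)"
    using bounded_linear.has_derivative[OF assms(1) C1_has_derivative[OF assms(2)]] .
  from frechet_derivative_at[OF this] show ?thesis by (simp add: partial_deriv_def fun_eq_iff)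
qed

lemma partial_deriv_vec_nth: "C1 f \<Longrightarrow> partial_deriv j (\<lambda>x. f x $ i) x = partial_deriv j f x $ i"
  by (rule partial_deriv_linear[OF bounded_linear_vec_nth])

lemma partial_deriv_mult:
  fixes f g :: "real^'n::finite \<Rightarrow> real"
  assumes "C1 f" "C1 g"
  shows "partial_deriv j (\<lambda>x. f x * g x) x = f x * partial_deriv j g x + partial_deriv j f x * g x"
proof -
  have "((\<lambda>x. f x * g x) has_derivative (\<lambda>v. f x * frechet_derivative g (at x) v + frechet_derivative f (at x) v * g x)) (at x)"
    using has_derivative_mult[OF C1_has_derivative[OF assms(1)] C1_has_derivative[OF assms(2)]] .
  from frechet_derivative_at[OF this] show ?thesis by (simp add: partial_deriv_def fun_eq_iff)
qed

text \<open>Truncated subtraction does no harm: where \<open>\<alpha> j = 0\<close> the numerical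
  factor is zero.\<close>

lemma partial_deriv_monomial:
  fixes \<alpha> :: "'n::finite \<Rightarrow> nat"
  shows "partial_deriv j (monomial \<alpha>) x = real (\<alpha> j) * monomial (\<alpha>(j := \<alpha> j - 1)) x"
proof -
  have d: "((\<lambda>x. x $ i ^ \<alpha> i) has_derivative (\<lambda>v. real (\<alpha> i) * x $ i ^ (\<alpha> i - 1) * v $ i)) (at x)" for i
    by (rule derivative_eq_intros bounded_linear_imp_has_derivative[OF bounded_linear_vec_nth] refl | simp add: mult_ac)+
  have "(monomial \<alpha> has_derivative (\<lambda>v. \<Sum>i\<in>UNIV. (real (\<alpha> i) * x $ i ^ (\<alpha> i - 1) * v $ i) * (\<Prod>j\<in>UNIV - {i}. x $ j ^ \<alpha> j))) (at x)"
    unfolding monomial_def[abs_def] by (rule has_derivative_prod) (rule d)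
  from frechet_derivative_at[OF this]
  have "partial_deriv j (monomial \<alpha>) x = (\<Sum>i\<in>UNIV. (real (\<alpha> i) * x $ i ^ (\<alpha> i - 1) * axis j 1 $ i) * (\<Prod>j\<in>UNIV - {i}. x $ j ^ \<alpha> j))"
    unfolding partial_deriv_def by (rule fun_cong[OF sym])
  also have "\<dots> = (\<Sum>i\<in>{j}. (real (\<alpha> i) * x $ i ^ (\<alpha> i - 1) * axis j 1 $ i) * (\<Prod>j\<in>UNIV - {i}. x $ j ^ \<alpha> j))"
    by (rule sum.mono_neutral_right) (auto simp: axis_def)
  also have "\<dots> = real (\<alpha> j) * (x $ j ^ (\<alpha> j - 1) * (\<Prod>i\<in>UNIV - {j}. x $ i ^ \<alpha> i))"
    by (simp add: axis_def)
  also have "x $ j ^ (\<alpha> j - 1) * (\<Prod>i\<in>UNIV - {j}. x $ i ^ \<alpha> i) = monomial (\<alpha>(j := \<alpha> j - 1)) x"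
  proof -
    have "monomial (\<alpha>(j := \<alpha> j - 1)) x = x $ j ^ (\<alpha>(j := \<alpha> j - 1)) j * (\<Prod>i\<in>UNIV - {j}. x $ i ^ (\<alpha>(j := \<alpha> j - 1)) i)"
      unfolding monomial_def by (rule prod.remove) auto
    also have "(\<Prod>i\<in>UNIV - {j}. x $ i ^ (\<alpha>(j := \<alpha> j - 1)) i) = (\<Prod>i\<in>UNIV - {j}. x $ i ^ \<alpha> i)"
      by (rule prod.cong) auto
    finally show ?thesis by (simp only: fun_upd_same)
  qed
  finally show ?thesis .
qed

lemma partial_deriv_add:
  assumes "C1 f" "C1 g"
  shows "partial_deriv j (\<lambda>x. f x + g x) x = partial_deriv j f x + partial_deriv j g x"
proof -
  have "((\<lambda>x. f x + g x) has_derivative (\<lambda>v. frechet_derivative f (at x) v + frechet_derivative g (at x) v)) (at x)"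
    using has_derivative_add[OF C1_has_derivative[OF assms(1)] C1_has_derivative[OF assms(2)]] .
  from frechet_derivative_at[OF this] show ?thesis by (simp add: partial_deriv_def fun_eq_iff)
qed

lemma partial_deriv_const: "partial_deriv j (\<lambda>x. c) x = 0"
  unfolding partial_deriv_def by (simp add: frechet_derivative_const)

lemma partial_deriv_sum:
  "finite A \<Longrightarrow> (\<And>i. i \<in> A \<Longrightarrow> C1 (f i)) \<Longrightarrow>
    partial_deriv j (\<lambda>x. \<Sum>i\<in>A. f i x) x = (\<Sum>i\<in>A. partial_deriv j (f i) x)"
  by (induction A rule: finite_induct) (auto simp: partial_deriv_const partial_deriv_add C1_sum)

text \<open>For \<open>k = 0\<close> the bound \<open>k - 1\<close> is again 0, which the zero
  derivative satisfies.\<close>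

lemma partial_deriv_polys:
  assumes "f \<in> polys k" shows "partial_deriv j f \<in> polys (k - 1)"
proof -
  obtain C where C: "f = (\<lambda>x. \<Sum>\<alpha>\<in>multi_indices k. monomial \<alpha> x *\<^sub>R C \<alpha>)"
    using assms polys_iff by blast
  have C1t: "C1 (\<lambda>x. monomial \<alpha> x *\<^sub>R C \<alpha>)" for \<alpha>
    by (intro C1_bilinear[OF bounded_bilinear_scaleR] C1_monomial C1_const)
  have "partial_deriv j f x = (\<Sum>\<alpha>\<in>multi_indices k. real (\<alpha> j) *\<^sub>R (monomial (\<alpha>(j := \<alpha> j - 1)) x *\<^sub>R C \<alpha>))" for x
  proof -
    have "partial_deriv j f x = (\<Sum>\<alpha>\<in>multi_indices k. partial_deriv j (\<lambda>x. monomial \<alpha> x *\<^sub>R C \<alpha>) x)"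
      unfolding C by (rule partial_deriv_sum[OF finite_multi_indices C1t])
    also have "\<dots> = (\<Sum>\<alpha>\<in>multi_indices k. partial_deriv j (monomial \<alpha>) x *\<^sub>R C \<alpha>)"
      by (rule sum.cong[OF refl], rule partial_deriv_linear[OF bounded_linear_scaleR_left C1_monomial])
    finally show ?thesis by (simp add: partial_deriv_monomial)
  qed
  then have eq: "partial_deriv j f = (\<lambda>x. \<Sum>\<alpha>\<in>multi_indices k. real (\<alpha> j) *\<^sub>R (monomial (\<alpha>(j := \<alpha> j - 1)) x *\<^sub>R C \<alpha>))"
    by (rule ext)
  have "(\<lambda>x. real (\<alpha> j) *\<^sub>R (monomial (\<alpha>(j := \<alpha> j - 1)) x *\<^sub>R C \<alpha>)) \<in> polys (k - 1)"
    if \<alpha>: "\<alpha> \<in> multi_indices k" for \<alpha>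
  proof (cases "\<alpha> j = 0")
    case False
    have "(\<Sum>i\<in>UNIV. (\<alpha>(j := \<alpha> j - 1)) i) = (\<alpha> j - 1) + (\<Sum>i\<in>UNIV - {j}. (\<alpha>(j := \<alpha> j - 1)) i)"
      by (subst sum.remove[of UNIV j]) auto
    also have "(\<Sum>i\<in>UNIV - {j}. (\<alpha>(j := \<alpha> j - 1)) i) = (\<Sum>i\<in>UNIV - {j}. \<alpha> i)" by (rule sum.cong) auto
    finally have "(\<Sum>i\<in>UNIV. (\<alpha>(j := \<alpha> j - 1)) i) = (\<alpha> j - 1) + (\<Sum>i\<in>UNIV - {j}. \<alpha> i)" .
    moreover have "(\<Sum>i\<in>UNIV. \<alpha> i) = \<alpha> j + (\<Sum>i\<in>UNIV - {j}. \<alpha> i)" by (rule sum.remove) auto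
    ultimately have "\<alpha>(j := \<alpha> j - 1) \<in> multi_indices (k - 1)"
      using \<alpha> False by (simp add: multi_indices_def)
    then show ?thesis by (intro polys_scaleR polys_monomial)
  qed (simp add: polys_0)
  then show ?thesis unfolding eq by (intro polys_sum finite_multi_indices)
qed


section \<open>Riesz representation on polynomials\<close>

text \<open>Common abstraction of Lebesgue measure on a compact set and surface measure on a compact
  face, so that Riesz representation and projections are treated once.\<close>

definition integrates_continuous :: "('a::topological_space) measure \<Rightarrow> bool" where
  "integrates_continuous \<mu> \<longleftrightarrow> (\<forall>g::'a \<Rightarrow> real. continuous_on UNIV g \<longrightarrow> integrable \<mu> g)"

lemma integrates_continuousD:
  "integrates_continuous \<mu> \<Longrightarrow> continuous_on UNIV g \<Longrightarrow> integrable \<mu> (g :: _ \<Rightarrow> real)"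
  by (simp add: integrates_continuous_def)

lemma integrates_continuous_lebesgue_on:
  fixes K :: "'a::euclidean_space set"
  assumes "compact K" shows "integrates_continuous (lebesgue_on K)"
  unfolding integrates_continuous_def
proof (intro allI impI)
  fix g :: "'a \<Rightarrow> real" assume g: "continuous_on UNIV g"
  have "integrable lborel (\<lambda>x. indicator K x *\<^sub>R g x)"
    by (rule borel_integrable_compact[OF assms]) (use g continuous_on_subset in blast)
  then have "integrable lebesgue (\<lambda>x. indicator K x *\<^sub>R g x)"
    by (subst integrable_completion) auto
  then show "integrable (lebesgue_on K) g"
    using assms by (subst integrable_restrict_space) (auto simp: lmeasurable_compact fmeasurableD)
qed

lemma emeasure_surf:
  fixes \<nu> :: "real^'n"
  assumes "closed S" "S \<noteq> {}" "\<And>x. x \<in> S \<Longrightarrow> \<nu> \<bullet> x = c" "norm \<nu> = 1"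
  shows "emeasure (surf \<nu> S) S = emeasure lborel (oproj \<nu> c \<nu> -` S \<inter> slab \<nu> c)"
proof -
  have \<nu>: "\<nu> \<bullet> \<nu> = 1" using assms(4) by (simp add: dot_square_norm)
  have S[measurable]: "S \<in> sets borel" using assms(1) by simp
  have m: "oproj \<nu> c \<nu> \<in> measurable (restrict_space lborel (slab \<nu> c)) borel"
    by (intro measurable_restrict_space1) simp
  have "surf \<nu> S = restrict_space (distr (restrict_space lborel (slab \<nu> c)) borel (oproj \<nu> c \<nu>)) S"
    by (rule surf_eq[OF assms(2) assms(3) assms(4) \<nu>])
  then have "emeasure (surf \<nu> S) S = emeasure (distr (restrict_space lborel (slab \<nu> c)) borel (oproj \<nu> c \<nu>)) S"
    by (simp add: emeasure_restrict_space)
  also have "\<dots> = emeasure lborel (oproj \<nu> c \<nu> -` S \<inter> slab \<nu> c)"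
    using m by (subst emeasure_distr) (auto simp: space_restrict_space emeasure_restrict_space)
  finally show ?thesis .
qed

lemma finite_measure_surf:
  fixes \<nu> :: "real^'n"
  assumes "compact S" "S \<noteq> {}" "\<And>x. x \<in> S \<Longrightarrow> \<nu> \<bullet> x = c" "norm \<nu> = 1"
  shows "finite_measure (surf \<nu> S)"
proof
  have \<nu>: "\<nu> \<bullet> \<nu> = 1" using assms(4) by (simp add: dot_square_norm)
  have S[measurable]: "S \<in> sets borel" using assms(1) by (simp add: borel_compact)
  obtain B where B: "\<And>x. x \<in> S \<Longrightarrow> norm x \<le> B" using compact_imp_bounded[OF assms(1)] by (auto simp: bounded_iff)
  have "emeasure (surf \<nu> S) S = emeasure lborel (oproj \<nu> c \<nu> -` S \<inter> slab \<nu> c)"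
    by (rule emeasure_surf[OF compact_imp_closed[OF assms(1)] assms(2) assms(3) assms(4)])
  also have "\<dots> < \<infinity>"
  proof (rule emeasure_bounded_finite, rule boundedI)
    fix x assume x: "x \<in> oproj \<nu> c \<nu> -` S \<inter> slab \<nu> c"
    have "x = oproj \<nu> c \<nu> x + (\<nu> \<bullet> x - c) *\<^sub>R \<nu>" by (simp add: oproj_def)
    then have "norm x \<le> norm (oproj \<nu> c \<nu> x) + norm ((\<nu> \<bullet> x - c) *\<^sub>R \<nu>)" by (metis norm_triangle_ineq)
    also have "\<dots> \<le> B + 1" using x B[of "oproj \<nu> c \<nu> x"] assms(4) by (auto simp: slab_def)
    finally show "norm x \<le> B + 1" .
  qed
  finally show "emeasure (surf \<nu> S) (space (surf \<nu> S)) \<noteq> \<infinity>" by simp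
qed

lemma surf_integrable_bounded:
  fixes \<nu> :: "real^'n" and g :: "real^'n \<Rightarrow> real"
  assumes "compact S" "S \<noteq> {}" "\<And>x. x \<in> S \<Longrightarrow> \<nu> \<bullet> x = c" "norm \<nu> = 1"
    and "g \<in> borel_measurable borel" "\<And>x. x \<in> S \<Longrightarrow> \<bar>g x\<bar> \<le> B"
  shows "integrable (surf \<nu> S) g"
proof -
  interpret finite_measure "surf \<nu> S" using finite_measure_surf[OF assms(1,2) assms(3) assms(4)] by blast
  have "g \<in> borel_measurable (surf \<nu> S)"
    using measurable_restrict_space1[OF assms(5), of S] by (simp cong: measurable_cong_sets add: sets_surf)
  then show ?thesis by (rule integrable_const_bound[rotated, of _ B]) (use assms(6) in auto)
qed

lemma integrates_continuous_surf:
  fixes \<nu> :: "real^'n"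
  assumes "compact S" "S \<noteq> {}" "\<And>x. x \<in> S \<Longrightarrow> \<nu> \<bullet> x = c" "norm \<nu> = 1"
  shows "integrates_continuous (surf \<nu> S)"
  unfolding integrates_continuous_def
proof (intro allI impI)
  fix g :: "real^'n \<Rightarrow> real" assume g: "continuous_on UNIV g"
  obtain B where "\<And>x. x \<in> S \<Longrightarrow> \<bar>g x\<bar> \<le> B"
    using compact_continuous_bound[OF assms(1) g] by auto
  then show "integrable (surf \<nu> S) g"
    using g by (intro surf_integrable_bounded[OF assms(1,2) assms(3) assms(4)] borel_measurable_continuous_onI) auto
qed

lemma continuous_polys: "f \<in> polys k \<Longrightarrow> continuous_on UNIV f"
  by (intro C1_continuous C1_polys)

lemma integrable_inner_continuous:
  "integrates_continuous \<mu> \<Longrightarrow> continuous_on UNIV f \<Longrightarrow> continuous_on UNIV g \<Longrightarrow>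
    integrable \<mu> (\<lambda>x. f x \<bullet> (g x :: 'b::real_inner))"
  by (intro integrates_continuousD continuous_on_inner)

text \<open>On a face the form is degenerate, since polynomials vanishing on the hyperplane have
  norm zero. A coefficient vector in the kernel of the Gram matrix represents a polynomial that is
  zero almost everywhere, so \<open>null\<close> is exactly the solvability condition of the
  semidefinite system.\<close>

lemma riesz_polys:
  fixes \<mu> :: "(real^'n::finite) measure" and L :: "(real^'n \<Rightarrow> 'b::euclidean_space) \<Rightarrow> real"
  assumes \<mu>: "integrates_continuous \<mu>"
    and add: "\<And>f g. f \<in> polys k \<Longrightarrow> g \<in> polys k \<Longrightarrow> L (\<lambda>x. f x + g x) = L f + L g"
    and scale: "\<And>c f. f \<in> polys k \<Longrightarrow> L (\<lambda>x. c *\<^sub>R f x) = c * L f"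
    and null: "\<And>f. f \<in> polys k \<Longrightarrow> AE x in \<mu>. f x = 0 \<Longrightarrow> L f = 0"
  shows "\<exists>q\<in>polys k. \<forall>\<phi>\<in>polys k. (LINT x|\<mu>. q x \<bullet> \<phi> x) = L \<phi>"
proof -
  define I where "I = (multi_indices k :: ('n \<Rightarrow> nat) set) \<times> (Basis :: 'b set)"
  have I: "finite I" by (simp add: I_def finite_multi_indices)
  define b where "b i x = monomial (fst i) x *\<^sub>R (snd i :: 'b)" for i :: "('n \<Rightarrow> nat) \<times> 'b" and x
  have bc: "continuous_on UNIV (b i)" for i
    unfolding b_def[abs_def] by (intro continuous_on_scaleR continuous_on_const C1_continuous C1_monomial)
  have bp: "b i \<in> polys k" if "i \<in> I" for i
    unfolding b_def[abs_def] using that by (intro polys_monomial) (auto simp: I_def)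
  have span: "\<exists>c. f = (\<lambda>x. \<Sum>i\<in>I. c i *\<^sub>R b i x)" if f: "f \<in> polys k" for f
  proof -
    obtain C where C: "f = (\<lambda>x. \<Sum>\<alpha>\<in>multi_indices k. monomial \<alpha> x *\<^sub>R C \<alpha>)"
      using f polys_iff by blast
    have "f x = (\<Sum>i\<in>I. (C (fst i) \<bullet> snd i) *\<^sub>R b i x)" for x
    proof -
      have "f x = (\<Sum>\<alpha>\<in>multi_indices k. monomial \<alpha> x *\<^sub>R (\<Sum>v\<in>Basis. (C \<alpha> \<bullet> v) *\<^sub>R v))"
        by (simp add: C euclidean_representation)
      also have "\<dots> = (\<Sum>\<alpha>\<in>multi_indices k. \<Sum>v\<in>Basis. (C \<alpha> \<bullet> v) *\<^sub>R b (\<alpha>, v) x)"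
        by (simp add: scaleR_sum_right b_def mult.commute)
      finally show ?thesis by (simp add: I_def sum.cartesian_product case_prod_unfold)
    qed
    then have "f = (\<lambda>x. \<Sum>i\<in>I. (C (fst i) \<bullet> snd i) *\<^sub>R b i x)" by (rule ext)
    then show ?thesis by (rule exI[of _ "\<lambda>i. C (fst i) \<bullet> snd i"])
  qed
  have Lsum: "L (\<lambda>x. \<Sum>i\<in>J. c i *\<^sub>R b i x) = (\<Sum>i\<in>J. c i * L (b i))" if "J \<subseteq> I" for J c
  proof -
    have "finite J" using that I finite_subset by blast
    then show ?thesis using that
    proof (induction J rule: finite_induct)
      case empty
      show ?case using scale[OF polys_0, of 0] by simp
    next
      case (insert a J)
      then have "L (\<lambda>x. c a *\<^sub>R b a x + (\<Sum>i\<in>J. c i *\<^sub>R b i x)) = c a * L (b a) + (\<Sum>i\<in>J. c i * L (b i))"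
      proof -
        have "b a \<in> polys k" and J: "\<And>i. i \<in> J \<Longrightarrow> b i \<in> polys k" using bp insert by blast+
        moreover have "(\<lambda>x. \<Sum>i\<in>J. c i *\<^sub>R b i x) \<in> polys k"
          using insert J by (intro polys_sum polys_scaleR)
        ultimately show ?thesis using insert by (simp add: add scale polys_scaleR)
      qed
      then show ?case using insert by simp
    qed
  qed
  define G where "G i j = (LINT x|\<mu>. b i x \<bullet> b j x)" for i j
  have Gi: "integrable \<mu> (\<lambda>x. b i x \<bullet> b j x)" for i j
    by (intro integrable_inner_continuous \<mu> bc)
  have quad: "(\<Sum>i\<in>J. \<Sum>j\<in>J. c i * c j * G i j) = (LINT x|\<mu>. (\<Sum>i\<in>J. c i *\<^sub>R b i x) \<bullet> (\<Sum>i\<in>J. c i *\<^sub>R b i x))"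
    for J c
    using Gi by (simp add: G_def inner_sum_left inner_sum_right Bochner_Integration.integral_sum sum_distrib_left mult.assoc)
       (simp add: inner_commute)
  have "\<exists>c. \<forall>i\<in>I. (\<Sum>j\<in>I. c j * G i j) = L (b i)"
  proof (rule semidefinite_system_solvable[OF _ _ I])
    show "G i j = G j i" for i j by (simp add: G_def inner_commute)
    show "0 \<le> (\<Sum>i\<in>J. \<Sum>j\<in>J. c i * c j * G i j)" for J c
      unfolding quad by (rule Bochner_Integration.integral_nonneg) simp
    fix c assume c: "\<And>i. i \<in> I \<Longrightarrow> (\<Sum>j\<in>I. c j * G i j) = 0"
    let ?f = "\<lambda>x. \<Sum>i\<in>I. c i *\<^sub>R b i x"
    have fp: "?f \<in> polys k" by (intro polys_sum[OF I] polys_scaleR bp)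
    have "(\<Sum>i\<in>I. \<Sum>j\<in>I. c i * c j * G i j) = (\<Sum>i\<in>I. c i * (\<Sum>j\<in>I. c j * G i j))"
      by (simp add: sum_distrib_left mult.assoc)
    then have "(LINT x|\<mu>. ?f x \<bullet> ?f x) = 0" using quad[of c I] c by simp
    moreover have "integrable \<mu> (\<lambda>x. ?f x \<bullet> ?f x)"
      by (intro integrable_inner_continuous \<mu> continuous_polys[OF fp])
    ultimately have "AE x in \<mu>. ?f x \<bullet> ?f x = 0"
      by (subst (asm) integral_nonneg_eq_0_iff_AE) auto
    then have "AE x in \<mu>. ?f x = 0" by simp
    from null[OF fp this] show "(\<Sum>i\<in>I. c i * L (b i)) = 0" using Lsum[of I c] by simp
  qed
  then obtain c where c: "\<And>i. i \<in> I \<Longrightarrow> (\<Sum>j\<in>I. c j * G i j) = L (b i)" by blast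
  let ?q = "\<lambda>x. \<Sum>i\<in>I. c i *\<^sub>R b i x"
  have "?q \<in> polys k" by (intro polys_sum[OF I] polys_scaleR bp)
  moreover have "(LINT x|\<mu>. ?q x \<bullet> \<phi> x) = L \<phi>" if \<phi>: "\<phi> \<in> polys k" for \<phi>
  proof -
    obtain d where d: "\<phi> = (\<lambda>x. \<Sum>i\<in>I. d i *\<^sub>R b i x)" using span[OF \<phi>] by blast
    have "L \<phi> = (\<Sum>i\<in>I. d i * (\<Sum>j\<in>I. c j * G i j))" unfolding d using Lsum[of I d] c by simp
    also have "\<dots> = (\<Sum>i\<in>I. \<Sum>j\<in>I. c j * (d i * G j i))"
      by (simp add: sum_distrib_left G_def inner_commute mult.left_commute)
    also have "\<dots> = (\<Sum>j\<in>I. \<Sum>i\<in>I. c j * (d i * G j i))" by (rule sum.swap)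
    also have "\<dots> = (LINT x|\<mu>. ?q x \<bullet> \<phi> x)"
      unfolding d using Gi by (simp add: G_def inner_sum_left inner_sum_right Bochner_Integration.integral_sum sum_distrib_left)
         (subst sum.swap, simp add: mult.left_commute)
    finally show ?thesis by simp
  qed
  ultimately show ?thesis by (intro bexI[of _ ?q] ballI)
qed

lemma L2_proj_spec:
  fixes \<mu> :: "(real^'n::finite) measure" and f :: "real^'n \<Rightarrow> 'b::euclidean_space"
  assumes \<mu>: "integrates_continuous \<mu>" and f: "\<And>\<phi>. \<phi> \<in> polys k \<Longrightarrow> integrable \<mu> (\<lambda>x. f x \<bullet> \<phi> x)"
  shows "L2_proj \<mu> k f \<in> polys k"
    and "\<phi> \<in> polys k \<Longrightarrow> (LINT x|\<mu>. L2_proj \<mu> k f x \<bullet> \<phi> x) = (LINT x|\<mu>. f x \<bullet> \<phi> x)"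
proof -
  have "\<exists>q\<in>polys k. \<forall>\<phi>\<in>polys k. (LINT x|\<mu>. q x \<bullet> \<phi> x) = (LINT x|\<mu>. f x \<bullet> \<phi> x)"
  proof (rule riesz_polys[OF \<mu>])
    fix g :: "real^'n \<Rightarrow> 'b" assume g: "g \<in> polys k" "AE x in \<mu>. g x = 0"
    have "(LINT x|\<mu>. f x \<bullet> g x) = (LINT x|\<mu>. 0)"
      using f[OF g(1)] g(2) by (intro integral_cong_AE) auto
    then show "(LINT x|\<mu>. f x \<bullet> g x) = 0" by simp
  qed (use f in \<open>auto simp: inner_add_right\<close>)
  then have "\<exists>q. q \<in> polys k \<and> (\<forall>\<phi>\<in>polys k. (LINT x|\<mu>. q x \<bullet> \<phi> x) = (LINT x|\<mu>. f x \<bullet> \<phi> x))" by blast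
  from someI_ex[OF this] have *: "L2_proj \<mu> k f \<in> polys k \<and>
      (\<forall>\<phi>\<in>polys k. (LINT x|\<mu>. L2_proj \<mu> k f x \<bullet> \<phi> x) = (LINT x|\<mu>. f x \<bullet> \<phi> x))"
    unfolding L2_proj_def .
  show "L2_proj \<mu> k f \<in> polys k" using * by blast
  show "\<phi> \<in> polys k \<Longrightarrow> (LINT x|\<mu>. L2_proj \<mu> k f x \<bullet> \<phi> x) = (LINT x|\<mu>. f x \<bullet> \<phi> x)" using * by blast
qed

text \<open>Hypotheses of \<open>gauss_green\<close> on one set \<open>A\<close>. The weights
  \<open>\<epsilon>\<close> are prescribed jumps and may be 0, so the list of all mesh faces serves
  every cell, whether or not a face touches it; for a simplex the facets are listed.\<close>

definition face_system :: "(real^'n::finite) set \<Rightarrow> 's set \<Rightarrow> ('s \<Rightarrow> real^'n) \<Rightarrow> ('s \<Rightarrow> real) \<Rightarrow> ('s \<Rightarrow> real)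
    \<Rightarrow> ('s \<Rightarrow> (real^'n) set) \<Rightarrow> bool" where
  "face_system A I \<nu> c \<epsilon> S \<longleftrightarrow> finite I \<and> compact A \<and> frontier A \<subseteq> (\<Union>i\<in>I. S i) \<and>
    (\<forall>i\<in>I. compact (S i) \<and> S i \<noteq> {} \<and> norm (\<nu> i) = 1 \<and> (\<forall>x\<in>S i. \<nu> i \<bullet> x = c i) \<and>
      face_AE (\<nu> i) (c i) (S i) (\<lambda>y. (\<forall>j\<in>I. y \<in> S j \<longrightarrow> j = i) \<and> has_jump (indicat_real A) (\<nu> i) (\<epsilon> i) y))"

lemma gauss_green_partial_deriv:
  fixes h :: "real^'n::finite \<Rightarrow> real"
  assumes fs: "face_system A I \<nu> c \<epsilon> S" and h: "C1 h"
  shows "(LINT x|lebesgue_on A. partial_deriv j h x) = (\<Sum>i\<in>I. \<epsilon> i * (\<nu> i $ j) * integral\<^sup>L (surf (\<nu> i) (S i)) h)"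
proof -
  have "(LINT x|lebesgue_on A. frechet_derivative h (at x) (axis j 1))
      = (\<Sum>i\<in>I. \<epsilon> i * (axis j 1 \<bullet> \<nu> i) * integral\<^sup>L (surf (\<nu> i) (S i)) h)"
    by (rule gauss_green[where c = c and \<epsilon> = \<epsilon>])
       (use fs C1_has_derivative[OF h] C1_continuous_deriv[OF h] in
         \<open>auto simp: face_system_def compact_imp_bounded compact_imp_closed inner_axis_axis\<close>)
  then show ?thesis by (simp add: partial_deriv_def inner_axis inner_commute[of "axis j 1"])
qed

lemma continuous_Jac: "C1 \<phi> \<Longrightarrow> continuous_on UNIV (Jac \<phi>)"
  unfolding Jac_def[abs_def]
  by (intro continuous_on_vec_lambda continuous_on_component C1_partial_deriv)

lemma continuous_row_div: "C1 \<tau> \<Longrightarrow> continuous_on UNIV (row_div \<tau>)"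
  unfolding row_div_def[abs_def]
  by (intro continuous_on_vec_lambda continuous_on_sum continuous_on_component C1_partial_deriv)

text \<open>The scalar formula is applied to each product of \<open>\<phi> x $ i\<close> and
  \<open>\<tau> x $ i $ j\<close> in the coordinate direction \<open>j\<close>, and the product rule
  splits the integrand.\<close>

lemma gauss_green_matrix:
  fixes \<phi> :: "real^'n::finite \<Rightarrow> real^'m::finite" and \<tau> :: "real^'n \<Rightarrow> real^'n^'m"
  assumes fs: "face_system A I \<nu> c \<epsilon> S" and \<phi>: "C1 \<phi>" and \<tau>: "C1 \<tau>"
  shows "(LINT x|lebesgue_on A. \<phi> x \<bullet> row_div \<tau> x) = - (LINT x|lebesgue_on A. Jac \<phi> x \<bullet> \<tau> x)
     + (\<Sum>s\<in>I. \<epsilon> s * (LINT x|surf (\<nu> s) (S s). \<phi> x \<bullet> (\<tau> x *v \<nu> s)))"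
proof -
  have cA: "compact A" using fs by (simp add: face_system_def)
  note ic = integrates_continuous_lebesgue_on[OF cA]
  have C1p: "C1 (\<lambda>x. \<phi> x $ i * \<tau> x $ i $ j)" for i j
    by (intro C1_mult C1_vec_nth \<phi> \<tau>)
  have 1: "\<phi> x \<bullet> row_div \<tau> x + Jac \<phi> x \<bullet> \<tau> x = (\<Sum>i\<in>UNIV. \<Sum>j\<in>UNIV. partial_deriv j (\<lambda>x. \<phi> x $ i * \<tau> x $ i $ j) x)" for x
  proof -
    have "partial_deriv j (\<lambda>x. \<phi> x $ i * \<tau> x $ i $ j) x =
        \<phi> x $ i * partial_deriv j \<tau> x $ i $ j + partial_deriv j \<phi> x $ i * \<tau> x $ i $ j" for i j
      by (simp add: partial_deriv_mult C1_vec_nth \<phi> \<tau> partial_deriv_vec_nth)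
    then show ?thesis
      by (simp add: inner_vec_def row_div_def Jac_def sum.distrib sum_distrib_left)
  qed
  have int: "integrable (lebesgue_on A) (\<lambda>x. \<phi> x \<bullet> row_div \<tau> x)" "integrable (lebesgue_on A) (\<lambda>x. Jac \<phi> x \<bullet> \<tau> x)"
    by (intro integrable_inner_continuous ic C1_continuous \<phi> \<tau> continuous_row_div continuous_Jac)+
  have "(LINT x|lebesgue_on A. \<phi> x \<bullet> row_div \<tau> x) + (LINT x|lebesgue_on A. Jac \<phi> x \<bullet> \<tau> x)
    = (LINT x|lebesgue_on A. (\<Sum>i\<in>UNIV. \<Sum>j\<in>UNIV. partial_deriv j (\<lambda>x. \<phi> x $ i * \<tau> x $ i $ j) x))"
    using int by (simp add: 1[symmetric])
  also have "\<dots> = (\<Sum>i\<in>UNIV. \<Sum>j\<in>UNIV. (LINT x|lebesgue_on A. partial_deriv j (\<lambda>x. \<phi> x $ i * \<tau> x $ i $ j) x))"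
    using integrates_continuousD[OF ic C1_partial_deriv[OF C1p]]
    by (subst Bochner_Integration.integral_sum) (auto intro!: sum.cong Bochner_Integration.integral_sum Bochner_Integration.integrable_sum)
  also have "\<dots> = (\<Sum>i\<in>UNIV. \<Sum>j\<in>UNIV. \<Sum>s\<in>I. \<epsilon> s * (\<nu> s $ j) * (LINT x|surf (\<nu> s) (S s). \<phi> x $ i * \<tau> x $ i $ j))"
    by (simp add: gauss_green_partial_deriv[OF fs C1p])
  also have "\<dots> = (\<Sum>i\<in>UNIV. \<Sum>s\<in>I. \<Sum>j\<in>UNIV. \<epsilon> s * (\<nu> s $ j) * (LINT x|surf (\<nu> s) (S s). \<phi> x $ i * \<tau> x $ i $ j))"
    by (intro sum.cong refl sum.swap)
  also have "\<dots> = (\<Sum>s\<in>I. \<Sum>i\<in>UNIV. \<Sum>j\<in>UNIV. \<epsilon> s * (\<nu> s $ j) * (LINT x|surf (\<nu> s) (S s). \<phi> x $ i * \<tau> x $ i $ j))"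
    by (rule sum.swap)
  also have "\<dots> = (\<Sum>s\<in>I. \<epsilon> s * (LINT x|surf (\<nu> s) (S s). \<phi> x \<bullet> (\<tau> x *v \<nu> s)))"
  proof (rule sum.cong[OF refl])
    fix s assume s: "s \<in> I"
    have ics: "integrates_continuous (surf (\<nu> s) (S s))"
      by (rule integrates_continuous_surf[of _ _ "c s"]) (use fs s in \<open>auto simp: face_system_def\<close>)
    have i: "integrable (surf (\<nu> s) (S s)) (\<lambda>x. \<phi> x $ i * \<tau> x $ i $ j)" for i j
      by (rule integrates_continuousD[OF ics C1_continuous[OF C1p]])
    have "(LINT x|surf (\<nu> s) (S s). \<phi> x \<bullet> (\<tau> x *v \<nu> s)) =
       (LINT x|surf (\<nu> s) (S s). (\<Sum>i\<in>UNIV. \<Sum>j\<in>UNIV. (\<phi> x $ i * \<tau> x $ i $ j) * \<nu> s $ j))"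
      by (simp add: inner_vec_def matrix_vector_mult_def sum_distrib_left mult.assoc)
    also have "\<dots> = (\<Sum>i\<in>UNIV. \<Sum>j\<in>UNIV. (LINT x|surf (\<nu> s) (S s). (\<phi> x $ i * \<tau> x $ i $ j)) * \<nu> s $ j)"
      using i by (subst Bochner_Integration.integral_sum) (auto intro!: sum.cong simp: Bochner_Integration.integral_sum)
    finally show "(\<Sum>i\<in>UNIV. \<Sum>j\<in>UNIV. \<epsilon> s * (\<nu> s $ j) * (LINT x|surf (\<nu> s) (S s). \<phi> x $ i * \<tau> x $ i $ j))
        = \<epsilon> s * (LINT x|surf (\<nu> s) (S s). \<phi> x \<bullet> (\<tau> x *v \<nu> s))"
      by (simp add: sum_distrib_left mult_ac)
  qed
  finally show ?thesis by simp
qed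


section \<open>Smooth cutoffs and the weak divergence\<close>

text \<open>Dividing by powers of \<open>t\<close> closes the family under differentiation: the
  derivative of member \<open>m\<close> combines members \<open>m + 1\<close> and
  \<open>m + 2\<close>.\<close>

definition flat_exp :: "nat \<Rightarrow> real \<Rightarrow> real" where
  "flat_exp m t = (if t > 0 then exp (- 1 / t) / t ^ m else 0)"

lemma power_div_fact_le_exp:
  fixes x :: real
  assumes "0 \<le> x" shows "x ^ k / fact k \<le> exp x"
proof -
  have s: "(\<lambda>n. x ^ n / fact n) sums exp x"
    using exp_converges[of x] by (simp add: divide_inverse mult.commute)
  have "sum (\<lambda>n. x ^ n / fact n) {k} \<le> suminf (\<lambda>n. x ^ n / fact n)"
    by (rule sum_le_suminf) (use s assms in \<open>auto simp: sums_iff\<close>)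
  then show ?thesis using s by (simp add: sums_iff)
qed

text \<open>One term of the exponential series at \<open>1 / t\<close> suffices, taken at index
  \<open>m + 2\<close>: \<open>m\<close> powers absorb the denominator and two remain, so difference
  quotients at 0 tend to 0.\<close>

lemma flat_exp_le:
  assumes "t > 0" shows "flat_exp m t \<le> fact (m + 2) * t\<^sup>2"
proof -
  define N where "N = m + 2"
  have "(1 / t) ^ N / fact N \<le> exp (1 / t)"
    by (rule power_div_fact_le_exp) (use assms in simp)
  then have "1 \<le> fact N * t ^ N * exp (1 / t)"
    using assms by (simp add: power_one_over field_simps)
  then have "exp (- 1 / t) \<le> fact N * t ^ N"
    by (simp add: exp_minus field_simps)
  then have "exp (- 1 / t) \<le> fact (m + 2) * t ^ (m + 2)" unfolding N_def .
  then have "exp (- 1 / t) / t ^ m \<le> fact (m + 2) * t ^ (m + 2) / t ^ m"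
    using assms by (intro divide_right_mono) auto
  then show ?thesis using assms by (simp add: flat_exp_def power_add power2_eq_square)
qed

lemma DERIV_flat_exp:
  "(flat_exp m has_real_derivative - real m * flat_exp (m + 1) t + flat_exp (m + 2) t) (at t)"
proof -
  consider "t > 0" | "t < 0" | "t = 0" by linarith
  then show ?thesis
  proof cases
    case 1
    have "((\<lambda>t. exp (- 1 / t) / t ^ m) has_real_derivative
       (exp (- 1 / t) * (1 / t\<^sup>2) * t ^ m - exp (- 1 / t) * (real m * t ^ (m - 1))) / (t ^ m * t ^ m)) (at t)"
      by (rule derivative_eq_intros refl | use 1 in \<open>simp add: power2_eq_square\<close>)+
    also have "(exp (- 1 / t) * (1 / t\<^sup>2) * t ^ m - exp (- 1 / t) * (real m * t ^ (m - 1))) / (t ^ m * t ^ m)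
        = - real m * flat_exp (m + 1) t + flat_exp (m + 2) t"
      using 1 by (cases m) (simp_all add: flat_exp_def power2_eq_square field_simps)
    finally show ?thesis
      by (rule has_field_derivative_transform_within_open[where S = "{0<..}"]) (use 1 in \<open>auto simp: flat_exp_def\<close>)
  next
    case 2
    have "((\<lambda>t. 0) has_real_derivative 0) (at t)" by simp
    then have "(flat_exp m has_real_derivative 0) (at t)"
      by (rule has_field_derivative_transform_within_open[where S = "{..<0}"]) (use 2 in \<open>auto simp: flat_exp_def\<close>)
    then show ?thesis using 2 by (simp add: flat_exp_def)
  next
    case 3
    have "((\<lambda>h. flat_exp m h / h) \<longlongrightarrow> 0) (at 0)"
    proof (rule Lim_null_comparison)
      have "norm (flat_exp m h / h) \<le> fact (m + 2) * \<bar>h\<bar>" for h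
      proof (cases "h > 0")
        case True
        then have "flat_exp m h / h \<le> fact (m + 2) * h\<^sup>2 / h"
          by (intro divide_right_mono flat_exp_le) auto
        moreover have "0 \<le> flat_exp m h" using True by (simp add: flat_exp_def)
        ultimately show ?thesis using True by (simp add: power2_eq_square)
      next
        case False
        then have "flat_exp m h / h = 0" by (simp add: flat_exp_def)
        then show ?thesis using mult_nonneg_nonneg[OF fact_ge_zero[of "m + 2"] abs_ge_zero[of h]] by (simp only: norm_zero)
      qed
      then show "\<forall>\<^sub>F h in at 0. norm (flat_exp m h / h) \<le> fact (m + 2) * \<bar>h\<bar>" by simp
      show "((\<lambda>h::real. fact (m + 2) * \<bar>h\<bar>) \<longlongrightarrow> 0) (at 0)" by (rule tendsto_eq_intros refl | simp)+
    qed
    then show ?thesis using 3 by (simp add: has_field_derivative_iff flat_exp_def)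
  qed
qed

lemma continuous_flat_exp: "continuous_on A (flat_exp m)"
  by (meson DERIV_flat_exp DERIV_isCont continuous_at_imp_continuous_on)

text \<open>A witness for \<open>smooth_fun\<close>: closed under partial derivatives, made of C1
  functions, and large enough for polynomials and for cutoffs adapted to half-spaces.\<close>

inductive_set smooth_algebra :: "(real^'n::finite \<Rightarrow> real) set" where
  const: "(\<lambda>x. c) \<in> smooth_algebra"
| coord: "(\<lambda>x. x $ i) \<in> smooth_algebra"
| flat: "(\<lambda>x. flat_exp m (a \<bullet> x + b)) \<in> smooth_algebra"
| add: "f \<in> smooth_algebra \<Longrightarrow> g \<in> smooth_algebra \<Longrightarrow> (\<lambda>x. f x + g x) \<in> smooth_algebra"
| mult: "f \<in> smooth_algebra \<Longrightarrow> g \<in> smooth_algebra \<Longrightarrow> (\<lambda>x. f x * g x) \<in> smooth_algebra"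

lemma has_derivative_flat_exp_affine:
  "((\<lambda>x. flat_exp m (a \<bullet> x + b)) has_derivative
     (\<lambda>v. (- real m * flat_exp (m + 1) (a \<bullet> x + b) + flat_exp (m + 2) (a \<bullet> x + b)) * (a \<bullet> v))) (at x)"
proof -
  have "((\<lambda>x. a \<bullet> x + b) has_derivative (\<lambda>v. a \<bullet> v)) (at x)"
    by (rule derivative_eq_intros refl | simp)+
  from has_derivative_compose[OF this DERIV_flat_exp[of m "a \<bullet> x + b", unfolded has_field_derivative_def]]
  show ?thesis .
qed

lemma smooth_algebra_C1: "f \<in> smooth_algebra \<Longrightarrow> C1 f"
proof (induction rule: smooth_algebra.induct)
  case (coord i)
  show ?case by (rule C1_linear[OF bounded_linear_vec_nth])
next
  case (flat m a b)
  show ?case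
    by (rule C1I[OF has_derivative_flat_exp_affine])
       (intro continuous_intros continuous_on_compose2[OF continuous_flat_exp[of UNIV]] | simp)+
qed (auto intro: C1_const C1_add C1_mult)

lemma smooth_algebra_partial_deriv:
  fixes f :: "real^'n::finite \<Rightarrow> real"
  shows "f \<in> smooth_algebra \<Longrightarrow> partial_deriv j f \<in> smooth_algebra"
proof (induction rule: smooth_algebra.induct)
  case (const c)
  then show ?case unfolding partial_deriv_const[abs_def] by (rule smooth_algebra.const)
next
  case (coord i)
  have "partial_deriv j (\<lambda>x. x $ i) x = axis j 1 $ i" for x :: "real^'n"
    unfolding partial_deriv_def
    by (rule fun_cong[OF sym]) (rule frechet_derivative_at[OF bounded_linear_imp_has_derivative[OF bounded_linear_vec_nth]])
  then have "partial_deriv j (\<lambda>x::real^'n. x $ i) = (\<lambda>x. axis j 1 $ i)" by (rule ext)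
  then show ?case by (simp only: smooth_algebra.const)
next
  case (flat m a b)
  have "partial_deriv j (\<lambda>x. flat_exp m (a \<bullet> x + b)) x
     = (- real m * flat_exp (m + 1) (a \<bullet> x + b) + flat_exp (m + 2) (a \<bullet> x + b)) * (a \<bullet> axis j 1)" for x
    unfolding partial_deriv_def
    by (rule fun_cong[OF sym]) (rule frechet_derivative_at[OF has_derivative_flat_exp_affine])
  then have "partial_deriv j (\<lambda>x. flat_exp m (a \<bullet> x + b))
     = (\<lambda>x. (- real m * flat_exp (m + 1) (a \<bullet> x + b) + flat_exp (m + 2) (a \<bullet> x + b)) * (a \<bullet> axis j 1))" by (rule ext)
  then show ?case by (simp only:) (intro smooth_algebra.intros)
next
  case (add f g)
  have "partial_deriv j (\<lambda>x. f x + g x) = (\<lambda>x. partial_deriv j f x + partial_deriv j g x)"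
    using add by (intro ext partial_deriv_add smooth_algebra_C1)
  then show ?case using add by (simp only: smooth_algebra.add)
next
  case (mult f g)
  have "partial_deriv j (\<lambda>x. f x * g x) = (\<lambda>x. f x * partial_deriv j g x + partial_deriv j f x * g x)"
    using mult by (intro ext partial_deriv_mult smooth_algebra_C1)
  then show ?case using mult by (simp only:) (intro smooth_algebra.intros)
qed

lemma smooth_algebra_smooth: "f \<in> smooth_algebra \<Longrightarrow> smooth_fun f"
  unfolding smooth_fun_def
  by (intro exI[of _ smooth_algebra] conjI ballI allI C1_differentiable smooth_algebra_C1 smooth_algebra_partial_deriv)

lemma smooth_algebra_sum: "finite A \<Longrightarrow> (\<And>i. i \<in> A \<Longrightarrow> f i \<in> smooth_algebra) \<Longrightarrow> (\<lambda>x. \<Sum>i\<in>A. f i x) \<in> smooth_algebra"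
  by (induction A rule: finite_induct) (auto intro: smooth_algebra.intros)

lemma smooth_algebra_prod: "finite A \<Longrightarrow> (\<And>i. i \<in> A \<Longrightarrow> f i \<in> smooth_algebra) \<Longrightarrow> (\<lambda>x. \<Prod>i\<in>A. f i x) \<in> smooth_algebra"
  by (induction A rule: finite_induct) (auto intro: smooth_algebra.intros)

lemma smooth_algebra_power: "f \<in> smooth_algebra \<Longrightarrow> (\<lambda>x. f x ^ k) \<in> smooth_algebra"
  by (induction k) (auto intro: smooth_algebra.intros)

lemma smooth_algebra_polys:
  fixes f :: "real^'n::finite \<Rightarrow> real"
  assumes "f \<in> polys k" shows "f \<in> smooth_algebra"
proof -
  obtain C where C: "f = (\<lambda>x. \<Sum>\<alpha>\<in>multi_indices k. monomial \<alpha> x *\<^sub>R C \<alpha>)"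
    using assms polys_iff by blast
  have "(\<lambda>x::real^'n. monomial \<alpha> x * C \<alpha>) \<in> smooth_algebra" for \<alpha>
    unfolding monomial_def
    by (intro smooth_algebra.mult smooth_algebra.const smooth_algebra_prod smooth_algebra_power smooth_algebra.coord) auto
  then show ?thesis unfolding C real_scaleR_def by (intro smooth_algebra_sum finite_multi_indices)
qed

section \<open>Integrability on subsets of the domain\<close>

lemma integrable_lebesgue_on_iff:
  fixes f :: "'a::euclidean_space \<Rightarrow> 'b::{banach, second_countable_topology}"
  shows "S \<in> sets lebesgue \<Longrightarrow> integrable (lebesgue_on S) f \<longleftrightarrow> set_integrable lebesgue S f"
  by (simp add: integrable_restrict_space set_integrable_def)

lemma integral_lebesgue_on:
  fixes f :: "'a::euclidean_space \<Rightarrow> 'b::{banach, second_countable_topology}"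
  shows "S \<in> sets lebesgue \<Longrightarrow> integral\<^sup>L (lebesgue_on S) f = (LINT x|lebesgue. indicator S x *\<^sub>R f x)"
  by (simp add: integral_restrict_space)

text \<open>Moves integrability from the open domain to closed cells and simplices, which exceed it
  only by a null set.\<close>

lemma integrable_lebesgue_on_subset:
  fixes f :: "'a::euclidean_space \<Rightarrow> 'b::euclidean_space"
  assumes f: "integrable (lebesgue_on S) f" and S: "S \<in> sets lebesgue" "T \<in> sets lebesgue"
    and neg: "negligible (T - S)"
  shows "integrable (lebesgue_on T) f"
proof -
  have "set_integrable lebesgue (S \<inter> T) f"
    by (rule set_integrable_subset[of _ S]) (use f S in \<open>auto simp: integrable_lebesgue_on_iff\<close>)
  then have "f absolutely_integrable_on T"
    by (rule absolutely_integrable_spike_set) (use neg in \<open>auto intro: negligible_subset\<close>)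
  then show ?thesis using S by (simp add: integrable_lebesgue_on_iff)
qed

text \<open>\<open>norm (f x)\<close> is at most \<open>1 + norm (f x) powr q\<close>, and 1 is
  integrable on a bounded set.\<close>

lemma integrable_Lp_fun:
  fixes f :: "real^'n::finite \<Rightarrow> 'b::euclidean_space"
  assumes "Lp_fun q \<Omega> f" "1 \<le> q" "open \<Omega>" "bounded \<Omega>"
  shows "integrable (lebesgue_on \<Omega>) f"
proof (rule Bochner_Integration.integrable_bound)
  have "emeasure lebesgue \<Omega> < \<infinity>" using assms(3) emeasure_bounded_finite[OF assms(4)] by simp
  then have "integrable (lebesgue_on \<Omega>) (\<lambda>x. 1::real)"
    using assms(3) by (intro finite_measure.integrable_const finite_measureI) (auto simp: emeasure_restrict_space space_restrict_space)
  then show "integrable (lebesgue_on \<Omega>) (\<lambda>x. 1 + norm (f x) powr q)"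
    using assms(1) by (simp add: Lp_fun_def)
  show "f \<in> borel_measurable (lebesgue_on \<Omega>)" using assms(1) by (simp add: Lp_fun_def)
  have "norm (f x) \<le> norm (1 + norm (f x) powr q)" for x
  proof (cases "norm (f x) \<le> 1")
    case True
    have "0 \<le> norm (f x) powr q" by simp
    then show ?thesis using True unfolding real_norm_def by linarith
  next
    case False
    then have "norm (f x) powr 1 \<le> norm (f x) powr q" using assms(2) by (intro powr_mono) auto
    then show ?thesis using False by simp
  qed
  then show "AE x in lebesgue_on \<Omega>. norm (f x) \<le> norm (1 + norm (f x) powr q)" by simp
qed

section \<open>Pairing the weak divergence with polynomials on a polytope\<close>

lemma partial_deriv_zero_outside:
  fixes \<phi> :: "real^'n::finite \<Rightarrow> real"
  assumes "closed C" "\<And>x. x \<notin> C \<Longrightarrow> \<phi> x = 0" "x \<notin> C"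
  shows "partial_deriv j \<phi> x = 0"
proof -
  have "((\<lambda>x. 0) has_derivative (\<lambda>v. 0)) (at x)" by simp
  then have "(\<phi> has_derivative (\<lambda>v. 0)) (at x)"
    by (rule has_derivative_transform_within_open[of _ _ _ _ "- C"]) (use assms in auto)
  from frechet_derivative_at[OF this, symmetric] show ?thesis by (simp add: partial_deriv_def)
qed

text \<open>There is one factor per bounding half-space. For fixed \<open>x\<close> in the interior
  all slacks \<open>b h - a h \<bullet> x\<close> are positive, so the arguments tend to infinity
  with \<open>l\<close> and each factor tends to 1.\<close>

lemma polytope_cutoff:
  fixes T :: "(real^'n::finite) set"
  assumes "polytope T"
  obtains \<theta> C where "\<And>l::nat. \<theta> l \<in> smooth_algebra" "\<And>l. compact (C l)" "\<And>l. C l \<subseteq> interior T"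
    "\<And>l x. x \<notin> C l \<Longrightarrow> \<theta> l x = 0" "\<And>l x. \<bar>\<theta> l x\<bar> \<le> 1"
    "\<And>x. x \<in> interior T \<Longrightarrow> (\<lambda>l. \<theta> l x) \<longlonglongrightarrow> 1"
proof -
  obtain H where H: "finite H" "T = \<Inter>H" "\<And>h. h \<in> H \<Longrightarrow> \<exists>a b. a \<noteq> 0 \<and> h = {x. a \<bullet> x \<le> b}"
    using polytope_imp_polyhedron[OF assms] unfolding polyhedron_def by blast
  have "\<forall>h\<in>H. \<exists>p. fst p \<noteq> 0 \<and> h = {x. fst p \<bullet> x \<le> snd p}"
  proof
    fix h assume "h \<in> H"
    then obtain a b where "a \<noteq> 0 \<and> h = {x. a \<bullet> x \<le> b}" using H(3) by blast
    then show "\<exists>p. fst p \<noteq> 0 \<and> h = {x. fst p \<bullet> x \<le> snd p}" by (intro exI[of _ "(a, b)"]) simp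
  qed
  from bchoice[OF this] obtain p where
    p: "\<And>h. h \<in> H \<Longrightarrow> fst (p h) \<noteq> 0 \<and> h = {x. fst (p h) \<bullet> x \<le> snd (p h)}" by blast
  define a b where "a h = fst (p h)" and "b h = snd (p h)" for h
  have h: "a h \<noteq> 0" "h = {x. a h \<bullet> x \<le> b h}" if "h \<in> H" for h using p[OF that] by (auto simp: a_def b_def)
  \<comment> \<open>The offset \<open>- 1\<close> makes a factor vanish until \<open>l\<close> times
    the slack exceeds 1, which keeps the support in a compact part of the interior.\<close>
  define \<theta> where "\<theta> l x = (\<Prod>h\<in>H. flat_exp 0 (real l * (b h - a h \<bullet> x) - 1))" for l x
  define C where "C l = T \<inter> (\<Inter>h\<in>H. {x. 1 \<le> real l * (b h - a h \<bullet> x)})" for l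
  have 1: "\<theta> l \<in> smooth_algebra" for l
  proof -
    have "\<theta> l = (\<lambda>x. \<Prod>h\<in>H. flat_exp 0 ((- real l *\<^sub>R a h) \<bullet> x + (real l * b h - 1)))"
      by (simp add: \<theta>_def[abs_def] algebra_simps)
    then show ?thesis by (simp only:) (intro smooth_algebra_prod H smooth_algebra.flat)
  qed
  have 2: "compact (C l)" for l
    unfolding C_def by (intro compact_Int_closed polytope_imp_compact assms closed_INT ballI closed_Collect_le continuous_intros)
  have 3: "C l \<subseteq> interior T" for l
  proof (rule order_trans)
    let ?U = "\<Inter>h\<in>H. {x. a h \<bullet> x < b h}"
    show "C l \<subseteq> ?U"
    proof (intro subsetI INT_I CollectI)
      fix x h assume x: "x \<in> C l" and "h \<in> H"
      then have "1 \<le> real l * (b h - a h \<bullet> x)" by (auto simp: C_def)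
      then have "0 < real l * (b h - a h \<bullet> x)" by linarith
      then show "a h \<bullet> x < b h" by (simp add: zero_less_mult_iff)
    qed
    have "open ?U" using H(1) by (intro open_INT ballI open_Collect_less continuous_intros)
    moreover have "?U \<subseteq> T" unfolding H(2) using h(2) by (auto intro: less_imp_le)
    ultimately show "?U \<subseteq> interior T" by (rule interior_maximal[rotated])
  qed
  have 4: "\<theta> l x = 0" if "x \<notin> C l" for l x
  proof -
    obtain h' where h': "h' \<in> H" "\<not> (0 < real l * (b h' - a h' \<bullet> x) - 1)"
    proof (cases "x \<in> T")
      case True
      then show ?thesis using that \<open>x \<notin> C l\<close> by (force simp: C_def)
    next
      case False
      then obtain h' where h': "h' \<in> H" "x \<notin> h'" using H(2) by auto
      then have "b h' - a h' \<bullet> x < 0" using h(2)[of h'] by auto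
      then have "real l * (b h' - a h' \<bullet> x) \<le> 0" by (simp add: mult_nonneg_nonpos)
      then show ?thesis using that[of h'] h' by simp
    qed
    then show ?thesis using H(1) by (auto simp: \<theta>_def flat_exp_def prod_zero_iff)
  qed
  have 5: "\<bar>\<theta> l x\<bar> \<le> 1" for l x
    unfolding \<theta>_def abs_prod by (rule prod_le_1) (auto simp: flat_exp_def)
  have 6: "(\<lambda>l. \<theta> l x) \<longlonglongrightarrow> 1" if x: "x \<in> interior T" for x
  proof -
    have "(\<lambda>l. flat_exp 0 (real l * (b h - a h \<bullet> x) - 1)) \<longlonglongrightarrow> 1" if hH: "h \<in> H" for h
    proof -
      have "T \<subseteq> h" using H(2) hH by auto
      then have "x \<in> interior {x. a h \<bullet> x \<le> b h}" using x interior_mono h(2)[OF hH] by blast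
      then have pos: "0 < b h - a h \<bullet> x" using h(1)[OF hH] by (simp add: interior_halfspace_le)
      have "filterlim (\<lambda>l. - 1 + real l * (b h - a h \<bullet> x)) at_top sequentially"
        by (intro filterlim_tendsto_add_at_top[OF tendsto_const]
            filterlim_at_top_mult_tendsto_pos[OF tendsto_const pos] filterlim_real_sequentially)
      then have lim: "filterlim (\<lambda>l. real l * (b h - a h \<bullet> x) - 1) at_top sequentially"
        by (simp add: add.commute)
      then have "(\<lambda>l. exp (- 1 / (real l * (b h - a h \<bullet> x) - 1))) \<longlonglongrightarrow> exp 0"
        by (intro tendsto_exp tendsto_divide_0[OF tendsto_const] filterlim_at_top_imp_at_infinity)
      moreover have "\<forall>\<^sub>F l in sequentially. exp (- 1 / (real l * (b h - a h \<bullet> x) - 1)) = flat_exp 0 (real l * (b h - a h \<bullet> x) - 1)"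
        using filterlim_at_top_dense[THEN iffD1, OF lim, rule_format, of 0] by eventually_elim (simp add: flat_exp_def)
      ultimately show ?thesis by (simp add: tendsto_cong)
    qed
    then have "(\<lambda>l. \<theta> l x) \<longlonglongrightarrow> (\<Prod>h\<in>H. 1)" unfolding \<theta>_def by (intro tendsto_prod)
    then show ?thesis by simp
  qed
  show thesis using that[of \<theta> C] 1 2 3 4 5 6 by blast
qed

text \<open>Test with \<open>\<xi>\<close> times a smooth cutoff supported in the interior of \<open>T\<close> that tends to 1 there.\<close>

lemma weak_div_moments_component:
  fixes \<tau> :: "real^'n::finite \<Rightarrow> real^'n^'m::finite" and \<xi> :: "real^'n \<Rightarrow> real"
  assumes T: "polytope T" and \<Omega>: "open \<Omega>" and sub: "interior T \<subseteq> \<Omega>"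
    and g: "has_weak_div q \<Omega> \<tau> g" and gi: "integrable (lebesgue_on T) g"
    and eq: "\<And>x. x \<in> interior T \<Longrightarrow> \<tau> x = \<tau>' x" and \<tau>': "C1 \<tau>'"
    and fs: "face_system T I \<nu> c \<epsilon> S" and S: "\<And>s. s \<in> I \<Longrightarrow> S s \<inter> interior T = {}"
    and \<xi>: "\<xi> \<in> polys k"
  shows "(LINT x|lebesgue_on T. g x $ i * \<xi> x) = (LINT x|lebesgue_on T. row_div \<tau>' x $ i * \<xi> x)"
proof -
  have cT: "compact T" using T by (rule polytope_imp_compact)
  have Tl: "T \<in> sets lebesgue" using cT by (simp add: lmeasurable_compact fmeasurableD)
  note ic = integrates_continuous_lebesgue_on[OF cT]
  obtain \<theta> C where \<theta>: "\<And>l::nat. \<theta> l \<in> smooth_algebra" and C: "\<And>l. compact (C l)" "\<And>l. C l \<subseteq> interior T"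
    "\<And>l x. x \<notin> C l \<Longrightarrow> \<theta> l x = 0" and \<theta>1: "\<And>l x. \<bar>\<theta> l x\<bar> \<le> 1"
    and \<theta>lim: "\<And>x. x \<in> interior T \<Longrightarrow> (\<lambda>l. \<theta> l x) \<longlonglongrightarrow> 1"
    by (rule polytope_cutoff[OF T], blast)
  define \<phi> where "\<phi> l x = \<xi> x * \<theta> l x" for l x
  have \<phi>s: "\<phi> l \<in> smooth_algebra" for l
    unfolding \<phi>_def[abs_def] by (intro smooth_algebra.mult smooth_algebra_polys[OF \<xi>] \<theta>)
  have \<phi>0: "\<phi> l x = 0" if "x \<notin> C l" for l x using C(3)[OF that] by (simp add: \<phi>_def)
  have \<phi>t: "test_fun \<Omega> (\<phi> l)" for l
    unfolding test_fun_def using \<phi>s C(1) \<phi>0 order_trans[OF C(2) sub] by (intro conjI smooth_algebra_smooth exI[of _ "C l"]) auto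
  \<comment> \<open>Functions that vanish off \<open>C l\<close> do not distinguish integration over
    the domain from integration over \<open>T\<close>.\<close>
  have swap: "(LINT x|lebesgue_on \<Omega>. F x) = (LINT x|lebesgue_on T. F x)"
    if "\<And>x. x \<notin> C l \<Longrightarrow> F x = 0" for F :: "real^'n \<Rightarrow> real" and l
  proof -
    have "indicator \<Omega> x *\<^sub>R F x = indicator T x *\<^sub>R F x" for x
      using that[of x] C(2)[of l] sub interior_subset[of T] by (cases "x \<in> C l") (auto simp: indicator_def)
    then have "(LINT x|lebesgue. indicator \<Omega> x *\<^sub>R F x) = (LINT x|lebesgue. indicator T x *\<^sub>R F x)" by (simp only:)
    then show ?thesis using \<Omega> Tl by (simp add: integral_lebesgue_on)
  qed
  have Cc: "closed (C l)" for l using C(1) by (rule compact_imp_closed)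
  \<comment> \<open>For fixed \<open>l\<close> both sides equal minus the integral of row
    \<open>i\<close> of \<open>\<tau>\<close> against the gradient of \<open>\<phi> l\<close>: for
    \<open>g\<close> by definition of the weak divergence, for \<open>row_div \<tau>'\<close> by
    integration by parts. The face terms vanish since the support stays in the interior of
    \<open>T\<close>.\<close>
  have main: "(LINT x|lebesgue_on T. g x $ i * \<phi> l x) = (LINT x|lebesgue_on T. row_div \<tau>' x $ i * \<phi> l x)" for l
  proof -
    let ?v = "\<lambda>x. axis i (\<phi> l x) :: real^'m"
    have bl: "bounded_linear (\<lambda>t. axis i t :: real^'m)"
      by (rule linear_conv_bounded_linear[THEN iffD1]) (rule linearI; simp add: vec_eq_iff axis_def)
    have C1v: "C1 ?v" by (rule C1_linear_compose[OF bl smooth_algebra_C1[OF \<phi>s]])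
    have J: "Jac ?v x \<bullet> \<tau>' x = (\<Sum>j\<in>UNIV. \<tau>' x $ i $ j * partial_deriv j (\<phi> l) x)" for x
    proof -
      have "partial_deriv j ?v x = axis i (partial_deriv j (\<phi> l) x)" for j
        by (rule partial_deriv_linear[OF bl smooth_algebra_C1[OF \<phi>s]])
      then have "Jac ?v x \<bullet> \<tau>' x = (\<Sum>i'\<in>UNIV. \<Sum>j\<in>UNIV. axis i (partial_deriv j (\<phi> l) x) $ i' * \<tau>' x $ i' $ j)"
        by (simp add: Jac_def inner_vec_def)
      also have "\<dots> = (\<Sum>i'\<in>{i}. \<Sum>j\<in>UNIV. axis i (partial_deriv j (\<phi> l) x) $ i' * \<tau>' x $ i' $ j)"
        by (rule sum.mono_neutral_right) (auto simp: axis_def)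
      finally show ?thesis by (simp add: mult.commute axis_def)
    qed
    have R: "?v x \<bullet> row_div \<tau>' x = row_div \<tau>' x $ i * \<phi> l x" for x
      by (simp add: inner_axis' mult.commute)
    have "(LINT x|surf (\<nu> s) (S s). ?v x \<bullet> (\<tau>' x *v \<nu> s)) = (LINT x|surf (\<nu> s) (S s). 0)" if "s \<in> I" for s
    proof (rule Bochner_Integration.integral_cong[OF refl])
      fix x assume "x \<in> space (surf (\<nu> s) (S s))"
      then have "x \<notin> C l" using S[OF that] C(2)[of l] by auto
      then show "?v x \<bullet> (\<tau>' x *v \<nu> s) = 0" by (simp add: \<phi>0 inner_axis')
    qed
    then have "(LINT x|lebesgue_on T. row_div \<tau>' x $ i * \<phi> l x) = - (LINT x|lebesgue_on T. (\<Sum>j\<in>UNIV. \<tau>' x $ i $ j * partial_deriv j (\<phi> l) x))"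
      using gauss_green_matrix[OF fs C1v \<tau>'] by (simp add: J R)
    also have "(LINT x|lebesgue_on T. (\<Sum>j\<in>UNIV. \<tau>' x $ i $ j * partial_deriv j (\<phi> l) x))
        = (LINT x|lebesgue_on \<Omega>. (\<Sum>j\<in>UNIV. \<tau>' x $ i $ j * partial_deriv j (\<phi> l) x))"
      by (rule swap[symmetric, of l]) (simp add: partial_deriv_zero_outside[OF Cc[of l] \<phi>0])
    also have "\<dots> = (LINT x|lebesgue_on \<Omega>. (\<Sum>j\<in>UNIV. \<tau> x $ i $ j * partial_deriv j (\<phi> l) x))"
    proof (rule Bochner_Integration.integral_cong[OF refl])
      fix x
      show "(\<Sum>j\<in>UNIV. \<tau>' x $ i $ j * partial_deriv j (\<phi> l) x) = (\<Sum>j\<in>UNIV. \<tau> x $ i $ j * partial_deriv j (\<phi> l) x)"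
      proof (cases "x \<in> C l")
        case True
        then show ?thesis using eq[of x] C(2)[of l] by auto
      next
        case False
        then show ?thesis by (simp add: partial_deriv_zero_outside[OF Cc[of l] \<phi>0])
      qed
    qed
    also have "\<dots> = - (LINT x|lebesgue_on \<Omega>. g x $ i * \<phi> l x)"
      using g \<phi>t unfolding has_weak_div_def by blast
    also have "(LINT x|lebesgue_on \<Omega>. g x $ i * \<phi> l x) = (LINT x|lebesgue_on T. g x $ i * \<phi> l x)"
      by (rule swap[of l]) (simp add: \<phi>0)
    finally show ?thesis by simp
  qed
  have contxi: "continuous_on UNIV \<xi>" by (rule continuous_polys[OF \<xi>])
  obtain B where B: "\<And>x. x \<in> T \<Longrightarrow> \<bar>\<xi> x\<bar> \<le> B"
    using compact_continuous_bound[OF cT contxi] by auto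
  have int_T: "AE x in lebesgue_on T. x \<in> interior T"
  proof -
    have "negligible (frontier T)" using polytope_imp_convex[OF T] by (rule negligible_convex_frontier)
    then have "AE x in lebesgue. x \<notin> frontier T" by (intro AE_not_in) (simp add: negligible_iff_null_sets)
    then have "AE x in lebesgue_on T. x \<notin> frontier T" using Tl by (auto simp: AE_restrict_space_iff)
    moreover have "AE x in lebesgue_on T. x \<in> T" using Tl by (auto simp: AE_restrict_space_iff)
    ultimately show ?thesis
      by eventually_elim (use closure_subset in \<open>auto simp: frontier_def\<close>)
  qed
  \<comment> \<open>Dominated convergence: the cutoffs are bounded by 1 and \<open>\<xi>\<close> by
    \<open>B\<close> on \<open>T\<close>, and the limit holds off the frontier, a null set.\<close>
  have lim: "(\<lambda>l. LINT x|lebesgue_on T. w x * \<phi> l x) \<longlonglongrightarrow> (LINT x|lebesgue_on T. w x * \<xi> x)"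
    if w: "integrable (lebesgue_on T) w" for w :: "real^'n \<Rightarrow> real"
  proof (rule integral_dominated_convergence[where w = "\<lambda>x. \<bar>w x\<bar> * B"])
    have mxi: "\<xi> \<in> borel_measurable (lebesgue_on T)"
      using borel_measurable_integrable[OF integrates_continuousD[OF ic contxi]] .
    have m\<theta>: "\<theta> l \<in> borel_measurable (lebesgue_on T)" for l
      using borel_measurable_integrable[OF integrates_continuousD[OF ic C1_continuous[OF smooth_algebra_C1[OF \<theta>]]]] .
    have mw: "w \<in> borel_measurable (lebesgue_on T)" using w by (rule borel_measurable_integrable)
    show "(\<lambda>x. w x * \<xi> x) \<in> borel_measurable (lebesgue_on T)" using mw mxi by (rule borel_measurable_times)
    show "(\<lambda>x. w x * \<phi> l x) \<in> borel_measurable (lebesgue_on T)" for l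
      unfolding \<phi>_def using mw mxi m\<theta> by (intro borel_measurable_times)
    show "integrable (lebesgue_on T) (\<lambda>x. \<bar>w x\<bar> * B)" using w by simp
    show "AE x in lebesgue_on T. (\<lambda>l. w x * \<phi> l x) \<longlonglongrightarrow> w x * \<xi> x"
      using int_T
    proof eventually_elim
      case (elim x)
      have "(\<lambda>l. w x * (\<xi> x * \<theta> l x)) \<longlonglongrightarrow> w x * (\<xi> x * 1)"
        by (intro tendsto_mult tendsto_const \<theta>lim elim)
      then show ?case by (simp add: \<phi>_def)
    qed
    show "AE x in lebesgue_on T. norm (w x * \<phi> l x) \<le> \<bar>w x\<bar> * B" for l
      using int_T
    proof eventually_elim
      case (elim x)
      then have "x \<in> T" using interior_subset by blast
      have "\<bar>\<xi> x\<bar> * \<bar>\<theta> l x\<bar> \<le> B * 1"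
        by (intro mult_mono B \<theta>1 \<open>x \<in> T\<close>) (use B[OF \<open>x \<in> T\<close>] in auto)
      then show ?case by (simp add: \<phi>_def abs_mult mult_left_mono)
    qed
  qed
  have gi': "integrable (lebesgue_on T) (\<lambda>x. g x $ i)"
    by (rule integrable_bounded_linear[OF bounded_linear_vec_nth gi])
  have di: "integrable (lebesgue_on T) (\<lambda>x. row_div \<tau>' x $ i)"
    by (rule integrates_continuousD[OF ic]) (intro continuous_on_component continuous_row_div \<tau>')
  show ?thesis
    by (rule LIMSEQ_unique[OF lim[OF gi', unfolded main] lim[OF di]])
qed

lemma weak_div_moments:
  fixes \<tau> :: "real^'n::finite \<Rightarrow> real^'n^'m::finite" and \<phi> :: "real^'n \<Rightarrow> real^'m"
  assumes T: "polytope T" and \<Omega>: "open \<Omega>" and sub: "interior T \<subseteq> \<Omega>"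
    and g: "has_weak_div q \<Omega> \<tau> g" and gi: "integrable (lebesgue_on T) g"
    and eq: "\<And>x. x \<in> interior T \<Longrightarrow> \<tau> x = \<tau>' x" and \<tau>': "C1 \<tau>'"
    and fs: "face_system T I \<nu> c \<epsilon> S" and S: "\<And>s. s \<in> I \<Longrightarrow> S s \<inter> interior T = {}"
    and \<phi>: "\<phi> \<in> polys k" and gp: "\<And>i. integrable (lebesgue_on T) (\<lambda>x. g x $ i * \<phi> x $ i)"
  shows "(LINT x|lebesgue_on T. g x \<bullet> \<phi> x) = (LINT x|lebesgue_on T. row_div \<tau>' x \<bullet> \<phi> x)"
proof -
  note ic = integrates_continuous_lebesgue_on[OF polytope_imp_compact[OF T]]
  have di: "integrable (lebesgue_on T) (\<lambda>x. row_div \<tau>' x $ i * \<phi> x $ i)" for i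
    by (rule integrates_continuousD[OF ic]) (intro continuous_on_mult continuous_on_component continuous_row_div \<tau>' continuous_polys[OF \<phi>])
  have "(\<lambda>x. \<phi> x $ i) \<in> polys k" for i
    by (rule polys_linear[OF bounded_linear.linear[OF bounded_linear_vec_nth] \<phi>])
  note c = weak_div_moments_component[OF T \<Omega> sub g gi eq \<tau>' fs S this]
  show ?thesis
    by (simp add: inner_vec_def Bochner_Integration.integral_sum gp di c)
qed


section \<open>Geometry of polytopal meshes\<close>

text \<open>A Lipschitz domain lies on one side of its boundary. Near a boundary point the part
  below the graph is open and misses the domain, hence also its closure; points just below the
  boundary point lie there, so it cannot be interior to the closure.\<close>

lemma interior_closure_lipschitz_domain:
  fixes \<Omega> :: "(real^'n::finite) set"
  assumes "open \<Omega>" "lipschitz_boundary \<Omega>"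
  shows "interior (closure \<Omega>) = \<Omega>"
proof
  show "\<Omega> \<subseteq> interior (closure \<Omega>)"
    using assms(1) closure_subset by (rule interior_maximal[rotated])
  show "interior (closure \<Omega>) \<subseteq> \<Omega>"
  proof (rule ccontr)
    assume "\<not> interior (closure \<Omega>) \<subseteq> \<Omega>"
    then obtain x where x: "x \<in> interior (closure \<Omega>)" "x \<notin> \<Omega>" by blast
    then have "x \<in> frontier \<Omega>"
      using assms(1) interior_subset[of "closure \<Omega>"] by (auto simp: frontier_def interior_open)
    then obtain \<rho> e L and g :: "real^'n \<Rightarrow> real" where \<rho>: "0 < \<rho>" and e: "norm e = 1" and lip: "L-lipschitz_on UNIV g"
      and loc: "\<And>y. y \<in> ball x \<rho> \<Longrightarrow> y \<in> \<Omega> \<longleftrightarrow> g (y - (e \<bullet> y) *\<^sub>R e) < e \<bullet> y"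
      using assms(2) unfolding lipschitz_boundary_def by metis
    have ee: "e \<bullet> e = 1" using e by (simp add: dot_square_norm)
    have cg: "continuous_on UNIV g" using lip by (rule lipschitz_on_continuous_on)
    have cg': "continuous_on UNIV (\<lambda>y. g (y - (e \<bullet> y) *\<^sub>R e))"
      by (rule continuous_on_compose2[OF cg]) (auto intro!: continuous_intros)
    let ?V = "ball x \<rho> \<inter> {y. e \<bullet> y < g (y - (e \<bullet> y) *\<^sub>R e)}"
    have V: "open ?V" by (intro open_Int open_ball open_Collect_less cg' continuous_intros)
    have "?V \<inter> \<Omega> = {}" using loc by force
    then have V0: "?V \<inter> closure \<Omega> = {}" using open_Int_closure_eq_empty[OF V] by blast
    have gx: "e \<bullet> x \<le> g (x - (e \<bullet> x) *\<^sub>R e)" using loc[of x] \<rho> x(2) by simp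
    obtain \<delta> where \<delta>: "0 < \<delta>" "ball x \<delta> \<subseteq> closure \<Omega>" using x(1) by (auto simp: mem_interior)
    define t where "t = min \<rho> \<delta> / 2"
    have t: "0 < t" "t < \<rho>" "t < \<delta>" using \<rho> \<delta>(1) by (auto simp: t_def min_def)
    have d: "dist x (x - t *\<^sub>R e) = t" using t e by (simp add: dist_norm)
    have eq1: "x - t *\<^sub>R e - (e \<bullet> (x - t *\<^sub>R e)) *\<^sub>R e = x - (e \<bullet> x) *\<^sub>R e"
      using ee by (simp add: inner_diff_right algebra_simps)
    have "e \<bullet> (x - t *\<^sub>R e) < e \<bullet> x" using t ee by (simp add: inner_diff_right)
    then have "e \<bullet> (x - t *\<^sub>R e) < g (x - t *\<^sub>R e - (e \<bullet> (x - t *\<^sub>R e)) *\<^sub>R e)"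
      unfolding eq1 using gx by linarith
    then have "x - t *\<^sub>R e \<in> ?V" using t d by (simp only: Int_iff mem_ball mem_Collect_eq)
    moreover have "x - t *\<^sub>R e \<in> closure \<Omega>" using \<delta>(2) d t by auto
    ultimately show False using V0 by blast
  qed
qed

text \<open>Measurability of \<open>F\<close> comes from completeness of Lebesgue measure:
  \<open>F\<close> agrees almost everywhere with an integrable sum of pieces. This handles glued
  functions, whose values on overlaps are arbitrary choices.\<close>

lemma integral_partition:
  fixes F :: "'a::euclidean_space \<Rightarrow> real"
  assumes fin: "finite \<T>" and T: "\<And>T. T \<in> \<T> \<Longrightarrow> T \<in> sets lebesgue" and A: "A \<in> sets lebesgue"
    and ov: "\<And>T T'. T \<in> \<T> \<Longrightarrow> T' \<in> \<T> \<Longrightarrow> T \<noteq> T' \<Longrightarrow> negligible (T \<inter> T')"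
    and cover: "negligible (A - \<Union>\<T>)" "negligible (\<Union>\<T> - A)"
    and int: "\<And>T. T \<in> \<T> \<Longrightarrow> integrable (lebesgue_on T) (G T)"
    and eq: "\<And>T. T \<in> \<T> \<Longrightarrow> AE x in lebesgue_on T. F x = G T x"
  shows "integrable (lebesgue_on A) F" "integral\<^sup>L (lebesgue_on A) F = (\<Sum>T\<in>\<T>. integral\<^sup>L (lebesgue_on T) (G T))"
proof -
  have neg: "AE x in lebesgue. x \<notin> N" if "negligible N" for N :: "'a set"
    using that by (intro AE_not_in) (simp add: negligible_iff_null_sets)
  have ae1: "AE x in lebesgue. \<forall>T\<in>\<T>. \<forall>T'\<in>\<T>. T \<noteq> T' \<longrightarrow> x \<notin> T \<inter> T'"
  proof (intro AE_finite_allI[OF fin])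
    fix T T' assume "T \<in> \<T>" "T' \<in> \<T>"
    show "AE x in lebesgue. T \<noteq> T' \<longrightarrow> x \<notin> T \<inter> T'"
    proof (cases "T = T'")
      case False
      show ?thesis
        by (rule eventually_mono[OF neg[OF ov[OF \<open>T \<in> \<T>\<close> \<open>T' \<in> \<T>\<close> False]]]) blast
    qed simp
  qed
  have ae2: "AE x in lebesgue. \<forall>T\<in>\<T>. x \<in> T \<longrightarrow> F x = G T x"
    using fin eq T by (intro AE_finite_allI) (auto simp: AE_restrict_space_iff)
  have ae: "AE x in lebesgue. indicator A x *\<^sub>R F x = (\<Sum>T\<in>\<T>. indicator T x *\<^sub>R G T x)"
    using ae1 ae2 neg[OF cover(1)] neg[OF cover(2)]
  proof eventually_elim
    case (elim x)
    show ?case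
    proof (cases "x \<in> A")
      case False
      then have "\<And>T. T \<in> \<T> \<Longrightarrow> x \<notin> T" using elim by blast
      then show ?thesis using False by simp
    next
      case True
      then obtain T where T: "T \<in> \<T>" "x \<in> T" using elim by blast
      have "(\<Sum>T\<in>\<T>. indicator T x *\<^sub>R G T x) = (\<Sum>T'\<in>{T}. indicator T' x *\<^sub>R G T' x)"
        by (rule sum.mono_neutral_right) (use fin T elim(1) in \<open>auto simp: indicator_def\<close>)
      then show ?thesis using True T elim(2) by simp
    qed
  qed
  have sint: "integrable lebesgue (\<lambda>x. \<Sum>T\<in>\<T>. indicator T x *\<^sub>R G T x)"
    using int T by (intro Bochner_Integration.integrable_sum) (simp add: integrable_restrict_space)
  then have ai: "(\<lambda>x. \<Sum>T\<in>\<T>. indicator T x *\<^sub>R G T x) absolutely_integrable_on UNIV"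
    by (simp add: set_integrable_def)
  obtain N where N: "{x. \<not> (indicator A x *\<^sub>R F x = (\<Sum>T\<in>\<T>. indicator T x *\<^sub>R G T x))} \<subseteq> N" "N \<in> null_sets lebesgue"
    using ae by (auto simp: eventually_ae_filter)
  have "(\<lambda>x. indicator A x *\<^sub>R F x) absolutely_integrable_on UNIV"
  proof (rule absolutely_integrable_spike[OF ai])
    show "negligible N" using N(2) by (simp add: negligible_iff_null_sets)
    show "indicator A x *\<^sub>R F x = (\<Sum>T\<in>\<T>. indicator T x *\<^sub>R G T x)" if "x \<in> UNIV - N" for x
      using that N(1) by blast
  qed
  then have i: "integrable lebesgue (\<lambda>x. indicator A x *\<^sub>R F x)"
    by (simp add: set_integrable_def)
  then show "integrable (lebesgue_on A) F" using A by (simp add: integrable_restrict_space)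
  have "integral\<^sup>L (lebesgue_on A) F = (LINT x|lebesgue. indicator A x *\<^sub>R F x)"
    using A by (simp add: integral_lebesgue_on)
  also have "\<dots> = (LINT x|lebesgue. (\<Sum>T\<in>\<T>. indicator T x *\<^sub>R G T x))"
    by (rule integral_cong_AE) (use i sint ae borel_measurable_integrable in auto)
  also have "\<dots> = (\<Sum>T\<in>\<T>. LINT x|lebesgue. indicator T x *\<^sub>R G T x)"
    using int T by (intro Bochner_Integration.integral_sum) (simp add: integrable_restrict_space)
  finally show "integral\<^sup>L (lebesgue_on A) F = (\<Sum>T\<in>\<T>. integral\<^sup>L (lebesgue_on T) (G T))"
    using T by (simp add: integral_lebesgue_on cong: sum.cong)
qed

text \<open>An open half ball is convex, hence connected; if it misses the frontier of
  \<open>A\<close> it lies inside \<open>A\<close> or outside.\<close>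

lemma half_balls_indicator:
  fixes y \<nu> :: "real^'n::finite"
  assumes "\<forall>\<^sub>F z in nhds y. z \<in> frontier A \<longrightarrow> \<nu> \<bullet> (z - y) = 0"
  obtains \<rho> b b' where "0 < \<rho>" "b \<in> {0, 1}" "b' \<in> {0, 1}"
    "\<And>z. z \<in> ball y \<rho> \<Longrightarrow> \<nu> \<bullet> (z - y) < 0 \<Longrightarrow> indicat_real A z = b"
    "\<And>z. z \<in> ball y \<rho> \<Longrightarrow> \<nu> \<bullet> (z - y) > 0 \<Longrightarrow> indicat_real A z = b'"
proof -
  obtain \<rho> where \<rho>: "0 < \<rho>" "\<And>z. z \<in> ball y \<rho> \<Longrightarrow> z \<in> frontier A \<Longrightarrow> \<nu> \<bullet> (z - y) = 0"
    using assms unfolding eventually_nhds_metric by (auto simp: dist_commute)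
  have const: "\<exists>b\<in>{0, 1}. \<forall>z\<in>C. indicat_real A z = b"
    if "connected C" "C \<inter> frontier A = {}" for C :: "(real^'n) set"
  proof -
    have "C \<inter> A = {} \<or> C - A = {}" using connected_Int_frontier[of C A] that by blast
    then show ?thesis
    proof
      assume "C \<inter> A = {}" then show ?thesis by (intro bexI[of _ 0]) (auto simp: indicator_def)
    next
      assume "C - A = {}" then show ?thesis by (intro bexI[of _ 1]) (auto simp: indicator_def)
    qed
  qed
  let ?lo = "ball y \<rho> \<inter> {z. \<nu> \<bullet> z < \<nu> \<bullet> y}" and ?up = "ball y \<rho> \<inter> {z. \<nu> \<bullet> z > \<nu> \<bullet> y}"
  have "connected ?lo" "connected ?up"
    by (intro convex_connected convex_Int convex_ball convex_halfspace_lt convex_halfspace_gt)+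
  moreover have "?lo \<inter> frontier A = {}" "?up \<inter> frontier A = {}"
    using \<rho>(2) by (force simp: inner_diff_right)+
  ultimately obtain b b' where "b \<in> {0, 1}" "b' \<in> {0, 1}" "\<forall>z\<in>?lo. indicat_real A z = b" "\<forall>z\<in>?up. indicat_real A z = b'"
    using const by meson
  then show ?thesis using \<rho>(1) by (intro that[of \<rho> b b']) (auto simp: inner_diff_right)
qed

lemma half_ball_point:
  fixes y \<nu> :: "real^'n::finite"
  assumes "norm \<nu> = 1" "0 < \<rho>"
  shows "y - (\<rho> / 2) *\<^sub>R \<nu> \<in> ball y \<rho> \<inter> {z. \<nu> \<bullet> (z - y) < 0}"
    "y + (\<rho> / 2) *\<^sub>R \<nu> \<in> ball y \<rho> \<inter> {z. \<nu> \<bullet> (z - y) > 0}"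
  using assms by (auto simp: dist_norm dot_square_norm)

lemma open_half_ball:
  fixes y \<nu> :: "real^'n::finite"
  shows "open (ball y \<rho> \<inter> {z. \<nu> \<bullet> (z - y) < 0})" "open (ball y \<rho> \<inter> {z. \<nu> \<bullet> (z - y) > 0})"
  by (intro open_Int open_ball open_Collect_less continuous_intros)+

text \<open>Positive surface measure means that a set of positive volume projects into
  \<open>S\<close>, so not all of these projections can be exceptional.\<close>

lemma face_AE_witness:
  fixes \<nu> :: "real^'n"
  assumes "closed S" "S \<noteq> {}" "\<And>x. x \<in> S \<Longrightarrow> \<nu> \<bullet> x = c" "norm \<nu> = 1"
    and "0 < emeasure (surf \<nu> S) S" "face_AE \<nu> c S P"
  shows "\<exists>y\<in>S. P y"
proof (rule ccontr)
  assume "\<not> (\<exists>y\<in>S. P y)"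
  then have "AE z in lborel. oproj \<nu> c \<nu> z \<notin> S"
    using assms(6) unfolding face_AE_def by (auto elim!: eventually_mono)
  then have ae: "AE z in lborel. z \<notin> oproj \<nu> c \<nu> -` S \<inter> slab \<nu> c" by eventually_elim auto
  have "oproj \<nu> c \<nu> -` S \<in> sets borel"
    using measurable_sets[OF oproj_measurable, of S] assms(1) by simp
  then have "emeasure lborel (oproj \<nu> c \<nu> -` S \<inter> slab \<nu> c) = 0"
    using ae AE_iff_null_sets[of "oproj \<nu> c \<nu> -` S \<inter> slab \<nu> c" lborel] by (auto simp: null_sets_def)
  then show False using assms(5) emeasure_surf[OF assms(1,2) assms(3) assms(4)] by simp
qed

section \<open>Orientation of cells at generic points of faces\<close>

definition plane_const :: "'n::finite mesh \<Rightarrow> (real^'n) set \<Rightarrow> real" where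
  "plane_const X S = nrm X S \<bullet> (SOME x. x \<in> S)"

text \<open>The sign with which a cell enters the jump over \<open>S\<close>. \<open>Kminus\<close>
  is consulted only on interior faces, as its value elsewhere is arbitrary.\<close>

definition incidence :: "'n::finite mesh \<Rightarrow> (real^'n) set \<Rightarrow> (real^'n) set \<Rightarrow> real" where
  "incidence X K S = (if K = Kplus X S then 1 else if S \<in> int_faces X \<and> K = Kminus X S then -1 else 0)"

definition outer_point :: "(real^'n::finite) set \<Rightarrow> real^'n \<Rightarrow> real^'n \<Rightarrow> bool" where
  "outer_point A \<nu> x \<longleftrightarrow> (\<exists>\<epsilon>>0. \<forall>t. 0 < t \<and> t < \<epsilon> \<longrightarrow> x - t *\<^sub>R \<nu> \<in> A \<and> x + t *\<^sub>R \<nu> \<notin> A)"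

definition generic_point :: "'n::finite mesh \<Rightarrow> (real^'n) set \<Rightarrow> real^'n \<Rightarrow> bool" where
  "generic_point X S y \<longleftrightarrow> (\<forall>S'\<in>faces X. y \<in> S' \<longrightarrow> S' = S) \<and>
     (S \<in> int_faces X \<longrightarrow> outer_point (Kplus X S) (nrm X S) y \<and> outer_point (Kminus X S) (- nrm X S) y) \<and>
     (S \<in> bd_faces X \<longrightarrow> outer_point (dom X) (nrm X S) y)"

locale poly_mesh =
  fixes X :: "'n::finite mesh"
  assumes mesh: "polytopal_mesh X"
begin

lemma dom_open: "open (dom X)" and dom_bounded: "bounded (dom X)"
  and dom_regular: "interior (closure (dom X)) = dom X"
  using mesh interior_closure_lipschitz_domain
  by (auto simp: polytopal_mesh_def polyhedral_lipschitz_domain_def)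

lemma finite_cells: "finite (cells X)" and finite_faces: "finite (faces X)"
  and cells_cover: "\<Union>(cells X) = closure (dom X)"
  and skeleton_faces: "skeleton X = \<Union>(faces X)"
  and faces_int_bd: "faces X = int_faces X \<union> bd_faces X"
  using mesh by (auto simp: polytopal_mesh_def)

lemma cell_regular: "K \<in> cells X \<Longrightarrow> K = closure (interior K)"
  using mesh by (auto simp: polytopal_mesh_def polytopal_cell_def)

lemma cell_closed: "K \<in> cells X \<Longrightarrow> closed K"
  by (metis cell_regular closed_closure)

lemma cell_compact: "K \<in> cells X \<Longrightarrow> compact K"
  using cell_closed cells_cover bounded_closure[OF dom_bounded] bounded_subset[of "closure (dom X)" K]
  by (auto simp: compact_eq_bounded_closed)

lemma cell_sets: "K \<in> cells X \<Longrightarrow> K \<in> sets lebesgue"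
  using cell_closed by (simp add: borel_closed)

lemma cell_overlap: "K \<in> cells X \<Longrightarrow> K' \<in> cells X \<Longrightarrow> K \<noteq> K' \<Longrightarrow> negligible (K \<inter> K')"
  using mesh cell_sets by (auto simp: polytopal_mesh_def negligible_iff_null_sets null_sets_def)

lemma cells_disjoint_open:
  assumes "K \<in> cells X" "K' \<in> cells X" "K \<noteq> K'" "open U" "U \<subseteq> K" "U \<subseteq> K'"
  shows "U = {}"
  using cell_overlap[OF assms(1-3)] negligible_subset[of "K \<inter> K'" U] open_not_negligible[of U] assms(4-6) by blast

lemma cell_frontier: "K \<in> cells X \<Longrightarrow> frontier K \<subseteq> \<Union>(faces X)"
  using skeleton_faces by (auto simp: skeleton_def)

text \<open>A boundary point lies in some cell. The interior of that cell is inside the domain,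
  because the domain equals the interior of its closure, so the point is on the frontier of the cell
  and thus on the skeleton.\<close>

lemma dom_frontier: "frontier (dom X) \<subseteq> \<Union>(faces X)"
proof
  fix x assume x: "x \<in> frontier (dom X)"
  then have "x \<in> closure (dom X)" "x \<notin> dom X" using dom_open by (auto simp: frontier_def interior_open)
  then obtain K where K: "K \<in> cells X" "x \<in> K" using cells_cover by blast
  have "K \<subseteq> closure (dom X)" using K cells_cover by blast
  then have "interior K \<subseteq> dom X" using interior_mono dom_regular by metis
  then have "x \<in> frontier K" using K \<open>x \<notin> dom X\<close> closure_subset by (auto simp: frontier_def)
  then show "x \<in> \<Union>(faces X)" using cell_frontier[OF K(1)] by blast
qed

lemma face_flat: "S \<in> faces X \<Longrightarrow> flat_face (nrm X S) S"
  using mesh by (auto simp: polytopal_mesh_def)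

lemma face_closed: "S \<in> faces X \<Longrightarrow> closed S" and face_norm: "S \<in> faces X \<Longrightarrow> norm (nrm X S) = 1"
  and face_pos: "S \<in> faces X \<Longrightarrow> 0 < emeasure (surf (nrm X S) S) S"
  using face_flat by (auto simp: flat_face_def)

lemma face_nonempty: "S \<in> faces X \<Longrightarrow> S \<noteq> {}"
  using face_pos by fastforce

lemma face_plane: "S \<in> faces X \<Longrightarrow> x \<in> S \<Longrightarrow> nrm X S \<bullet> x = plane_const X S"
  using face_flat[of S] unfolding flat_face_def plane_const_def by (metis someI)

lemma face_compact: "S \<in> faces X \<Longrightarrow> compact S"
proof -
  assume S: "S \<in> faces X"
  have "S \<subseteq> \<Union>(cells X)"
    using S skeleton_faces cell_closed unfolding skeleton_def by (blast dest: frontier_subset_closed)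
  then show ?thesis
    using face_closed[OF S] cells_cover bounded_closure[OF dom_bounded] bounded_subset
    by (auto simp: compact_eq_bounded_closed)
qed

lemma int_face: 
  assumes "S \<in> int_faces X"
  shows "S \<in> faces X" "Kplus X S \<in> cells X" "Kminus X S \<in> cells X" "Kplus X S \<noteq> Kminus X S"
    "outer_normal_on (Kplus X S) S (nrm X S)" "outer_normal_on (Kminus X S) S (- nrm X S)"
    "S \<subseteq> Kplus X S" "S \<subseteq> Kminus X S"
  using assms mesh by (auto simp: polytopal_mesh_def int_faces_def)

lemma bd_face:
  assumes "S \<in> bd_faces X"
  shows "S \<in> faces X" "Kplus X S \<in> cells X" "S \<subseteq> Kplus X S" "S \<subseteq> frontier (dom X)"
    "outer_normal_on (dom X) S (nrm X S)"
  using assms mesh by (auto simp: polytopal_mesh_def bd_faces_def)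

lemma face_AE_mono_surf:
  assumes "S \<in> faces X" "AE y in surf (nrm X S) S. P y"
  shows "face_AE (nrm X S) (plane_const X S) S P"
  by (rule AE_surf_imp_face_AE[OF face_nonempty face_closed face_plane face_norm]) (use assms in auto)

lemma face_AE_generic:
  assumes S: "S \<in> faces X"
  shows "face_AE (nrm X S) (plane_const X S) S (generic_point X S)"
proof -
  let ?F = "face_AE (nrm X S) (plane_const X S) S"
  have 1: "?F (\<lambda>y. \<forall>S'\<in>faces X. y \<in> S' \<longrightarrow> S' = S)"
  proof (rule face_AE_ball[OF finite_faces])
    fix S' assume S': "S' \<in> faces X"
    show "?F (\<lambda>y. y \<in> S' \<longrightarrow> S' = S)"
    proof (cases "S' = S")
      case False
      then have "emeasure (surf (nrm X S) S) (S \<inter> S') = 0"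
        using mesh S S' by (auto simp: polytopal_mesh_def)
      moreover have "S \<inter> S' \<in> sets (surf (nrm X S) S)"
        using face_closed[OF S'] face_closed[OF S] by (auto simp: sets_surf sets_restrict_space)
      ultimately have "AE y in surf (nrm X S) S. y \<notin> S \<inter> S'"
        by (intro AE_not_in) (auto simp: null_sets_def)
      from face_AE_mono_surf[OF S this] show ?thesis by (rule face_AE_mp) auto
    qed (auto intro: face_AE_I)
  qed
  have 2: "?F (\<lambda>y. S \<in> int_faces X \<longrightarrow> outer_point (Kplus X S) (nrm X S) y)"
  proof (cases "S \<in> int_faces X")
    case True
    from face_AE_mono_surf[OF S int_face(5)[OF True, unfolded outer_normal_on_def]]
    show ?thesis by (rule face_AE_mp) (simp add: outer_point_def)
  qed (auto intro: face_AE_I)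
  have 3: "?F (\<lambda>y. S \<in> int_faces X \<longrightarrow> outer_point (Kminus X S) (- nrm X S) y)"
  proof (cases "S \<in> int_faces X")
    case True
    have "face_AE (- nrm X S) (- plane_const X S) S (outer_point (Kminus X S) (- nrm X S))"
      by (rule AE_surf_imp_face_AE[OF face_nonempty[OF S] face_closed[OF S]])
         (use face_plane[OF S] face_norm[OF S] int_face(6)[OF True] in \<open>auto simp: outer_normal_on_def outer_point_def\<close>)
    then have "?F (outer_point (Kminus X S) (- nrm X S))" by (simp only: face_AE_uminus)
    then show ?thesis by (rule face_AE_mp) simp
  qed (auto intro: face_AE_I)
  have 4: "?F (\<lambda>y. S \<in> bd_faces X \<longrightarrow> outer_point (dom X) (nrm X S) y)"
  proof (cases "S \<in> bd_faces X")
    case True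
    from face_AE_mono_surf[OF S bd_face(5)[OF True, unfolded outer_normal_on_def]]
    show ?thesis by (rule face_AE_mp) (simp add: outer_point_def)
  qed (auto intro: face_AE_I)
  show ?thesis
    by (rule face_AE_mp[OF face_AE_conj[OF 1 face_AE_conj[OF 2 face_AE_conj[OF 3 4]]]])
       (simp add: generic_point_def)
qed

lemma generic_half_balls:
  assumes S: "S \<in> faces X" and y: "y \<in> S" "generic_point X S y" and A: "frontier A \<subseteq> \<Union>(faces X)"
  obtains \<rho> b b' where "0 < \<rho>" "b \<in> {0, 1}" "b' \<in> {0, 1}"
    "\<And>z. z \<in> ball y \<rho> \<Longrightarrow> nrm X S \<bullet> (z - y) < 0 \<Longrightarrow> indicat_real A z = b"
    "\<And>z. z \<in> ball y \<rho> \<Longrightarrow> nrm X S \<bullet> (z - y) > 0 \<Longrightarrow> indicat_real A z = b'"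
proof -
  let ?N = "\<Union>(faces X - {S})"
  have "closed ?N" using finite_faces face_closed by (intro closed_Union) auto
  moreover have "y \<notin> ?N" using y(2) by (auto simp: generic_point_def)
  ultimately have "\<forall>\<^sub>F z in nhds y. z \<in> - ?N" by (intro eventually_nhds_in_open) auto
  then have "\<forall>\<^sub>F z in nhds y. z \<in> frontier A \<longrightarrow> nrm X S \<bullet> (z - y) = 0"
  proof eventually_elim
    case (elim z)
    show ?case
    proof
      assume "z \<in> frontier A"
      then have "z \<in> S" using A elim by blast
      then show "nrm X S \<bullet> (z - y) = 0" using face_plane[OF S] y(1) by (simp add: inner_diff_right)
    qed
  qed
  then show ?thesis by (rule half_balls_indicator) (rule that)
qed

text \<open>Outer normals only speak about the normal line through \<open>y\<close>; since the
  indicator is constant on half balls, one point on each side decides the whole half ball.\<close>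

lemma outer_point_values:
  assumes "outer_point A \<nu> y" and \<nu>: "norm \<nu> = 1" and \<rho>: "0 < \<rho>"
    and lo: "\<And>z. z \<in> ball y \<rho> \<Longrightarrow> \<nu> \<bullet> (z - y) < 0 \<Longrightarrow> indicat_real A z = b"
    and up: "\<And>z. z \<in> ball y \<rho> \<Longrightarrow> \<nu> \<bullet> (z - y) > 0 \<Longrightarrow> indicat_real A z = b'"
  shows "b = 1" "b' = 0"
proof -
  obtain \<epsilon> where \<epsilon>: "0 < \<epsilon>" "\<And>t. 0 < t \<Longrightarrow> t < \<epsilon> \<Longrightarrow> y - t *\<^sub>R \<nu> \<in> A \<and> y + t *\<^sub>R \<nu> \<notin> A"
    using assms(1) by (auto simp: outer_point_def)
  define \<delta> where "\<delta> = min \<epsilon> \<rho>"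
  have \<delta>: "0 < \<delta>" "\<delta> / 2 < \<epsilon>" "\<delta> \<le> \<rho>" using \<epsilon>(1) \<rho> by (auto simp: \<delta>_def min_def)
  have A: "y - (\<delta> / 2) *\<^sub>R \<nu> \<in> A" "y + (\<delta> / 2) *\<^sub>R \<nu> \<notin> A" using \<epsilon>(2)[of "\<delta> / 2"] \<delta> by auto
  have sub: "ball y \<delta> \<subseteq> ball y \<rho>" using \<delta> by (intro subset_ball)
  have lo': "y - (\<delta> / 2) *\<^sub>R \<nu> \<in> ball y \<delta>" "\<nu> \<bullet> (y - (\<delta> / 2) *\<^sub>R \<nu> - y) < 0"
    using half_ball_point(1)[OF \<nu> \<delta>(1), of y] by blast+
  have up': "y + (\<delta> / 2) *\<^sub>R \<nu> \<in> ball y \<delta>" "\<nu> \<bullet> (y + (\<delta> / 2) *\<^sub>R \<nu> - y) > 0"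
    using half_ball_point(2)[OF \<nu> \<delta>(1), of y] by blast+
  show "b = 1" using A(1) lo[OF subsetD[OF sub lo'(1)] lo'(2)] by simp
  show "b' = 0" using A(2) up[OF subsetD[OF sub up'(1)] up'(2)] by simp
qed

lemma generic_dom_upper:
  assumes S: "S \<in> bd_faces X" and y: "y \<in> S" "generic_point X S y"
  obtains \<rho> where "0 < \<rho>" "ball y \<rho> \<inter> {z. nrm X S \<bullet> (z - y) > 0} \<inter> closure (dom X) = {}"
proof -
  have Sf: "S \<in> faces X" by (rule bd_face(1)[OF S])
  obtain \<rho> b b' where \<rho>: "0 < \<rho>"
    and lo: "\<And>z. z \<in> ball y \<rho> \<Longrightarrow> nrm X S \<bullet> (z - y) < 0 \<Longrightarrow> indicat_real (dom X) z = b"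
    and up: "\<And>z. z \<in> ball y \<rho> \<Longrightarrow> nrm X S \<bullet> (z - y) > 0 \<Longrightarrow> indicat_real (dom X) z = b'"
    by (rule generic_half_balls[OF Sf y dom_frontier], blast)
  have "outer_point (dom X) (nrm X S) y" using y(2) S by (simp add: generic_point_def)
  from outer_point_values(2)[OF this face_norm[OF Sf] \<rho> lo up] have "b' = 0" by blast
  then have "ball y \<rho> \<inter> {z. nrm X S \<bullet> (z - y) > 0} \<inter> dom X = {}" using up by (force simp: indicator_def)
  then have "ball y \<rho> \<inter> {z. nrm X S \<bullet> (z - y) > 0} \<inter> closure (dom X) = {}"
    using open_Int_closure_eq_empty[OF open_half_ball(2)] by blast
  then show ?thesis using \<rho> that by blast
qed

text \<open>At a generic point of a common face, \<open>Kminus\<close> would contain points ahead of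
  the normal, where a boundary face has nothing of the closed domain.\<close>

lemma int_bd_disjoint: "int_faces X \<inter> bd_faces X = {}"
proof (rule ccontr)
  assume "int_faces X \<inter> bd_faces X \<noteq> {}"
  then obtain S where S: "S \<in> int_faces X" "S \<in> bd_faces X" by blast
  have Sf: "S \<in> faces X" by (rule bd_face(1)[OF S(2)])
  obtain y where y: "y \<in> S" "generic_point X S y"
    using face_AE_witness[OF face_closed[OF Sf] face_nonempty[OF Sf] face_plane[OF Sf] face_norm[OF Sf] face_pos[OF Sf] face_AE_generic[OF Sf]]
    by blast
  obtain \<rho> where \<rho>: "0 < \<rho>" "ball y \<rho> \<inter> {z. nrm X S \<bullet> (z - y) > 0} \<inter> closure (dom X) = {}"
    by (rule generic_dom_upper[OF S(2) y])
  have "outer_point (Kminus X S) (- nrm X S) y" using y(2) S by (simp add: generic_point_def)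
  then obtain \<epsilon> where \<epsilon>: "0 < \<epsilon>" "\<And>t. 0 < t \<Longrightarrow> t < \<epsilon> \<Longrightarrow> y + t *\<^sub>R nrm X S \<in> Kminus X S"
    by (auto simp: outer_point_def)
  define \<delta> where "\<delta> = min \<epsilon> \<rho>"
  have \<delta>: "0 < \<delta>" "\<delta> / 2 < \<epsilon>" "\<delta> \<le> \<rho>" using \<epsilon>(1) \<rho> by (auto simp: \<delta>_def min_def)
  have "y + (\<delta> / 2) *\<^sub>R nrm X S \<in> closure (dom X)"
    using \<epsilon>(2)[of "\<delta> / 2"] \<delta> int_face(3)[OF S(1)] cells_cover by auto
  moreover have "ball y \<delta> \<subseteq> ball y \<rho>" using \<delta> by (intro subset_ball)
  ultimately show False using \<rho>(2) half_ball_point(2)[OF face_norm[OF Sf] \<delta>(1), of y] by blast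
qed

text \<open>The two half-ball values are found one by one: the adjacent cells fill their half balls,
  and any other cell gets 0 there because cells overlap only in null sets. On boundary faces nothing
  lies ahead of the normal.\<close>

lemma generic_cell_jump:
  assumes S: "S \<in> faces X" and y: "y \<in> S" "generic_point X S y" and K: "K \<in> cells X"
  shows "has_jump (indicat_real K) (nrm X S) (incidence X K S) y"
proof -
  let ?\<nu> = "nrm X S"
  have \<nu>: "norm ?\<nu> = 1" by (rule face_norm[OF S])
  obtain \<rho> b b' where \<rho>: "0 < \<rho>" and bb: "b \<in> {0, 1}" "b' \<in> {0, 1}"
    and lo: "\<And>z. z \<in> ball y \<rho> \<Longrightarrow> ?\<nu> \<bullet> (z - y) < 0 \<Longrightarrow> indicat_real K z = b"
    and up: "\<And>z. z \<in> ball y \<rho> \<Longrightarrow> ?\<nu> \<bullet> (z - y) > 0 \<Longrightarrow> indicat_real K z = b'"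
    by (rule generic_half_balls[OF S y cell_frontier[OF K]], blast)
  have no_lo: "b = 0" if "K' \<in> cells X" "K \<noteq> K'" "0 < \<rho>'" "ball y \<rho>' \<inter> {z. ?\<nu> \<bullet> (z - y) < 0} \<subseteq> K'" for K' \<rho>'
  proof (rule ccontr)
    assume "b \<noteq> 0" then have "b = 1" using bb by auto
    define \<delta> where "\<delta> = min \<rho> \<rho>'"
    have \<delta>: "0 < \<delta>" "ball y \<delta> \<subseteq> ball y \<rho>" "ball y \<delta> \<subseteq> ball y \<rho>'" using \<rho> that by (auto simp: \<delta>_def)
    have "ball y \<delta> \<inter> {z. ?\<nu> \<bullet> (z - y) < 0} \<subseteq> K"
      using lo \<delta>(2) \<open>b = 1\<close> by (auto simp: indicator_def split: if_splits)
    moreover have "ball y \<delta> \<inter> {z. ?\<nu> \<bullet> (z - y) < 0} \<subseteq> K'" using that(4) \<delta>(3) by blast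
    ultimately have "ball y \<delta> \<inter> {z. ?\<nu> \<bullet> (z - y) < 0} = {}"
      using cells_disjoint_open[OF K that(1,2) open_half_ball(1)] by blast
    then show False using half_ball_point(1)[OF \<nu> \<delta>(1), of y] by blast
  qed
  have no_up: "b' = 0" if "K' \<in> cells X" "K \<noteq> K'" "0 < \<rho>'" "ball y \<rho>' \<inter> {z. ?\<nu> \<bullet> (z - y) > 0} \<subseteq> K'" for K' \<rho>'
  proof (rule ccontr)
    assume "b' \<noteq> 0" then have "b' = 1" using bb by auto
    define \<delta> where "\<delta> = min \<rho> \<rho>'"
    have \<delta>: "0 < \<delta>" "ball y \<delta> \<subseteq> ball y \<rho>" "ball y \<delta> \<subseteq> ball y \<rho>'" using \<rho> that by (auto simp: \<delta>_def)
    have "ball y \<delta> \<inter> {z. ?\<nu> \<bullet> (z - y) > 0} \<subseteq> K"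
      using up \<delta>(2) \<open>b' = 1\<close> by (auto simp: indicator_def split: if_splits)
    moreover have "ball y \<delta> \<inter> {z. ?\<nu> \<bullet> (z - y) > 0} \<subseteq> K'" using that(4) \<delta>(3) by blast
    ultimately have "ball y \<delta> \<inter> {z. ?\<nu> \<bullet> (z - y) > 0} = {}"
      using cells_disjoint_open[OF K that(1,2) open_half_ball(2)] by blast
    then show False using half_ball_point(2)[OF \<nu> \<delta>(1), of y] by blast
  qed
  have plus_lo: "\<exists>\<rho>'>0. ball y \<rho>' \<inter> {z. ?\<nu> \<bullet> (z - y) < 0} \<subseteq> Kplus X S"
  proof (cases "S \<in> int_faces X")
    case True
    have Kp: "Kplus X S \<in> cells X" by (rule int_face(2)[OF True])
    obtain \<rho>' c c' where \<rho>': "0 < \<rho>'"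
      and lo': "\<And>z. z \<in> ball y \<rho>' \<Longrightarrow> ?\<nu> \<bullet> (z - y) < 0 \<Longrightarrow> indicat_real (Kplus X S) z = c"
      and up': "\<And>z. z \<in> ball y \<rho>' \<Longrightarrow> ?\<nu> \<bullet> (z - y) > 0 \<Longrightarrow> indicat_real (Kplus X S) z = c'"
      by (rule generic_half_balls[OF S y cell_frontier[OF Kp]], blast)
    have "outer_point (Kplus X S) ?\<nu> y" using y(2) True by (simp add: generic_point_def)
    from outer_point_values(1)[OF this \<nu> \<rho>' lo' up'] have "c = 1" by blast
    then show ?thesis using \<rho>' lo' by (intro exI[of _ \<rho>']) (auto simp: indicator_def split: if_splits)
  next
    case False
    then have bd: "S \<in> bd_faces X" using S faces_int_bd by blast
    have Kp: "Kplus X S \<in> cells X" by (rule bd_face(2)[OF bd])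
    obtain \<rho>' c c' where \<rho>': "0 < \<rho>'" and cc: "c \<in> {0, 1}"
      and lo': "\<And>z. z \<in> ball y \<rho>' \<Longrightarrow> ?\<nu> \<bullet> (z - y) < 0 \<Longrightarrow> indicat_real (Kplus X S) z = c"
      by (rule generic_half_balls[OF S y cell_frontier[OF Kp]], blast)
    obtain \<rho>2 where \<rho>2: "0 < \<rho>2" "ball y \<rho>2 \<inter> {z. ?\<nu> \<bullet> (z - y) > 0} \<inter> closure (dom X) = {}"
      by (rule generic_dom_upper[OF bd y])
    define \<delta> where "\<delta> = min \<rho>' \<rho>2"
    have \<delta>: "0 < \<delta>" "ball y \<delta> \<subseteq> ball y \<rho>'" "ball y \<delta> \<subseteq> ball y \<rho>2" using \<rho>' \<rho>2 by (auto simp: \<delta>_def)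
    \<comment> \<open>On a boundary face only the domain has a known outer normal. But interior
      points of \<open>Kplus\<close> accumulate at \<open>y\<close>, cannot all lie on the
      hyperplane and cannot lie ahead of it, so one lies behind it and decides the half
      ball.\<close>
    have "y \<in> closure (interior (Kplus X S))" using y(1) bd_face(3)[OF bd] cell_regular[OF Kp] by blast
    then have ne: "ball y \<delta> \<inter> interior (Kplus X S) \<noteq> {}"
      using \<delta>(1) open_Int_closure_eq_empty[OF open_ball, of y \<delta>] by (metis centre_in_ball disjoint_iff)
    have "negligible {z. ?\<nu> \<bullet> z = ?\<nu> \<bullet> y}" using \<nu> by (intro negligible_hyperplane) auto
    then have "\<not> ball y \<delta> \<inter> interior (Kplus X S) \<subseteq> {z. ?\<nu> \<bullet> z = ?\<nu> \<bullet> y}"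
      using ne open_not_negligible[of "ball y \<delta> \<inter> interior (Kplus X S)"] negligible_subset by blast
    then obtain z where z: "z \<in> ball y \<delta>" "z \<in> interior (Kplus X S)" and "?\<nu> \<bullet> z \<noteq> ?\<nu> \<bullet> y" by blast
    then have z3: "?\<nu> \<bullet> (z - y) \<noteq> 0" by (simp add: inner_diff_right)
    have zK: "z \<in> Kplus X S" using z(2) interior_subset by blast
    then have "z \<in> closure (dom X)" using Kp cells_cover by blast
    then have "\<not> ?\<nu> \<bullet> (z - y) > 0" using \<rho>2(2) \<delta>(3) z(1) by blast
    then have "?\<nu> \<bullet> (z - y) < 0" using z3 by linarith
    then have "c = 1" using lo'[of z] z \<delta>(2) zK by auto
    then show ?thesis using \<rho>' lo' by (intro exI[of _ \<rho>']) (auto simp: indicator_def split: if_splits)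
  qed
  have "b - b' = incidence X K S"
  proof (cases "S \<in> int_faces X")
    case True
    have Km: "Kminus X S \<in> cells X" "Kplus X S \<noteq> Kminus X S" by (rule int_face[OF True])+
    have Kp: "Kplus X S \<in> cells X" by (rule int_face(2)[OF True])
    have op: "outer_point (Kplus X S) ?\<nu> y" "outer_point (Kminus X S) (- ?\<nu>) y"
      using y(2) True by (simp_all add: generic_point_def)
    consider "K = Kplus X S" | "K = Kminus X S" | "K \<noteq> Kplus X S" "K \<noteq> Kminus X S" by blast
    then show ?thesis
    proof cases
      case 1
      have "b = 1" "b' = 0" using outer_point_values[OF op(1)[folded 1] \<nu> \<rho> lo up] by blast+
      then show ?thesis using 1 by (simp add: incidence_def)
    next
      case 2
      have "b' = 1" "b = 0"
        using outer_point_values[OF op(2)[folded 2] _ \<rho>, of b' b] up lo \<nu> by auto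
      then show ?thesis using 2 Km True by (simp add: incidence_def)
    next
      case 3
      have "b = 0" using plus_lo no_lo[OF Kp 3(1)] by blast
      moreover obtain \<rho>' c c' where \<rho>': "0 < \<rho>'"
        and lo': "\<And>z. z \<in> ball y \<rho>' \<Longrightarrow> ?\<nu> \<bullet> (z - y) < 0 \<Longrightarrow> indicat_real (Kminus X S) z = c"
        and up': "\<And>z. z \<in> ball y \<rho>' \<Longrightarrow> ?\<nu> \<bullet> (z - y) > 0 \<Longrightarrow> indicat_real (Kminus X S) z = c'"
        by (rule generic_half_balls[OF S y cell_frontier[OF Km(1)]], blast)
      have "c' = 1"
        using outer_point_values(1)[OF op(2) _ \<rho>', of c' c] up' lo' \<nu> by auto
      then have "ball y \<rho>' \<inter> {z. ?\<nu> \<bullet> (z - y) > 0} \<subseteq> Kminus X S"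
        using up' by (auto simp: indicator_def split: if_splits)
      then have "b' = 0" by (rule no_up[OF Km(1) 3(2) \<rho>'])
      ultimately show ?thesis using 3 by (simp add: incidence_def)
    qed
  next
    case False
    then have bd: "S \<in> bd_faces X" using S faces_int_bd by blast
    have Kp: "Kplus X S \<in> cells X" by (rule bd_face(2)[OF bd])
    obtain \<rho>2 where \<rho>2: "0 < \<rho>2" "ball y \<rho>2 \<inter> {z. ?\<nu> \<bullet> (z - y) > 0} \<inter> closure (dom X) = {}"
      by (rule generic_dom_upper[OF bd y])
    define \<delta> where "\<delta> = min \<rho> \<rho>2"
    have \<delta>: "0 < \<delta>" "ball y \<delta> \<subseteq> ball y \<rho>" "ball y \<delta> \<subseteq> ball y \<rho>2" using \<rho> \<rho>2 by (auto simp: \<delta>_def)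
    let ?z = "y + (\<delta> / 2) *\<^sub>R ?\<nu>"
    have z: "?z \<in> ball y \<delta>" "?\<nu> \<bullet> (?z - y) > 0" using half_ball_point(2)[OF \<nu> \<delta>(1), of y] by auto
    then have "?z \<notin> K" using \<rho>2(2) \<delta>(3) K cells_cover by blast
    then have b': "b' = 0" using up[of ?z] z \<delta>(2) by auto
    show ?thesis
    proof (cases "K = Kplus X S")
      case True
      obtain \<rho>' where \<rho>': "0 < \<rho>'" "ball y \<rho>' \<inter> {z. ?\<nu> \<bullet> (z - y) < 0} \<subseteq> K" using plus_lo True by blast
      define \<eta> where "\<eta> = min \<rho> \<rho>'"
      have \<eta>: "0 < \<eta>" "ball y \<eta> \<subseteq> ball y \<rho>" "ball y \<eta> \<subseteq> ball y \<rho>'" using \<rho> \<rho>' by (auto simp: \<eta>_def)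
      have "y - (\<eta> / 2) *\<^sub>R ?\<nu> \<in> ball y \<eta> \<inter> {z. ?\<nu> \<bullet> (z - y) < 0}" by (rule half_ball_point(1)[OF \<nu> \<eta>(1)])
      then have w: "y - (\<eta> / 2) *\<^sub>R ?\<nu> \<in> ball y \<rho>" "?\<nu> \<bullet> (y - (\<eta> / 2) *\<^sub>R ?\<nu> - y) < 0" "y - (\<eta> / 2) *\<^sub>R ?\<nu> \<in> K"
        using \<eta> \<rho>'(2) by blast+
      then have "b = 1" using lo[OF w(1,2)] by simp
      then show ?thesis using True b' by (simp add: incidence_def)
    next
      case neq: False
      have "b = 0" using plus_lo no_lo[OF Kp neq] by blast
      then show ?thesis using neq b' False by (simp add: incidence_def)
    qed
  qed
  then have "\<forall>\<^sub>F z in nhds y. (?\<nu> \<bullet> (z - y) < 0 \<longrightarrow> indicat_real K z = b) \<and> (?\<nu> \<bullet> (z - y) > 0 \<longrightarrow> indicat_real K z = b - incidence X K S)"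
    unfolding eventually_nhds_metric using \<rho> lo up by (intro exI[of _ \<rho>]) (auto simp: dist_commute)
  then show ?thesis unfolding has_jump_def by blast
qed

lemma cell_face_system:
  assumes K: "K \<in> cells X"
  shows "face_system K (faces X) (nrm X) (plane_const X) (incidence X K) (\<lambda>S. S)"
  unfolding face_system_def
proof (intro conjI ballI)
  fix S assume S: "S \<in> faces X"
  show "face_AE (nrm X S) (plane_const X S) S
      (\<lambda>y. (\<forall>j\<in>faces X. y \<in> j \<longrightarrow> j = S) \<and> has_jump (indicat_real K) (nrm X S) (incidence X K S) y)"
    by (rule face_AE_mp[OF face_AE_generic[OF S]])
       (use generic_cell_jump[OF S _ _ K] in \<open>auto simp: generic_point_def\<close>)
qed (use finite_faces cell_compact[OF K] cell_frontier[OF K] face_compact face_nonempty face_norm face_plane in auto)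

text \<open>Rewriting jumps as signed sums over cells lets face sums be exchanged with cell
  sums.\<close>

lemma jump_eq_sum:
  fixes v :: "('n, 'b::real_vector) pieces"
  assumes S: "S \<in> faces X"
  shows "jump X v S x = (\<Sum>K\<in>cells X. incidence X K S *\<^sub>R v K x)"
proof (cases "S \<in> int_faces X")
  case True
  note f = int_face[OF True]
  have "(\<Sum>K\<in>cells X. incidence X K S *\<^sub>R v K x) = (\<Sum>K\<in>{Kplus X S, Kminus X S}. incidence X K S *\<^sub>R v K x)"
    by (rule sum.mono_neutral_right) (use finite_cells f in \<open>auto simp: incidence_def\<close>)
  then show ?thesis using True f by (simp add: jump_def incidence_def)
next
  case False
  then have bd: "S \<in> bd_faces X" using S faces_int_bd by blast
  have "(\<Sum>K\<in>cells X. incidence X K S *\<^sub>R v K x) = (\<Sum>K\<in>{Kplus X S}. incidence X K S *\<^sub>R v K x)"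
    by (rule sum.mono_neutral_right) (use finite_cells bd_face[OF bd] False in \<open>auto simp: incidence_def\<close>)
  then show ?thesis using False by (simp add: jump_def incidence_def)
qed

lemma glue_cells:
  fixes v :: "('n, 'b) pieces"
  assumes "K \<in> cells X"
  shows "AE x in lebesgue_on K. glue (cells X) v x = v K x"
proof -
  have "AE x in lebesgue. \<forall>K'\<in>cells X. K' \<noteq> K \<longrightarrow> x \<notin> K \<inter> K'"
    using finite_cells cell_overlap[OF assms]
    by (intro AE_finite_allI AE_impI AE_not_in) (auto simp: negligible_iff_null_sets)
  then have "AE x in lebesgue. x \<in> K \<longrightarrow> glue (cells X) v x = v K x"
  proof eventually_elim
    case (elim x)
    show ?case
    proof
      assume "x \<in> K"
      then have "(SOME A. A \<in> cells X \<and> x \<in> A) = K" using elim assms by (intro some_equality) auto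
      then show "glue (cells X) v x = v K x" by (simp add: glue_def)
    qed
  qed
  then show ?thesis using cell_sets[OF assms] by (simp add: AE_restrict_space_iff)
qed

lemma dom_negligible: "negligible (\<Union>(cells X) - dom X)"
proof -
  have "negligible (frontier (dom X))"
  proof (rule negligible_subset[OF _ dom_frontier], rule negligible_Union[OF finite_faces])
    fix S assume S: "S \<in> faces X"
    have "nrm X S \<noteq> 0" using face_norm[OF S] by auto
    then have "negligible {x. nrm X S \<bullet> x = plane_const X S}" by (intro negligible_hyperplane) auto
    then show "negligible S" by (rule negligible_subset) (use face_plane[OF S] in auto)
  qed
  then show ?thesis
    unfolding cells_cover using dom_open by (simp add: frontier_def interior_open)
qed

lemma vol_int_cells:
  assumes int: "\<And>K. K \<in> cells X \<Longrightarrow> integrable (lebesgue_on K) (G K)"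
    and eq: "\<And>K. K \<in> cells X \<Longrightarrow> AE x in lebesgue_on K. F x = G K x"
  shows "integrable (lebesgue_on (dom X)) F" "vol_int X F = (\<Sum>K\<in>cells X. integral\<^sup>L (lebesgue_on K) (G K))"
proof -
  note dom_negligible
  moreover have "dom X - \<Union>(cells X) = {}" unfolding cells_cover using closure_subset by blast
  ultimately show "integrable (lebesgue_on (dom X)) F" "vol_int X F = (\<Sum>K\<in>cells X. integral\<^sup>L (lebesgue_on K) (G K))"
    using integral_partition[OF finite_cells cell_sets _ cell_overlap _ _ int eq, of "dom X"] dom_open
    by auto
qed

end


section \<open>The discrete divergence\<close>

lemma integrable_inner_compact:
  fixes f \<phi> :: "'a::euclidean_space \<Rightarrow> 'b::euclidean_space"
  assumes f: "integrable (lebesgue_on K) f" and K: "compact K" and \<phi>: "continuous_on UNIV \<phi>"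
  shows "integrable (lebesgue_on K) (\<lambda>x. f x \<bullet> \<phi> x)"
proof -
  obtain B where B: "\<And>x. x \<in> K \<Longrightarrow> norm (\<phi> x) \<le> B"
    by (rule compact_continuous_bound[OF K \<phi>], blast)
  have mf: "f \<in> borel_measurable (lebesgue_on K)" using f by (rule borel_measurable_integrable)
  have m\<phi>: "\<phi> \<in> borel_measurable (lebesgue_on K)"
    by (intro measurable_restrict_space1 measurable_completion) (use \<phi> borel_measurable_continuous_onI in auto)
  show ?thesis
  proof (rule Bochner_Integration.integrable_bound)
    show "integrable (lebesgue_on K) (\<lambda>x. norm (f x) * B)" using f by simp
    show "(\<lambda>x. f x \<bullet> \<phi> x) \<in> borel_measurable (lebesgue_on K)" using mf m\<phi> by (rule borel_measurable_inner)
    have "norm (f x \<bullet> \<phi> x) \<le> norm (norm (f x) * B)" if "x \<in> K" for x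
    proof -
      have "\<bar>f x \<bullet> \<phi> x\<bar> \<le> norm (f x) * norm (\<phi> x)" by (rule Cauchy_Schwarz_ineq2)
      also have "\<dots> \<le> norm (f x) * B" using B that by (intro mult_left_mono) auto
      finally show ?thesis by simp
    qed
    then show "AE x in lebesgue_on K. norm (f x \<bullet> \<phi> x) \<le> norm (norm (f x) * B)"
      by (intro AE_I2) simp
  qed
qed

lemma continuous_matrix_vector_mult_left:
  fixes \<tau> :: "'a::topological_space \<Rightarrow> real^'n^'m"
  shows "continuous_on A \<tau> \<Longrightarrow> continuous_on A (\<lambda>x. \<tau> x *v \<nu>)"
  unfolding matrix_vector_mult_def by (intro continuous_on_vec_lambda continuous_on_sum continuous_on_mult continuous_on_component continuous_on_const)

lemma linear_matrix_vector_mult_left: "linear (\<lambda>A :: real^'n::finite^'m::finite. A *v \<nu>)"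
  by (rule linearI) (auto simp: matrix_vector_mult_add_rdistrib scaleR_matrix_vector_assoc)

lemma row_div_add: "C1 f \<Longrightarrow> C1 g \<Longrightarrow> row_div (\<lambda>x. f x + g x) x = row_div f x + row_div g x"
  by (simp add: row_div_def vec_eq_iff partial_deriv_add sum.distrib)

lemma row_div_scaleR: "C1 f \<Longrightarrow> row_div (\<lambda>x. c *\<^sub>R f x) x = c *\<^sub>R row_div f x"
  by (simp add: row_div_def vec_eq_iff partial_deriv_linear[OF bounded_linear_scaleR_right] sum_distrib_left)

context poly_mesh
begin

lemma cell_integrates: "K \<in> cells X \<Longrightarrow> integrates_continuous (lebesgue_on K)"
  by (intro integrates_continuous_lebesgue_on cell_compact)

lemma face_integrates: "S \<in> faces X \<Longrightarrow> integrates_continuous (surf (nrm X S) S)"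
  by (rule integrates_continuous_surf[OF face_compact face_nonempty face_plane face_norm])

text \<open>The nonzero set is open in the interior, hence empty there, and a cell is the closure of
  its interior. Thus vanishing almost everywhere on a cell also forces zero traces on its
  faces.\<close>

lemma cell_AE_zero:
  fixes f :: "real^'n \<Rightarrow> 'b::euclidean_space"
  assumes K: "K \<in> cells X" and f: "continuous_on UNIV f" and ae: "AE x in lebesgue_on K. f x = 0" and x: "x \<in> K"
  shows "f x = 0"
proof -
  have "AE x in lebesgue. x \<in> K \<longrightarrow> f x = 0"
    using ae cell_sets[OF K] by (simp add: AE_restrict_space_iff)
  then obtain N where N: "{x. \<not> (x \<in> K \<longrightarrow> f x = 0)} \<subseteq> N" "negligible N"
    by (auto simp: eventually_ae_filter negligible_iff_null_sets)
  let ?U = "interior K \<inter> {x. f x \<noteq> 0}"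
  have "open ?U" by (intro open_Int open_interior open_Collect_neq f continuous_on_const)
  moreover have "?U \<subseteq> N" using N(1) interior_subset by blast
  ultimately have "?U = {}" using N(2) negligible_subset open_not_negligible by blast
  then have "interior K \<subseteq> {x. f x = 0}" by blast
  moreover have "closed {x. f x = 0}" by (intro closed_Collect_eq f continuous_on_const)
  ultimately have "closure (interior K) \<subseteq> {x. f x = 0}" by (rule closure_minimal)
  then show ?thesis using x cell_regular[OF K] by blast
qed

lemma cell_polys_eqI:
  fixes p q :: "real^'n \<Rightarrow> 'b::euclidean_space"
  assumes K: "K \<in> cells X" and p: "p \<in> polys k" and q: "q \<in> polys k"
    and eq: "\<And>\<phi>. \<phi> \<in> polys k \<Longrightarrow> (LINT x|lebesgue_on K. p x \<bullet> \<phi> x) = (LINT x|lebesgue_on K. q x \<bullet> \<phi> x)"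
    and x: "x \<in> K"
  shows "p x = q x"
proof -
  let ?d = "\<lambda>x. p x - q x"
  have d: "?d \<in> polys k" by (rule polys_diff[OF p q])
  note ic = integrable_inner_continuous[OF cell_integrates[OF K]]
  have ints: "integrable (lebesgue_on K) (\<lambda>x. p x \<bullet> ?d x)" "integrable (lebesgue_on K) (\<lambda>x. q x \<bullet> ?d x)"
    by (intro ic continuous_polys[OF p] continuous_polys[OF q] continuous_polys[OF d])+
  have "(LINT x|lebesgue_on K. ?d x \<bullet> ?d x) = 0"
    using eq[OF d] ints by (simp add: inner_diff_left)
  moreover have "integrable (lebesgue_on K) (\<lambda>x. ?d x \<bullet> ?d x)"
    by (intro ic continuous_polys[OF d])
  ultimately have "AE x in lebesgue_on K. ?d x \<bullet> ?d x = 0"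
    by (subst (asm) integral_nonneg_eq_0_iff_AE) auto
  then have "AE x in lebesgue_on K. ?d x = 0" by simp
  from cell_AE_zero[OF K continuous_polys[OF d] this x] show ?thesis by simp
qed

lemma incidence_subset: "S \<in> faces X \<Longrightarrow> K \<in> cells X \<Longrightarrow> incidence X K S \<noteq> 0 \<Longrightarrow> S \<subseteq> K"
  using int_face(7,8)[of S] bd_face(3)[of S] faces_int_bd by (auto simp: incidence_def split: if_splits)

lemma vol_int_glue:
  fixes a b :: "('n, 'b::euclidean_space) pieces"
  assumes "\<And>K. K \<in> cells X \<Longrightarrow> continuous_on UNIV (a K)" "\<And>K. K \<in> cells X \<Longrightarrow> continuous_on UNIV (b K)"
  shows "vol_int X (\<lambda>x. glue (cells X) a x \<bullet> glue (cells X) b x) = (\<Sum>K\<in>cells X. LINT x|lebesgue_on K. a K x \<bullet> b K x)"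
proof (rule vol_int_cells(2))
  fix K assume K: "K \<in> cells X"
  show "integrable (lebesgue_on K) (\<lambda>x. a K x \<bullet> b K x)"
    by (intro integrable_inner_continuous cell_integrates K assms)
  show "AE x in lebesgue_on K. glue (cells X) a x \<bullet> glue (cells X) b x = a K x \<bullet> b K x"
    using glue_cells[OF K, of a] glue_cells[OF K, of b] by eventually_elim simp
qed

lemma face_int_jump:
  fixes w :: "real^'n \<Rightarrow> 'b::euclidean_space" and v :: "('n, 'b) pieces"
  assumes S: "S \<in> faces X" and w: "continuous_on UNIV w" and v: "\<And>K. K \<in> cells X \<Longrightarrow> continuous_on UNIV (v K)"
  shows "face_int X S (\<lambda>x. w x \<bullet> jump X v S x) = (\<Sum>K\<in>cells X. incidence X K S * face_int X S (\<lambda>x. w x \<bullet> v K x))"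
proof -
  have "integrable (surf (nrm X S) S) (\<lambda>x. w x \<bullet> v K x)" if "K \<in> cells X" for K
    by (intro integrable_inner_continuous face_integrates S w v that)
  then show ?thesis
    by (simp add: jump_eq_sum[OF S] inner_sum_right Bochner_Integration.integral_sum)
qed

lemma cell_gauss_green:
  fixes \<phi> :: "real^'n \<Rightarrow> real^'m::finite" and \<tau> :: "real^'n \<Rightarrow> real^'n^'m"
  assumes "K \<in> cells X" "C1 \<phi>" "C1 \<tau>"
  shows "(LINT x|lebesgue_on K. \<phi> x \<bullet> row_div \<tau> x) = - (LINT x|lebesgue_on K. Jac \<phi> x \<bullet> \<tau> x)
     + (\<Sum>S\<in>faces X. incidence X K S * face_int X S (\<lambda>x. \<phi> x \<bullet> (\<tau> x *v nrm X S)))"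
  by (rule gauss_green_matrix[OF cell_face_system[OF assms(1)] assms(2,3)])

section \<open>The discrete gradient, cell by cell\<close>

lemma V_h_polys:
  assumes "v \<in> V_h k X"
  shows "K \<in> cells X \<Longrightarrow> fst v K \<in> polys (k + 1)" "S \<in> faces X \<Longrightarrow> snd v S \<in> polys k"
  using assms by (auto simp: V_h_def pw_polys_def mem_Times_iff)

text \<open>The share of one cell in the functional that defines \<open>D_h\<close>; the jump is
  distributed by \<open>incidence\<close>.\<close>

definition D_functional :: "('n, real^'m::finite) pieces \<times> ('n, real^'m) pieces \<Rightarrow> (real^'n) set \<Rightarrow> (real^'n \<Rightarrow> real^'n^'m) \<Rightarrow> real" where
  "D_functional v K \<tau> = - (LINT x|lebesgue_on K. fst v K x \<bullet> row_div \<tau> x)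
     + (\<Sum>S\<in>faces X. incidence X K S * face_int X S (\<lambda>x. snd v S x \<bullet> (\<tau> x *v nrm X S)))"

lemma D_functional_sum:
  fixes v :: "('n, real^'m::finite) pieces \<times> ('n, real^'m) pieces"
  assumes v: "v \<in> V_h k X" and \<tau>: "\<tau> \<in> pw_polys k (cells X)"
  shows "- vol_int X (\<lambda>x. glue (cells X) (fst v) x \<bullet> glue (cells X) (\<lambda>K. row_div (\<tau> K)) x)
        + (\<Sum>S\<in>faces X. face_int X S (\<lambda>x. snd v S x \<bullet> jump X (\<lambda>K y. \<tau> K y *v nrm X S) S x))
    = (\<Sum>K\<in>cells X. D_functional v K (\<tau> K))"
proof -
  have vK: "continuous_on UNIV (fst v K)" if "K \<in> cells X" for K
    by (rule continuous_polys, rule V_h_polys(1)[OF v that])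
  have vS: "continuous_on UNIV (snd v S)" if "S \<in> faces X" for S
    by (rule continuous_polys, rule V_h_polys(2)[OF v that])
  have \<tau>C: "C1 (\<tau> K)" if "K \<in> cells X" for K
    using \<tau> that by (auto simp: pw_polys_def intro: C1_polys)
  have "(\<Sum>S\<in>faces X. face_int X S (\<lambda>x. snd v S x \<bullet> jump X (\<lambda>K y. \<tau> K y *v nrm X S) S x))
    = (\<Sum>S\<in>faces X. \<Sum>K\<in>cells X. incidence X K S * face_int X S (\<lambda>x. snd v S x \<bullet> (\<tau> K x *v nrm X S)))"
    by (intro sum.cong refl face_int_jump vS continuous_matrix_vector_mult_left C1_continuous \<tau>C)
  also have "\<dots> = (\<Sum>K\<in>cells X. \<Sum>S\<in>faces X. incidence X K S * face_int X S (\<lambda>x. snd v S x \<bullet> (\<tau> K x *v nrm X S)))"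
    by (rule sum.swap)
  finally show ?thesis
    by (simp add: vol_int_glue vK continuous_row_div \<tau>C D_functional_def sum.distrib sum_negf sum_subtractf)
qed

text \<open>The delicate point is that the functional ignores polynomials vanishing almost
  everywhere on the cell. Integration by parts moves the derivative onto \<open>fst v K\<close>, so
  only values of \<open>f\<close> on the cell and its faces remain, and they are zero.\<close>

lemma D_functional_riesz:
  fixes v :: "('n, real^'m::finite) pieces \<times> ('n, real^'m) pieces"
  assumes v: "v \<in> V_h k X" and K: "K \<in> cells X"
  shows "\<exists>G\<in>polys k. \<forall>\<tau>\<in>polys k. (LINT x|lebesgue_on K. G x \<bullet> \<tau> x) = D_functional v K \<tau>"
proof (rule riesz_polys[OF cell_integrates[OF K]])
  have vC: "C1 (fst v K)"
    by (rule C1_polys, rule V_h_polys(1)[OF v K])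
  have vS: "continuous_on UNIV (snd v S)" if "S \<in> faces X" for S
    by (rule continuous_polys, rule V_h_polys(2)[OF v that])
  have i1: "integrable (lebesgue_on K) (\<lambda>x. fst v K x \<bullet> row_div \<tau> x)" if "C1 \<tau>" for \<tau> :: "real^'n \<Rightarrow> real^'n^'m"
    by (intro integrable_inner_continuous cell_integrates K C1_continuous vC continuous_row_div that)
  have i2: "integrable (surf (nrm X S) S) (\<lambda>x. snd v S x \<bullet> (\<tau> x *v nrm X S))"
    if "C1 \<tau>" "S \<in> faces X" for \<tau> :: "real^'n \<Rightarrow> real^'n^'m" and S
    by (intro integrable_inner_continuous face_integrates vS continuous_matrix_vector_mult_left C1_continuous that)
  show "D_functional v K (\<lambda>x. f x + g x) = D_functional v K f + D_functional v K g"
    if "f \<in> polys k" "g \<in> polys k" for f g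
    using C1_polys[OF that(1)] C1_polys[OF that(2)] i1 i2
    by (simp add: D_functional_def row_div_add matrix_vector_mult_add_rdistrib inner_add_right sum.distrib distrib_left)
  show "D_functional v K (\<lambda>x. c *\<^sub>R f x) = c * D_functional v K f" if "f \<in> polys k" for f c
    using C1_polys[OF that]
    by (simp add: D_functional_def row_div_scaleR scaleR_matrix_vector_assoc[symmetric] sum_distrib_left distrib_left algebra_simps)
  show "D_functional v K f = 0" if f: "f \<in> polys k" and ae: "AE x in lebesgue_on K. f x = 0" for f
  proof -
    have z: "f x = 0" if "x \<in> K" for x by (rule cell_AE_zero[OF K continuous_polys[OF f] ae that])
    have 1: "(LINT x|lebesgue_on K. Jac (fst v K) x \<bullet> f x) = (LINT x|lebesgue_on K. 0)"
      by (rule Bochner_Integration.integral_cong) (use z in auto)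
    have 2: "incidence X K S * face_int X S (\<lambda>x. w x \<bullet> (f x *v nrm X S)) = 0" if "S \<in> faces X" for S and w :: "real^'n \<Rightarrow> real^'m"
    proof (cases "incidence X K S = 0")
      case False
      then have "face_int X S (\<lambda>x. w x \<bullet> (f x *v nrm X S)) = face_int X S (\<lambda>x. 0)"
        by (intro Bochner_Integration.integral_cong) (use z incidence_subset[OF that K False] in auto)
      then show ?thesis by simp
    qed simp
    show ?thesis unfolding D_functional_def cell_gauss_green[OF K vC C1_polys[OF f]]
      using 1 by (simp only: sum.neutral[OF ballI, OF 2]) simp
  qed
qed

lemma D_h_spec:
  fixes v :: "('n, real^'m::finite) pieces \<times> ('n, real^'m) pieces"
  assumes v: "v \<in> V_h k X"
  shows "D_h k X v \<in> pw_polys k (cells X)"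
    and "\<tau> \<in> pw_polys k (cells X) \<Longrightarrow>
      (\<Sum>K\<in>cells X. LINT x|lebesgue_on K. D_h k X v K x \<bullet> \<tau> K x) = (\<Sum>K\<in>cells X. D_functional v K (\<tau> K))"
proof -
  have cont: "continuous_on UNIV (\<tau> K)" if "\<tau> \<in> pw_polys k (cells X)" "K \<in> cells X" for K and \<tau> :: "('n, real^'n^'m) pieces"
    using that by (auto simp: pw_polys_def intro: continuous_polys)
  have "\<forall>K\<in>cells X. \<exists>G. G \<in> polys k \<and> (\<forall>\<tau>\<in>polys k. (LINT x|lebesgue_on K. G x \<bullet> \<tau> x) = D_functional v K \<tau>)"
    using D_functional_riesz[OF v] by blast
  from bchoice[OF this] obtain G where G: "\<And>K. K \<in> cells X \<Longrightarrow> G K \<in> polys k"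
    "\<And>K \<tau>. K \<in> cells X \<Longrightarrow> \<tau> \<in> polys k \<Longrightarrow> (LINT x|lebesgue_on K. G K x \<bullet> \<tau> x) = D_functional v K \<tau>"
    by blast
  let ?P = "\<lambda>G. G \<in> pw_polys k (cells X) \<and>
     (\<forall>\<tau>\<in>pw_polys k (cells X).
        vol_int X (\<lambda>x. glue (cells X) G x \<bullet> glue (cells X) \<tau> x) =
        - vol_int X (\<lambda>x. glue (cells X) (fst v) x \<bullet> glue (cells X) (\<lambda>K. row_div (\<tau> K)) x)
        + (\<Sum>S\<in>faces X. face_int X S (\<lambda>x. snd v S x \<bullet> jump X (\<lambda>K y. \<tau> K y *v nrm X S) S x)))"
  have "?P G"
  proof (intro conjI ballI)
    show Gp: "G \<in> pw_polys k (cells X)" using G by (simp add: pw_polys_def)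
    fix \<tau> :: "('n, real^'n^'m) pieces" assume \<tau>: "\<tau> \<in> pw_polys k (cells X)"
    have "vol_int X (\<lambda>x. glue (cells X) G x \<bullet> glue (cells X) \<tau> x) = (\<Sum>K\<in>cells X. LINT x|lebesgue_on K. G K x \<bullet> \<tau> K x)"
      by (rule vol_int_glue) (use cont Gp \<tau> in blast)+
    also have "\<dots> = (\<Sum>K\<in>cells X. D_functional v K (\<tau> K))"
      using \<tau> by (intro sum.cong refl G) (auto simp: pw_polys_def)
    finally have "vol_int X (\<lambda>x. glue (cells X) G x \<bullet> glue (cells X) \<tau> x) = (\<Sum>K\<in>cells X. D_functional v K (\<tau> K))" .
    then show "vol_int X (\<lambda>x. glue (cells X) G x \<bullet> glue (cells X) \<tau> x) =
        - vol_int X (\<lambda>x. glue (cells X) (fst v) x \<bullet> glue (cells X) (\<lambda>K. row_div (\<tau> K)) x)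
        + (\<Sum>S\<in>faces X. face_int X S (\<lambda>x. snd v S x \<bullet> jump X (\<lambda>K y. \<tau> K y *v nrm X S) S x))"
      by (simp only: D_functional_sum[OF v \<tau>])
  qed
  then have P: "?P (D_h k X v)" unfolding D_h_def by (rule someI[of ?P])
  then show Dp: "D_h k X v \<in> pw_polys k (cells X)" by blast
  assume \<tau>: "\<tau> \<in> pw_polys k (cells X)"
  have "vol_int X (\<lambda>x. glue (cells X) (D_h k X v) x \<bullet> glue (cells X) \<tau> x) =
        - vol_int X (\<lambda>x. glue (cells X) (fst v) x \<bullet> glue (cells X) (\<lambda>K. row_div (\<tau> K)) x)
        + (\<Sum>S\<in>faces X. face_int X S (\<lambda>x. snd v S x \<bullet> jump X (\<lambda>K y. \<tau> K y *v nrm X S) S x))"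
    using P \<tau> by blast
  then show "(\<Sum>K\<in>cells X. LINT x|lebesgue_on K. D_h k X v K x \<bullet> \<tau> K x) = (\<Sum>K\<in>cells X. D_functional v K (\<tau> K))"
    unfolding D_functional_sum[OF v \<tau>] using vol_int_glue[of "D_h k X v" \<tau>] cont Dp \<tau> by simp
qed

section \<open>Projections and the stabilization\<close>

lemma pw_proj_spec:
  fixes f :: "real^'n \<Rightarrow> 'b::euclidean_space"
  assumes K: "K \<in> cells X" and f: "\<And>\<phi>. \<phi> \<in> polys k \<Longrightarrow> integrable (lebesgue_on K) (\<lambda>x. f x \<bullet> \<phi> x)"
  shows "pw_proj k f K \<in> polys k"
    and "\<phi> \<in> polys k \<Longrightarrow> (LINT x|lebesgue_on K. pw_proj k f K x \<bullet> \<phi> x) = (LINT x|lebesgue_on K. f x \<bullet> \<phi> x)"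
  unfolding pw_proj_def using L2_proj_spec[OF cell_integrates[OF K] f] by blast+

lemma integrable_cell_cong_AE:
  fixes F G :: "real^'n \<Rightarrow> real"
  assumes K: "K \<in> cells X" and G: "integrable (lebesgue_on K) G" and eq: "AE x in lebesgue_on K. F x = G x"
  shows "integrable (lebesgue_on K) F" "integral\<^sup>L (lebesgue_on K) F = integral\<^sup>L (lebesgue_on K) G"
  using integral_partition[of "{K}" K "\<lambda>_. G" F] cell_sets[OF K] G eq by auto

lemma pw_proj_poly:
  fixes p f :: "real^'n \<Rightarrow> 'b::euclidean_space"
  assumes K: "K \<in> cells X" and p: "p \<in> polys k" and eq: "AE x in lebesgue_on K. f x = p x" and x: "x \<in> K"
  shows "pw_proj k f K x = p x"
proof -
  have pi: "integrable (lebesgue_on K) (\<lambda>x. p x \<bullet> \<phi> x)" if "\<phi> \<in> polys k" for \<phi>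
    by (intro integrable_inner_continuous cell_integrates K continuous_polys[OF p] continuous_polys[OF that])
  have ae: "AE x in lebesgue_on K. f x \<bullet> \<phi> x = p x \<bullet> \<phi> x" for \<phi>
    using eq by eventually_elim simp
  note fi = integrable_cell_cong_AE[OF K pi ae]
  show ?thesis
  proof (rule cell_polys_eqI[OF K _ p _ x])
    show "pw_proj k f K \<in> polys k" using pw_proj_spec(1)[OF K fi(1)] .
    show "(LINT x|lebesgue_on K. pw_proj k f K x \<bullet> \<phi> x) = (LINT x|lebesgue_on K. p x \<bullet> \<phi> x)" if "\<phi> \<in> polys k" for \<phi>
      using pw_proj_spec(2)[OF K fi(1) that] fi(2)[OF that] by simp
  qed
qed

lemma integrable_on_cell:
  fixes f :: "real^'n \<Rightarrow> 'b::euclidean_space"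
  assumes "integrable (lebesgue_on (dom X)) f" "K \<in> cells X"
  shows "integrable (lebesgue_on K) f"
  by (rule integrable_lebesgue_on_subset[OF assms(1)])
     (use dom_open cell_sets[OF assms(2)] dom_negligible assms(2) in \<open>auto intro: negligible_subset\<close>)

lemma face_proj_spec:
  fixes f :: "real^'n \<Rightarrow> 'b::euclidean_space"
  assumes S: "S \<in> faces X" and f: "\<And>\<phi>. \<phi> \<in> polys k \<Longrightarrow> integrable (surf (nrm X S) S) (\<lambda>x. f x \<bullet> \<phi> x)"
  shows "face_proj X k S f \<in> polys k"
    and "\<phi> \<in> polys k \<Longrightarrow> face_int X S (\<lambda>x. face_proj X k S f x \<bullet> \<phi> x) = face_int X S (\<lambda>x. f x \<bullet> \<phi> x)"
  unfolding face_proj_def using L2_proj_spec[OF face_integrates[OF S] f] by blast+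

lemma face_proj_continuous:
  fixes f :: "real^'n \<Rightarrow> 'b::euclidean_space"
  assumes S: "S \<in> faces X" and f: "continuous_on UNIV f"
  shows "face_proj X k S f \<in> polys k"
    and "\<phi> \<in> polys k \<Longrightarrow> face_int X S (\<lambda>x. face_proj X k S f x \<bullet> \<phi> x) = face_int X S (\<lambda>x. f x \<bullet> \<phi> x)"
proof -
  have "integrable (surf (nrm X S) S) (\<lambda>x. f x \<bullet> \<phi> x)" if "\<phi> \<in> polys k" for \<phi>
    by (intro integrable_inner_continuous face_integrates S f continuous_polys[OF that])
  from face_proj_spec[OF S this]
  show "face_proj X k S f \<in> polys k"
    "\<phi> \<in> polys k \<Longrightarrow> face_int X S (\<lambda>x. face_proj X k S f x \<bullet> \<phi> x) = face_int X S (\<lambda>x. f x \<bullet> \<phi> x)" by blast+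
qed

text \<open>For \<open>r < 2\<close> the factor \<open>norm (w x) powr (r - 2)\<close> may blow up
  near zeros of \<open>w\<close>, but the whole vector has norm
  \<open>norm (w x) powr (r - 1)\<close>, which is bounded as \<open>r > 1\<close>. At zeros of
  \<open>w\<close> both are 0, since \<open>powr\<close> maps base 0 to 0.\<close>

lemma T_stab_polys:
  fixes u :: "('n, real^'m::finite) pieces \<times> ('n, real^'m) pieces"
  assumes S: "S \<in> faces X" and K: "K \<in> cells X" and u: "u \<in> V_h k X" and r: "1 < r"
  shows "T_stab k r X K S u \<in> polys k"
proof -
  have uK: "continuous_on UNIV (fst u K)" and uS: "snd u S \<in> polys k"
    using continuous_polys[OF V_h_polys(1)[OF u K]] V_h_polys(2)[OF u S] by auto
  define w where "w x = snd u S x - face_proj X k S (fst u K) x" for x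
  have w: "continuous_on UNIV w"
    unfolding w_def[abs_def] by (rule continuous_polys[of _ k]) (intro polys_diff uS face_proj_continuous(1)[OF S uK])
  then have wm[measurable]: "w \<in> borel_measurable borel" by (rule borel_measurable_continuous_onI)
  let ?f = "\<lambda>x. norm (w x) powr (r - 2) *\<^sub>R w x"
  obtain B where B: "\<And>x. x \<in> S \<Longrightarrow> norm (w x) \<le> B"
    by (rule compact_continuous_bound[OF face_compact[OF S] w], blast)
  have "integrable (surf (nrm X S) S) (\<lambda>x. ?f x \<bullet> \<phi> x)" if \<phi>: "\<phi> \<in> polys k" for \<phi>
  proof -
    have \<phi>c: "continuous_on UNIV \<phi>" by (rule continuous_polys[OF \<phi>])
    then have [measurable]: "\<phi> \<in> borel_measurable borel" by (rule borel_measurable_continuous_onI)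
    obtain B' where B': "\<And>x. x \<in> S \<Longrightarrow> norm (\<phi> x) \<le> B'"
      by (rule compact_continuous_bound[OF face_compact[OF S] \<phi>c], blast)
    show ?thesis
    proof (rule surf_integrable_bounded[OF face_compact[OF S] face_nonempty[OF S] face_plane[OF S] face_norm[OF S]])
      show "(\<lambda>x. ?f x \<bullet> \<phi> x) \<in> borel_measurable borel" by measurable
      fix x assume x: "x \<in> S"
      have "norm (?f x) = norm (w x) powr (r - 1)"
      proof (cases "w x = 0")
        case False
        then have "norm (w x) powr (r - 2) * norm (w x) powr 1 = norm (w x) powr (r - 1)"
          by (simp only: powr_add[symmetric]) simp
        then show ?thesis using False by simp
      qed simp
      also have "\<dots> \<le> B powr (r - 1)" using B x r by (intro powr_mono2) auto
      finally have "norm (?f x) * norm (\<phi> x) \<le> B powr (r - 1) * B'" using B' x by (intro mult_mono) auto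
      then show "\<bar>?f x \<bullet> \<phi> x\<bar> \<le> B powr (r - 1) * B'"
        using Cauchy_Schwarz_ineq2[of "?f x" "\<phi> x"] by linarith
    qed
  qed
  from face_proj_spec(1)[OF S this] show ?thesis by (simp add: T_stab_def w_def Let_def)
qed

lemma sum_faces_of:
  fixes g :: "(real^'n) set \<Rightarrow> (real^'n) set \<Rightarrow> real"
  shows "(\<Sum>K\<in>cells X. \<Sum>S\<in>faces_of X K. g K S)
    = (\<Sum>S\<in>faces X. g (Kplus X S) S + (if S \<in> int_faces X then g (Kminus X S) S else 0))"
proof -
  have "(\<Sum>K\<in>cells X. \<Sum>S\<in>faces_of X K. g K S) = (\<Sum>K\<in>cells X. \<Sum>S\<in>{S. S \<in> faces X \<and> S \<in> faces_of X K}. g K S)"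
    by (intro sum.cong refl) (auto simp: faces_of_def)
  also have "\<dots> = (\<Sum>S\<in>faces X. \<Sum>K\<in>{K. K \<in> cells X \<and> S \<in> faces_of X K}. g K S)"
    by (rule sum.swap_restrict[OF finite_cells finite_faces])
  also have "\<dots> = (\<Sum>S\<in>faces X. g (Kplus X S) S + (if S \<in> int_faces X then g (Kminus X S) S else 0))"
  proof (rule sum.cong[OF refl])
    fix S assume S: "S \<in> faces X"
    show "(\<Sum>K\<in>{K. K \<in> cells X \<and> S \<in> faces_of X K}. g K S) = g (Kplus X S) S + (if S \<in> int_faces X then g (Kminus X S) S else 0)"
    proof (cases "S \<in> int_faces X")
      case True
      note f = int_face[OF True]
      have "{K. K \<in> cells X \<and> S \<in> faces_of X K} = {Kplus X S, Kminus X S}"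
        using True f S by (auto simp: faces_of_def)
      then show ?thesis using True f by simp
    next
      case False
      then have "S \<in> bd_faces X" using S faces_int_bd by blast
      then have "{K. K \<in> cells X \<and> S \<in> faces_of X K} = {Kplus X S}"
        using False S bd_face(2)[of S] by (auto simp: faces_of_def)
      then show ?thesis using False by simp
    qed
  qed
  finally show ?thesis .
qed

lemma D_faces_subset: "D_faces X \<subseteq> bd_faces X"
proof
  fix S assume "S \<in> D_faces X"
  then have S: "S \<in> faces X" "S \<subseteq> frontier (dom X)" using mesh by (auto simp: D_faces_def polytopal_mesh_def)
  show "S \<in> bd_faces X"
  proof (cases "S \<in> int_faces X")
    case True
    have "S \<subseteq> Kplus X S \<inter> frontier (dom X)" using int_face(7)[OF True] S(2) by blast
    then show ?thesis using S(1) int_face(2)[OF True] unfolding bd_faces_def by blast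
  qed (use S faces_int_bd in blast)
qed


section \<open>The dual variable and its discrete divergence\<close>

lemma sigma_cells_polys:
  fixes u :: "('n, real^'m::finite) pieces \<times> ('n, real^'m) pieces"
  assumes u: "u \<in> V_h k X" and D\<Psi>: "continuous_on UNIV D\<Psi>" and K: "K \<in> cells X"
  shows "sigma_cells k X D\<Psi> u K \<in> polys k"
proof -
  have cD: "continuous_on UNIV (D_h k X u K)"
    by (rule continuous_polys[of _ k]) (use D_h_spec(1)[OF u] K in \<open>auto simp: pw_polys_def\<close>)
  have c: "continuous_on UNIV (\<lambda>x. D\<Psi> (D_h k X u K x))"
    by (rule continuous_on_compose2[OF D\<Psi> cD]) simp
  have "integrable (lebesgue_on K) (\<lambda>x. D\<Psi> (glue (cells X) (D_h k X u) x) \<bullet> \<phi> x)" if \<phi>: "\<phi> \<in> polys k" for \<phi>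
  proof (rule integrable_cell_cong_AE(1)[OF K])
    show "integrable (lebesgue_on K) (\<lambda>x. D\<Psi> (D_h k X u K x) \<bullet> \<phi> x)"
      by (intro integrable_inner_continuous cell_integrates K c continuous_polys[OF \<phi>])
    show "AE x in lebesgue_on K. D\<Psi> (glue (cells X) (D_h k X u) x) \<bullet> \<phi> x = D\<Psi> (D_h k X u K x) \<bullet> \<phi> x"
      using glue_cells[OF K, of "D_h k X u"] by eventually_elim simp
  qed
  from pw_proj_spec(1)[OF K this] show ?thesis by (simp add: sigma_cells_def)
qed

lemma sigma_faces_polys:
  fixes u :: "('n, real^'m::finite) pieces \<times> ('n, real^'m) pieces"
  assumes u: "u \<in> V_h k X" and D\<Psi>: "continuous_on UNIV D\<Psi>" and r: "1 < r" and S: "S \<in> faces X"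
  shows "sigma_faces k r s X D\<Psi> u S \<in> polys k"
proof -
  have \<sigma>: "(\<lambda>x. sigma_cells k X D\<Psi> u K x *v nrm X S) \<in> polys k" if "K \<in> cells X" for K
    by (rule polys_linear[OF linear_matrix_vector_mult_left sigma_cells_polys[OF u D\<Psi> that]])
  note T = T_stab_polys[OF S _ u r]
  show ?thesis
  proof (cases "S \<in> int_faces X")
    case True
    note f = int_face[OF True]
    show ?thesis unfolding sigma_faces_def[abs_def] avg_def using True
      by (simp only: if_True) (intro polys_add polys_diff polys_scaleR \<sigma> T f)
  next
    case False
    then have bd: "Kplus X S \<in> cells X" using S faces_int_bd bd_face(2) by blast
    show ?thesis
    proof (cases "S \<in> D_faces X")
      case True
      then show ?thesis unfolding sigma_faces_def[abs_def] using False
        by (simp only: if_True if_False) (intro polys_add polys_scaleR \<sigma> T bd)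
    next
      case D: False
      show ?thesis unfolding sigma_faces_def[abs_def] using False D
        by (simp only: if_False polys_0)
    qed
  qed
qed

lemma sigma_h_WN:
  fixes u :: "('n, real^'m::finite) pieces \<times> ('n, real^'m) pieces"
  assumes u: "u \<in> V_h k X" and D\<Psi>: "continuous_on UNIV D\<Psi>" and r: "1 < r"
  shows "sigma_h k r s X D\<Psi> u \<in> WN_h k X"
proof -
  have "sigma_faces k r s X D\<Psi> u S x = 0" if "S \<in> N_faces X" for S x
  proof -
    have "S \<notin> int_faces X" "S \<notin> D_faces X" using that int_bd_disjoint by (auto simp: N_faces_def)
    then show ?thesis by (simp add: sigma_faces_def)
  qed
  then show ?thesis
    using sigma_cells_polys[OF u D\<Psi>] sigma_faces_polys[OF u D\<Psi> r]
    by (simp add: WN_h_def W_h_def sigma_h_def pw_polys_def)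
qed

text \<open>The face values of the test function are chosen such that every face contributes exactly the
  pairing of the jump of \<open>\<phi>\<close> with \<open>\<sigma>\<close>.\<close>

definition face_test :: "('n, real^'m::finite) pieces \<Rightarrow> ('n, real^'m) pieces" where
  "face_test \<phi> S = (if S \<in> D_faces X then (\<lambda>x. 0) else avg X \<phi> S)"

text \<open>On interior faces the jump of a product is jump times average plus average times jump,
  and \<open>face_test \<phi> S\<close> differs from the traces of \<open>\<phi>\<close> on
  \<open>Kplus\<close> and \<open>Kminus\<close> by minus and plus half the jump, which produces the
  stabilization terms in the dual variable. On Dirichlet faces the test value is 0; on Neumann faces
  it is the trace, and all terms cancel as the dual variable is zero there.\<close>

lemma face_balance:
  fixes u :: "('n, real^'m::finite) pieces \<times> ('n, real^'m) pieces" and s :: real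
  assumes u: "u \<in> V_h k X" and D\<Psi>: "continuous_on UNIV D\<Psi>" and r: "1 < r" and S: "S \<in> faces X"
    and \<phi>: "\<phi> \<in> pw_polys k (cells X)"
  defines "\<sigma> \<equiv> sigma_cells k X D\<Psi> u"
  defines "g \<equiv> (\<lambda>K. diameter S powr (- s) *
     face_int X S (\<lambda>x. T_stab k r X K S u x \<bullet> (face_test \<phi> S x - face_proj X k S (\<phi> K) x)))"
  shows "face_int X S (\<lambda>x. jump X \<phi> S x \<bullet> sigma_faces k r s X D\<Psi> u S x)
    = - (\<Sum>K\<in>cells X. incidence X K S * face_int X S (\<lambda>x. face_test \<phi> S x \<bullet> (\<sigma> K x *v nrm X S)))
      + (\<Sum>K\<in>cells X. incidence X K S * face_int X S (\<lambda>x. \<phi> K x \<bullet> (\<sigma> K x *v nrm X S)))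
      - (g (Kplus X S) + (if S \<in> int_faces X then g (Kminus X S) else 0))"
proof -
  let ?h = "diameter S powr (- s)" and ?T = "\<lambda>K. T_stab k r X K S u" and ?v = "face_test \<phi> S"
  let ?\<nu> = "nrm X S"
  have Kp: "Kplus X S \<in> cells X" using S faces_int_bd int_face(2) bd_face(2) by blast
  have \<phi>p: "\<phi> K \<in> polys k" if "K \<in> cells X" for K using \<phi> that by (simp add: pw_polys_def)
  have \<phi>c: "continuous_on UNIV (\<phi> K)" if "K \<in> cells X" for K by (rule continuous_polys[OF \<phi>p[OF that]])
  have Tp: "?T K \<in> polys k" if "K \<in> cells X" for K by (rule T_stab_polys[OF S that u r])
  have Tc: "continuous_on UNIV (?T K)" if "K \<in> cells X" for K by (rule continuous_polys[OF Tp[OF that]])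
  have \<sigma>c: "continuous_on UNIV (\<lambda>x. \<sigma> K x *v ?\<nu>)" if "K \<in> cells X" for K
    unfolding \<sigma>_def by (intro continuous_matrix_vector_mult_left continuous_polys[OF sigma_cells_polys[OF u D\<Psi> that]])
  note ii = integrable_inner_continuous[OF face_integrates[OF S]]
  have vc: "continuous_on UNIV ?v"
  proof (cases "S \<in> int_faces X")
    case True
    then show ?thesis using int_face[OF True]
      unfolding face_test_def avg_def by (auto intro!: continuous_intros \<phi>c)
  next
    case False
    then show ?thesis unfolding face_test_def avg_def by (auto intro!: \<phi>c Kp)
  qed
  \<comment> \<open>The face projection in the stabilization drops out because \<open>T_stab\<close>
    is itself a polynomial of degree at most \<open>k\<close>.\<close>
  have g: "g K = ?h * (face_int X S (\<lambda>x. ?v x \<bullet> ?T K x) - face_int X S (\<lambda>x. \<phi> K x \<bullet> ?T K x))" if K: "K \<in> cells X" for K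
  proof -
    have "face_int X S (\<lambda>x. ?T K x \<bullet> (?v x - face_proj X k S (\<phi> K) x))
      = face_int X S (\<lambda>x. ?v x \<bullet> ?T K x) - face_int X S (\<lambda>x. face_proj X k S (\<phi> K) x \<bullet> ?T K x)"
      using ii[OF vc Tc[OF K]] ii[OF continuous_polys[OF face_proj_continuous(1)[OF S \<phi>c[OF K]]] Tc[OF K]]
      by (simp add: inner_diff_right inner_commute[of "?T K _"])
    then show ?thesis unfolding g_def using face_proj_continuous(2)[OF S \<phi>c[OF K] Tp[OF K]] by simp
  qed
  show ?thesis
  proof (cases "S \<in> int_faces X")
    case True
    note f = int_face[OF True]
    have nD: "S \<notin> D_faces X" using True int_bd_disjoint D_faces_subset by blast
    let ?a = "\<phi> (Kplus X S)" and ?b = "\<phi> (Kminus X S)"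
    let ?A = "\<lambda>x. \<sigma> (Kplus X S) x *v ?\<nu>" and ?B = "\<lambda>x. \<sigma> (Kminus X S) x *v ?\<nu>"
    let ?T1 = "?T (Kplus X S)" and ?T2 = "?T (Kminus X S)"
    have v: "?v x = (?a x + ?b x) /\<^sub>R 2" for x using nD True by (simp add: face_test_def avg_def)
    have sums: "(\<Sum>K\<in>cells X. incidence X K S * c K) = c (Kplus X S) - c (Kminus X S)" for c :: "_ \<Rightarrow> real"
    proof -
      have "(\<Sum>K\<in>cells X. incidence X K S * c K) = (\<Sum>K\<in>{Kplus X S, Kminus X S}. incidence X K S * c K)"
        by (rule sum.mono_neutral_right) (use finite_cells f in \<open>auto simp: incidence_def\<close>)
      then show ?thesis using True f by (simp add: incidence_def)
    qed
    note i = ii[OF \<phi>c[OF f(2)] \<sigma>c[OF f(2)]] ii[OF \<phi>c[OF f(2)] \<sigma>c[OF f(3)]]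
      ii[OF \<phi>c[OF f(3)] \<sigma>c[OF f(2)]] ii[OF \<phi>c[OF f(3)] \<sigma>c[OF f(3)]]
      ii[OF \<phi>c[OF f(2)] Tc[OF f(2)]] ii[OF \<phi>c[OF f(2)] Tc[OF f(3)]]
      ii[OF \<phi>c[OF f(3)] Tc[OF f(2)]] ii[OF \<phi>c[OF f(3)] Tc[OF f(3)]]
    have vv: "face_int X S (\<lambda>x. ?v x \<bullet> q x) = (face_int X S (\<lambda>x. ?a x \<bullet> q x) + face_int X S (\<lambda>x. ?b x \<bullet> q x)) / 2"
      if "integrable (surf ?\<nu> S) (\<lambda>x. ?a x \<bullet> q x)" "integrable (surf ?\<nu> S) (\<lambda>x. ?b x \<bullet> q x)" for q
      using that by (simp add: v inner_add_left add_divide_distrib)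
    have "jump X \<phi> S x \<bullet> sigma_faces k r s X D\<Psi> u S x =
      (?a x \<bullet> ?A x + ?a x \<bullet> ?B x - ?b x \<bullet> ?A x - ?b x \<bullet> ?B x
        + ?h * (?a x \<bullet> ?T1 x - ?a x \<bullet> ?T2 x - ?b x \<bullet> ?T1 x + ?b x \<bullet> ?T2 x)) / 2" for x
      using True by (simp add: jump_def sigma_faces_def avg_def \<sigma>_def inner_simps field_simps)
    then have "face_int X S (\<lambda>x. jump X \<phi> S x \<bullet> sigma_faces k r s X D\<Psi> u S x) = face_int X S (\<lambda>x.
      (?a x \<bullet> ?A x + ?a x \<bullet> ?B x - ?b x \<bullet> ?A x - ?b x \<bullet> ?B x
        + ?h * (?a x \<bullet> ?T1 x - ?a x \<bullet> ?T2 x - ?b x \<bullet> ?T1 x + ?b x \<bullet> ?T2 x)) / 2)" by (simp only:)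
    also have "\<dots> =
      (face_int X S (\<lambda>x. ?a x \<bullet> ?A x) + face_int X S (\<lambda>x. ?a x \<bullet> ?B x) - face_int X S (\<lambda>x. ?b x \<bullet> ?A x) - face_int X S (\<lambda>x. ?b x \<bullet> ?B x)
        + ?h * (face_int X S (\<lambda>x. ?a x \<bullet> ?T1 x) - face_int X S (\<lambda>x. ?a x \<bullet> ?T2 x) - face_int X S (\<lambda>x. ?b x \<bullet> ?T1 x) + face_int X S (\<lambda>x. ?b x \<bullet> ?T2 x))) / 2"
      using i by simp
    finally show ?thesis
      using True by (simp add: sums g[OF f(2)] g[OF f(3)] vv[OF i(1,3)] vv[OF i(2,4)] vv[OF i(5,7)] vv[OF i(6,8)] field_simps)
  next
    case False
    then have bd: "S \<in> bd_faces X" using S faces_int_bd by blast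
    note f = bd_face[OF bd]
    let ?a = "\<phi> (Kplus X S)" and ?A = "\<lambda>x. \<sigma> (Kplus X S) x *v ?\<nu>" and ?T1 = "?T (Kplus X S)"
    have sums: "(\<Sum>K\<in>cells X. incidence X K S * c K) = c (Kplus X S)" for c :: "_ \<Rightarrow> real"
    proof -
      have "(\<Sum>K\<in>cells X. incidence X K S * c K) = (\<Sum>K\<in>{Kplus X S}. incidence X K S * c K)"
        by (rule sum.mono_neutral_right) (use finite_cells f False in \<open>auto simp: incidence_def\<close>)
      then show ?thesis by (simp add: incidence_def)
    qed
    note i = ii[OF \<phi>c[OF f(2)] \<sigma>c[OF f(2)]] ii[OF \<phi>c[OF f(2)] Tc[OF f(2)]]
    show ?thesis
    proof (cases "S \<in> D_faces X")
      case True
      have "jump X \<phi> S x \<bullet> sigma_faces k r s X D\<Psi> u S x = ?a x \<bullet> ?A x + ?h * (?a x \<bullet> ?T1 x)" for x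
        using True False by (simp add: jump_def sigma_faces_def \<sigma>_def inner_simps)
      then have "face_int X S (\<lambda>x. jump X \<phi> S x \<bullet> sigma_faces k r s X D\<Psi> u S x) =
         face_int X S (\<lambda>x. ?a x \<bullet> ?A x) + ?h * face_int X S (\<lambda>x. ?a x \<bullet> ?T1 x)" using i by simp
      then show ?thesis using True False by (simp add: sums g[OF f(2)] face_test_def)
    next
      case D: False
      have v: "?v = ?a" using D False by (simp add: face_test_def avg_def fun_eq_iff)
      show ?thesis using False D by (simp add: sums g[OF f(2)] v sigma_faces_def)
    qed
  qed
qed

lemma discrete_divergence:
  fixes u :: "('n, real^'m::finite) pieces \<times> ('n, real^'m) pieces"
  assumes u: "u \<in> V_h k X" and D\<Psi>: "continuous_on UNIV D\<Psi>" and r: "1 < r"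
    and f: "integrable (lebesgue_on (dom X)) f"
    and euler_lagrange: "\<And>v. v \<in> VD_h k X \<Longrightarrow>
           vol_int X (\<lambda>x. glue (cells X) (sigma_cells k X D\<Psi> u) x \<bullet> glue (cells X) (D_h k X v) x
             + f x \<bullet> glue (cells X) (pw_proj k (glue (cells X) (fst v))) x)
           + s_h k r s X u v = 0"
    and \<phi>: "\<phi> \<in> pw_polys k (cells X)"
  shows "- vol_int X (\<lambda>x. glue (cells X) (\<lambda>K. Jac (\<phi> K)) x \<bullet> glue (cells X) (sigma_cells k X D\<Psi> u) x)
        + (\<Sum>S\<in>faces X. face_int X S (\<lambda>x. jump X \<phi> S x \<bullet> sigma_faces k r s X D\<Psi> u S x))
      = (\<Sum>K\<in>cells X. LINT x|lebesgue_on K. f x \<bullet> \<phi> K x)"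
proof -
  let ?\<sigma> = "sigma_cells k X D\<Psi> u"
  define v where "v = (\<phi>, face_test \<phi>)"
  have \<phi>p: "\<phi> K \<in> polys k" if "K \<in> cells X" for K using \<phi> that by (simp add: pw_polys_def)
  have \<phi>C: "C1 (\<phi> K)" if "K \<in> cells X" for K by (rule C1_polys[OF \<phi>p[OF that]])
  have \<phi>c: "continuous_on UNIV (\<phi> K)" if "K \<in> cells X" for K by (rule continuous_polys[OF \<phi>p[OF that]])
  have \<sigma>p: "?\<sigma> K \<in> polys k" if "K \<in> cells X" for K by (rule sigma_cells_polys[OF u D\<Psi> that])
  have \<sigma>C: "C1 (?\<sigma> K)" if "K \<in> cells X" for K by (rule C1_polys[OF \<sigma>p[OF that]])
  have \<sigma>c: "continuous_on UNIV (?\<sigma> K)" if "K \<in> cells X" for K by (rule continuous_polys[OF \<sigma>p[OF that]])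
  have \<sigma>pw: "?\<sigma> \<in> pw_polys k (cells X)" using \<sigma>p by (simp add: pw_polys_def)
  have vS: "face_test \<phi> S \<in> polys k" if S: "S \<in> faces X" for S
  proof (cases "S \<in> int_faces X")
    case True
    then show ?thesis using int_face[OF True] unfolding face_test_def avg_def
      by (auto intro!: polys_0 polys_scaleR polys_add \<phi>p)
  next
    case False
    then have "Kplus X S \<in> cells X" using S faces_int_bd bd_face(2) by blast
    then show ?thesis using False unfolding face_test_def avg_def by (auto intro!: polys_0 \<phi>p)
  qed
  have vV: "v \<in> V_h k X"
    using \<phi>p vS polys_le[OF \<phi>p, of _ "k + 1"] by (simp add: V_h_def v_def pw_polys_def)
  have vD: "v \<in> VD_h k X" using vV by (simp add: VD_h_def v_def face_test_def)
  have Dp: "D_h k X v K \<in> polys k" if "K \<in> cells X" for K using D_h_spec(1)[OF vV] that by (simp add: pw_polys_def)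
  have Dc: "continuous_on UNIV (D_h k X v K)" if "K \<in> cells X" for K by (rule continuous_polys[OF Dp[OF that]])
  let ?\<Pi> = "pw_proj k (glue (cells X) \<phi>)"
  \<comment> \<open>The cell part of the test function has degree at most \<open>k\<close>, although
    \<open>V_h\<close> admits \<open>k + 1\<close>, so the projection in the Euler-Lagrange
    equations leaves it unchanged on each cell.\<close>
  have \<Pi>: "?\<Pi> K x = \<phi> K x" if "K \<in> cells X" "x \<in> K" for K x
    by (rule pw_proj_poly[of K "\<phi> K"]) (use that \<phi>p glue_cells in auto)
  have fi: "integrable (lebesgue_on K) (\<lambda>x. f x \<bullet> \<phi> K x)" if "K \<in> cells X" for K
    by (rule integrable_inner_compact[OF integrable_on_cell[OF f that] cell_compact[OF that] \<phi>c[OF that]])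
  have \<sigma>D: "integrable (lebesgue_on K) (\<lambda>x. ?\<sigma> K x \<bullet> D_h k X v K x)" if "K \<in> cells X" for K
    by (intro integrable_inner_continuous cell_integrates \<sigma>c Dc that)
  have "vol_int X (\<lambda>x. glue (cells X) ?\<sigma> x \<bullet> glue (cells X) (D_h k X v) x + f x \<bullet> glue (cells X) ?\<Pi> x)
    = (\<Sum>K\<in>cells X. LINT x|lebesgue_on K. ?\<sigma> K x \<bullet> D_h k X v K x + f x \<bullet> \<phi> K x)"
  proof (rule vol_int_cells(2))
    fix K assume K: "K \<in> cells X"
    show "integrable (lebesgue_on K) (\<lambda>x. ?\<sigma> K x \<bullet> D_h k X v K x + f x \<bullet> \<phi> K x)"
      using fi[OF K] \<sigma>D[OF K] by simp
    have "AE x in lebesgue_on K. x \<in> K" using cell_sets[OF K] by (simp add: AE_restrict_space_iff)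
    then show "AE x in lebesgue_on K. glue (cells X) ?\<sigma> x \<bullet> glue (cells X) (D_h k X v) x + f x \<bullet> glue (cells X) ?\<Pi> x
       = ?\<sigma> K x \<bullet> D_h k X v K x + f x \<bullet> \<phi> K x"
      using glue_cells[OF K, of ?\<sigma>] glue_cells[OF K, of "D_h k X v"] glue_cells[OF K, of ?\<Pi>]
      by eventually_elim (simp add: \<Pi>[OF K])
  qed
  also have "\<dots> = (\<Sum>K\<in>cells X. LINT x|lebesgue_on K. ?\<sigma> K x \<bullet> D_h k X v K x) + (\<Sum>K\<in>cells X. LINT x|lebesgue_on K. f x \<bullet> \<phi> K x)"
    using fi \<sigma>D by (simp add: sum.distrib)
  finally have EL: "(\<Sum>K\<in>cells X. LINT x|lebesgue_on K. ?\<sigma> K x \<bullet> D_h k X v K x) + (\<Sum>K\<in>cells X. LINT x|lebesgue_on K. f x \<bullet> \<phi> K x)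
      + s_h k r s X u v = 0"
    using euler_lagrange[OF vD] by (simp add: v_def)
  have "(\<Sum>K\<in>cells X. LINT x|lebesgue_on K. ?\<sigma> K x \<bullet> D_h k X v K x) = (\<Sum>K\<in>cells X. D_functional v K (?\<sigma> K))"
    using D_h_spec(2)[OF vV \<sigma>pw] by (simp add: inner_commute)
  \<comment> \<open>Integration by parts against \<open>\<phi>\<close> turns the cell term into
    \<open>Jac (\<phi> K)\<close> and leaves the difference of the face terms for
    \<open>face_test \<phi>\<close> and for \<open>\<phi>\<close>.\<close>
  also have "\<dots> = (\<Sum>K\<in>cells X. (LINT x|lebesgue_on K. Jac (\<phi> K) x \<bullet> ?\<sigma> K x)
      + ((\<Sum>S\<in>faces X. incidence X K S * face_int X S (\<lambda>x. face_test \<phi> S x \<bullet> (?\<sigma> K x *v nrm X S)))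
      - (\<Sum>S\<in>faces X. incidence X K S * face_int X S (\<lambda>x. \<phi> K x \<bullet> (?\<sigma> K x *v nrm X S)))))"
    by (rule sum.cong[OF refl]) (simp add: D_functional_def v_def cell_gauss_green \<phi>C \<sigma>C)
  also have "\<dots> = (\<Sum>K\<in>cells X. LINT x|lebesgue_on K. Jac (\<phi> K) x \<bullet> ?\<sigma> K x)
      + ((\<Sum>S\<in>faces X. \<Sum>K\<in>cells X. incidence X K S * face_int X S (\<lambda>x. face_test \<phi> S x \<bullet> (?\<sigma> K x *v nrm X S)))
      - (\<Sum>S\<in>faces X. \<Sum>K\<in>cells X. incidence X K S * face_int X S (\<lambda>x. \<phi> K x \<bullet> (?\<sigma> K x *v nrm X S))))"
    by (simp only: sum.distrib sum_subtractf sum.swap[of _ "cells X" "faces X"])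
  finally have \<sigma>Dv: "(\<Sum>K\<in>cells X. LINT x|lebesgue_on K. ?\<sigma> K x \<bullet> D_h k X v K x) = \<dots>" .
  define g where "g K S = diameter S powr (- s) *
     face_int X S (\<lambda>x. T_stab k r X K S u x \<bullet> (face_test \<phi> S x - face_proj X k S (\<phi> K) x))" for K S
  have sh: "s_h k r s X u v = (\<Sum>S\<in>faces X. g (Kplus X S) S + (if S \<in> int_faces X then g (Kminus X S) S else 0))"
    unfolding s_h_def v_def fst_conv snd_conv g_def by (rule sum_faces_of)
  have "(\<Sum>S\<in>faces X. face_int X S (\<lambda>x. jump X \<phi> S x \<bullet> sigma_faces k r s X D\<Psi> u S x))
    = (\<Sum>S\<in>faces X. - (\<Sum>K\<in>cells X. incidence X K S * face_int X S (\<lambda>x. face_test \<phi> S x \<bullet> (?\<sigma> K x *v nrm X S)))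
      + (\<Sum>K\<in>cells X. incidence X K S * face_int X S (\<lambda>x. \<phi> K x \<bullet> (?\<sigma> K x *v nrm X S)))
      - (g (Kplus X S) S + (if S \<in> int_faces X then g (Kminus X S) S else 0)))"
    unfolding g_def by (rule sum.cong[OF refl], rule face_balance[OF u D\<Psi> r _ \<phi>])
  also have "\<dots> = - (\<Sum>S\<in>faces X. \<Sum>K\<in>cells X. incidence X K S * face_int X S (\<lambda>x. face_test \<phi> S x \<bullet> (?\<sigma> K x *v nrm X S)))
      + (\<Sum>S\<in>faces X. \<Sum>K\<in>cells X. incidence X K S * face_int X S (\<lambda>x. \<phi> K x \<bullet> (?\<sigma> K x *v nrm X S)))
      - s_h k r s X u v"
    unfolding sh by (simp only: sum.distrib sum_subtractf sum_negf)
  finally have jumps: "(\<Sum>S\<in>faces X. face_int X S (\<lambda>x. jump X \<phi> S x \<bullet> sigma_faces k r s X D\<Psi> u S x)) = \<dots>" .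
  have "vol_int X (\<lambda>x. glue (cells X) (\<lambda>K. Jac (\<phi> K)) x \<bullet> glue (cells X) ?\<sigma> x)
     = (\<Sum>K\<in>cells X. LINT x|lebesgue_on K. Jac (\<phi> K) x \<bullet> ?\<sigma> K x)"
    by (rule vol_int_glue) (intro continuous_Jac \<phi>C \<sigma>c, assumption)+
  then show ?thesis using EL \<sigma>Dv jumps by linarith
qed

text \<open>By \<open>discrete_divergence\<close> the projection of \<open>f\<close> solves the
  equations that define \<open>div_h\<close>, so the choice there is not vacuous. Test functions
  supported on one cell then show that any solution coincides with the projection on that
  cell.\<close>

lemma div_h_eq_proj:
  fixes u :: "('n, real^'m::finite) pieces \<times> ('n, real^'m) pieces"
  assumes u: "u \<in> V_h k X" and D\<Psi>: "continuous_on UNIV D\<Psi>" and r: "1 < r"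
    and f: "integrable (lebesgue_on (dom X)) f"
    and euler_lagrange: "\<And>v. v \<in> VD_h k X \<Longrightarrow>
           vol_int X (\<lambda>x. glue (cells X) (sigma_cells k X D\<Psi> u) x \<bullet> glue (cells X) (D_h k X v) x
             + f x \<bullet> glue (cells X) (pw_proj k (glue (cells X) (fst v))) x)
           + s_h k r s X u v = 0"
  shows "pw_proj k f \<in> pw_polys k (cells X)"
    and "K \<in> cells X \<Longrightarrow> x \<in> K \<Longrightarrow> div_h k X (sigma_h k r s X D\<Psi> u) K x = pw_proj k f K x"
proof -
  have fi: "integrable (lebesgue_on K) (\<lambda>x. f x \<bullet> \<phi> x)" if "K \<in> cells X" "\<phi> \<in> polys k" for K \<phi>
    by (rule integrable_inner_compact[OF integrable_on_cell[OF f that(1)] cell_compact[OF that(1)] continuous_polys[OF that(2)]])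
  have spec1: "pw_proj k f K \<in> polys k" if "K \<in> cells X" for K
    by (rule pw_proj_spec(1)[OF that]) (rule fi[OF that])
  have spec2: "(LINT x|lebesgue_on K. pw_proj k f K x \<bullet> \<phi> x) = (LINT x|lebesgue_on K. f x \<bullet> \<phi> x)"
    if "K \<in> cells X" "\<phi> \<in> polys k" for K \<phi>
    by (rule pw_proj_spec(2)[OF that(1) fi[OF that(1)] that(2)])
  show pp: "pw_proj k f \<in> pw_polys k (cells X)" using spec1 by (simp add: pw_polys_def)
  let ?R = "\<lambda>\<phi>. - vol_int X (\<lambda>x. glue (cells X) (\<lambda>K. Jac (\<phi> K)) x \<bullet> glue (cells X) (fst (sigma_h k r s X D\<Psi> u)) x)
        + (\<Sum>S\<in>faces X. face_int X S (\<lambda>x. jump X \<phi> S x \<bullet> snd (sigma_h k r s X D\<Psi> u) S x))"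
  let ?P = "\<lambda>d. d \<in> pw_polys k (cells X) \<and> (\<forall>\<phi>\<in>pw_polys k (cells X).
        vol_int X (\<lambda>x. glue (cells X) d x \<bullet> glue (cells X) \<phi> x) = ?R \<phi>)"
  have R: "?R \<phi> = (\<Sum>K\<in>cells X. LINT x|lebesgue_on K. f x \<bullet> \<phi> K x)" if "\<phi> \<in> pw_polys k (cells X)" for \<phi>
    unfolding sigma_h_def fst_conv snd_conv by (rule discrete_divergence[OF u D\<Psi> r f euler_lagrange that])
  have lhs: "vol_int X (\<lambda>x. glue (cells X) d x \<bullet> glue (cells X) \<phi> x) = (\<Sum>K\<in>cells X. LINT x|lebesgue_on K. d K x \<bullet> \<phi> K x)"
    if "d \<in> pw_polys k (cells X)" "\<phi> \<in> pw_polys k (cells X)" for d \<phi> :: "('n, real^'m) pieces"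
    by (rule vol_int_glue) (use that in \<open>auto simp: pw_polys_def intro: continuous_polys[of _ k]\<close>)
  have "?P (pw_proj k f)"
  proof (intro conjI ballI pp)
    fix \<phi> :: "('n, real^'m) pieces" assume \<phi>: "\<phi> \<in> pw_polys k (cells X)"
    show "vol_int X (\<lambda>x. glue (cells X) (pw_proj k f) x \<bullet> glue (cells X) \<phi> x) = ?R \<phi>"
      unfolding lhs[OF pp \<phi>] R[OF \<phi>] using \<phi> by (intro sum.cong refl spec2) (auto simp: pw_polys_def)
  qed
  then have P: "?P (div_h k X (sigma_h k r s X D\<Psi> u))" unfolding div_h_def by (rule someI[of ?P])
  let ?d = "div_h k X (sigma_h k r s X D\<Psi> u)"
  have dp: "?d \<in> pw_polys k (cells X)" by (rule conjunct1[OF P])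
  assume K: "K \<in> cells X" and x: "x \<in> K"
  show "?d K x = pw_proj k f K x"
  proof (rule cell_polys_eqI[OF K _ spec1[OF K] _ x])
    show "?d K \<in> polys k" using dp K by (simp add: pw_polys_def)
    fix \<phi> :: "real^'n \<Rightarrow> real^'m" assume \<phi>: "\<phi> \<in> polys k"
    let ?\<phi> = "\<lambda>K'. if K' = K then \<phi> else (\<lambda>x. 0)"
    have \<phi>p: "?\<phi> \<in> pw_polys k (cells X)" using \<phi> by (simp add: pw_polys_def polys_0)
    have single: "(\<Sum>K'\<in>cells X. LINT x|lebesgue_on K'. w K' x \<bullet> ?\<phi> K' x) = (LINT x|lebesgue_on K. w K x \<bullet> \<phi> x)" for w :: "('n, real^'m) pieces"
    proof -
      have "(\<Sum>K'\<in>cells X. LINT x|lebesgue_on K'. w K' x \<bullet> ?\<phi> K' x) = (\<Sum>K'\<in>{K}. LINT x|lebesgue_on K'. w K' x \<bullet> ?\<phi> K' x)"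
        by (rule sum.mono_neutral_right) (use finite_cells K in auto)
      then show ?thesis by simp
    qed
    have "(\<Sum>K'\<in>cells X. LINT x|lebesgue_on K'. ?d K' x \<bullet> ?\<phi> K' x) = (\<Sum>K'\<in>cells X. LINT x|lebesgue_on K'. f x \<bullet> ?\<phi> K' x)"
      using bspec[OF conjunct2[OF P] \<phi>p] by (simp only: lhs[OF dp \<phi>p] R[OF \<phi>p])
    then have "(LINT x|lebesgue_on K. ?d K x \<bullet> \<phi> x) = (LINT x|lebesgue_on K. f x \<bullet> \<phi> x)"
      using single[of ?d] single[of "\<lambda>_. f"] by simp
    then show "(LINT x|lebesgue_on K. ?d K x \<bullet> \<phi> x) = (LINT x|lebesgue_on K. pw_proj k f K x \<bullet> \<phi> x)"
      using spec2[OF K \<phi>] by simp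
  qed
qed

end


section \<open>The simplicial submesh\<close>

lemma affine_lborel_AE:
  fixes A :: "'a::euclidean_space set"
  assumes "affine A" "h \<notin> A" shows "AE z in lborel. z \<notin> A"
proof -
  have "interior A = {}"
  proof (rule ccontr)
    assume "interior A \<noteq> {}"
    then have "affine hull A = UNIV" by (rule affine_hull_nonempty_interior)
    then show False using assms by (metis UNIV_I affine_hull_eq)
  qed
  then have "negligible A" using assms(1) by (simp add: negligible_convex_interior affine_imp_convex)
  then have "AE z in lebesgue. z \<notin> A" by (intro AE_not_in) (simp add: negligible_iff_null_sets)
  then show ?thesis by (simp add: AE_completion_iff)
qed

text \<open>The preimage of an affine set under the projection is affine and misses the point
  \<open>h\<close> of the hyperplane, so it is proper and hence null.\<close>

lemma face_AE_notin_affine: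
  fixes \<nu> :: "real^'n"
  assumes "affine A" "\<nu> \<bullet> h = c" "h \<notin> A" "norm \<nu> = 1"
  shows "face_AE \<nu> c S (\<lambda>y. y \<notin> A)"
proof -
  have \<nu>: "\<nu> \<bullet> \<nu> = 1" using assms(4) by (simp add: dot_square_norm)
  have lin: "oproj \<nu> c \<nu> (u *\<^sub>R x + v *\<^sub>R y) = u *\<^sub>R oproj \<nu> c \<nu> x + v *\<^sub>R oproj \<nu> c \<nu> y" if "u + v = 1" for u v x y
  proof -
    have "c = u * c + v * c" using that by (metis distrib_right mult_1)
    then have eq: "\<nu> \<bullet> (u *\<^sub>R x + v *\<^sub>R y) - c = u * (\<nu> \<bullet> x - c) + v * (\<nu> \<bullet> y - c)"
      by (simp add: inner_add_right right_diff_distrib)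
    have "u *\<^sub>R x + v *\<^sub>R y - (u * p + v * q) *\<^sub>R \<nu> = u *\<^sub>R (x - p *\<^sub>R \<nu>) + v *\<^sub>R (y - q *\<^sub>R \<nu>)" for p q
      by (simp add: algebra_simps)
    then show ?thesis unfolding oproj_def eq .
  qed
  have "affine {z. oproj \<nu> c \<nu> z \<in> A}"
    using assms(1) unfolding affine_def by (auto simp: lin)
  moreover have "h \<notin> {z. oproj \<nu> c \<nu> z \<in> A}" using assms by (simp add: oproj_def)
  ultimately have "AE z in lborel. z \<notin> {z. oproj \<nu> c \<nu> z \<in> A}" by (rule affine_lborel_AE)
  then show ?thesis unfolding face_AE_def by eventually_elim simp
qed

lemma hyperplane_unit_normal_unique:
  fixes \<nu> \<mu> :: "'a::real_inner"
  assumes "norm \<nu> = 1" "norm \<mu> = 1" "{x. \<nu> \<bullet> x = c} \<subseteq> {x. \<mu> \<bullet> x = d}"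
  shows "\<mu> = \<nu> \<or> \<mu> = - \<nu>"
proof -
  have \<nu>: "\<nu> \<bullet> \<nu> = 1" using assms(1) by (simp add: dot_square_norm)
  have orth: "\<mu> \<bullet> w = 0" if "\<nu> \<bullet> w = 0" for w
  proof -
    have "c *\<^sub>R \<nu> \<in> {x. \<nu> \<bullet> x = c}" "c *\<^sub>R \<nu> + w \<in> {x. \<nu> \<bullet> x = c}" using \<nu> that by (auto simp: inner_simps)
    then have "\<mu> \<bullet> (c *\<^sub>R \<nu>) = d" "\<mu> \<bullet> (c *\<^sub>R \<nu> + w) = d" using assms(3) by blast+
    then show ?thesis by (simp add: inner_add_right)
  qed
  define w where "w = \<mu> - (\<mu> \<bullet> \<nu>) *\<^sub>R \<nu>"
  have 1: "\<nu> \<bullet> w = 0" using \<nu> by (simp add: w_def inner_diff_right inner_commute)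
  have "w \<bullet> w = \<mu> \<bullet> w - (\<mu> \<bullet> \<nu>) * (\<nu> \<bullet> w)" by (simp add: w_def inner_diff_left)
  also have "\<dots> = 0" using 1 orth[OF 1] by simp
  finally have eq: "\<mu> = (\<mu> \<bullet> \<nu>) *\<^sub>R \<nu>" by (simp add: w_def)
  then have "\<bar>\<mu> \<bullet> \<nu>\<bar> = 1" using assms(1,2) by (metis mult.right_neutral norm_scaleR)
  then have "\<mu> \<bullet> \<nu> = 1 \<or> \<mu> \<bullet> \<nu> = -1" by linarith
  then show ?thesis using eq by auto
qed

locale submesh = poly_mesh X for X :: "'n::finite mesh" +
  fixes \<T> :: "(real^'n) set set" and \<nu>F :: "(real^'n) set \<Rightarrow> real^'n"
  assumes submesh: "matching_submesh X \<T> \<nu>F"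
begin

abbreviation "\<F> \<equiv> submesh_faces \<T>"

definition cF :: "(real^'n) set \<Rightarrow> real" where "cF F = \<nu>F F \<bullet> (SOME x. x \<in> F)"

text \<open>Plus or minus 1 according to whether \<open>\<nu>F F\<close> points out of or into
  \<open>T\<close>. A simplex lies on one side of the hyperplane of each of its facets, so testing
  one inequality is enough.\<close>

definition side :: "(real^'n) set \<Rightarrow> (real^'n) set \<Rightarrow> real" where
  "side T F = (if F facet_of T then if \<forall>x\<in>T. \<nu>F F \<bullet> x \<le> cF F then 1 else -1 else 0)"

lemma finite_T: "finite \<T>" and T_cover: "\<Union>\<T> = closure (dom X)"
  and T_simplex: "T \<in> \<T> \<Longrightarrow> int CARD('n) simplex T"
  and T_cell: "T \<in> \<T> \<Longrightarrow> \<exists>!K. K \<in> cells X \<and> T \<subseteq> K"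
  and T_Int: "T \<in> \<T> \<Longrightarrow> T' \<in> \<T> \<Longrightarrow> (T \<inter> T') face_of T"
  using submesh by (auto simp: matching_submesh_def triangulation_def)

lemma T_polytope: "T \<in> \<T> \<Longrightarrow> polytope T"
  by (rule simplex_imp_polytope[OF T_simplex])

lemma T_convex: "T \<in> \<T> \<Longrightarrow> convex T" and T_compact: "T \<in> \<T> \<Longrightarrow> compact T" and T_closed: "T \<in> \<T> \<Longrightarrow> closed T"
  by (auto intro: polytope_imp_convex polytope_imp_compact polytope_imp_closed T_polytope)

lemma T_sets: "T \<in> \<T> \<Longrightarrow> T \<in> sets lebesgue"
  using T_closed by (simp add: borel_closed)

lemma T_dim: "T \<in> \<T> \<Longrightarrow> aff_dim T = int CARD('n)"
  by (rule aff_dim_simplex[OF T_simplex])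

lemma T_hull: "T \<in> \<T> \<Longrightarrow> affine hull T = UNIV"
  using T_dim[of T] by (simp add: aff_dim_eq_full[symmetric])

lemma T_interior: "T \<in> \<T> \<Longrightarrow> interior T \<noteq> {}"
  using T_hull[of T] T_convex[of T] rel_interior_interior[of T] rel_interior_eq_empty[of T] by auto

lemma T_regular: "T \<in> \<T> \<Longrightarrow> closure (interior T) = T"
  using convex_closure_interior[OF T_convex T_interior] T_closed by simp

text \<open>Two simplices meet in a common face. If it were all of \<open>T\<close>, then
  \<open>T\<close> would be a proper face of \<open>T'\<close>, of smaller dimension. A proper face
  misses the interior.\<close>

lemma T_disjoint:
  assumes "T \<in> \<T>" "T' \<in> \<T>" "T \<noteq> T'" shows "T' \<inter> interior T = {}"
proof -
  have "T \<inter> T' \<noteq> T"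
  proof
    assume eq: "T \<inter> T' = T"
    have "T face_of T'" using T_Int[OF assms(2,1)] eq by (simp add: Int_commute)
    then have "aff_dim T < aff_dim T'" using assms T_convex by (intro face_of_aff_dim_lt) auto
    then show False using assms T_dim by simp
  qed
  from face_of_disjoint_interior[OF T_Int[OF assms(1,2)] this]
  show ?thesis using interior_subset[of T] by blast
qed

lemma T_overlap: "T \<in> \<T> \<Longrightarrow> T' \<in> \<T> \<Longrightarrow> T \<noteq> T' \<Longrightarrow> negligible (T \<inter> T')"
proof (rule negligible_subset[OF negligible_convex_frontier])
  assume "T \<in> \<T>" "T' \<in> \<T>" "T \<noteq> T'"
  then show "convex T" "T \<inter> T' \<subseteq> frontier T"
    using T_convex T_disjoint closure_subset[of T] by (auto simp: frontier_def)
qed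

lemma T_interior_dom: "T \<in> \<T> \<Longrightarrow> interior T \<subseteq> dom X"
proof -
  assume "T \<in> \<T>"
  then have "T \<subseteq> closure (dom X)" using T_cover by blast
  then have "interior T \<subseteq> interior (closure (dom X))" by (rule interior_mono)
  then show ?thesis by (simp only: dom_regular)
qed

text \<open>The point may lie on the frontier of \<open>K\<close>. Since \<open>K\<close> is the
  closure of its interior, nearby interior points of \<open>K\<close> lie in \<open>T\<close> as
  well, and two distinct cells cannot share a nonempty open set.\<close>

lemma cell_Int_interior:
  assumes T: "T \<in> \<T>" and K: "K \<in> cells X" and x: "x \<in> interior T" "x \<in> K"
  shows "T \<subseteq> K"
proof -
  obtain K' where K': "K' \<in> cells X" "T \<subseteq> K'" using T_cell[OF T] by blast
  have "x \<in> closure (interior K)" using x(2) cell_regular[OF K] by blast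
  then have ne: "interior T \<inter> interior K \<noteq> {}"
    using x(1) open_Int_closure_eq_empty[OF open_interior] by blast
  have sub: "interior T \<inter> interior K \<subseteq> K" "interior T \<inter> interior K \<subseteq> K'"
    using K'(2) interior_subset by blast+
  have "K = K'"
  proof (rule ccontr)
    assume "K \<noteq> K'"
    from cells_disjoint_open[OF K K'(1) this _ sub] ne show False by (simp add: open_Int)
  qed
  then show ?thesis using K' by simp
qed

lemma indicator_cell_sum:
  assumes K: "K \<in> cells X" and z: "\<And>T. T \<in> \<T> \<Longrightarrow> z \<notin> frontier T"
  shows "indicat_real K z = (\<Sum>T\<in>{T\<in>\<T>. T \<subseteq> K}. indicat_real T z)"
proof (cases "z \<in> K")
  case True
  then obtain T where T: "T \<in> \<T>" "z \<in> T" using K cells_cover T_cover by blast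
  then have zi: "z \<in> interior T" using z[OF T(1)] closure_subset[of T] by (auto simp: frontier_def)
  have TK: "T \<subseteq> K" by (rule cell_Int_interior[OF T(1) K zi True])
  have "(\<Sum>T\<in>{T\<in>\<T>. T \<subseteq> K}. indicat_real T z) = (\<Sum>T\<in>{T}. indicat_real T z)"
    by (rule sum.mono_neutral_right) (use finite_T T TK T_disjoint[OF T(1)] zi in \<open>auto simp: indicator_def\<close>)
  then show ?thesis using True T by simp
next
  case False
  have "(\<Sum>T\<in>{T\<in>\<T>. T \<subseteq> K}. indicat_real T z) = 0"
    by (rule sum.neutral) (use False in \<open>auto simp: indicator_def\<close>)
  then show ?thesis using False by simp
qed

section \<open>Facets and the jumps of simplices across them\<close>

lemma facet_F: "T \<in> \<T> \<Longrightarrow> F facet_of T \<Longrightarrow> F \<in> \<F>"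
  by (auto simp: submesh_faces_def)

lemma finite_F: "finite \<F>"
proof -
  have "\<F> = (\<Union>T\<in>\<T>. {F. F facet_of T})" by (auto simp: submesh_faces_def)
  then show ?thesis using finite_T finite_polytope_facets[OF T_polytope] by auto
qed

lemma F_norm: "F \<in> \<F> \<Longrightarrow> norm (\<nu>F F) = 1"
  using submesh by (auto simp: matching_submesh_def)

lemma F_plane: "F \<in> \<F> \<Longrightarrow> x \<in> F \<Longrightarrow> \<nu>F F \<bullet> x = cF F"
  using submesh unfolding matching_submesh_def cF_def by (metis someI)

lemma F_skeleton: "F \<in> \<F> \<Longrightarrow> F \<subseteq> skeleton X \<Longrightarrow> \<exists>!S. S \<in> faces X \<and> F \<subseteq> S"
  and F_normal: "F \<in> \<F> \<Longrightarrow> S \<in> faces X \<Longrightarrow> F \<subseteq> S \<Longrightarrow> \<nu>F F = nrm X S"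
  using submesh by (auto simp: matching_submesh_def)

lemma F_facts:
  assumes "F \<in> \<F>"
  shows F_nonempty: "F \<noteq> {}" and F_convex: "convex F" and F_compact: "compact F" and F_closed: "closed F"
    and F_dim: "aff_dim F = int CARD('n) - 1" and F_hull: "affine hull F = {x. \<nu>F F \<bullet> x = cF F}"
proof -
  obtain T where T: "T \<in> \<T>" "F facet_of T" using assms by (auto simp: submesh_faces_def)
  show ne: "F \<noteq> {}" and d: "aff_dim F = int CARD('n) - 1" using T T_dim by (auto simp: facet_of_def)
  have "polytope F" using T T_polytope face_of_polytope_polytope facet_of_imp_face_of by blast
  then show "convex F" "compact F" "closed F" by (auto intro: polytope_imp_convex polytope_imp_compact polytope_imp_closed)
  have "F \<subseteq> {x. \<nu>F F \<bullet> x = cF F}" using F_plane[OF assms] by blast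
  then have "affine hull F \<subseteq> {x. \<nu>F F \<bullet> x = cF F}" by (rule hull_minimal) (rule affine_hyperplane)
  moreover have "aff_dim (affine hull F) = aff_dim {x. \<nu>F F \<bullet> x = cF F}"
    using F_norm[OF assms] d by (subst aff_dim_hyperplane) auto
  ultimately show "affine hull F = {x. \<nu>F F \<bullet> x = cF F}"
    using ne by (intro affine_dim_equal affine_affine_hull affine_hyperplane) auto
qed

lemma T_frontier: "T \<in> \<T> \<Longrightarrow> frontier T = \<Union>{F. F facet_of T}"
  using rel_frontier_of_polyhedron[OF polytope_imp_polyhedron[OF T_polytope]] rel_frontier_frontier[OF T_hull] by simp

lemma facet_interior:
  assumes T: "T \<in> \<T>" and F: "F facet_of T"
  shows "interior T \<inter> {x. \<nu>F F \<bullet> x = cF F} = {}" "F \<inter> interior T = {}"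
proof -
  have ff: "F face_of T" by (rule facet_of_imp_face_of[OF F])
  have "F \<noteq> T" using F by auto
  then show 1: "F \<inter> interior T = {}" using face_of_disjoint_interior[OF ff] by simp
  have "F = (affine hull F) \<inter> T"
    using face_of_imp_eq_affine_Int[OF T_convex[OF T] ff] .
  then show "interior T \<inter> {x. \<nu>F F \<bullet> x = cF F} = {}"
    using 1 interior_subset[of T] F_hull[OF facet_F[OF T F]] by blast
qed

text \<open>The interior of \<open>T\<close> is connected and misses the hyperplane of a facet, so
  it lies in one open half-space; \<open>T\<close> is its closure.\<close>

lemma facet_sides:
  assumes T: "T \<in> \<T>" and F: "F facet_of T"
  shows "(side T F = 1 \<and> interior T \<subseteq> {x. \<nu>F F \<bullet> x < cF F} \<and> T \<subseteq> {x. \<nu>F F \<bullet> x \<le> cF F}) \<or>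
    (side T F = -1 \<and> interior T \<subseteq> {x. \<nu>F F \<bullet> x > cF F} \<and> T \<subseteq> {x. \<nu>F F \<bullet> x \<ge> cF F})"
proof -
  let ?l = "{x. \<nu>F F \<bullet> x < cF F}" and ?g = "{x. \<nu>F F \<bullet> x > cF F}"
  have conn: "connected (interior T)" using T_convex[OF T] by (intro convex_connected convex_interior)
  have "?l \<inter> interior T = {} \<or> ?g \<inter> interior T = {}"
    by (rule connectedD[OF conn open_halfspace_lt open_halfspace_gt]) (use facet_interior(1)[OF T F] in force)+
  then show ?thesis
  proof
    assume "?l \<inter> interior T = {}"
    then have i: "interior T \<subseteq> ?g" using facet_interior(1)[OF T F] by force
    then have "interior T \<subseteq> {x. \<nu>F F \<bullet> x \<ge> cF F}" by force
    then have c: "T \<subseteq> {x. \<nu>F F \<bullet> x \<ge> cF F}"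
      using closure_minimal[OF _ closed_halfspace_ge] T_regular[OF T] by metis
    obtain x where "x \<in> interior T" using T_interior[OF T] by blast
    then have "x \<in> T" "\<not> \<nu>F F \<bullet> x \<le> cF F" using i interior_subset by force+
    then have "side T F = -1" using F by (auto simp: side_def)
    then show ?thesis using i c by blast
  next
    assume "?g \<inter> interior T = {}"
    then have i: "interior T \<subseteq> ?l" using facet_interior(1)[OF T F] by force
    then have "interior T \<subseteq> {x. \<nu>F F \<bullet> x \<le> cF F}" by force
    then have c: "T \<subseteq> {x. \<nu>F F \<bullet> x \<le> cF F}"
      using closure_minimal[OF _ closed_halfspace_le] T_regular[OF T] by metis
    then have "side T F = 1" using F by (auto simp: side_def)
    then show ?thesis using i c by blast
  qed
qed

text \<open>Interior points of \<open>T\<close> accumulate at \<open>y\<close> and show which half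
  ball is inside, while the supporting half-space keeps \<open>T\<close> out of the other.\<close>

lemma facet_jump:
  assumes T: "T \<in> \<T>" and F: "F facet_of T" and y: "y \<in> F" "\<And>F'. F' facet_of T \<Longrightarrow> y \<in> F' \<Longrightarrow> F' = F"
  shows "has_jump (indicat_real T) (\<nu>F F) (side T F) y"
proof -
  let ?\<nu> = "\<nu>F F"
  have FF: "F \<in> \<F>" by (rule facet_F[OF T F])
  have \<nu>: "norm ?\<nu> = 1" by (rule F_norm[OF FF])
  let ?N = "\<Union>({F'. F' facet_of T} - {F})"
  have "closed ?N"
    using finite_polytope_facets[OF T_polytope[OF T]] F_closed[OF facet_F[OF T]] by (intro closed_Union) auto
  moreover have "y \<notin> ?N" using y(2) by blast
  ultimately have "\<forall>\<^sub>F z in nhds y. z \<in> - ?N" by (intro eventually_nhds_in_open) auto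
  then have "\<forall>\<^sub>F z in nhds y. z \<in> frontier T \<longrightarrow> ?\<nu> \<bullet> (z - y) = 0"
  proof eventually_elim
    case (elim z)
    show ?case
    proof
      assume "z \<in> frontier T"
      then have "z \<in> F" using elim T_frontier[OF T] by blast
      then show "?\<nu> \<bullet> (z - y) = 0" using F_plane[OF FF] y(1) by (simp add: inner_diff_right)
    qed
  qed
  then obtain \<rho> b b' where \<rho>: "0 < \<rho>" and bb: "b \<in> {0, 1}" "b' \<in> {0, 1}"
    and lo: "\<And>z. z \<in> ball y \<rho> \<Longrightarrow> ?\<nu> \<bullet> (z - y) < 0 \<Longrightarrow> indicat_real T z = b"
    and up: "\<And>z. z \<in> ball y \<rho> \<Longrightarrow> ?\<nu> \<bullet> (z - y) > 0 \<Longrightarrow> indicat_real T z = b'"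
    by (rule half_balls_indicator, blast)
  have yc: "?\<nu> \<bullet> y = cF F" by (rule F_plane[OF FF y(1)])
  have yT: "y \<in> closure (interior T)" using y(1) facet_of_imp_subset[OF F] T_regular[OF T] by blast
  then obtain w where w: "w \<in> ball y \<rho>" "w \<in> interior T"
    using open_Int_closure_eq_empty[OF open_ball, of y \<rho> "interior T"] \<rho> by (metis centre_in_ball disjoint_iff)
  have wT: "indicat_real T w = 1" using w(2) interior_subset by (auto simp: indicator_def)
  have lop: "y - (\<rho> / 2) *\<^sub>R ?\<nu> \<in> ball y \<rho>" "?\<nu> \<bullet> (y - (\<rho> / 2) *\<^sub>R ?\<nu> - y) < 0"
    and upp: "y + (\<rho> / 2) *\<^sub>R ?\<nu> \<in> ball y \<rho>" "?\<nu> \<bullet> (y + (\<rho> / 2) *\<^sub>R ?\<nu> - y) > 0"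
    using half_ball_point[OF \<nu> \<rho>, of y] by blast+
  from facet_sides[OF T F] have "b - b' = side T F"
  proof (elim disjE conjE)
    assume s: "side T F = 1" "interior T \<subseteq> {x. \<nu>F F \<bullet> x < cF F}" "T \<subseteq> {x. \<nu>F F \<bullet> x \<le> cF F}"
    have "?\<nu> \<bullet> (w - y) < 0" using s(2) w(2) yc by (auto simp: inner_diff_right)
    then have "b = 1" using lo[OF w(1)] wT by simp
    moreover have "y + (\<rho> / 2) *\<^sub>R ?\<nu> \<notin> T"
    proof
      assume "y + (\<rho> / 2) *\<^sub>R ?\<nu> \<in> T"
      then have "?\<nu> \<bullet> (y + (\<rho> / 2) *\<^sub>R ?\<nu>) \<le> cF F" using s(3) by blast
      then show False using upp(2) yc by (simp only: inner_diff_right)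
    qed
    then have "b' = 0" using up[OF upp] by simp
    ultimately show ?thesis using s(1) by simp
  next
    assume s: "side T F = -1" "interior T \<subseteq> {x. \<nu>F F \<bullet> x > cF F}" "T \<subseteq> {x. \<nu>F F \<bullet> x \<ge> cF F}"
    have "?\<nu> \<bullet> (w - y) > 0" using s(2) w(2) yc by (auto simp: inner_diff_right)
    then have "b' = 1" using up[OF w(1)] wT by simp
    moreover have "y - (\<rho> / 2) *\<^sub>R ?\<nu> \<notin> T"
    proof
      assume "y - (\<rho> / 2) *\<^sub>R ?\<nu> \<in> T"
      then have "?\<nu> \<bullet> (y - (\<rho> / 2) *\<^sub>R ?\<nu>) \<ge> cF F" using s(3) by blast
      then show False using lop(2) yc by (simp only: inner_diff_right)
    qed
    then have "b = 0" using lo[OF lop] by simp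
    ultimately show ?thesis using s(1) by simp
  qed
  then have "\<forall>\<^sub>F z in nhds y. (?\<nu> \<bullet> (z - y) < 0 \<longrightarrow> indicat_real T z = b) \<and> (?\<nu> \<bullet> (z - y) > 0 \<longrightarrow> indicat_real T z = b - side T F)"
    unfolding eventually_nhds_metric using \<rho> lo up by (intro exI[of _ \<rho>]) (auto simp: dist_commute)
  then show ?thesis unfolding has_jump_def by blast
qed

text \<open>As there are no hanging nodes, the intersection is a common face of both facets and
  proper in at least one of them, so a dimension is lost.\<close>

lemma F_Int_dim:
  assumes "F \<in> \<F>" "F' \<in> \<F>" "F \<noteq> F'"
  shows "aff_dim (F \<inter> F') < int CARD('n) - 1"
proof -
  obtain T T' where T: "T \<in> \<T>" "F facet_of T" and T': "T' \<in> \<T>" "F' facet_of T'"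
    using assms by (auto simp: submesh_faces_def)
  have F: "F face_of T" and F': "F' face_of T'" using T T' facet_of_imp_face_of by blast+
  have I: "(T \<inter> T') face_of T" "(T \<inter> T') face_of T'" using T_Int[OF T(1) T'(1)] T_Int[OF T'(1) T(1)] by (simp_all only: Int_commute)
  have sub: "F \<subseteq> T" "F' \<subseteq> T'" using F F' face_of_imp_subset by blast+
  have "(F \<inter> (T \<inter> T')) face_of T" "(F' \<inter> (T \<inter> T')) face_of T'"
    using face_of_Int[OF F I(1)] face_of_Int[OF F' I(2)] .
  then have "(F \<inter> (T \<inter> T')) face_of (T \<inter> T')" "(F' \<inter> (T \<inter> T')) face_of (T \<inter> T')"
    by (auto intro: face_of_subset)
  then have "(F \<inter> (T \<inter> T') \<inter> (F' \<inter> (T \<inter> T'))) face_of (T \<inter> T')" by (rule face_of_Int)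
  moreover have "F \<inter> (T \<inter> T') \<inter> (F' \<inter> (T \<inter> T')) = F \<inter> F'" using sub by blast
  ultimately have ff: "(F \<inter> F') face_of (T \<inter> T')" by simp
  have fT: "(F \<inter> F') face_of T" "(F \<inter> F') face_of T'"
    using face_of_trans[OF ff I(1)] face_of_trans[OF ff I(2)] .
  have fF: "(F \<inter> F') face_of F" "(F \<inter> F') face_of F'"
    using face_of_subset[OF fT(1) _ sub(1)] face_of_subset[OF fT(2) _ sub(2)] by auto
  have "F \<inter> F' \<noteq> F \<or> F \<inter> F' \<noteq> F'" using assms(3) by blast
  then show ?thesis
  proof
    assume "F \<inter> F' \<noteq> F"
    from face_of_aff_dim_lt[OF F_convex[OF assms(1)] fF(1) this] show ?thesis using F_dim[OF assms(1)] by simp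
  next
    assume "F \<inter> F' \<noteq> F'"
    from face_of_aff_dim_lt[OF F_convex[OF assms(2)] fF(2) this] show ?thesis using F_dim[OF assms(2)] by simp
  qed
qed

text \<open>An affine hull of dimension below \<open>int CARD('n) - 1\<close> contains no
  hyperplane, so it meets each in a null set; this covers hyperplanes of mesh faces as well as those
  of facets.\<close>

lemma face_AE_F_overlap:
  assumes "F \<in> \<F>" "F' \<in> \<F>" "F \<noteq> F'" "norm \<nu> = 1"
  shows "face_AE \<nu> c S (\<lambda>y. \<not> (y \<in> F \<and> y \<in> F'))"
proof -
  have lt: "aff_dim (affine hull (F \<inter> F')) < aff_dim {x. \<nu> \<bullet> x = c}"
    using F_Int_dim[OF assms(1-3)] assms(4) by (subst aff_dim_hyperplane) auto
  have "\<not> {x. \<nu> \<bullet> x = c} \<subseteq> affine hull (F \<inter> F')"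
  proof
    assume "{x. \<nu> \<bullet> x = c} \<subseteq> affine hull (F \<inter> F')"
    from aff_dim_subset[OF this] lt show False by linarith
  qed
  then obtain h where "\<nu> \<bullet> h = c" "h \<notin> affine hull (F \<inter> F')" by (auto simp: subset_iff)
  from face_AE_notin_affine[OF affine_affine_hull this assms(4)]
  show ?thesis by (rule face_AE_mp) (use hull_subset[of "F \<inter> F'" affine] in blast)
qed

definition F_generic :: "real^'n \<Rightarrow> bool" where
  "F_generic y \<longleftrightarrow> (\<forall>F\<in>\<F>. \<forall>F'\<in>\<F>. y \<in> F \<longrightarrow> y \<in> F' \<longrightarrow> F = F')"

lemma face_AE_F_generic:
  assumes "norm \<nu> = 1" shows "face_AE \<nu> c S F_generic"
  unfolding F_generic_def
proof (intro face_AE_ball finite_F)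
  fix F F' assume "F \<in> \<F>" "F' \<in> \<F>"
  then show "face_AE \<nu> c S (\<lambda>y. y \<in> F \<longrightarrow> y \<in> F' \<longrightarrow> F = F')"
    by (cases "F = F'") (auto intro: face_AE_I face_AE_mp[OF face_AE_F_overlap[OF _ _ _ assms]])
qed

lemma T_face_system:
  assumes T: "T \<in> \<T>"
  shows "face_system T {F. F facet_of T} \<nu>F cF (side T) (\<lambda>F. F)"
  unfolding face_system_def
proof (intro conjI ballI)
  show "finite {F. F facet_of T}" by (rule finite_polytope_facets[OF T_polytope[OF T]])
  fix F assume "F \<in> {F. F facet_of T}"
  then have F: "F facet_of T" by simp
  note FF = facet_F[OF T F]
  show "compact F" "F \<noteq> {}" "norm (\<nu>F F) = 1" "\<And>x. x \<in> F \<Longrightarrow> \<nu>F F \<bullet> x = cF F"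
    using F_compact[OF FF] F_nonempty[OF FF] F_norm[OF FF] F_plane[OF FF] by auto
  show "face_AE (\<nu>F F) (cF F) F (\<lambda>y. (\<forall>j\<in>{F. F facet_of T}. y \<in> j \<longrightarrow> j = F) \<and>
      has_jump (indicat_real T) (\<nu>F F) (side T F) y)"
  proof (rule face_AE_mp[OF face_AE_F_generic[OF F_norm[OF FF]]])
    fix y assume y: "y \<in> F" "F_generic y"
    then have *: "F' facet_of T \<Longrightarrow> y \<in> F' \<Longrightarrow> F' = F" for F'
      using FF facet_F[OF T] unfolding F_generic_def by blast
    then show "(\<forall>j\<in>{F. F facet_of T}. y \<in> j \<longrightarrow> j = F) \<and> has_jump (indicat_real T) (\<nu>F F) (side T F) y"
      using facet_jump[OF T F y(1)] by blast
  qed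
qed (use T_compact[OF T] T_frontier[OF T] in auto)

text \<open>Contributions of two simplices on opposite sides of \<open>F\<close> cancel, so this is
  the net orientation of \<open>F\<close> as part of the boundary of \<open>K\<close>.\<close>

definition multiplicity_in :: "(real^'n) set \<Rightarrow> (real^'n) set \<Rightarrow> real" where
  "multiplicity_in K F = (\<Sum>T\<in>{T\<in>\<T>. T \<subseteq> K}. side T F)"

text \<open>Off the facets the indicator of \<open>K\<close> is the sum of those of its simplices,
  and jumps add up; at a generic point \<open>F\<close> is the only facet nearby.\<close>

lemma generic_F_jump:
  assumes K: "K \<in> cells X" and F: "F \<in> \<F>" and y: "y \<in> F" "F_generic y"
  shows "has_jump (indicat_real K) (\<nu>F F) (multiplicity_in K F) y"
proof -
  have gen: "F' \<in> \<F> \<Longrightarrow> y \<in> F' \<Longrightarrow> F' = F" for F' using y F unfolding F_generic_def by blast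
  have "has_jump (\<lambda>z. \<Sum>T\<in>{T\<in>\<T>. T \<subseteq> K}. indicat_real T z) (\<nu>F F) (multiplicity_in K F) y"
    unfolding multiplicity_in_def
  proof (rule has_jump_sum)
    fix T assume "T \<in> {T\<in>\<T>. T \<subseteq> K}"
    then have T: "T \<in> \<T>" by simp
    show "has_jump (indicat_real T) (\<nu>F F) (side T F) y"
    proof (cases "F facet_of T")
      case True
      then show ?thesis using facet_jump[OF T True y(1)] gen facet_F[OF T] by blast
    next
      case False
      then have "y \<notin> frontier T" using T_frontier[OF T] gen facet_F[OF T] by blast
      from has_jump_zero[OF this] show ?thesis using False by (simp add: side_def)
    qed
  qed (use finite_T in auto)
  moreover have "\<forall>\<^sub>F z in nhds y. \<nu>F F \<bullet> (z - y) \<noteq> 0 \<longrightarrow> (\<Sum>T\<in>{T\<in>\<T>. T \<subseteq> K}. indicat_real T z) = indicat_real K z"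
  proof -
    have "closed (\<Union>(\<F> - {F}))" using finite_F F_closed by (intro closed_Union) auto
    moreover have "y \<notin> \<Union>(\<F> - {F})" using gen by blast
    ultimately have "\<forall>\<^sub>F z in nhds y. z \<in> - \<Union>(\<F> - {F})" by (intro eventually_nhds_in_open) auto
    then show ?thesis
    proof eventually_elim
      case (elim z)
      show ?case
      proof
        assume "\<nu>F F \<bullet> (z - y) \<noteq> 0"
        then have "z \<notin> F" using F_plane[OF F] y(1) by (auto simp: inner_diff_right)
        then have "T \<in> \<T> \<Longrightarrow> z \<notin> frontier T" for T using elim T_frontier facet_F by blast
        then show "(\<Sum>T\<in>{T\<in>\<T>. T \<subseteq> K}. indicat_real T z) = indicat_real K z"
          using indicator_cell_sum[OF K] by simp
      qed
    qed
  qed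
  ultimately show ?thesis by (rule has_jump_cong)
qed

text \<open>Upgrades a property of almost every point to existence of such points near any given
  point of \<open>F\<close>. Near a relative interior point \<open>F\<close> fills the hyperplane,
  so the points projecting into \<open>F\<close> near it contain a nonempty open set.\<close>

lemma F_open_witness:
  assumes F: "F \<in> \<F>" and ae: "face_AE (\<nu>F F) (cF F) F P" and z0: "z0 \<in> F" "z0 \<in> U" "open U"
  shows "\<exists>y\<in>F \<inter> U. P y"
proof -
  let ?Q = "oproj (\<nu>F F) (cF F) (\<nu>F F)"
  have \<nu>: "\<nu>F F \<bullet> \<nu>F F = 1" using F_norm[OF F] by (simp add: dot_square_norm)
  have "z0 \<in> closure (rel_interior F)"
    using convex_closure_rel_interior[OF F_convex[OF F]] closure_subset z0(1) by blast
  then have "U \<inter> rel_interior F \<noteq> {}" using open_Int_closure_eq_empty[OF z0(3)] z0(2) by blast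
  then obtain z1 \<delta> where z1: "z1 \<in> U" "z1 \<in> F" and \<delta>: "0 < \<delta>" "ball z1 \<delta> \<inter> affine hull F \<subseteq> F"
    by (auto simp: mem_rel_interior_ball)
  have cQ: "continuous_on UNIV ?Q" unfolding oproj_def[abs_def] by (intro continuous_intros)
  let ?V = "?Q -` (ball z1 \<delta> \<inter> U)"
  have "open ?V" by (rule open_vimage[OF _ cQ]) (use z0(3) in auto)
  have "?Q z1 = z1" using F_plane[OF F z1(2)] by (simp add: oproj_def)
  then have "z1 \<in> ?V" using z1 \<delta> by simp
  have QF: "?Q z \<in> F \<inter> U" if "z \<in> ?V" for z
  proof -
    have "\<nu>F F \<bullet> ?Q z = cF F" using \<nu> by (simp add: oproj_def inner_diff_right)
    then show ?thesis using that \<delta>(2) F_hull[OF F] by auto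
  qed
  show ?thesis
  proof (rule ccontr)
    assume none: "\<not> (\<exists>y\<in>F \<inter> U. P y)"
    have "AE z in lborel. z \<notin> ?V"
      using ae unfolding face_AE_def by eventually_elim (use QF none in blast)
    then have "AE z in lebesgue. z \<notin> ?V" by (simp add: AE_completion_iff)
    then have "?V \<in> null_sets lebesgue" using \<open>open ?V\<close> by (subst AE_iff_null_sets) auto
    then have "negligible ?V" by (simp add: negligible_iff_null_sets)
    then show False using \<open>open ?V\<close> \<open>z1 \<in> ?V\<close> open_not_negligible by blast
  qed
qed

text \<open>Were some point of \<open>F\<close> interior to \<open>K\<close>, a generic point of
  \<open>F\<close> nearby would be too; there the indicator of \<open>K\<close> has jump 0, and by
  uniqueness of jumps the multiplicity would vanish.\<close>

lemma multiplicity_nonzero: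
  assumes K: "K \<in> cells X" and F: "F \<in> \<F>" and nz: "multiplicity_in K F \<noteq> 0"
  shows "F \<subseteq> frontier K"
proof
  fix z0 assume z0: "z0 \<in> F"
  obtain T where T: "T \<in> \<T>" "T \<subseteq> K" "side T F \<noteq> 0"
    using nz unfolding multiplicity_in_def by (metis (mono_tags, lifting) mem_Collect_eq sum.neutral)
  then have "F facet_of T" by (auto simp: side_def split: if_splits)
  then have zK: "z0 \<in> K" using z0 T facet_of_imp_subset by blast
  show "z0 \<in> frontier K"
  proof (rule ccontr)
    assume "z0 \<notin> frontier K"
    then have "z0 \<in> interior K" using zK closure_subset[of K] by (auto simp: frontier_def)
    from F_open_witness[OF F face_AE_F_generic[OF F_norm[OF F]] z0 this open_interior]
    obtain y where y: "y \<in> F" "y \<in> interior K" "F_generic y" by blast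
    have "y \<notin> frontier K" using y(2) by (simp add: frontier_def)
    from has_jump_unique[OF _ has_jump_zero[OF this] generic_F_jump[OF K F y(1,3)]]
    have "multiplicity_in K F = 0" using F_norm[OF F] by fastforce
    then show False using nz by simp
  qed
qed

lemma F_plane_const: "F \<in> \<F> \<Longrightarrow> S \<in> faces X \<Longrightarrow> F \<subseteq> S \<Longrightarrow> cF F = plane_const X S"
  using F_plane[of F] F_normal[of F S] face_plane[of S] F_nonempty[of F] by (metis ex_in_conv subsetD)

text \<open>Both numbers are jumps of the indicator of \<open>K\<close>, taken at a point of
  \<open>F\<close> that is generic for the mesh and for the triangulation.\<close>

lemma multiplicity_incidence:
  assumes K: "K \<in> cells X" and F: "F \<in> \<F>" and S: "S \<in> faces X" and FS: "F \<subseteq> S"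
  shows "multiplicity_in K F = incidence X K S"
proof -
  obtain z0 where z0: "z0 \<in> F" using F_nonempty[OF F] by blast
  have "face_AE (\<nu>F F) (cF F) F (generic_point X S)"
    using face_AE_subset[OF face_AE_generic[OF S] FS] F_normal[OF F S FS] F_plane_const[OF F S FS] by simp
  from F_open_witness[OF F face_AE_conj[OF this face_AE_F_generic[OF F_norm[OF F]]] z0, of UNIV]
  obtain y where y: "y \<in> F" "generic_point X S y" "F_generic y" by auto
  have "has_jump (indicat_real K) (nrm X S) (multiplicity_in K F) y"
    using generic_F_jump[OF K F y(1,3)] F_normal[OF F S FS] by simp
  moreover have "has_jump (indicat_real K) (nrm X S) (incidence X K S) y"
    using generic_cell_jump[OF S _ y(2) K] y(1) FS by blast
  ultimately show ?thesis using has_jump_unique face_norm[OF S] by (metis norm_zero zero_neq_one)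
qed

text \<open>The submesh only states that facets on the skeleton lie in faces; that they fill the
  faces is derived from jumps. At a generic point of \<open>S\<close> the indicator of
  \<open>Kplus\<close> jumps by 1, which requires a facet there with nonzero multiplicity; this
  facet lies on the skeleton, hence in one face, which must be \<open>S\<close>.\<close>

lemma face_AE_covered:
  assumes S: "S \<in> faces X"
  shows "face_AE (nrm X S) (plane_const X S) S (\<lambda>y. \<exists>F\<in>\<F>. F \<subseteq> S \<and> y \<in> F)"
proof -
  let ?\<nu> = "nrm X S" and ?c = "plane_const X S"
  have \<nu>: "norm ?\<nu> = 1" by (rule face_norm[OF S])
  \<comment> \<open>A facet in another hyperplane meets that of \<open>S\<close> in a null
    set.\<close>
  have 1: "face_AE ?\<nu> ?c S (\<lambda>y. \<forall>F\<in>\<F>. y \<in> F \<longrightarrow> {x. ?\<nu> \<bullet> x = ?c} \<subseteq> {x. \<nu>F F \<bullet> x = cF F})"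
  proof (rule face_AE_ball[OF finite_F])
    fix F assume F: "F \<in> \<F>"
    show "face_AE ?\<nu> ?c S (\<lambda>y. y \<in> F \<longrightarrow> {x. ?\<nu> \<bullet> x = ?c} \<subseteq> {x. \<nu>F F \<bullet> x = cF F})"
    proof (cases "{x. ?\<nu> \<bullet> x = ?c} \<subseteq> {x. \<nu>F F \<bullet> x = cF F}")
      case False
      then obtain h where "?\<nu> \<bullet> h = ?c" "h \<notin> {x. \<nu>F F \<bullet> x = cF F}" by blast
      from face_AE_notin_affine[OF affine_hyperplane this \<nu>]
      show ?thesis by (rule face_AE_mp) (use F_plane[OF F] in auto)
    qed (auto intro: face_AE_I)
  qed
  have "face_AE ?\<nu> ?c S (\<lambda>y. (\<forall>F\<in>\<F>. y \<in> F \<longrightarrow> {x. ?\<nu> \<bullet> x = ?c} \<subseteq> {x. \<nu>F F \<bullet> x = cF F}) \<and>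
      (generic_point X S y \<and> F_generic y))"
    by (intro face_AE_conj 1 face_AE_generic[OF S] face_AE_F_generic[OF \<nu>])
  then show ?thesis
  proof (rule face_AE_mp)
    fix y assume yS: "y \<in> S" and "(\<forall>F\<in>\<F>. y \<in> F \<longrightarrow> {x. ?\<nu> \<bullet> x = ?c} \<subseteq> {x. \<nu>F F \<bullet> x = cF F}) \<and>
      (generic_point X S y \<and> F_generic y)"
    then have y: "\<And>F. F \<in> \<F> \<Longrightarrow> y \<in> F \<Longrightarrow> {x. ?\<nu> \<bullet> x = ?c} \<subseteq> {x. \<nu>F F \<bullet> x = cF F}"
      and g: "generic_point X S y" "F_generic y" by blast+
    let ?K = "Kplus X S"
    have K: "?K \<in> cells X" using S faces_int_bd int_face(2) bd_face(2) by blast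
    have j: "has_jump (indicat_real ?K) ?\<nu> 1 y"
      using generic_cell_jump[OF S yS g(1) K] by (simp add: incidence_def)
    have \<nu>0: "?\<nu> \<noteq> 0" using \<nu> by auto
    have "y \<in> \<Union>\<F>"
    proof (rule ccontr)
      assume no: "y \<notin> \<Union>\<F>"
      have "has_jump (\<lambda>z. \<Sum>T\<in>{T\<in>\<T>. T \<subseteq> ?K}. indicat_real T z) ?\<nu> (\<Sum>T\<in>{T\<in>\<T>. T \<subseteq> ?K}. 0) y"
        by (rule has_jump_sum, use finite_T in simp, rule has_jump_zero) (use no T_frontier facet_F in blast)
      moreover have "\<forall>\<^sub>F z in nhds y. ?\<nu> \<bullet> (z - y) \<noteq> 0 \<longrightarrow> (\<Sum>T\<in>{T\<in>\<T>. T \<subseteq> ?K}. indicat_real T z) = indicat_real ?K z"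
      proof -
        have "closed (\<Union>\<F>)" using finite_F F_closed by (intro closed_Union) auto
        then have "\<forall>\<^sub>F z in nhds y. z \<in> - \<Union>\<F>" using no by (intro eventually_nhds_in_open) auto
        then show ?thesis
        proof eventually_elim
          case (elim z)
          then have "T \<in> \<T> \<Longrightarrow> z \<notin> frontier T" for T using T_frontier facet_F by blast
          then show ?case using indicator_cell_sum[OF K] by simp
        qed
      qed
      ultimately have "has_jump (indicat_real ?K) ?\<nu> (\<Sum>T\<in>{T\<in>\<T>. T \<subseteq> ?K}. 0) y" by (rule has_jump_cong)
      from has_jump_unique[OF \<nu>0 this j] show False by simp
    qed
    then obtain F where F: "F \<in> \<F>" "y \<in> F" by blast
    \<comment> \<open>The prescribed agreement of normals is available only once
      \<open>F \<subseteq> S\<close> is known, so here both signs are allowed.\<close>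
    have "\<nu>F F = ?\<nu> \<or> \<nu>F F = - ?\<nu>"
      by (rule hyperplane_unit_normal_unique[OF \<nu> F_norm[OF F(1)] y[OF F]])
    moreover note gj = generic_F_jump[OF K F g(2)]
    ultimately have "multiplicity_in ?K F = 1 \<or> - multiplicity_in ?K F = 1"
      using has_jump_unique[OF \<nu>0 _ j, of "multiplicity_in ?K F"]
        has_jump_unique[OF \<nu>0 _ j, of "- multiplicity_in ?K F"] has_jump_uminus[OF gj] by auto
    then have "multiplicity_in ?K F \<noteq> 0" by auto
    then have "F \<subseteq> skeleton X" using multiplicity_nonzero[OF K F(1)] K by (auto simp: skeleton_def)
    then obtain S' where S': "S' \<in> faces X" "F \<subseteq> S'" using F_skeleton[OF F(1)] by blast
    then have "S' = S" using g(1) F(2) unfolding generic_point_def by blast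
    then show "\<exists>F\<in>\<F>. F \<subseteq> S \<and> y \<in> F" using F S' by blast
  qed
qed

text \<open>The facets in \<open>S\<close> share its hyperplane, so all surface integrals become
  integrals over one slab, where the facets tile \<open>S\<close> up to null sets.\<close>

lemma face_int_F:
  fixes g :: "real^'n \<Rightarrow> real"
  assumes S: "S \<in> faces X" and g: "continuous_on UNIV g"
  shows "face_int X S g = (\<Sum>F\<in>{F\<in>\<F>. F \<subseteq> S}. integral\<^sup>L (surf (\<nu>F F) F) g)"
proof -
  let ?\<nu> = "nrm X S" and ?c = "plane_const X S" and ?J = "{F\<in>\<F>. F \<subseteq> S}"
  let ?Q = "oproj ?\<nu> ?c ?\<nu>"
  have \<nu>n: "norm ?\<nu> = 1" by (rule face_norm[OF S])
  then have \<nu>: "?\<nu> \<bullet> ?\<nu> = 1" by (simp add: dot_square_norm)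
  have gm[measurable]: "g \<in> borel_measurable borel" using g by (rule borel_measurable_continuous_onI)
  have Sm[measurable]: "S \<in> sets borel" using face_closed[OF S] by simp
  have Fm[measurable]: "F \<in> ?J \<Longrightarrow> F \<in> sets borel" for F using F_closed[of F] by simp
  have finJ: "finite ?J" using finite_F by simp
  have FS: "integral\<^sup>L (surf (\<nu>F F) F) g = (LINT z|lborel. indicat_real (slab ?\<nu> ?c) z * (indicat_real F (?Q z) * g (?Q z)))"
    if "F \<in> ?J" for F
  proof -
    have F: "F \<in> \<F>" "F \<subseteq> S" using that by auto
    have "integral\<^sup>L (surf ?\<nu> F) g = (LINT z|lborel. indicat_real (slab ?\<nu> ?c) z * (indicat_real F (?Q z) * g (?Q z)))"
      by (rule surf_integral[OF F_nonempty[OF F(1)] F_closed[OF F(1)] _ \<nu>n \<nu> gm]) (use face_plane[OF S] F(2) in blast)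
    then show ?thesis by (simp only: F_normal[OF F(1) S F(2)])
  qed
  obtain B where B: "\<And>x. x \<in> S \<Longrightarrow> norm x \<le> B" using compact_imp_bounded[OF face_compact[OF S]] by (auto simp: bounded_iff)
  obtain Bg where Bg: "\<And>x. x \<in> S \<Longrightarrow> \<bar>g x\<bar> \<le> Bg"
    using compact_continuous_bound[OF face_compact[OF S] g] by auto
  have int: "integrable lborel (\<lambda>z. indicat_real (slab ?\<nu> ?c) z * (indicat_real F (?Q z) * g (?Q z)))" if F: "F \<in> ?J" for F
  proof (rule integrable_lborel_bounded_support[where R = "B + 1" and B = Bg])
    have [measurable]: "F \<in> sets borel" by (rule Fm[OF F])
    show "(\<lambda>z. indicat_real (slab ?\<nu> ?c) z * (indicat_real F (?Q z) * g (?Q z))) \<in> borel_measurable borel" by measurable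
    fix z assume "indicat_real (slab ?\<nu> ?c) z * (indicat_real F (?Q z) * g (?Q z)) \<noteq> 0"
    then have z: "z \<in> slab ?\<nu> ?c" "?Q z \<in> S" and zF: "?Q z \<in> F" using F by (auto simp: indicator_def split: if_splits)
    have "z = ?Q z + (?\<nu> \<bullet> z - ?c) *\<^sub>R ?\<nu>" by (simp add: oproj_def)
    then have "norm z \<le> norm (?Q z) + norm ((?\<nu> \<bullet> z - ?c) *\<^sub>R ?\<nu>)" by (metis norm_triangle_ineq)
    also have "\<dots> \<le> B + 1" using z(1) B[OF z(2)] \<nu>n by (auto simp: slab_def)
    finally show "norm z \<le> B + 1 \<and> \<bar>indicat_real (slab ?\<nu> ?c) z * (indicat_real F (?Q z) * g (?Q z))\<bar> \<le> Bg"
      using Bg[OF z(2)] z zF by simp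
  qed
  have ae: "AE z in lborel. indicat_real S (?Q z) = (\<Sum>F\<in>?J. indicat_real F (?Q z))"
    using face_AE_covered[OF S, unfolded face_AE_def] face_AE_F_generic[OF \<nu>n, of ?c S, unfolded face_AE_def]
  proof eventually_elim
    case (elim z)
    show ?case
    proof (cases "?Q z \<in> S")
      case True
      then obtain F where F: "F \<in> ?J" "?Q z \<in> F" using elim(1) by blast
      have "(\<Sum>F\<in>?J. indicat_real F (?Q z)) = (\<Sum>F\<in>{F}. indicat_real F (?Q z))"
        by (rule sum.mono_neutral_right) (use finJ F elim(2) True in \<open>auto simp: indicator_def F_generic_def\<close>)
      then show ?thesis using True F by simp
    next
      case False
      have "(\<Sum>F\<in>?J. indicat_real F (?Q z)) = 0"
        by (rule sum.neutral) (use False in \<open>auto simp: indicator_def\<close>)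
      then show ?thesis using False by simp
    qed
  qed
  have "face_int X S g = (LINT z|lborel. indicat_real (slab ?\<nu> ?c) z * (indicat_real S (?Q z) * g (?Q z)))"
    by (rule surf_integral[OF face_nonempty[OF S] face_closed[OF S] face_plane[OF S] \<nu>n \<nu> gm])
  also have "\<dots> = (LINT z|lborel. (\<Sum>F\<in>?J. indicat_real (slab ?\<nu> ?c) z * (indicat_real F (?Q z) * g (?Q z))))"
  proof (rule integral_cong_AE)
    show "AE z in lborel. indicat_real (slab ?\<nu> ?c) z * (indicat_real S (?Q z) * g (?Q z))
      = (\<Sum>F\<in>?J. indicat_real (slab ?\<nu> ?c) z * (indicat_real F (?Q z) * g (?Q z)))"
      using ae by eventually_elim (simp only: sum_distrib_left sum_distrib_right)
    show "(\<lambda>z. indicat_real (slab ?\<nu> ?c) z * (indicat_real S (?Q z) * g (?Q z))) \<in> borel_measurable lborel"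
      by measurable
    show "(\<lambda>z. \<Sum>F\<in>?J. indicat_real (slab ?\<nu> ?c) z * (indicat_real F (?Q z) * g (?Q z))) \<in> borel_measurable lborel"
      by (rule borel_measurable_sum, rule borel_measurable_integrable, rule int)
  qed
  also have "\<dots> = (\<Sum>F\<in>?J. integral\<^sup>L (surf (\<nu>F F) F) g)"
    using int FS by (simp add: Bochner_Integration.integral_sum)
  finally show ?thesis .
qed


section \<open>From simplices to cells\<close>

lemma glue_submesh: "T \<in> \<T> \<Longrightarrow> x \<in> interior T \<Longrightarrow> glue \<T> v x = v T x"
proof -
  assume T: "T \<in> \<T>" and x: "x \<in> interior T"
  have "(SOME A. A \<in> \<T> \<and> x \<in> A) = T"
    by (rule some_equality) (use T x interior_subset T_disjoint[OF T] in blast)+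
  then show ?thesis by (simp add: glue_def)
qed

lemma T_AE_interior: "T \<in> \<T> \<Longrightarrow> AE x in lebesgue_on T. x \<in> interior T"
proof -
  assume T: "T \<in> \<T>"
  have "negligible (frontier T)" using T_convex[OF T] by (rule negligible_convex_frontier)
  then have "AE x in lebesgue. x \<notin> frontier T" by (intro AE_not_in) (simp add: negligible_iff_null_sets)
  then have "AE x in lebesgue. x \<in> T \<longrightarrow> x \<in> interior T"
    by eventually_elim (use closure_subset[of T] in \<open>auto simp: frontier_def\<close>)
  then show ?thesis using T_sets[OF T] by (simp add: AE_restrict_space_iff)
qed

lemma cell_partition:
  fixes F :: "real^'n \<Rightarrow> real"
  assumes K: "K \<in> cells X" and int: "\<And>T. T \<in> \<T> \<Longrightarrow> T \<subseteq> K \<Longrightarrow> integrable (lebesgue_on T) F"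
  shows "integral\<^sup>L (lebesgue_on K) F = (\<Sum>T\<in>{T\<in>\<T>. T \<subseteq> K}. integral\<^sup>L (lebesgue_on T) F)"
proof (rule integral_partition(2))
  show "finite {T\<in>\<T>. T \<subseteq> K}" using finite_T by simp
  have "K - \<Union>{T\<in>\<T>. T \<subseteq> K} \<subseteq> (\<Union>T\<in>\<T>. frontier T)"
  proof
    fix x assume x: "x \<in> K - \<Union>{T\<in>\<T>. T \<subseteq> K}"
    then obtain T where T: "T \<in> \<T>" "x \<in> T" using K cells_cover T_cover by blast
    then have "x \<notin> interior T" using cell_Int_interior[OF T(1) K] x by blast
    then have "x \<in> frontier T" using T(2) closure_subset[of T] by (auto simp: frontier_def)
    then show "x \<in> (\<Union>T\<in>\<T>. frontier T)" using T(1) by blast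
  qed
  moreover have "negligible (\<Union>T\<in>\<T>. frontier T)"
    using finite_T T_convex by (intro negligible_Union) (auto intro: negligible_convex_frontier)
  ultimately show "negligible (K - \<Union>{T\<in>\<T>. T \<subseteq> K})" using negligible_subset by blast
  have "\<Union>{T\<in>\<T>. T \<subseteq> K} - K = {}" by blast
  then show "negligible (\<Union>{T\<in>\<T>. T \<subseteq> K} - K)" by simp
qed (use T_sets cell_sets[OF K] T_overlap int in auto)

section \<open>Moments of the divergence of Raviart-Thomas functions\<close>

lemma Jac_polys:
  fixes \<phi> :: "real^'n \<Rightarrow> real^'m::finite"
  assumes \<phi>: "\<phi> \<in> polys k" shows "Jac \<phi> \<in> polys (k - 1)"
proof -
  let ?L = "\<lambda>j. \<lambda>v :: real^'m. (\<chi> i l. if l = j then v $ i else 0) :: real^'n^'m"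
  have lin: "linear (?L j)" for j
    by (rule linearI) (auto simp: vec_eq_iff)
  have "Jac \<phi> = (\<lambda>x. \<Sum>j\<in>UNIV. ?L j (partial_deriv j \<phi> x))"
    by (auto simp: Jac_def fun_eq_iff vec_eq_iff)
  then show ?thesis
    by (simp only:) (intro polys_sum polys_linear[OF lin] partial_deriv_polys[OF \<phi>] finite)
qed

text \<open>Covers the lowest order, in which the Raviart-Thomas function has no prescribed interior
  moments.\<close>

lemma Jac_degree_0:
  fixes \<phi> :: "real^'n \<Rightarrow> real^'m::finite"
  assumes "\<phi> \<in> polys 0" shows "Jac \<phi> x = 0"
proof -
  obtain C where C: "\<phi> = (\<lambda>x. \<Sum>\<alpha>\<in>multi_indices 0. monomial \<alpha> x *\<^sub>R C \<alpha>)"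
    using assms polys_iff by blast
  have "monomial \<alpha> x = 1" if "\<alpha> \<in> multi_indices 0" for \<alpha> and x :: "real^'n"
    using that by (simp add: multi_indices_def monomial_def)
  then have "\<phi> = (\<lambda>x. \<Sum>\<alpha>\<in>multi_indices 0. C \<alpha>)" unfolding C by (intro ext sum.cong) auto
  then show ?thesis by (simp add: Jac_def partial_deriv_const vec_eq_iff)
qed

lemma C1_RT:
  fixes \<tau> :: "real^'n \<Rightarrow> real^'n^'m::finite"
  assumes "\<And>i. (\<lambda>x. \<tau> x $ i) \<in> RT_local k"
  shows "C1 \<tau>"
proof -
  let ?L = "\<lambda>i. \<lambda>v :: real^'n. (\<chi> i'. if i' = i then v else 0) :: real^'n^'m"
  have lin: "bounded_linear (?L i)" for i
    by (rule linear_conv_bounded_linear[THEN iffD1], rule linearI) (auto simp: vec_eq_iff)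
  have row: "C1 (\<lambda>x. \<tau> x $ i)" for i
  proof -
    obtain a b where "a \<in> polys k" "b \<in> polys k" and eq: "\<And>x. \<tau> x $ i = a x + b x *\<^sub>R x"
      using assms[of i] by (auto simp: RT_local_def)
    then have "C1 (\<lambda>x. a x + b x *\<^sub>R x)"
      by (intro C1_add C1_bilinear[OF bounded_bilinear_scaleR] C1_polys C1_linear[OF bounded_linear_ident])
    then show ?thesis by (simp only: eq)
  qed
  have "C1 (\<lambda>x. \<Sum>i\<in>UNIV. ?L i (\<tau> x $ i))"
    by (intro C1_sum C1_linear_compose[OF lin row] finite)
  moreover have "(\<lambda>x. \<Sum>i\<in>UNIV. ?L i (\<tau> x $ i)) = \<tau>"
    by (auto simp: fun_eq_iff vec_eq_iff)
  ultimately show ?thesis by simp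
qed

lemma Raviart_Thomas_moments:
  fixes \<sigma> :: "('n, real^'n^'m::finite) pieces \<times> ('n, real^'m) pieces" and \<tau> :: "('n, real^'n^'m) pieces"
  assumes p: "1 < p" and \<sigma>K: "\<And>K. K \<in> cells X \<Longrightarrow> fst \<sigma> K \<in> polys k" and \<sigma>S: "\<And>S. S \<in> faces X \<Longrightarrow> snd \<sigma> S \<in> polys k"
    and RT: "\<tau> \<in> RT_space k p X \<T>" and interp: "RT_interpolates k X \<T> \<nu>F \<sigma> \<tau>"
    and K: "K \<in> cells X" and \<phi>: "\<phi> \<in> polys k"
  shows "(LINT x|lebesgue_on K. weak_div (p / (p - 1)) (dom X) (glue \<T> \<tau>) x \<bullet> \<phi> x)
    = - (LINT x|lebesgue_on K. Jac \<phi> x \<bullet> fst \<sigma> K x)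
      + (\<Sum>S\<in>faces X. incidence X K S * face_int X S (\<lambda>x. \<phi> x \<bullet> snd \<sigma> S x))"
proof -
  let ?q = "p / (p - 1)" and ?TK = "{T\<in>\<T>. T \<subseteq> K}"
  define g where "g = weak_div ?q (dom X) (glue \<T> \<tau>)"
  have wd: "has_weak_div ?q (dom X) (glue \<T> \<tau>) g"
  proof -
    have "\<exists>g. has_weak_div ?q (dom X) (glue \<T> \<tau>) g" using RT by (simp add: RT_space_def)
    from someI_ex[OF this] show ?thesis unfolding g_def weak_div_def .
  qed
  have "1 \<le> ?q" using p by (simp add: field_simps)
  then have gi: "integrable (lebesgue_on (dom X)) g"
    using wd integrable_Lp_fun[OF _ _ dom_open dom_bounded] by (auto simp: has_weak_div_def)
  have giT: "integrable (lebesgue_on T) g" if T: "T \<in> \<T>" for T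
  proof (rule integrable_lebesgue_on_subset[OF gi _ T_sets[OF T]])
    have "T \<subseteq> \<Union>(cells X)" using T T_cover cells_cover by blast
    then show "negligible (T - dom X)" by (intro negligible_subset[OF dom_negligible]) blast
  qed (use dom_open in simp)
  have \<phi>C: "C1 \<phi>" by (rule C1_polys[OF \<phi>])
  have \<phi>c: "continuous_on UNIV \<phi>" by (rule continuous_polys[OF \<phi>])
  have \<tau>C: "C1 (\<tau> T)" if "T \<in> \<T>" for T
    by (rule C1_RT[of _ k]) (use RT that in \<open>auto simp: RT_space_def\<close>)
  have \<sigma>c: "continuous_on UNIV (fst \<sigma> K)" by (rule continuous_polys[OF \<sigma>K[OF K]])
  note icT = integrates_continuous_lebesgue_on[OF T_compact]
  have gphi: "integrable (lebesgue_on T) (\<lambda>x. g x \<bullet> \<phi> x)" if "T \<in> \<T>" for T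
    by (rule integrable_inner_compact[OF giT[OF that] T_compact[OF that] \<phi>c])
  have gphi_i: "integrable (lebesgue_on T) (\<lambda>x. g x $ i * \<phi> x $ i)" if "T \<in> \<T>" for T i
  proof -
    have "integrable (lebesgue_on T) (\<lambda>x. g x $ i)"
      by (rule integrable_bounded_linear[OF bounded_linear_vec_nth giT[OF that]])
    from integrable_inner_compact[OF this T_compact[OF that], of "\<lambda>x. \<phi> x $ i"]
    show ?thesis using \<phi>c by (simp add: continuous_on_component)
  qed
  \<comment> \<open>\<open>Jac \<phi>\<close> has degree at most \<open>k - 1\<close>, so the
    prescribed moments exchange \<open>\<tau>\<close> for \<open>\<sigma>\<close>; for
    \<open>k = 0\<close> it vanishes.\<close>
  have vol: "(LINT x|lebesgue_on T. Jac \<phi> x \<bullet> \<tau> T x) = (LINT x|lebesgue_on T. Jac \<phi> x \<bullet> fst \<sigma> K x)"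
    if T: "T \<in> ?TK" for T
  proof (cases "k = 0")
    case True
    then have "Jac \<phi> x = 0" for x using Jac_degree_0[of \<phi>] \<phi> by simp
    then show ?thesis by simp
  next
    case False
    have TT: "T \<in> \<T>" "T \<subseteq> K" using T by auto
    have Jp: "Jac \<phi> \<in> polys (k - 1)" by (rule Jac_polys[OF \<phi>])
    have ae1: "AE x in lebesgue_on T. glue \<T> \<tau> x = \<tau> T x"
      using T_AE_interior[OF TT(1)] by eventually_elim (rule glue_submesh[OF TT(1)])
    have "AE x in lebesgue. x \<in> K \<longrightarrow> glue (cells X) (fst \<sigma>) x = fst \<sigma> K x"
      using glue_cells[OF K, of "fst \<sigma>"] cell_sets[OF K] by (simp add: AE_restrict_space_iff)
    then have "AE x in lebesgue. x \<in> T \<longrightarrow> glue (cells X) (fst \<sigma>) x = fst \<sigma> K x"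
      by eventually_elim (use TT(2) in blast)
    then have ae2: "AE x in lebesgue_on T. glue (cells X) (fst \<sigma>) x = fst \<sigma> K x"
      using T_sets[OF TT(1)] by (simp add: AE_restrict_space_iff)
    have cong: "integrable (lebesgue_on T) (\<lambda>x. w x \<bullet> \<psi> x) \<and>
        (LINT x|lebesgue_on T. w x \<bullet> \<psi> x) = (LINT x|lebesgue_on T. w' x \<bullet> \<psi> x)"
      if "continuous_on UNIV w'" "AE x in lebesgue_on T. w x = w' x" "continuous_on UNIV \<psi>"
      for w w' \<psi> :: "real^'n \<Rightarrow> real^'n^'m"
    proof -
      have i: "integrable (lebesgue_on T) (\<lambda>x. w' x \<bullet> \<psi> x)"
        by (intro integrable_inner_continuous icT TT that)
      have "AE x in lebesgue_on T. w x \<bullet> \<psi> x = w' x \<bullet> \<psi> x" using that(2) by eventually_elim simp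
      then show ?thesis
        using integral_partition[of "{T}" T "\<lambda>_ x. w' x \<bullet> \<psi> x" "\<lambda>x. w x \<bullet> \<psi> x"] T_sets[OF TT(1)] i by auto
    qed
    note c1 = cong[OF C1_continuous[OF \<tau>C[OF TT(1)]] ae1] and c2 = cong[OF \<sigma>c ae2]
    have q: "(LINT x|lebesgue_on T. pw_proj (k - 1) w T x \<bullet> Jac \<phi> x) = (LINT x|lebesgue_on T. w x \<bullet> Jac \<phi> x)"
      if "\<And>\<psi>. continuous_on UNIV \<psi> \<Longrightarrow> integrable (lebesgue_on T) (\<lambda>x. w x \<bullet> \<psi> x)" for w :: "real^'n \<Rightarrow> real^'n^'m"
      unfolding pw_proj_def by (rule L2_proj_spec(2)[OF icT[OF TT(1)] that[OF continuous_polys] Jp])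
    have "(LINT x|lebesgue_on T. \<tau> T x \<bullet> Jac \<phi> x) = (LINT x|lebesgue_on T. glue \<T> \<tau> x \<bullet> Jac \<phi> x)"
      using c1[OF continuous_polys[OF Jp]] by simp
    also have "\<dots> = (LINT x|lebesgue_on T. pw_proj (k - 1) (glue \<T> \<tau>) T x \<bullet> Jac \<phi> x)"
      using q[of "glue \<T> \<tau>"] c1 by simp
    also have "\<dots> = (LINT x|lebesgue_on T. pw_proj (k - 1) (glue (cells X) (fst \<sigma>)) T x \<bullet> Jac \<phi> x)"
      by (rule Bochner_Integration.integral_cong[OF refl])
         (use interp False TT(1) in \<open>auto simp: RT_interpolates_def\<close>)
    also have "\<dots> = (LINT x|lebesgue_on T. glue (cells X) (fst \<sigma>) x \<bullet> Jac \<phi> x)"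
      using q[of "glue (cells X) (fst \<sigma>)"] c2 by simp
    also have "\<dots> = (LINT x|lebesgue_on T. fst \<sigma> K x \<bullet> Jac \<phi> x)"
      using c2[OF continuous_polys[OF Jp]] by simp
    finally show ?thesis by (simp only: inner_commute)
  qed
  \<comment> \<open>The normal trace on \<open>F\<close> prescribed from inside \<open>K\<close>,
    independent of the simplex. Thus \<open>J F\<close> is common to the simplices of
    \<open>K\<close> adjacent to \<open>F\<close>, and their signs can be summed.\<close>
  define \<zeta> where "\<zeta> F x = (if \<exists>S\<in>faces X. F \<subseteq> S then snd \<sigma> (THE S. S \<in> faces X \<and> F \<subseteq> S) x else fst \<sigma> K x *v \<nu>F F)" for F x
  have uniq: "(THE S. S \<in> faces X \<and> F \<subseteq> S) = S" if "F \<in> \<F>" "S \<in> faces X" "F \<subseteq> S" for F S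
  proof -
    have "F \<subseteq> skeleton X" using that skeleton_faces by blast
    from F_skeleton[OF that(1) this] show ?thesis using that by (intro the1_equality) auto
  qed
  define J where "J F = (LINT x|surf (\<nu>F F) F. \<phi> x \<bullet> \<zeta> F x)" for F
  have trace: "(LINT x|surf (\<nu>F F) F. \<phi> x \<bullet> (\<tau> T x *v \<nu>F F)) = J F" if T: "T \<in> ?TK" and F: "F facet_of T" for T F
    unfolding J_def
  proof (rule Bochner_Integration.integral_cong[OF refl])
    fix x assume "x \<in> space (surf (\<nu>F F) F)"
    then have x: "x \<in> F" by simp
    have TT: "T \<in> \<T>" "T \<subseteq> K" using T by auto
    note FF = facet_F[OF TT(1) F]
    have "\<tau> T x *v \<nu>F F = \<zeta> F x"
    proof (cases "\<exists>S\<in>faces X. F \<subseteq> S")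
      case True
      then obtain S where S: "S \<in> faces X" "F \<subseteq> S" by blast
      then have "\<tau> T x *v \<nu>F F = snd \<sigma> S x" using interp TT(1) F x unfolding RT_interpolates_def by blast
      then show ?thesis using True uniq[OF FF S] by (simp add: \<zeta>_def)
    next
      case False
      have "\<not> F \<subseteq> skeleton X" using F_skeleton[OF FF] False by blast
      then have "\<not> F \<subseteq> frontier K" using K by (auto simp: skeleton_def)
      moreover have "F \<subseteq> K" using facet_of_imp_subset[OF F] TT(2) by blast
      ultimately have "\<tau> T x *v \<nu>F F = fst \<sigma> K x *v \<nu>F F"
        using interp TT(1) F x K unfolding RT_interpolates_def by blast
      then show ?thesis using False by (simp only: \<zeta>_def if_False)
    qed
    then show "\<phi> x \<bullet> (\<tau> T x *v \<nu>F F) = \<phi> x \<bullet> \<zeta> F x" by simp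
  qed
  have local: "(LINT x|lebesgue_on T. g x \<bullet> \<phi> x)
      = - (LINT x|lebesgue_on T. Jac \<phi> x \<bullet> fst \<sigma> K x) + (\<Sum>F\<in>\<F>. side T F * J F)" if T: "T \<in> ?TK" for T
  proof -
    have TT: "T \<in> \<T>" using T by simp
    have "(LINT x|lebesgue_on T. g x \<bullet> \<phi> x) = (LINT x|lebesgue_on T. row_div (\<tau> T) x \<bullet> \<phi> x)"
      by (rule weak_div_moments[OF T_polytope[OF TT] dom_open T_interior_dom[OF TT] wd giT[OF TT] glue_submesh[OF TT]
            \<tau>C[OF TT] T_face_system[OF TT] _ \<phi> gphi_i[OF TT]])
         (use facet_interior(2)[OF TT] in auto)
    also have "\<dots> = (LINT x|lebesgue_on T. \<phi> x \<bullet> row_div (\<tau> T) x)" by (simp only: inner_commute)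
    also have "\<dots> = - (LINT x|lebesgue_on T. Jac \<phi> x \<bullet> \<tau> T x)
        + (\<Sum>F\<in>{F. F facet_of T}. side T F * (LINT x|surf (\<nu>F F) F. \<phi> x \<bullet> (\<tau> T x *v \<nu>F F)))"
      by (rule gauss_green_matrix[OF T_face_system[OF TT] \<phi>C \<tau>C[OF TT]])
    also have "(\<Sum>F\<in>{F. F facet_of T}. side T F * (LINT x|surf (\<nu>F F) F. \<phi> x \<bullet> (\<tau> T x *v \<nu>F F)))
        = (\<Sum>F\<in>{F. F facet_of T}. side T F * J F)"
      by (rule sum.cong[OF refl]) (simp add: trace[OF T])
    also have "\<dots> = (\<Sum>F\<in>\<F>. side T F * J F)"
      by (rule sum.mono_neutral_left) (use finite_F facet_F[OF TT] in \<open>auto simp: side_def\<close>)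
    finally show ?thesis by (simp only: vol[OF T])
  qed
  have JacK: "integrable (lebesgue_on T) (\<lambda>x. Jac \<phi> x \<bullet> fst \<sigma> K x)" if "T \<in> \<T>" for T
    by (intro integrable_inner_continuous icT that \<sigma>c continuous_Jac \<phi>C)
  have "(LINT x|lebesgue_on K. g x \<bullet> \<phi> x) = (\<Sum>T\<in>?TK. LINT x|lebesgue_on T. g x \<bullet> \<phi> x)"
    by (rule cell_partition[OF K gphi])
  also have "\<dots> = (\<Sum>T\<in>?TK. - (LINT x|lebesgue_on T. Jac \<phi> x \<bullet> fst \<sigma> K x) + (\<Sum>F\<in>\<F>. side T F * J F))"
    by (rule sum.cong[OF refl local])
  also have "\<dots> = - (\<Sum>T\<in>?TK. LINT x|lebesgue_on T. Jac \<phi> x \<bullet> fst \<sigma> K x) + (\<Sum>T\<in>?TK. \<Sum>F\<in>\<F>. side T F * J F)"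
    by (simp only: sum.distrib sum_negf)
  also have "(\<Sum>T\<in>?TK. LINT x|lebesgue_on T. Jac \<phi> x \<bullet> fst \<sigma> K x) = (LINT x|lebesgue_on K. Jac \<phi> x \<bullet> fst \<sigma> K x)"
    by (rule cell_partition[OF K JacK, symmetric])
  also have "(\<Sum>T\<in>?TK. \<Sum>F\<in>\<F>. side T F * J F) = (\<Sum>F\<in>\<F>. multiplicity_in K F * J F)"
    by (subst sum.swap) (simp add: multiplicity_in_def sum_distrib_right)
  \<comment> \<open>A facet contained in no face of the mesh has multiplicity 0, and every other one
    lies in exactly one face, so inserting the sum over faces changes nothing.\<close>
  also have "\<dots> = (\<Sum>F\<in>\<F>. \<Sum>S\<in>{S. S \<in> faces X \<and> F \<subseteq> S}. multiplicity_in K F * J F)"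
  proof (rule sum.cong[OF refl])
    fix F assume F: "F \<in> \<F>"
    show "multiplicity_in K F * J F = (\<Sum>S\<in>{S. S \<in> faces X \<and> F \<subseteq> S}. multiplicity_in K F * J F)"
    proof (cases "\<exists>S\<in>faces X. F \<subseteq> S")
      case True
      then obtain S where S: "S \<in> faces X" "F \<subseteq> S" by blast
      have "{S. S \<in> faces X \<and> F \<subseteq> S} = {S}" using uniq[OF F] S by blast
      then show ?thesis by simp
    next
      case False
      then have "\<not> F \<subseteq> skeleton X" using F_skeleton[OF F] by blast
      then have "\<not> F \<subseteq> frontier K" using K by (auto simp: skeleton_def)
      then have "multiplicity_in K F = 0" using multiplicity_nonzero[OF K F] by blast
      then show ?thesis by simp
    qed
  qed
  also have "\<dots> = (\<Sum>S\<in>faces X. \<Sum>F\<in>{F. F \<in> \<F> \<and> F \<subseteq> S}. multiplicity_in K F * J F)"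
    by (rule sum.swap_restrict[OF finite_F finite_faces])
  also have "\<dots> = (\<Sum>S\<in>faces X. incidence X K S * face_int X S (\<lambda>x. \<phi> x \<bullet> snd \<sigma> S x))"
  proof (rule sum.cong[OF refl])
    fix S assume S: "S \<in> faces X"
    have "J F = (LINT x|surf (\<nu>F F) F. \<phi> x \<bullet> snd \<sigma> S x)" if "F \<in> \<F>" "F \<subseteq> S" for F
    proof -
      have "\<zeta> F = snd \<sigma> S" using uniq[OF that(1) S that(2)] S that(2) by (auto simp: \<zeta>_def fun_eq_iff)
      then show ?thesis by (simp add: J_def)
    qed
    then have "(\<Sum>F\<in>{F. F \<in> \<F> \<and> F \<subseteq> S}. multiplicity_in K F * J F)
      = (\<Sum>F\<in>{F. F \<in> \<F> \<and> F \<subseteq> S}. incidence X K S * (LINT x|surf (\<nu>F F) F. \<phi> x \<bullet> snd \<sigma> S x))"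
      using multiplicity_incidence[OF K _ S] by (intro sum.cong refl) auto
    also have "\<dots> = incidence X K S * face_int X S (\<lambda>x. \<phi> x \<bullet> snd \<sigma> S x)"
      unfolding face_int_F[OF S continuous_on_inner[OF \<phi>c continuous_polys[OF \<sigma>S[OF S]]]] by (rule sum_distrib_left[symmetric])
    finally show "(\<Sum>F\<in>{F. F \<in> \<F> \<and> F \<subseteq> S}. multiplicity_in K F * J F)
      = incidence X K S * face_int X S (\<lambda>x. \<phi> x \<bullet> snd \<sigma> S x)" .
  qed
  finally show ?thesis unfolding g_def .
qed

end

text \<open>The projection is a choice whose predicate mentions the function only through its
  moments, so equal moments give literally the same choice.\<close>

lemma pw_proj_cong_moments:
  fixes f g :: "real^'n::finite \<Rightarrow> 'b::euclidean_space"
  assumes "\<And>\<phi>. \<phi> \<in> polys k \<Longrightarrow> (LINT x|lebesgue_on K. f x \<bullet> \<phi> x) = (LINT x|lebesgue_on K. g x \<bullet> \<phi> x)"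
  shows "pw_proj k f K = pw_proj k g K"
proof -
  have "(\<lambda>q. q \<in> polys k \<and> (\<forall>\<phi>\<in>polys k. (LINT x|lebesgue_on K. q x \<bullet> \<phi> x) = (LINT x|lebesgue_on K. f x \<bullet> \<phi> x)))
    = (\<lambda>q. q \<in> polys k \<and> (\<forall>\<phi>\<in>polys k. (LINT x|lebesgue_on K. q x \<bullet> \<phi> x) = (LINT x|lebesgue_on K. g x \<bullet> \<phi> x)))"
    using assms by (intro ext) (simp cong: conj_cong)
  then show ?thesis unfolding pw_proj_def L2_proj_def by simp
qed

context poly_mesh
begin

text \<open>The global identity tested with \<open>\<phi>\<close> on \<open>K\<close> and zero on
  all other cells.\<close>

lemma cell_discrete_divergence:
  fixes u :: "('n, real^'m::finite) pieces \<times> ('n, real^'m) pieces"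
  assumes u: "u \<in> V_h k X" and D\<Psi>: "continuous_on UNIV D\<Psi>" and r: "1 < r"
    and f: "integrable (lebesgue_on (dom X)) f"
    and euler_lagrange: "\<And>v. v \<in> VD_h k X \<Longrightarrow>
           vol_int X (\<lambda>x. glue (cells X) (sigma_cells k X D\<Psi> u) x \<bullet> glue (cells X) (D_h k X v) x
             + f x \<bullet> glue (cells X) (pw_proj k (glue (cells X) (fst v))) x)
           + s_h k r s X u v = 0"
    and K: "K \<in> cells X" and \<phi>: "\<phi> \<in> polys k"
  shows "- (LINT x|lebesgue_on K. Jac \<phi> x \<bullet> sigma_cells k X D\<Psi> u K x)
      + (\<Sum>S\<in>faces X. incidence X K S * face_int X S (\<lambda>x. \<phi> x \<bullet> sigma_faces k r s X D\<Psi> u S x))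
    = (LINT x|lebesgue_on K. f x \<bullet> \<phi> x)"
proof -
  let ?\<phi> = "\<lambda>K'. if K' = K then \<phi> else (\<lambda>x. 0)"
  have \<phi>p: "?\<phi> \<in> pw_polys k (cells X)" using \<phi> by (simp add: pw_polys_def polys_0)
  have pol: "?\<phi> K' \<in> polys k" for K' using \<phi> polys_0 by auto
  have Jz: "Jac (\<lambda>x::real^'n. 0::real^'m) = (\<lambda>x. 0)"
    by (simp add: Jac_def partial_deriv_const fun_eq_iff vec_eq_iff)
  have pick: "(\<Sum>K'\<in>cells X. w K') = w K" if "\<And>K'. K' \<noteq> K \<Longrightarrow> w K' = 0" for w :: "_ \<Rightarrow> real"
  proof -
    have "(\<Sum>K'\<in>cells X. w K') = (\<Sum>K'\<in>{K}. w K')"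
      by (rule sum.mono_neutral_right) (use finite_cells K that in auto)
    then show ?thesis by simp
  qed
  have 1: "vol_int X (\<lambda>x. glue (cells X) (\<lambda>K. Jac (?\<phi> K)) x \<bullet> glue (cells X) (sigma_cells k X D\<Psi> u) x)
    = (LINT x|lebesgue_on K. Jac \<phi> x \<bullet> sigma_cells k X D\<Psi> u K x)"
  proof -
    have "vol_int X (\<lambda>x. glue (cells X) (\<lambda>K. Jac (?\<phi> K)) x \<bullet> glue (cells X) (sigma_cells k X D\<Psi> u) x)
      = (\<Sum>K'\<in>cells X. LINT x|lebesgue_on K'. Jac (?\<phi> K') x \<bullet> sigma_cells k X D\<Psi> u K' x)"
      by (rule vol_int_glue) (rule continuous_Jac[OF C1_polys[OF pol]], rule continuous_polys[OF sigma_cells_polys[OF u D\<Psi>]])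
    also have "\<dots> = (LINT x|lebesgue_on K. Jac (?\<phi> K) x \<bullet> sigma_cells k X D\<Psi> u K x)"
      by (rule pick) (simp add: Jz)
    finally show ?thesis by simp
  qed
  have 2: "face_int X S (\<lambda>x. jump X ?\<phi> S x \<bullet> sigma_faces k r s X D\<Psi> u S x)
      = incidence X K S * face_int X S (\<lambda>x. \<phi> x \<bullet> sigma_faces k r s X D\<Psi> u S x)" if S: "S \<in> faces X" for S
  proof -
    have "face_int X S (\<lambda>x. sigma_faces k r s X D\<Psi> u S x \<bullet> jump X ?\<phi> S x)
      = (\<Sum>K'\<in>cells X. incidence X K' S * face_int X S (\<lambda>x. sigma_faces k r s X D\<Psi> u S x \<bullet> ?\<phi> K' x))"
      by (rule face_int_jump[OF S]) (rule continuous_polys[OF sigma_faces_polys[OF u D\<Psi> r S]], rule continuous_polys[OF pol])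
    also have "\<dots> = incidence X K S * face_int X S (\<lambda>x. sigma_faces k r s X D\<Psi> u S x \<bullet> ?\<phi> K x)"
      by (rule pick) simp
    finally show ?thesis by (simp add: inner_commute)
  qed
  have 3: "(\<Sum>K'\<in>cells X. LINT x|lebesgue_on K'. f x \<bullet> ?\<phi> K' x) = (LINT x|lebesgue_on K. f x \<bullet> ?\<phi> K x)"
    by (rule pick) simp
  from discrete_divergence[OF u D\<Psi> r f euler_lagrange \<phi>p] show ?thesis
    by (simp only: 1 3 sum.cong[OF refl 2]) simp
qed

end

theorem lemma5p2:
  fixes k :: nat and p r s :: real
    and X :: "'n::finite mesh"
    and \<Psi> :: "real^'n^'m::finite \<Rightarrow> real" and D\<Psi> :: "real^'n^'m \<Rightarrow> real^'n^'m"
    and \<psi> :: "real^'n \<Rightarrow> real^'m \<Rightarrow> real" and \<psi>' :: "real^'n \<Rightarrow> real^'m \<Rightarrow> real^'m"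
    and u :: "('n, real^'m) pieces \<times> ('n, real^'m) pieces"
  defines "\<sigma> \<equiv> sigma_h k r s X D\<Psi> u"
    and "f \<equiv> (\<lambda>x. \<psi>' x (glue (cells X) (pw_proj k (glue (cells X) (fst u))) x))"
  assumes "1 < p" and "1 < r"
    and "polytopal_mesh X"
    and "convex_on UNIV \<Psi>" and "\<And>A. GDERIV \<Psi> A :> D\<Psi> A" and "continuous_on UNIV D\<Psi>"
    and "AE x in lebesgue_on (dom X). convex_on UNIV (\<psi> x) \<and>
           (\<forall>a. GDERIV (\<psi> x) a :> \<psi>' x a) \<and> continuous_on UNIV (\<psi>' x)"
    and "discrete_minimizer k r s X \<Psi> \<psi> u"
    and "integrable (lebesgue_on (dom X)) f"
    and euler_lagrange: "\<And>v. v \<in> VD_h k X \<Longrightarrow>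
           vol_int X (\<lambda>x. glue (cells X) (fst \<sigma>) x \<bullet> glue (cells X) (D_h k X v) x
             + f x \<bullet> glue (cells X) (pw_proj k (glue (cells X) (fst v))) x)
           + s_h k r s X u v = 0"
  shows "\<sigma> \<in> WN_h k X \<and>
    pw_proj k f \<in> pw_polys k (cells X) \<and>
    (\<forall>K\<in>cells X. \<forall>x\<in>K. div_h k X \<sigma> K x = pw_proj k f K x) \<and>
    (\<forall>\<T> \<nu>F \<sigma>0. matching_submesh X \<T> \<nu>F \<and>
       \<sigma>0 \<in> RT_space k p X \<T> \<and> glue \<T> \<sigma>0 \<in> WN_space p X \<and> RT_interpolates k X \<T> \<nu>F \<sigma> \<sigma>0 \<longrightarrow>
       (\<forall>K\<in>cells X. \<forall>x\<in>K.
          pw_proj k (weak_div (p / (p - 1)) (dom X) (glue \<T> \<sigma>0)) K x = pw_proj k f K x))"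
proof -
  interpret poly_mesh X by standard fact
  have u: "u \<in> V_h k X" using \<open>discrete_minimizer k r s X \<Psi> \<psi> u\<close> by (simp add: discrete_minimizer_def VD_h_def)
  note D\<Psi> = \<open>continuous_on UNIV D\<Psi>\<close> and r = \<open>1 < r\<close> and f = \<open>integrable (lebesgue_on (dom X)) f\<close>
  have EL: "\<And>v. v \<in> VD_h k X \<Longrightarrow>
           vol_int X (\<lambda>x. glue (cells X) (sigma_cells k X D\<Psi> u) x \<bullet> glue (cells X) (D_h k X v) x
             + f x \<bullet> glue (cells X) (pw_proj k (glue (cells X) (fst v))) x)
           + s_h k r s X u v = 0"
    using euler_lagrange unfolding \<sigma>_def sigma_h_def fst_conv .
  show ?thesis
  proof (intro conjI allI impI ballI)
    show "\<sigma> \<in> WN_h k X" unfolding \<sigma>_def by (rule sigma_h_WN[OF u D\<Psi> r])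
    show "pw_proj k f \<in> pw_polys k (cells X)" by (rule div_h_eq_proj(1)[OF u D\<Psi> r f EL])
    show "div_h k X \<sigma> K x = pw_proj k f K x" if "K \<in> cells X" "x \<in> K" for K x
      unfolding \<sigma>_def by (rule div_h_eq_proj(2)[OF u D\<Psi> r f EL that])
    fix \<T> \<nu>F and \<sigma>0 :: "('n, real^'n^'m) pieces" and K x
    assume *: "matching_submesh X \<T> \<nu>F \<and>
       \<sigma>0 \<in> RT_space k p X \<T> \<and> glue \<T> \<sigma>0 \<in> WN_space p X \<and> RT_interpolates k X \<T> \<nu>F \<sigma> \<sigma>0"
      and K: "K \<in> cells X" and "x \<in> K"
    interpret submesh X \<T> \<nu>F by standard (use * in blast)
    \<comment> \<open>The two moment identities have the same middle term: what integration by parts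
      on the simplices gives for \<open>\<sigma>0\<close> is what the Euler-Lagrange equations give
      for \<open>f\<close>.\<close>
    have "pw_proj k (weak_div (p / (p - 1)) (dom X) (glue \<T> \<sigma>0)) K = pw_proj k f K"
    proof (rule pw_proj_cong_moments)
      fix \<phi> :: "real^'n \<Rightarrow> real^'m" assume \<phi>: "\<phi> \<in> polys k"
      have "(LINT x|lebesgue_on K. weak_div (p / (p - 1)) (dom X) (glue \<T> \<sigma>0) x \<bullet> \<phi> x)
        = - (LINT x|lebesgue_on K. Jac \<phi> x \<bullet> fst \<sigma> K x)
          + (\<Sum>S\<in>faces X. incidence X K S * face_int X S (\<lambda>x. \<phi> x \<bullet> snd \<sigma> S x))"
      proof (rule Raviart_Thomas_moments[OF \<open>1 < p\<close> _ _ _ _ K \<phi>])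
        show "fst \<sigma> K \<in> polys k" if "K \<in> cells X" for K
          unfolding \<sigma>_def sigma_h_def fst_conv by (rule sigma_cells_polys[OF u D\<Psi> that])
        show "snd \<sigma> S \<in> polys k" if "S \<in> faces X" for S
          unfolding \<sigma>_def sigma_h_def snd_conv by (rule sigma_faces_polys[OF u D\<Psi> r that])
        show "\<sigma>0 \<in> RT_space k p X \<T>" "RT_interpolates k X \<T> \<nu>F \<sigma> \<sigma>0" using * by blast+
      qed
      also have "\<dots> = (LINT x|lebesgue_on K. f x \<bullet> \<phi> x)"
        unfolding \<sigma>_def sigma_h_def fst_conv snd_conv
        by (rule cell_discrete_divergence[OF u D\<Psi> r f EL K \<phi>])
      finally show "(LINT x|lebesgue_on K. weak_div (p / (p - 1)) (dom X) (glue \<T> \<sigma>0) x \<bullet> \<phi> x)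
        = (LINT x|lebesgue_on K. f x \<bullet> \<phi> x)" .
    qed
    then show "pw_proj k (weak_div (p / (p - 1)) (dom X) (glue \<T> \<sigma>0)) K x = pw_proj k f K x" by simp
  qed
qed

end
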